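(* For each $T_0$ in the list $10^{30},10^{40},10^{50},10^{60},10^{70},10^{80},10^{90},10^{100}$ we have $$|E(T)|\leq J(T_0)\,T^{1/3}(\log T)^{5/3}\qquad\text{for all real } T\geq1.1\,T_0,$$ where $J(10^{30})=1.272\cdot10^6$, $J(10^{40})=14.366$, $J(10^{50})=3.194$, $J(10^{60})=3.09$, $J(10^{70})=3.011$, $J(10^{80})=2.95$, $J(10^{90})=2.9$, $J(10^{100})=2.856$.
   Context: $\zeta$ is the Riemann zeta-function, $\gamma$ is the Euler--Mascheroni constant, $\log$ is the natural logarithm. For $T\geq2$, $E(T)$ is defined by $$\int_0^T\left|\zeta\left(\tfrac12+it\right)\right|^2dt=T\log T-\left(1+\log 2\pi-2\gamma\right)T+E(T).$$ *)

theory Defs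
  imports "HOL-Complex_Analysis.Complex_Analysis"
begin

text \<open>
  The Riemann zeta function: the unique analytic continuation to the complex plane without 1 of
  the Dirichlet series. The value at the pole is set to 0 only so that the description determines
  a total function.
\<close>

definition zeta :: "complex \<Rightarrow> complex" where
  "zeta = (THE f. f holomorphic_on (- {1}) \<and>
                  (\<forall>s. Re s > 1 \<longrightarrow> (\<lambda>n. 1 / of_nat (Suc n) powr s) sums f s) \<and>
                  f 1 = 0)"

definition E :: "real \<Rightarrow> real" where
  "E T = integral {0..T} (\<lambda>t. (cmod (zeta (Complex (1/2) t)))\<^sup>2)
           - (T * ln T - (1 + ln (2 * pi) - 2 * euler_mascheroni) * T)"

end

theory Submission
  imports Defs "HOL-Probability.Probability" "HOL-Real_Asymp.Real_Asymp"
begin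

text \<open>
  Write Q = T^(1/3), L = ln T and u = \<surd>L. What is proved is |E(T)| \<le> 5.9 Q L^(3/2) for T \<ge> 1.1 10^30
  (lemma \<open>abs_E_le\<close>). This is smaller than J Q L^(5/3) as soon as 5.9 \<le> J L^(1/6), and that holds throughout:
  J is at least 14 for the two smallest thresholds, and J \<ge> 2.856 suffices once T \<ge> 10^50.

  The argument is a smoothed version of the classical evaluation of the mean square by squaring out a
  Dirichlet polynomial. The sharp range [-T, T] is replaced by its convolution w with a Gaussian density
  of standard deviation \<sigma> = Q/2. The integrand |\<zeta>|^2 is nonnegative, so the sharp mean square lies, up to
  Gaussian tails, between the smoothed ones at T - a and T + a with a = 1.225 u Q, and this costs a L
  (\<open>mean_square_le_smoothed\<close>, \<open>smoothed_le_mean_square\<close>). Smoothing pays because the Fourier transform of w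
  is 2 sin(Ty)/y exp(-\<sigma>^2y^2/2): two integers m and m + r interact only if their ratio is within about
  u/Q of 1, that is, if m exceeds \<xi> r with \<xi> of size Q/u.

  On the critical line \<zeta> is approximated by \<zeta>_N(s) = (\<Sum>m\<le>N. m^(-s)) - N^(1-s)/(1 - s), and N is taken near T^6. In
  |\<zeta>_N|^2 the product with the polar term is an integral of the fractional part of N x, so it contributes
  O(Q) uniformly in N (\<open>zeta_partial_pole_product\<close>, \<open>abs_cross_term_le\<close>). The square of the Dirichlet
  polynomial gives the diagonal 2T (\<Sum>m\<le>N. 1/m) and, for each shift r, a sum over m of K(r/(m+r))/(m+r),
  where K is the Fourier transform of w in the variable of ratios (\<open>weighted_partial_square\<close>).

  If each sum over m is replaced by the integral, the main term appears. The integrals are tails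
  of \<integral> K(u)/u du; summing them over r meets the same differences as Stirling's formula and yields ln(2\<pi>)
  (\<open>sum_kernel_tails\<close>, \<open>stirling_error\<close>), and the longest tail is evaluated by two Fubini arguments, one
  of which produces Euler's constant and the other T ln T (\<open>kernel_tail_evaluation\<close>). All terms in ln N
  cancel, and T (ln T + 2\<gamma> - 1 - ln 2\<pi>) remains.

  The error is the sum over r of the differences between sums and integrals. The summand is an increasing
  amplitude, at most 2/r, times sin(T ln(1 + r/m)), so partial summation (\<open>monotone_weight_sum\<close>) reduces
  everything to the pure sine. There the phase has derivative about -Tr/m^2, and three ranges of m
  arise (\<open>osc_bound_valid\<close>): from \<xi> r to \<surd>(Tr/\<pi>) van der Corput's second derivative estimate is used, from
  there to 0.4 Q^2 \<surd>r the inequality of Kusmin and Landau, and beyond that the trapezoidal rule. The sum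
  over r is at most 4.52 u^3 Q (\<open>shifted_sums_minus_tails\<close>); its largest part is \<surd>(T/\<xi>) (\<Sum> 1/r) over
  the r up to about L Q for which the first range is not empty.
\<close>

section \<open>Continuation and truncation of the zeta function\<close>

text \<open>
  Up to the power of x, the i-th derivative of x powr (1 - s).
\<close>

definition fall_prod :: "complex \<Rightarrow> nat \<Rightarrow> complex" where
  "fall_prod s i = (\<Prod>j<i. 1 - s - of_nat j)"

text \<open>
  The remainder of order K in the Taylor expansion of x powr (1 - s) about x = n, taken at x = n + 1. Expressing
  the telescoping series of n powr (1 - s) - (n + 1) powr (1 - s) by Taylor polynomials relates \<open>(s - 1) \<zeta>(s)\<close> to the values
  \<open>\<zeta>(s + 1), \<zeta>(s + 2), \<dots>\<close>, which lie further to the right.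
\<close>

definition taylor_rem :: "nat \<Rightarrow> nat \<Rightarrow> complex \<Rightarrow> complex" where
  "taylor_rem K n s = of_nat (Suc n) powr (1 - s)
     - (\<Sum>i\<le>K. fall_prod s i * of_nat n powr (1 - s - of_nat i) / fact i)"

lemma norm_of_nat_powr: "n > 0 \<Longrightarrow> norm ((of_nat n :: complex) powr s) = real n powr Re s"
  by (subst norm_powr_real_powr) auto

lemma norm_taylor_rem_le:
  assumes "n > 0" "Re s + real K \<ge> 0"
  shows "norm (taylor_rem K n s) \<le> norm (fall_prod s (Suc K)) * real n powr (- Re s - real K) / fact K"
proof -
  define S where "S = complex_of_real ` {real n..real (Suc n)}"
  have conv: "convex S" unfolding S_def
    by (intro convex_linear_image) (auto simp: bounded_linear.linear bounded_linear_of_real)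
  define f where "f = (\<lambda>i z. fall_prod s i * z powr (1 - s - of_nat i))"
  have S_pos: "\<exists>x. z = complex_of_real x \<and> real n \<le> x" if "z \<in> S" for z
    using that unfolding S_def by auto
  have 1: "(f i has_field_derivative f (Suc i) z) (at z within S)" if "z \<in> S" for i z
  proof -
    from S_pos[OF that] obtain x where x: "z = of_real x" "real n \<le> x" by auto
    then have "z \<notin> \<real>\<^sub>\<le>\<^sub>0" using assms by (auto simp: complex_nonpos_Reals_iff)
    then have "((\<lambda>z. z powr (1 - s - of_nat i)) has_field_derivative (1 - s - of_nat i) * z powr (1 - s - of_nat i - 1)) (at z)"
      by (rule has_field_derivative_powr)
    then have "(f i has_field_derivative fall_prod s i * ((1 - s - of_nat i) * z powr (1 - s - of_nat i - 1))) (at z)"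
      unfolding f_def by (rule DERIV_cmult)
    moreover have "fall_prod s i * ((1 - s - of_nat i) * z powr (1 - s - of_nat i - 1)) = f (Suc i) z"
      by (simp add: f_def fall_prod_def algebra_simps)
    ultimately show ?thesis by (metis DERIV_subset subset_UNIV)
  qed
  have 2: "norm (f (Suc K) z) \<le> norm (fall_prod s (Suc K)) * real n powr (- Re s - real K)" if "z \<in> S" for z
  proof -
    from S_pos[OF that] obtain x where x: "z = of_real x" "real n \<le> x" by auto
    have "norm (z powr (1 - s - of_nat (Suc K))) = x powr (Re (1 - s - of_nat (Suc K)))"
      using x assms by (simp add: norm_powr_real_powr)
    also have "\<dots> = x powr (- Re s - real K)" by simp
    also have "\<dots> \<le> real n powr (- Re s - real K)"
      using assms x by (intro powr_mono2') auto
    finally show ?thesis unfolding f_def norm_mult by (intro mult_left_mono) auto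
  qed
  have mem: "of_nat n \<in> S" "of_nat (Suc n) \<in> S"
  proof -
    show "of_nat n \<in> S" unfolding S_def by (rule image_eqI[of _ _ "real n"]) auto
    show "of_nat (Suc n) \<in> S" unfolding S_def by (rule image_eqI[of _ _ "real (Suc n)"]) auto
  qed
  have "norm (f 0 (of_nat (Suc n)) - (\<Sum>i\<le>K. f i (of_nat n) * (of_nat (Suc n) - of_nat n) ^ i / fact i))
      \<le> (norm (fall_prod s (Suc K)) * real n powr (- Re s - real K)) * norm (of_nat (Suc n) - of_nat n :: complex) ^ Suc K / fact K"
    using complex_Taylor[OF conv 1 2 mem] by blast
  then show ?thesis by (simp add: f_def taylor_rem_def fall_prod_def)
qed

lemma taylor_rem_holomorphic: "n > 0 \<Longrightarrow> taylor_rem K n holomorphic_on UNIV"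
  unfolding taylor_rem_def fall_prod_def
  by (intro holomorphic_intros) auto

lemma fall_prod_holomorphic: "(\<lambda>s. fall_prod s i) holomorphic_on UNIV"
  unfolding fall_prod_def by (intro holomorphic_intros)

lemma norm_inverse_powr: "norm (1 / (of_nat (Suc n) :: complex) powr s) = real (Suc n) powr (- Re s)"
  by (simp only: norm_divide norm_of_nat_powr[of "Suc n"] powr_minus_divide) simp

lemma summable_dirichlet:
  assumes "Re s > 1" shows "summable (\<lambda>n. 1 / (of_nat (Suc n) :: complex) powr s)"
proof (rule summable_norm_cancel)
  have "summable (\<lambda>n. real (Suc n) powr (- Re s))"
    using assms by (subst summable_Suc_iff) (simp add: summable_real_powr_iff)
  then show "summable (\<lambda>n. norm (1 / (of_nat (Suc n) :: complex) powr s))"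
    by (simp only: norm_inverse_powr)
qed

lemma summable_taylor_rem:
  assumes "Re s + real K > 1"
  shows "summable (\<lambda>n. taylor_rem K (Suc n) s)"
proof (rule summable_comparison_test')
  have "summable (\<lambda>n. real (Suc n) powr (- Re s - real K))"
    using assms by (subst summable_Suc_iff) (simp add: summable_real_powr_iff)
  then show "summable (\<lambda>n. norm (fall_prod s (Suc K)) * real (Suc n) powr (- Re s - real K) / fact K)"
    by (intro summable_divide summable_mult)
  show "norm (taylor_rem K (Suc n) s) \<le> norm (fall_prod s (Suc K)) * real (Suc n) powr (- Re s - real K) / fact K" for n
    using assms by (intro norm_taylor_rem_le) auto
qed

text \<open>
  The remainders decay like n powr (- Re s - K), uniformly on compact sets, so the Weierstrass test applies
  in a half-plane that grows with K.
\<close>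

lemma suminf_taylor_rem_holomorphic:
  assumes "K > 0"
  shows "(\<lambda>s. \<Sum>n. taylor_rem K (Suc n) s) holomorphic_on {s. Re s > 1 - real K}"
proof (rule holomorphic_uniform_sequence)
  show "open {s. Re s > 1 - real K}" by (rule open_halfspace_Re_gt)
  show "(\<lambda>s. \<Sum>i<n. taylor_rem K (Suc i) s) holomorphic_on {s. Re s > 1 - real K}" for n
    by (intro holomorphic_on_sum holomorphic_on_subset[OF taylor_rem_holomorphic]) auto
  fix z assume z: "z \<in> {s. Re s > 1 - real K}"
  define d where "d = (Re z - (1 - real K)) / 2"
  have d: "d > 0" using z by (simp add: d_def)
  have re: "Re s \<ge> 1 - real K + d" if "s \<in> cball z d" for s
  proof -
    have "Re z - Re s \<le> norm (z - s)" by (metis complex_Re_le_cmod minus_complex.simps(1))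
    then show ?thesis using that by (simp add: d_def dist_norm field_simps)
  qed
  have "bounded ((\<lambda>s. fall_prod s (Suc K)) ` cball z d)"
    by (intro compact_imp_bounded compact_continuous_image holomorphic_on_imp_continuous_on
        holomorphic_on_subset[OF fall_prod_holomorphic]) auto
  then obtain C where C: "\<And>s. s \<in> cball z d \<Longrightarrow> norm (fall_prod s (Suc K)) \<le> C"
    unfolding bounded_iff by blast
  have "uniform_limit (cball z d) (\<lambda>n s. \<Sum>i<n. taylor_rem K (Suc i) s) (\<lambda>s. \<Sum>n. taylor_rem K (Suc n) s) sequentially"
  proof (rule Weierstrass_m_test)
    have "summable (\<lambda>n. real (Suc n) powr (- (1 + d)))"
      using d by (subst summable_Suc_iff) (simp add: summable_real_powr_iff)
    then show "summable (\<lambda>n. C * real (Suc n) powr (- (1 + d)) / fact K)"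
      by (intro summable_divide summable_mult)
    fix n s assume s: "s \<in> cball z d"
    have "norm (taylor_rem K (Suc n) s) \<le> norm (fall_prod s (Suc K)) * real (Suc n) powr (- Re s - real K) / fact K"
      using re[OF s] d by (intro norm_taylor_rem_le) auto
    also have "\<dots> \<le> C * real (Suc n) powr (- (1 + d)) / fact K"
      using C[OF s] re[OF s] by (intro divide_right_mono mult_mono powr_mono) (auto intro: order_trans[OF norm_ge_zero])
    finally show "norm (taylor_rem K (Suc n) s) \<le> \<dots>" .
  qed
  moreover have "cball z d \<subseteq> {s. Re s > 1 - real K}" using re d by force
  ultimately show "\<exists>d>0. cball z d \<subseteq> {s. Re s > 1 - real K} \<and>
      uniform_limit (cball z d) (\<lambda>n s. \<Sum>i<n. taylor_rem K (Suc i) s) (\<lambda>s. \<Sum>n. taylor_rem K (Suc n) s) sequentially"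
    using d by blast
qed

lemma taylor_rem_split:
  assumes "K \<ge> 1" "n > 0"
  shows "of_nat n powr (1 - s) - of_nat (Suc n) powr (1 - s)
     = (s - 1) * (1 / of_nat n powr s)
       + (\<Sum>i\<in>{2..K}. fall_prod s (i - 1) * (s + of_nat i - 2) / fact i * (1 / of_nat n powr (s + of_nat i - 1)))
       - taylor_rem K n s"
proof -
  have pw: "of_nat n powr (1 - s - of_nat i) = 1 / (of_nat n :: complex) powr (s + of_nat i - 1)" for i
    by (metis (no_types, lifting) diff_diff_eq minus_diff_eq powr_minus_divide diff_add_eq_diff_diff_swap add.commute)
  have arith: "X = A + (1 - s) * B + - S \<Longrightarrow> X = A - (s - 1) * B - S" for X A B S :: complex
    by (simp add: algebra_simps)
  have set: "{..K} = insert 0 (insert 1 {2..K})" using assms by auto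
  have fp: "fall_prod s i = - (fall_prod s (i - 1) * (s + of_nat i - 2))" if "i \<ge> 2" for i
  proof -
    have "fall_prod s (Suc (i - 1)) = fall_prod s (i - 1) * (1 - s - of_nat (i - 1))"
      unfolding fall_prod_def by simp
    then show ?thesis using that by (simp add: of_nat_diff algebra_simps)
  qed
  have "(\<Sum>i\<le>K. fall_prod s i * of_nat n powr (1 - s - of_nat i) / fact i)
     = of_nat n powr (1 - s) + (1 - s) * (1 / of_nat n powr s)
      + (\<Sum>i\<in>{2..K}. fall_prod s i * of_nat n powr (1 - s - of_nat i) / fact i)"
    unfolding set using pw[of 1] by (simp add: fall_prod_def)
  also have "(\<Sum>i\<in>{2..K}. fall_prod s i * of_nat n powr (1 - s - of_nat i) / fact i)
    = - (\<Sum>i\<in>{2..K}. fall_prod s (i - 1) * (s + of_nat i - 2) / fact i * (1 / of_nat n powr (s + of_nat i - 1)))"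
    unfolding sum_negf[symmetric] by (intro sum.cong refl) (simp add: fp pw)
  finally have e: "(\<Sum>i\<le>K. fall_prod s i * of_nat n powr (1 - s - of_nat i) / fact i)
     = of_nat n powr (1 - s) - (s - 1) * (1 / of_nat n powr s)
      - (\<Sum>i\<in>{2..K}. fall_prod s (i - 1) * (s + of_nat i - 2) / fact i * (1 / of_nat n powr (s + of_nat i - 1)))"
    by (rule arith)
  show ?thesis unfolding taylor_rem_def e by simp
qed

text \<open>
  Sum \<open>taylor_rem_split\<close> over n: the left-hand sides telescope to 1.
\<close>

lemma dirichlet_recursion:
  assumes "Re s > 1" "K \<ge> 1"
  defines "D \<equiv> \<lambda>s. \<Sum>n. 1 / (of_nat (Suc n) :: complex) powr s"
  shows "(s - 1) * D s = 1 - (\<Sum>i\<in>{2..K}. fall_prod s (i - 1) / fact i * ((s + of_nat i - 2) * D (s + of_nat i - 1)))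
           + (\<Sum>n. taylor_rem K (Suc n) s)"
proof -
  have D: "(\<lambda>n. 1 / (of_nat (Suc n) :: complex) powr z) sums D z" if "Re z > 1" for z
    unfolding D_def using summable_dirichlet[OF that] by (rule summable_sums)
  have R: "(\<lambda>n. taylor_rem K (Suc n) s) sums (\<Sum>n. taylor_rem K (Suc n) s)"
    using assms by (intro summable_sums summable_taylor_rem) auto
  have "(\<lambda>n. (s - 1) * (1 / of_nat (Suc n) powr s)
       + (\<Sum>i\<in>{2..K}. fall_prod s (i - 1) * (s + of_nat i - 2) / fact i * (1 / of_nat (Suc n) powr (s + of_nat i - 1)))
       - taylor_rem K (Suc n) s) sums
     ((s - 1) * D s + (\<Sum>i\<in>{2..K}. fall_prod s (i - 1) * (s + of_nat i - 2) / fact i * D (s + of_nat i - 1))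
       - (\<Sum>n. taylor_rem K (Suc n) s))" (is "?f sums ?S")
    using assms by (intro sums_diff sums_add sums_mult D sums_sum R) auto
  moreover have "?f = (\<lambda>n. of_nat (Suc n) powr (1 - s) - of_nat (Suc (Suc n)) powr (1 - s))"
    using assms by (intro ext, subst taylor_rem_split[of K]) auto
  moreover have "(\<lambda>n. of_nat (Suc n) powr (1 - s) - (of_nat (Suc (Suc n)) :: complex) powr (1 - s)) sums (of_nat (Suc 0) powr (1 - s) - 0)"
  proof (rule telescope_sums')
    show "(\<lambda>n. (of_nat (Suc n) :: complex) powr (1 - s)) \<longlonglongrightarrow> 0"
    proof (rule tendsto_norm_zero_cancel)
      have "(\<lambda>n. real (Suc n) powr (1 - Re s)) \<longlonglongrightarrow> 0"
        using assms by (intro tendsto_neg_powr filterlim_compose[OF filterlim_real_sequentially filterlim_Suc]) auto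
      then show "(\<lambda>n. norm ((of_nat (Suc n) :: complex) powr (1 - s))) \<longlonglongrightarrow> 0"
        by (simp only: norm_of_nat_powr[OF zero_less_Suc]) simp
    qed
  qed
  ultimately have S: "?S = 1" by (metis (no_types, lifting) sums_unique2 of_nat_1 One_nat_def powr_one_eq_one diff_zero)
  have "(\<Sum>i\<in>{2..K}. fall_prod s (i - 1) * (s + of_nat i - 2) / fact i * D (s + of_nat i - 1))
     = (\<Sum>i\<in>{2..K}. fall_prod s (i - 1) / fact i * ((s + of_nat i - 2) * D (s + of_nat i - 1)))"
    by (intro sum.cong refl) simp
  moreover have "X + A - B = 1 \<Longrightarrow> A = A' \<Longrightarrow> X = 1 - A' + B" for X A A' B :: complex
    by (simp add: algebra_simps)
  ultimately show ?thesis using S by blast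
qed

definition zeta_series :: "complex \<Rightarrow> complex" where
  "zeta_series s = (\<Sum>n. 1 / (of_nat (Suc n) :: complex) powr s)"

lemma halfplane_connected: "connected {s. Re s > a}"
  by (intro convex_connected convex_halfspace_Re_gt)

text \<open>
  The values of the Dirichlet series on the right of \<open>dirichlet_recursion\<close> have arguments shifted by at least 1, and the series
  of remainders converges further to the left when K grows. So the formula continues \<open>(s - 1) \<zeta>(s)\<close> one unit to the left.
\<close>

lemma zeta_continuation_step:
  assumes "h holomorphic_on {s. Re s > 1 - real m}" "\<And>s. Re s > 1 \<Longrightarrow> h s = (s - 1) * zeta_series s"
  shows "\<exists>h'. h' holomorphic_on {s. Re s > 1 - real (Suc m)} \<and> (\<forall>s. Re s > 1 \<longrightarrow> h' s = (s - 1) * zeta_series s)"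
proof -
  define K where "K = Suc m"
  define h' where "h' = (\<lambda>s. 1 - (\<Sum>i\<in>{2..K}. fall_prod s (i - 1) / fact i * h (s + of_nat i - 1))
           + (\<Sum>n. taylor_rem K (Suc n) s))"
  have hol: "(\<lambda>s. h (s + of_nat i - 1)) holomorphic_on {s. Re s > 1 - real K}" if "i \<in> {2..K}" for i
  proof -
    have "(h \<circ> (\<lambda>s. s + of_nat i - 1)) holomorphic_on {s. Re s > 1 - real K}"
      by (rule holomorphic_on_compose_gen[OF _ assms(1)]) (use that in \<open>auto intro!: holomorphic_intros simp: K_def\<close>)
    then show ?thesis by (simp add: o_def)
  qed
  have "h' holomorphic_on {s. Re s > 1 - real K}"
    unfolding h'_def
    by (intro holomorphic_intros holomorphic_on_subset[OF fall_prod_holomorphic] hol suminf_taylor_rem_holomorphic)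
       (auto simp: K_def)
  moreover have "h' s = (s - 1) * zeta_series s" if "Re s > 1" for s
    unfolding h'_def using dirichlet_recursion[of s K] that
    by (simp add: zeta_series_def assms(2)[unfolded zeta_series_def] K_def)
  ultimately show ?thesis unfolding K_def by blast
qed

text \<open>
  Two continuations to half-planes agree on the smaller one, so the value at s may be taken from any
  half-plane that contains s.
\<close>

lemma zeta_continuation_exists:
  "\<exists>h. h holomorphic_on UNIV \<and> (\<forall>s. Re s > 1 \<longrightarrow> h s = (s - 1) * zeta_series s)"
proof -
  have ex: "\<exists>h. h holomorphic_on {s. Re s > 1 - real (Suc m)} \<and> (\<forall>s. Re s > 1 \<longrightarrow> h s = (s - 1) * zeta_series s)" for m
  proof (induction m)
    case 0
    let ?h = "\<lambda>s. 1 + (\<Sum>n. taylor_rem 1 (Suc n) s)"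
    have "?h holomorphic_on {s. Re s > 1 - real (Suc 0)}"
      using suminf_taylor_rem_holomorphic[of 1] by (intro holomorphic_intros) simp
    moreover have "?h s = (s - 1) * zeta_series s" if "Re s > 1" for s
      using dirichlet_recursion[OF that, of 1] unfolding zeta_series_def by simp
    ultimately show ?case by blast
  next
    case (Suc m)
    then show ?case using zeta_continuation_step by blast
  qed
  then have "\<exists>h. h holomorphic_on {s. Re s > 1 - real m} \<and> (\<forall>s. Re s > 1 \<longrightarrow> h s = (s - 1) * zeta_series s)"
    if "m \<ge> 1" for m
  proof -
    from that obtain m' where "m = Suc m'" by (cases m) auto
    then show ?thesis using ex by blast
  qed
  then obtain h where h: "\<And>m. m \<ge> 1 \<Longrightarrow> h m holomorphic_on {s. Re s > 1 - real m}"
    "\<And>m s. m \<ge> 1 \<Longrightarrow> Re s > 1 \<Longrightarrow> h m s = (s - 1) * zeta_series s"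
    by metis
  have eq: "h m s = h m' s" if "1 \<le> m" "m \<le> m'" "Re s > 1 - real m" for m m' s
  proof (rule analytic_continuation_open[of "{s. Re s > 1}" "{s. Re s > 1 - real m}" "h m" "h m'" s])
    show "{s. Re s > 1} \<noteq> {}" by (auto intro!: exI[of _ 2])
    show "h m' holomorphic_on {s. 1 - real m < Re s}"
      by (rule holomorphic_on_subset[OF h(1)]) (use that in auto)
    show "h m holomorphic_on {s. 1 - real m < Re s}" by (rule h(1)) (use that in auto)
    show "h m s = h m' s" if "s \<in> {s. Re s > 1}" for s using h(2)[of m s] h(2)[of m' s] that \<open>1 \<le> m\<close> \<open>m \<le> m'\<close> by simp
  qed (use that in \<open>auto simp: open_halfspace_Re_gt halfplane_connected\<close>)
  define m where "m = (\<lambda>s. nat \<lceil>\<bar>Re s\<bar>\<rceil> + 3)"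
  define H where "H = (\<lambda>s. h (m s) s)"
  have m: "1 - real (m s) < Re s" "m s \<ge> 1" for s
  proof -
    have "\<bar>Re s\<bar> \<le> real (nat \<lceil>\<bar>Re s\<bar>\<rceil>)" by linarith
    then show "1 - real (m s) < Re s" unfolding m_def by linarith
  qed (simp add: m_def)
  have H: "H s = h k s" if "k \<ge> 1" "Re s > 1 - real k" for s k
    unfolding H_def using eq[of k "m s" s] eq[of "m s" k s] m[of s] that by (metis nle_le)
  have "H holomorphic_on UNIV"
  proof (rule holomorphic_onI)
    fix z :: complex
    have "h (m z) holomorphic_on {s. Re s > 1 - real (m z)}" using h(1) m by blast
    then have "H holomorphic_on {s. Re s > 1 - real (m z)}"
      by (rule holomorphic_transform) (use H[of "m z"] m[of z] in simp)
    then have "H field_differentiable (at z)"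
      using m[of z] open_halfspace_Re_gt by (auto simp: holomorphic_on_open field_differentiable_def)
    then show "H field_differentiable (at z within UNIV)" by simp
  qed
  moreover have "H s = (s - 1) * zeta_series s" if "Re s > 1" for s
    using h(2)[OF m(2) that] unfolding H_def .
  ultimately show ?thesis by blast
qed

lemma zeta_unique:
  assumes "f holomorphic_on - {1}" "\<And>s. Re s > 1 \<Longrightarrow> f s = zeta_series s" "f 1 = 0"
      and "g holomorphic_on - {1}" "\<And>s. Re s > 1 \<Longrightarrow> g s = zeta_series s" "g 1 = 0"
  shows "f = g"
proof
  fix s show "f s = g s"
  proof (cases "s = 1")
    case False
    show ?thesis
    proof (rule analytic_continuation_open[of "{s. Re s > 1}" "- {1}" f g s])
      show "{s. Re s > 1} \<noteq> {}" by (auto intro!: exI[of _ 2])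
      show "connected (- {1 :: complex})" by (rule connected_punctured_universe) simp
    qed (use assms False in \<open>auto simp: open_halfspace_Re_gt\<close>)
  qed (use assms in simp)
qed

lemma zeta_spec:
  "zeta holomorphic_on - {1} \<and> (\<forall>s. Re s > 1 \<longrightarrow> (\<lambda>n. 1 / of_nat (Suc n) powr s) sums zeta s) \<and> zeta 1 = 0"
proof -
  let ?P = "\<lambda>f. f holomorphic_on - {1} \<and> (\<forall>s. Re s > 1 \<longrightarrow> (\<lambda>n. 1 / (of_nat (Suc n) :: complex) powr s) sums f s) \<and> f 1 = 0"
  obtain h where h: "h holomorphic_on UNIV" "\<And>s. Re s > 1 \<Longrightarrow> h s = (s - 1) * zeta_series s"
    using zeta_continuation_exists by blast
  define f where "f = (\<lambda>s. if s = 1 then 0 else h s / (s - 1))"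
  have "(\<lambda>s. h s / (s - 1)) holomorphic_on - {1}"
    by (intro holomorphic_intros holomorphic_on_subset[OF h(1)]) auto
  then have hol: "f holomorphic_on - {1}"
    by (rule holomorphic_transform) (auto simp: f_def)
  have ser: "f s = zeta_series s" if "Re s > 1" for s
    using h(2)[OF that] that by (auto simp: f_def)
  have P: "?P f"
    using hol ser summable_sums[OF summable_dirichlet] by (auto simp: zeta_series_def f_def)
  have "\<exists>!f. ?P f"
  proof (rule ex1I[of _ f])
    show "?P f" by (rule P)
    fix g assume "?P g"
    then show "g = f" using P by (intro zeta_unique) (auto simp: zeta_series_def sums_iff)
  qed
  from theI'[OF this] show ?thesis unfolding zeta_def .
qed

text \<open>
  The case K = 1 of the recursion. It holds by analytic continuation in the half-plane where the series of
  remainders converges.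
\<close>

lemma zeta_eq_taylor_rem:
  assumes "Re s > 0" "s \<noteq> 1"
  shows "(s - 1) * zeta s = 1 + (\<Sum>n. taylor_rem 1 (Suc n) s)"
proof -
  obtain h where h: "h holomorphic_on UNIV" "\<And>s. Re s > 1 \<Longrightarrow> h s = (s - 1) * zeta_series s"
    using zeta_continuation_exists by blast
  have z: "zeta s = zeta_series s" if "Re s > 1" for s
    using zeta_spec that by (auto simp: zeta_series_def sums_iff)
  have 1: "h s = (s - 1) * zeta s"
  proof (rule analytic_continuation_open[of "{s. Re s > 1}" "- {1}" h "\<lambda>s. (s - 1) * zeta s" s])
    show "{s. Re s > 1} \<noteq> {}" by (auto intro!: exI[of _ 2])
    show "connected (- {1 :: complex})" by (rule connected_punctured_universe) simp
    show "(\<lambda>s. (s - 1) * zeta s) holomorphic_on - {1}"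
      using zeta_spec by (intro holomorphic_intros) auto
    show "h holomorphic_on - {1}" using h(1) holomorphic_on_subset by blast
  qed (use assms z h(2) in \<open>auto simp: open_halfspace_Re_gt\<close>)
  have 2: "h s = 1 + (\<Sum>n. taylor_rem 1 (Suc n) s)"
  proof (rule analytic_continuation_open[of "{s. Re s > 1}" "{s. Re s > 0}" h "\<lambda>s. 1 + (\<Sum>n. taylor_rem 1 (Suc n) s)" s])
    show "{s. Re s > 1} \<noteq> {}" by (auto intro!: exI[of _ 2])
    show "(\<lambda>s. 1 + (\<Sum>n. taylor_rem 1 (Suc n) s)) holomorphic_on {s. Re s > 0}"
      using suminf_taylor_rem_holomorphic[of 1] by (auto intro!: holomorphic_intros)
    show "h s = 1 + (\<Sum>n. taylor_rem 1 (Suc n) s)" if "s \<in> {s. Re s > 1}" for s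
      using dirichlet_recursion[of s 1] that by (simp add: h(2) zeta_series_def)
    show "h holomorphic_on {s. Re s > 0}" using h(1) holomorphic_on_subset by blast
  qed (use assms in \<open>auto simp: open_halfspace_Re_gt halfplane_connected\<close>)
  show ?thesis using 1 2 by simp
qed

lemma sum_powr_three_halves_le:
  assumes "n \<ge> 1"
  shows "(\<Sum>i<m. real (n + i) powr (-3/2)) \<le> 4 / sqrt (real n) - 4 / sqrt (real (n + m))"
proof (induction m)
  case 0
  then show ?case by simp
next
  case (Suc m)
  define a where "a = sqrt (real (n + m))"
  define b where "b = sqrt (real (n + Suc m))"
  have a1: "a \<ge> 1" using assms by (simp add: a_def)
  have b2: "b\<^sup>2 = a\<^sup>2 + 1" by (simp add: a_def b_def)
  have b0: "b > 0" using assms by (simp add: b_def)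
  have "b\<^sup>2 \<le> (3/2 * a)\<^sup>2" using a1 b2 using mult_mono[of 1 a 1 a] by (simp add: power2_eq_square)
  then have b: "b \<le> 3/2 * a" by (rule power2_le_imp_le) (use a1 in auto)
  have "real (n + m) powr (-3/2) = 1 / a ^ 3"
  proof -
    have "real (n + m) powr (-3/2) = (a\<^sup>2) powr (-3/2)" by (simp add: a_def)
    also have "\<dots> = a powr (-3)" using a1 by (simp add: powr_powr flip: powr_numeral)
    also have "\<dots> = 1 / a ^ 3" using a1 by (simp add: powr_minus_divide flip: powr_numeral)
    finally show ?thesis .
  qed
  also have "\<dots> \<le> 4 / a - 4 / b"
  proof -
    have "b * (a + b) \<le> 3/2 * a * (a + 3/2 * a)" using a1 b b0 by (intro mult_mono) auto
    then have "b * (a + b) * 4 \<le> 15 * (a * a)" by simp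
    moreover have "0 \<le> a * a" by simp
    ultimately have q: "b * (a + b) \<le> 4 * a\<^sup>2" unfolding power2_eq_square by linarith
    have d: "(b - a) * (a + b) = 1" using b2 by (simp add: algebra_simps power2_eq_square)
    then have "b - a \<ge> 0" using a1 b0 by (metis add_pos_pos less_le_trans mult_le_cancel_right_pos mult_zero_left zero_le_one zero_less_one)
    then have "b * (a + b) * (b - a) \<le> 4 * a\<^sup>2 * (b - a)" using q by (rule mult_right_mono[rotated])
    moreover have "b * (a + b) * (b - a) = b" using d by (simp add: mult.assoc mult.commute[of "a + b"])
    ultimately have "b \<le> 4 * a\<^sup>2 * (b - a)" by simp
    then show ?thesis using a1 b0 by (simp add: field_simps power2_eq_square power3_eq_cube)
  qed
  finally show ?case using Suc.IH by (simp add: a_def b_def)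
qed

text \<open>
  The partial sum of the Dirichlet series minus \<open>N^(1-s)/(1 - s)\<close>, the first terms of the Euler--Maclaurin
  formula for \<open>\<zeta>(s)\<close>.
\<close>

definition zeta_partial :: "nat \<Rightarrow> complex \<Rightarrow> complex" where
  "zeta_partial N s = (\<Sum>m=1..N. of_nat m powr (- s)) - of_nat N powr (1 - s) / (1 - s)"

lemma zeta_minus_partial_eq:
  assumes "Re s > 0" "s \<noteq> 1" "N \<ge> 1"
  shows "(s - 1) * (zeta s - zeta_partial N s) = (\<Sum>n. taylor_rem 1 (n + N) s) - (s - 1) * of_nat N powr (- s)"
proof -
  have split: "(s - 1) * of_nat n powr (- s) = of_nat n powr (1 - s) - of_nat (Suc n) powr (1 - s) + taylor_rem 1 n s"
    if "n > 0" for n using taylor_rem_split[of 1 n s] that by (simp add: powr_minus_divide)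
  have fin: "(s - 1) * (\<Sum>n=1..<N. of_nat n powr (- s)) = 1 - of_nat N powr (1 - s) + (\<Sum>n=1..<N. taylor_rem 1 n s)"
    using assms(3)
  proof (induction N rule: nat_induct_at_least)
    case (Suc m)
    then show ?case using split[of m] by (simp add: ring_distribs)
  qed simp
  have summ: "summable (\<lambda>n. taylor_rem 1 (Suc n) s)" using assms by (intro summable_taylor_rem) auto
  have "(\<Sum>n. taylor_rem 1 (Suc n) s) = (\<Sum>n. taylor_rem 1 (Suc (n + (N - 1))) s) + (\<Sum>n<N-1. taylor_rem 1 (Suc n) s)"
    by (rule suminf_split_initial_segment[OF summ])
  also have "(\<lambda>n. taylor_rem 1 (Suc (n + (N - 1))) s) = (\<lambda>n. taylor_rem 1 (n + N) s)"
    using assms(3) by (intro ext) simp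
  also have "(\<Sum>n<N-1. taylor_rem 1 (Suc n) s) = (\<Sum>n=1..<N. taylor_rem 1 n s)"
    by (rule sum.reindex_bij_witness[of _ "\<lambda>n. n - 1" Suc]) auto
  finally have z: "(s - 1) * zeta s = 1 + (\<Sum>n. taylor_rem 1 (n + N) s) + (\<Sum>n=1..<N. taylor_rem 1 n s)"
    using zeta_eq_taylor_rem[OF assms(1,2)] by simp
  have set: "{1..N} = insert N {1..<N}" using assms by auto
  have p: "(s - 1) * zeta_partial N s = (s - 1) * of_nat N powr (- s) + (s - 1) * (\<Sum>n=1..<N. of_nat n powr (- s)) + of_nat N powr (1 - s)"
    using assms unfolding zeta_partial_def set by (simp add: ring_distribs field_simps)
  show ?thesis unfolding right_diff_distrib z p fin by simp
qed

text \<open>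
  The remainders of order 1 are at most |s| |s - 1| n powr (-3/2), and |s - 1| = |s| on the critical line.
\<close>

lemma norm_zeta_minus_partial_le:
  assumes "Re s = 1/2" "N \<ge> 1"
  shows "norm (zeta s - zeta_partial N s) \<le> (4 * norm s + 1) / sqrt (real N)"
proof -
  have s1: "s \<noteq> 1" using assms by auto
  have n1: "norm (s - 1) = norm s"
  proof -
    have "(Re s - 1)\<^sup>2 = (Re s)\<^sup>2" unfolding assms(1) by (simp add: power2_eq_square)
    then have "(cmod (s - 1))\<^sup>2 = (cmod s)\<^sup>2" by (simp add: cmod_power2)
    then show ?thesis by (metis norm_ge_zero power2_eq_iff_nonneg)
  qed
  have s0: "norm s > 0" using assms by auto
  have bd: "norm (taylor_rem 1 (n + N) s) \<le> (norm s)\<^sup>2 * real (N + n) powr (-3/2)" for n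
  proof -
    have "norm (taylor_rem 1 (n + N) s) \<le> norm (fall_prod s (Suc 1)) * real (n + N) powr (- Re s - real 1) / fact 1"
      using assms by (intro norm_taylor_rem_le) auto
    also have "norm (fall_prod s (Suc 1)) = (norm s)\<^sup>2"
      using n1 by (simp add: fall_prod_def norm_mult norm_minus_commute power2_eq_square)
    finally show ?thesis using assms by (simp add: add.commute)
  qed
  have sm: "(\<Sum>i<m. real (N + i) powr (-3/2)) \<le> 4 / sqrt (real N)" for m
    using sum_powr_three_halves_le[OF assms(2), of m] by (smt (verit) divide_nonneg_nonneg real_sqrt_ge_zero of_nat_0_le_iff)
  have sums: "summable (\<lambda>n. real (N + n) powr (-3/2))"
    by (rule summableI_nonneg_bounded[OF _ sm]) auto
  have "norm (\<Sum>n. taylor_rem 1 (n + N) s) \<le> (\<Sum>n. (norm s)\<^sup>2 * real (N + n) powr (-3/2))"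
    by (rule norm_suminf_le[OF bd summable_mult[OF sums]])
  also have "\<dots> = (norm s)\<^sup>2 * (\<Sum>n. real (N + n) powr (-3/2))" using sums by (rule suminf_mult)
  also have "\<dots> \<le> (norm s)\<^sup>2 * (4 / sqrt (real N))"
    by (intro mult_left_mono suminf_le_const sums sm) auto
  finally have A: "norm (\<Sum>n. taylor_rem 1 (n + N) s) \<le> (norm s)\<^sup>2 * (4 / sqrt (real N))" .
  have B: "norm ((s - 1) * of_nat N powr (- s)) = norm s * (1 / sqrt (real N))"
  proof -
    have "norm ((s - 1) * of_nat N powr (- s)) = norm s * real N powr (- (1/2))"
      unfolding norm_mult n1 using assms(2) by (subst norm_of_nat_powr) (simp_all add: assms(1))
    also have "real N powr (- (1/2)) = 1 / sqrt (real N)"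
      unfolding powr_minus_divide by (simp add: powr_half_sqrt)
    finally show ?thesis .
  qed
  have "norm s * norm (zeta s - zeta_partial N s) = norm ((\<Sum>n. taylor_rem 1 (n + N) s) - (s - 1) * of_nat N powr (- s))"
    using zeta_minus_partial_eq[of s N] assms s1 n1 by (simp add: norm_mult[symmetric]) (metis norm_mult)
  also have "\<dots> \<le> norm s * ((4 * norm s + 1) / sqrt (real N))"
  proof -
    have "norm ((\<Sum>n. taylor_rem 1 (n + N) s) - (s - 1) * of_nat N powr (- s))
        \<le> (norm s)\<^sup>2 * (4 / sqrt (real N)) + norm s * (1 / sqrt (real N))"
      using norm_triangle_ineq4[of "\<Sum>n. taylor_rem 1 (n + N) s" "(s - 1) * of_nat N powr (- s)"] A B by linarith
    also have "\<dots> = norm s * ((4 * norm s + 1) / sqrt (real N))"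
      by (simp add: add_divide_distrib ring_distribs power2_eq_square)
    finally show ?thesis .
  qed
  finally show ?thesis using mult_le_cancel_left_pos[OF s0] by blast
qed

text \<open>
  A crude bound, the case N = 1 of the truncation; it serves to control Gaussian tails and truncation errors.
\<close>

lemma norm_zeta_half_le: "norm (zeta (Complex (1/2) t)) \<le> 6 * (1 + \<bar>t\<bar>)"
proof -
  let ?s = "Complex (1/2) t"
  have ns: "norm ?s \<le> 1/2 + \<bar>t\<bar>" by (rule order_trans[OF cmod_le]) simp
  have "norm (zeta ?s - zeta_partial 1 ?s) \<le> (4 * norm ?s + 1) / sqrt (real 1)"
    by (rule norm_zeta_minus_partial_le) auto
  moreover have "norm (zeta_partial 1 ?s) \<le> 3"
  proof -
    have "norm (1 / (1 - ?s)) \<le> 2"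
    proof -
      have "norm (1 - ?s) \<ge> 1/2" using complex_Re_le_cmod[of "1 - ?s"] by simp
      then have "1 / norm (1 - ?s) \<le> 1 / (1/2)" by (intro divide_left_mono mult_pos_pos) auto
      then show ?thesis by (simp add: norm_divide)
    qed
    then show ?thesis using norm_triangle_ineq4[of 1 "1 / (1 - ?s)"] by (simp add: zeta_partial_def)
  qed
  ultimately show ?thesis using ns norm_triangle_sub[of "zeta ?s" "zeta_partial 1 ?s"] by simp
qed

lemma continuous_on_zeta_half: "continuous_on A (\<lambda>t. zeta (Complex (1/2) t))"
proof -
  have "continuous_on (- {1}) zeta" using zeta_spec holomorphic_on_imp_continuous_on by blast
  then show ?thesis
    by (rule continuous_on_compose2) (auto intro!: continuous_intros simp: complex_eq_iff Complex_eq)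
qed

section \<open>A smoothed indicator function and its Fourier transform\<close>

text \<open>
  The convolution of the indicator function of [-T, T] with a centred normal density of standard deviation \<sigma>.
\<close>

definition weight :: "real \<Rightarrow> real \<Rightarrow> real \<Rightarrow> real" where
  "weight T \<sigma> t = (LINT \<tau>|lborel. indicator {-T..T} \<tau> * normal_density \<tau> \<sigma> t)"

text \<open>
  The Fourier transform of \<open>weight T \<sigma>\<close>, a product of the transforms of the two convolved functions; the value at 0
  is the continuous one.
\<close>

definition weight_ft :: "real \<Rightarrow> real \<Rightarrow> real \<Rightarrow> real" where
  "weight_ft T \<sigma> y = (if y = 0 then 2 * T else 2 * sin (T * y) / y) * exp (- (\<sigma> * y)\<^sup>2 / 2)"

lemma normal_density_sym: "normal_density \<tau> \<sigma> t = normal_density t \<sigma> \<tau>"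
  by (simp add: normal_density_def power2_commute)

lemma measurable_normal_density2 [measurable]:
  "(\<lambda>(\<tau>, t). normal_density \<tau> \<sigma> t) \<in> borel_measurable (lborel \<Otimes>\<^sub>M lborel)"
  unfolding normal_density_def by measurable

lemma weight_integrable_kernel:
  assumes "\<sigma> > 0"
  shows "integrable lborel (\<lambda>\<tau>. indicator {-T..T} \<tau> * normal_density \<tau> \<sigma> t)"
  using integrable_mult_indicator[of "{-T..T}" lborel "normal_density t \<sigma>"] assms
  by (simp add: normal_density_sym[of _ \<sigma> t] integrable_normal_density)

lemma weight_nonneg: "weight T \<sigma> t \<ge> 0"
  unfolding weight_def by (intro integral_nonneg_AE) auto

lemma weight_le_1: "\<sigma> > 0 \<Longrightarrow> weight T \<sigma> t \<le> 1"
proof -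
  assume s: "\<sigma> > 0"
  have "weight T \<sigma> t \<le> (LINT \<tau>|lborel. normal_density t \<sigma> \<tau>)"
    unfolding weight_def
    by (intro integral_mono weight_integrable_kernel s integrable_normal_density)
       (auto simp: normal_density_sym[of _ \<sigma> t] indicator_def)
  then show ?thesis using s by (simp add: integral_normal_density)
qed

text \<open>
  If \<tau> lies in the interval and c is its end point nearest to t, then \<open>(t - \<tau>)^2 \<ge> (t - c)^2 + (\<tau> - c)^2\<close>. Hence the
  density splits off the factor \<open>exp (- (t - c)^2 / (2 \<sigma>^2))\<close>, and a normal density of total mass 1 is left.
\<close>

lemma weight_le_exp:
  assumes s: "\<sigma> > 0" and t: "\<bar>t\<bar> \<ge> T"
  shows "weight T \<sigma> t \<le> exp (- (\<bar>t\<bar> - T)\<^sup>2 / (2 * \<sigma>\<^sup>2))"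
proof -
  define c where "c = (if t \<ge> 0 then T else -T)"
  have le: "indicator {-T..T} \<tau> * normal_density \<tau> \<sigma> t \<le> exp (- (\<bar>t\<bar> - T)\<^sup>2 / (2 * \<sigma>\<^sup>2)) * normal_density c \<sigma> \<tau>" for \<tau>
  proof (cases "\<tau> \<in> {-T..T}")
    case True
    have "(t - \<tau>)\<^sup>2 = (t - c)\<^sup>2 + (\<tau> - c)\<^sup>2 + 2 * ((t - c) * (c - \<tau>))" by (simp add: power2_eq_square algebra_simps)
    moreover have "(t - c) * (c - \<tau>) \<ge> 0" using True t unfolding c_def
      by (cases "t \<ge> 0") (auto simp: zero_le_mult_iff)
    moreover have "(t - c)\<^sup>2 = (\<bar>t\<bar> - T)\<^sup>2" unfolding c_def by (auto simp: power2_eq_square algebra_simps)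
    ultimately have "(t - \<tau>)\<^sup>2 \<ge> (\<bar>t\<bar> - T)\<^sup>2 + (\<tau> - c)\<^sup>2" by linarith
    then have "- (t - \<tau>)\<^sup>2 / (2 * \<sigma>\<^sup>2) \<le> (- (\<bar>t\<bar> - T)\<^sup>2 + - (\<tau> - c)\<^sup>2) / (2 * \<sigma>\<^sup>2)"
      by (intro divide_right_mono) auto
    then have "exp (- (t - \<tau>)\<^sup>2 / (2 * \<sigma>\<^sup>2)) \<le> exp (- (\<bar>t\<bar> - T)\<^sup>2 / (2 * \<sigma>\<^sup>2)) * exp (- (\<tau> - c)\<^sup>2 / (2 * \<sigma>\<^sup>2))"
      unfolding exp_add[symmetric] add_divide_distrib[symmetric] by simp
    then have "1 / sqrt (2 * pi * \<sigma>\<^sup>2) * exp (- (t - \<tau>)\<^sup>2 / (2 * \<sigma>\<^sup>2))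
        \<le> 1 / sqrt (2 * pi * \<sigma>\<^sup>2) * (exp (- (\<bar>t\<bar> - T)\<^sup>2 / (2 * \<sigma>\<^sup>2)) * exp (- (\<tau> - c)\<^sup>2 / (2 * \<sigma>\<^sup>2)))"
      by (rule mult_left_mono) auto
    then show ?thesis using True by (simp add: normal_density_def mult_ac)
  qed auto
  have "weight T \<sigma> t \<le> (LINT \<tau>|lborel. exp (- (\<bar>t\<bar> - T)\<^sup>2 / (2 * \<sigma>\<^sup>2)) * normal_density c \<sigma> \<tau>)"
    unfolding weight_def
    by (intro integral_mono weight_integrable_kernel s integrable_mult_right integrable_normal_density le)
  then show ?thesis using s by (simp add: integral_normal_density)
qed

text \<open>
  The complement of the interval consists of two half-lines at distance at least a from t, and each of them is
  treated as in \<open>weight_le_exp\<close>.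
\<close>

lemma weight_ge:
  assumes s: "\<sigma> > 0" and a: "a \<ge> 0" "\<bar>t\<bar> \<le> T - a"
  shows "weight T \<sigma> t \<ge> 1 - 2 * exp (- a\<^sup>2 / (2 * \<sigma>\<^sup>2))"
proof -
  let ?e = "exp (- a\<^sup>2 / (2 * \<sigma>\<^sup>2))"
  have le1: "normal_density t \<sigma> \<tau> \<le> ?e * normal_density c \<sigma> \<tau>"
    if "(t - \<tau>)\<^sup>2 \<ge> a\<^sup>2 + (\<tau> - c)\<^sup>2" for c \<tau>
  proof -
    have "- (\<tau> - t)\<^sup>2 / (2 * \<sigma>\<^sup>2) \<le> (- a\<^sup>2 + - (\<tau> - c)\<^sup>2) / (2 * \<sigma>\<^sup>2)"
      using that by (intro divide_right_mono) (auto simp: power2_commute)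
    then have "exp (- (\<tau> - t)\<^sup>2 / (2 * \<sigma>\<^sup>2)) \<le> ?e * exp (- (\<tau> - c)\<^sup>2 / (2 * \<sigma>\<^sup>2))"
      unfolding exp_add[symmetric] add_divide_distrib[symmetric] by simp
    then have "1 / sqrt (2 * pi * \<sigma>\<^sup>2) * exp (- (\<tau> - t)\<^sup>2 / (2 * \<sigma>\<^sup>2))
        \<le> 1 / sqrt (2 * pi * \<sigma>\<^sup>2) * (?e * exp (- (\<tau> - c)\<^sup>2 / (2 * \<sigma>\<^sup>2)))"
      by (rule mult_left_mono) auto
    then show ?thesis by (simp add: normal_density_def mult_ac)
  qed
  have le: "normal_density t \<sigma> \<tau> - indicator {-T..T} \<tau> * normal_density \<tau> \<sigma> t
      \<le> ?e * normal_density (t + a) \<sigma> \<tau> + ?e * normal_density (t - a) \<sigma> \<tau>" for \<tau>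
  proof -
    have nn: "?e * normal_density (t + a) \<sigma> \<tau> \<ge> 0" "?e * normal_density (t - a) \<sigma> \<tau> \<ge> 0" by auto
    consider "\<tau> \<in> {-T..T}" | "\<tau> > T" | "\<tau> < -T" by fastforce
    then show ?thesis
    proof cases
      case 1
      then show ?thesis using nn by (simp add: normal_density_sym[of \<tau>])
    next
      case 2
      then have "a * (\<tau> - t - a) \<ge> 0" using a by (intro mult_nonneg_nonneg) auto
      then have "normal_density t \<sigma> \<tau> \<le> ?e * normal_density (t + a) \<sigma> \<tau>"
        by (intro le1) (simp add: power2_eq_square algebra_simps)
      moreover have "indicator {-T..T} \<tau> * normal_density \<tau> \<sigma> t = 0" using 2 by simp
      ultimately show ?thesis using nn by linarith
    next
      case 3
      then have "a * (t - \<tau> - a) \<ge> 0" using a by (intro mult_nonneg_nonneg) auto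
      then have "normal_density t \<sigma> \<tau> \<le> ?e * normal_density (t - a) \<sigma> \<tau>"
        by (intro le1) (simp add: power2_eq_square algebra_simps)
      moreover have "indicator {-T..T} \<tau> * normal_density \<tau> \<sigma> t = 0" using 3 by simp
      ultimately show ?thesis using nn by linarith
    qed
  qed
  have "(LINT \<tau>|lborel. normal_density t \<sigma> \<tau> - indicator {-T..T} \<tau> * normal_density \<tau> \<sigma> t)
      \<le> (LINT \<tau>|lborel. ?e * normal_density (t + a) \<sigma> \<tau> + ?e * normal_density (t - a) \<sigma> \<tau>)"
    by (rule integral_mono[OF _ _ le])
       (intro Bochner_Integration.integrable_diff Bochner_Integration.integrable_add integrable_mult_right
         integrable_normal_density weight_integrable_kernel s)+
  moreover have "(LINT \<tau>|lborel. normal_density t \<sigma> \<tau> - indicator {-T..T} \<tau> * normal_density \<tau> \<sigma> t)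
      = 1 - weight T \<sigma> t"
    using s unfolding weight_def
    by (subst Bochner_Integration.integral_diff) (auto intro: weight_integrable_kernel simp: integral_normal_density integrable_normal_density)
  moreover have "(LINT \<tau>|lborel. ?e * normal_density (t + a) \<sigma> \<tau> + ?e * normal_density (t - a) \<sigma> \<tau>) = ?e + ?e"
    using s by (subst Bochner_Integration.integral_add) (auto simp: integral_normal_density integrable_normal_density)
  ultimately show ?thesis by simp
qed

lemma normal_quadratic_moment:
  assumes "\<sigma> > 0"
  shows "has_bochner_integral lborel (\<lambda>t. normal_density \<tau> \<sigma> t * (1 + t\<^sup>2)) (1 + \<tau>\<^sup>2 + \<sigma>\<^sup>2)"
proof -
  have "has_bochner_integral lborel (\<lambda>t. normal_density \<tau> \<sigma> t * (t - \<tau>)\<^sup>2) (\<sigma>\<^sup>2)"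
    using normal_moment_even[of \<sigma> \<tau> 1] assms by (simp add: power2_eq_square fact_2 field_simps)
  moreover have "has_bochner_integral lborel (\<lambda>t. normal_density \<tau> \<sigma> t * t) \<tau>"
    by (rule normal_moment_nz_1[OF assms])
  moreover have "has_bochner_integral lborel (\<lambda>t. normal_density \<tau> \<sigma> t) 1"
    using assms by (simp add: has_bochner_integral_iff integral_normal_density integrable_normal_density)
  ultimately have "has_bochner_integral lborel
      (\<lambda>t. normal_density \<tau> \<sigma> t * (t - \<tau>)\<^sup>2 + 2 * \<tau> * (normal_density \<tau> \<sigma> t * t) + (1 - \<tau>\<^sup>2) * normal_density \<tau> \<sigma> t)
      (\<sigma>\<^sup>2 + 2 * \<tau> * \<tau> + (1 - \<tau>\<^sup>2) * 1)"
    by (intro has_bochner_integral_add has_bochner_integral_mult_right) auto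
  then show ?thesis by (simp add: power2_eq_square algebra_simps)
qed

text \<open>
  Quadratic growth is all that \<open>\<zeta>(1/2 + it)\<close> requires, and the normal density has a finite second moment.
\<close>

lemma integrable_pair_weight_kernel:
  assumes s: "\<sigma> > 0" and [measurable]: "f \<in> borel_measurable borel" and f: "\<And>t. \<bar>f t\<bar> \<le> C * (1 + t\<^sup>2)"
  shows "integrable (lborel \<Otimes>\<^sub>M lborel) (\<lambda>(\<tau>, t). indicator {-T..T} \<tau> * normal_density \<tau> \<sigma> t * (f t :: real))"
proof (rule lborel_pair.Fubini_integrable)
  have int: "integrable lborel (\<lambda>t. normal_density \<tau> \<sigma> t * (1 + t\<^sup>2))" for \<tau>
    using normal_quadratic_moment[OF s] by (auto simp: has_bochner_integral_iff)
  have C: "C \<ge> 0" using f[of 0] by simp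
  have intf: "integrable lborel (\<lambda>t. indicator {-T..T} \<tau> * normal_density \<tau> \<sigma> t * f t)" for \<tau>
  proof (rule Bochner_Integration.integrable_bound)
    show "integrable lborel (\<lambda>t. C * (normal_density \<tau> \<sigma> t * (1 + t\<^sup>2)))" using int by simp
    show "AE t in lborel. norm (indicator {-T..T} \<tau> * normal_density \<tau> \<sigma> t * f t) \<le> norm (C * (normal_density \<tau> \<sigma> t * (1 + t\<^sup>2)))"
    proof (rule AE_I2)
      fix t
      have "\<bar>indicator {-T..T} \<tau> * normal_density \<tau> \<sigma> t * f t\<bar> \<le> 1 * normal_density \<tau> \<sigma> t * (C * (1 + t\<^sup>2))"
        unfolding abs_mult using f C by (intro mult_mono) (auto simp: indicator_def)
      then show "norm (indicator {-T..T} \<tau> * normal_density \<tau> \<sigma> t * f t) \<le> norm (C * (normal_density \<tau> \<sigma> t * (1 + t\<^sup>2)))"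
        using C by (simp add: mult_ac abs_mult)
    qed
  qed simp
  show "AE \<tau> in lborel. integrable lborel (\<lambda>t. case (\<tau>, t) of (\<tau>, t) \<Rightarrow> indicator {-T..T} \<tau> * normal_density \<tau> \<sigma> t * f t)"
    using intf by simp
  show "integrable lborel (\<lambda>\<tau>. LINT t|lborel. norm (case (\<tau>, t) of (\<tau>, t) \<Rightarrow> indicator {-T..T} \<tau> * normal_density \<tau> \<sigma> t * f t))"
  proof (rule Bochner_Integration.integrable_bound)
    have "set_integrable lborel {-T..T} (\<lambda>\<tau>. C * (1 + \<tau>\<^sup>2 + \<sigma>\<^sup>2))"
      by (intro borel_integrable_atLeastAtMost') (auto intro!: continuous_intros)
    then show "integrable lborel (\<lambda>\<tau>. indicator {-T..T} \<tau> * (C * (1 + \<tau>\<^sup>2 + \<sigma>\<^sup>2)))"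
      by (simp add: set_integrable_def)
    show "AE \<tau> in lborel. norm (LINT t|lborel. norm (case (\<tau>, t) of (\<tau>, t) \<Rightarrow> indicator {-T..T} \<tau> * normal_density \<tau> \<sigma> t * f t))
       \<le> norm (indicator {-T..T} \<tau> * (C * (1 + \<tau>\<^sup>2 + \<sigma>\<^sup>2)))"
    proof (rule AE_I2)
      fix \<tau>
      have "(LINT t|lborel. norm (indicator {-T..T} \<tau> * normal_density \<tau> \<sigma> t * f t))
         \<le> (LINT t|lborel. indicator {-T..T} \<tau> * C * (normal_density \<tau> \<sigma> t * (1 + t\<^sup>2)))"
      proof (rule integral_mono)
        fix t
        show "norm (indicator {-T..T} \<tau> * normal_density \<tau> \<sigma> t * f t) \<le> indicator {-T..T} \<tau> * C * (normal_density \<tau> \<sigma> t * (1 + t\<^sup>2))"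
          using mult_left_mono[OF f[of t], of "normal_density \<tau> \<sigma> t"] by (auto simp: indicator_def abs_mult mult_ac)
      qed (use intf int in auto)
      also have "\<dots> = indicator {-T..T} \<tau> * (C * (1 + \<tau>\<^sup>2 + \<sigma>\<^sup>2))"
        using normal_quadratic_moment[OF s, of \<tau>] by (simp add: has_bochner_integral_iff)
      finally show "norm (LINT t|lborel. norm (case (\<tau>, t) of (\<tau>, t) \<Rightarrow> indicator {-T..T} \<tau> * normal_density \<tau> \<sigma> t * f t))
       \<le> norm (indicator {-T..T} \<tau> * (C * (1 + \<tau>\<^sup>2 + \<sigma>\<^sup>2)))"
        using C by (simp add: abs_mult)
    qed
  qed measurable
qed measurable

lemma weight_measurable [measurable]: "weight T \<sigma> \<in> borel_measurable borel"
  unfolding weight_def normal_density_def by measurable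

lemma weight_integral:
  assumes s: "\<sigma> > 0" and m[measurable]: "f \<in> borel_measurable borel" and f: "\<And>t. \<bar>f t\<bar> \<le> C * (1 + t\<^sup>2)"
  shows "integrable lborel (\<lambda>t. weight T \<sigma> t * f t)"
    and "(LINT t|lborel. weight T \<sigma> t * f t) = (LINT \<tau>|lborel. indicator {-T..T} \<tau> * (LINT t|lborel. normal_density \<tau> \<sigma> t * f t))"
proof -
  note I = integrable_pair_weight_kernel[OF s m f, of T]
  have w: "weight T \<sigma> t * f t = (LINT \<tau>|lborel. indicator {-T..T} \<tau> * normal_density \<tau> \<sigma> t * f t)" for t
    unfolding weight_def by simp
  show "integrable lborel (\<lambda>t. weight T \<sigma> t * f t)"
    unfolding w using lborel_pair.integrable_snd[OF I] by simp
  have "(LINT t|lborel. weight T \<sigma> t * f t) = (LINT \<tau>|lborel. LINT t|lborel. indicator {-T..T} \<tau> * normal_density \<tau> \<sigma> t * f t)"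
    unfolding w by (rule lborel_pair.Fubini_integral[OF I])
  then show "(LINT t|lborel. weight T \<sigma> t * f t) = (LINT \<tau>|lborel. indicator {-T..T} \<tau> * (LINT t|lborel. normal_density \<tau> \<sigma> t * f t))"
    by (simp add: mult.assoc)
qed

text \<open>
  Real and imaginary parts of the characteristic function of the standard normal distribution.
\<close>

lemma std_normal_cos_sin:
  "(LINT x|lborel. std_normal_density x * cos (y * x)) = exp (- y\<^sup>2 / 2)"
  "(LINT x|lborel. std_normal_density x * sin (y * x)) = 0"
  "integrable lborel (\<lambda>x. std_normal_density x * cos (y * x))"
  "integrable lborel (\<lambda>x. std_normal_density x * sin (y * x))"
proof -
  have I: "integrable lborel (\<lambda>x. std_normal_density x *\<^sub>R iexp (y * x))"
    by (rule Bochner_Integration.integrable_bound[OF integrable_normal_density[of 1 0]]) (auto simp: norm_mult)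
  have "char std_normal_distribution y = (CLINT x|lborel. std_normal_density x *\<^sub>R iexp (y * x))"
    unfolding char_def by (subst integral_density) auto
  then have e: "(CLINT x|lborel. std_normal_density x *\<^sub>R iexp (y * x)) = of_real (exp (- y\<^sup>2 / 2))"
    by (simp add: char_std_normal_distribution)
  show "integrable lborel (\<lambda>x. std_normal_density x * cos (y * x))"
    using integrable_Re[OF I] by (simp add: Re_exp)
  show "integrable lborel (\<lambda>x. std_normal_density x * sin (y * x))"
    using integrable_Im[OF I] by (simp add: Im_exp)
  show "(LINT x|lborel. std_normal_density x * cos (y * x)) = exp (- y\<^sup>2 / 2)"
    using arg_cong[OF e, of Re] integral_Re[OF I] by (simp add: Re_exp)
  show "(LINT x|lborel. std_normal_density x * sin (y * x)) = 0"
    using arg_cong[OF e, of Im] integral_Im[OF I] by (simp add: Im_exp)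
qed

lemma normal_cos:
  assumes "\<sigma> > 0"
  shows "(LINT t|lborel. normal_density \<tau> \<sigma> t * cos (t * y)) = cos (\<tau> * y) * exp (- (\<sigma> * y)\<^sup>2 / 2)"
proof -
  have nd: "\<sigma> * normal_density \<tau> \<sigma> (\<tau> + \<sigma> * x) = std_normal_density x" for x
    using assms by (simp add: normal_density_def real_sqrt_mult field_simps power_mult_distrib)
  have "(LINT t|lborel. normal_density \<tau> \<sigma> t * cos (t * y)) = \<bar>\<sigma>\<bar> *\<^sub>R (LINT x|lborel. normal_density \<tau> \<sigma> (\<tau> + \<sigma> * x) * cos ((\<tau> + \<sigma> * x) * y))"
    using assms by (intro lborel_integral_real_affine) auto
  also have "\<dots> = (LINT x|lborel. \<sigma> * normal_density \<tau> \<sigma> (\<tau> + \<sigma> * x) * cos ((\<tau> + \<sigma> * x) * y))"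
    using assms by (simp add: mult.assoc)
  also have "\<dots> = (LINT x|lborel. cos (\<tau> * y) * (std_normal_density x * cos (\<sigma> * y * x)) - sin (\<tau> * y) * (std_normal_density x * sin (\<sigma> * y * x)))"
    unfolding nd by (intro Bochner_Integration.integral_cong refl) (simp add: ring_distribs cos_add mult_ac)
  also have "\<dots> = cos (\<tau> * y) * exp (- (\<sigma> * y)\<^sup>2 / 2)"
    by (subst Bochner_Integration.integral_diff) (simp_all add: std_normal_cos_sin)
  finally show ?thesis .
qed

lemma integral_cos_interval:
  fixes T y :: real
  assumes "T \<ge> 0"
  shows "(LINT \<tau>|lborel. indicator {-T..T} \<tau> * cos (\<tau> * y)) = (if y = 0 then 2 * T else 2 * sin (T * y) / y)"
proof (cases "y = 0")
  case False
  have "(LINT \<tau>|lborel. indicator {-T..T} \<tau> *\<^sub>R cos (\<tau> * y)) = sin (T * y) / y - sin (- T * y) / y"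
    by (rule integral_FTC_atLeastAtMost[where F = "\<lambda>\<tau> :: real. sin (\<tau> * y) / y"])
       (use assms False in \<open>auto intro!: derivative_eq_intros continuous_intros simp: has_real_derivative_iff_has_vector_derivative[symmetric]\<close>)
  then show ?thesis using False by simp
qed (use assms in simp)

lemma weight_cos:
  assumes "\<sigma> > 0" "T \<ge> 0"
  shows "(LINT t|lborel. weight T \<sigma> t * cos (t * y)) = weight_ft T \<sigma> y"
proof -
  have "\<bar>cos (t * y)\<bar> \<le> 1 * (1 + t\<^sup>2)" for t
    using abs_cos_le_one[of "t * y"] by (smt (verit) zero_le_power2)
  then have "(LINT t|lborel. weight T \<sigma> t * cos (t * y)) = (LINT \<tau>|lborel. indicator {-T..T} \<tau> * (LINT t|lborel. normal_density \<tau> \<sigma> t * cos (t * y)))"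
    by (intro weight_integral(2)[OF assms(1), where C = 1]) auto
  also have "\<dots> = (LINT \<tau>|lborel. indicator {-T..T} \<tau> * cos (\<tau> * y) * exp (- (\<sigma> * y)\<^sup>2 / 2))"
    by (simp add: normal_cos assms mult.assoc)
  also have "\<dots> = weight_ft T \<sigma> y"
    using integral_cos_interval[OF assms(2), of y] by (simp add: weight_ft_def)
  finally show ?thesis .
qed

lemma weight_integrable:
  assumes "\<sigma> > 0" shows "integrable lborel (weight T \<sigma>)"
  using weight_integral(1)[OF assms, of "\<lambda>_. 1" 1 T] by simp

text \<open>
  Integration against the weight turns cosines into \<open>weight_ft\<close>. This is how each part of |\<zeta>_N|^2, a superposition of
  cosines of t times logarithms, is averaged.
\<close>

lemma weight_swap:
  assumes s: "\<sigma> > 0" "T \<ge> 0" and h: "integrable lborel h" and l[measurable]: "l \<in> borel_measurable borel"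
  shows "(LINT t|lborel. weight T \<sigma> t * (LINT x|lborel. h x * cos (t * l x))) = (LINT x|lborel. h x * weight_ft T \<sigma> (l x))"
proof -
  note [measurable] = borel_measurable_integrable[OF h]
  have I: "integrable (lborel \<Otimes>\<^sub>M lborel) (\<lambda>(x, t). h x * (weight T \<sigma> t * cos (t * l x)))"
  proof (rule lborel_pair.Fubini_integrable)
    have int: "integrable lborel (\<lambda>t. weight T \<sigma> t * cos (t * l x))" for x
      by (rule Bochner_Integration.integrable_bound[OF weight_integrable[OF s(1), of T]])
         (auto simp: abs_mult weight_nonneg intro!: mult_left_le)
    show "AE x in lborel. integrable lborel (\<lambda>t. case (x, t) of (x, t) \<Rightarrow> h x * (weight T \<sigma> t * cos (t * l x)))"
      using int by simp
    show "integrable lborel (\<lambda>x. LINT t|lborel. norm (case (x, t) of (x, t) \<Rightarrow> h x * (weight T \<sigma> t * cos (t * l x))))"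
    proof (rule Bochner_Integration.integrable_bound)
      show "integrable lborel (\<lambda>x. h x * (LINT t|lborel. weight T \<sigma> t))" using h by simp
      show "AE x in lborel. norm (LINT t|lborel. norm (case (x, t) of (x, t) \<Rightarrow> h x * (weight T \<sigma> t * cos (t * l x)))) \<le> norm (h x * (LINT t|lborel. weight T \<sigma> t))"
      proof (rule AE_I2)
        fix x
        have "(LINT t|lborel. norm (h x * (weight T \<sigma> t * cos (t * l x)))) \<le> (LINT t|lborel. \<bar>h x\<bar> * weight T \<sigma> t)"
        proof (rule integral_mono)
          show "integrable lborel (\<lambda>t. norm (h x * (weight T \<sigma> t * cos (t * l x))))"
            using int by (intro integrable_norm integrable_mult_right)
        qed (use s in \<open>auto simp: abs_mult weight_nonneg weight_integrable intro!: mult_left_mono mult_left_le\<close>)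
        also have "\<dots> = \<bar>h x\<bar> * (LINT t|lborel. weight T \<sigma> t)" by simp
        finally show "norm (LINT t|lborel. norm (case (x, t) of (x, t) \<Rightarrow> h x * (weight T \<sigma> t * cos (t * l x)))) \<le> norm (h x * (LINT t|lborel. weight T \<sigma> t))"
          by (simp add: abs_mult)  (smt (verit) mult_left_mono)
      qed
    qed measurable
  qed measurable
  have "(LINT t|lborel. weight T \<sigma> t * (LINT x|lborel. h x * cos (t * l x))) = (LINT t|lborel. LINT x|lborel. h x * (weight T \<sigma> t * cos (t * l x)))"
    by (intro Bochner_Integration.integral_cong refl) (simp add: mult.left_commute[of _ "weight T \<sigma> _"])
  also have "\<dots> = (LINT x|lborel. LINT t|lborel. h x * (weight T \<sigma> t * cos (t * l x)))"
    by (rule lborel_pair.Fubini_integral[OF I])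
  also have "\<dots> = (LINT x|lborel. h x * weight_ft T \<sigma> (l x))"
    by (simp add: weight_cos s)
  finally show ?thesis .
qed

section \<open>The inequalities of Kusmin--Landau and van der Corput\<close>

text \<open>
  The number \<open>1 / (1 - cis (2 \<pi> \<delta>))\<close>, written so that only its imaginary part depends on \<delta>. Differences of
  these coefficients are therefore differences of cotangents and have a constant sign when \<delta> is monotone.
\<close>

definition cot_coeff :: "real \<Rightarrow> complex" where
  "cot_coeff \<delta> = Complex (1/2) (cos (pi * \<delta>) / (2 * sin (pi * \<delta>)))"

text \<open>
  Multiplication by \<open>cot_coeff\<close> inverts the difference of consecutive terms of the exponential sum.
\<close>

lemma cot_coeff_mult:
  assumes "sin (pi * \<delta>) \<noteq> 0"
  shows "cot_coeff \<delta> * (z - z * cis (2 * pi * \<delta>)) = z"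
proof -
  define s c where "s = sin (pi * \<delta>)" and "c = cos (pi * \<delta>)"
  have sc: "s\<^sup>2 + c\<^sup>2 = 1" by (simp add: s_def c_def)
  have s: "s \<noteq> 0" using assms by (simp add: s_def)
  have dbl: "2 * pi * \<delta> = 2 * (pi * \<delta>)" by simp
  have e: "cis (2 * pi * \<delta>) = Complex (1 - 2 * s\<^sup>2) (2 * s * c)"
    using cos_double_sin[of "pi * \<delta>"] sin_double[of "pi * \<delta>"] unfolding dbl
    by (simp only: complex_eq_iff cis.sel complex.sel s_def c_def)
  have "cot_coeff \<delta> * (1 - cis (2 * pi * \<delta>)) = 1"
    using s sc unfolding cot_coeff_def e s_def[symmetric] c_def[symmetric]
    by (simp add: complex_eq_iff field_simps power2_eq_square)
  moreover have "cot_coeff \<delta> * (z - z * cis (2 * pi * \<delta>)) = z * (cot_coeff \<delta> * (1 - cis (2 * pi * \<delta>)))"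
    by (simp add: algebra_simps)
  ultimately show ?thesis by simp
qed

lemma sin_pi_ge:
  assumes "0 < \<theta>" "\<theta> \<le> \<delta>" "\<delta> \<le> 1 - \<theta>"
  shows "sin (pi * \<delta>) \<ge> sin (pi * \<theta>)" "sin (pi * \<theta>) > 0"
proof -
  have th: "\<theta> \<le> 1/2" using assms by linarith
  show "sin (pi * \<theta>) > 0" using assms th by (intro sin_gt_zero) auto
  show "sin (pi * \<delta>) \<ge> sin (pi * \<theta>)"
  proof (cases "\<delta> \<le> 1/2")
    case True
    have "0 \<le> pi * \<theta>" "pi * \<theta> \<le> pi * \<delta>" "pi * \<delta> \<le> pi * (1/2)"
      using assms True by (auto intro!: mult_left_mono simp del: times_divide_eq_right)
    then show ?thesis using pi_gt_zero by (intro sin_monotone_2pi_le) linarith+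
  next
    case False
    have "sin (pi * \<theta>) \<le> sin (pi * (1 - \<delta>))"
    proof -
      have "0 \<le> pi * \<theta>" "pi * \<theta> \<le> pi * (1 - \<delta>)" "pi * (1 - \<delta>) \<le> pi * (1/2)"
        using assms False by (auto intro!: mult_left_mono simp del: times_divide_eq_right)
      then show ?thesis using pi_gt_zero by (intro sin_monotone_2pi_le) linarith+
    qed
    also have "pi * (1 - \<delta>) = pi - pi * \<delta>" by (simp add: algebra_simps)
    finally show ?thesis by simp
  qed
qed

lemma norm_cot_coeff_le:
  assumes "0 < \<theta>" "\<theta> \<le> \<delta>" "\<delta> \<le> 1 - \<theta>"
  shows "norm (cot_coeff \<delta>) \<le> 1 / (2 * sin (pi * \<theta>))" "norm (1 - cot_coeff \<delta>) \<le> 1 / (2 * sin (pi * \<theta>))"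
proof -
  define s c where "s = sin (pi * \<delta>)" and "c = cos (pi * \<delta>)"
  have sc: "s\<^sup>2 + c\<^sup>2 = 1" by (simp add: s_def c_def)
  have s: "s > 0" using sin_pi_ge[OF assms] by (simp add: s_def)
  have e: "(1/2)\<^sup>2 + (c / (2 * s))\<^sup>2 = (1 / (2 * s))\<^sup>2"
  proof -
    have "(1/2)\<^sup>2 + (c / (2 * s))\<^sup>2 = (s\<^sup>2 + c\<^sup>2) / (2 * s)\<^sup>2" using s by (simp add: field_simps power2_eq_square)
    then show ?thesis using sc by (simp add: power_divide)
  qed
  have "norm (cot_coeff \<delta>) = 1 / (2 * s)"
    using s unfolding cot_coeff_def s_def[symmetric] c_def[symmetric] cmod_def complex.sel e by simp
  moreover have "norm (1 - cot_coeff \<delta>) = 1 / (2 * s)"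
    using s e unfolding cot_coeff_def s_def[symmetric] c_def[symmetric] cmod_def by simp
  moreover have "1 / (2 * s) \<le> 1 / (2 * sin (pi * \<theta>))"
    using sin_pi_ge[OF assms] by (simp add: s_def divide_left_mono)
  ultimately show "norm (cot_coeff \<delta>) \<le> 1 / (2 * sin (pi * \<theta>))" "norm (1 - cot_coeff \<delta>) \<le> 1 / (2 * sin (pi * \<theta>))" by auto
qed

lemma cot_decreasing:
  fixes x y :: real
  assumes "0 < x" "x \<le> y" "y < pi"
  shows "cos y / sin y \<le> cos x / sin x"
proof -
  have p: "sin x > 0" "sin y > 0" using assms by (auto intro!: sin_gt_zero)
  have "sin (y - x) \<ge> 0" using assms by (intro sin_ge_zero) auto
  then have "cos y * sin x \<le> cos x * sin y" by (simp add: sin_diff mult.commute)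
  then show ?thesis using p by (simp add: field_simps)
qed

lemma cot_pi_decreasing:
  fixes x y :: real
  assumes "0 < x" "x \<le> y" "y < 1"
  shows "cos (pi * y) / sin (pi * y) \<le> cos (pi * x) / sin (pi * x)"
  using assms by (intro cot_decreasing) (auto intro: mult_left_mono)

text \<open>
  The left-hand side is the cotangent of x/2.
\<close>

lemma half_angle_cot_le:
  fixes x :: real
  assumes "0 < x" "x \<le> pi / 2"
  shows "(1 + cos x) / sin x \<le> 2 / x"
proof -
  define h where "h = x / 2"
  have h: "0 < h" "h < pi" "x = 2 * h" using assms by (auto simp: h_def)
  have "sin 0 - 0 * cos 0 \<le> sin h - h * cos h"
  proof (rule DERIV_nonneg_imp_nondecreasing[of 0 h "\<lambda>z. sin z - z * cos z"])
    fix z assume "0 \<le> z" "z \<le> h"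
    then show "\<exists>y. ((\<lambda>z. sin z - z * cos z) has_real_derivative y) (at z) \<and> 0 \<le> y"
      using h by (intro exI[of _ "z * sin z"]) (auto intro!: derivative_eq_intros mult_nonneg_nonneg sin_ge_zero)
  qed (use h in auto)
  then have "h * cos h \<le> sin h" by simp
  moreover have s: "sin h > 0" "cos h > 0" using h assms by (auto intro!: sin_gt_zero cos_gt_zero_pi)
  moreover have "(1 + cos x) / sin x = cos h / sin h"
  proof -
    have "1 + cos x = 2 * (cos h)\<^sup>2" unfolding h(3) by (simp add: cos_double_cos)
    moreover have "sin x = 2 * sin h * cos h" unfolding h(3) by (rule sin_double)
    ultimately show ?thesis using s by (simp add: power2_eq_square)
  qed
  moreover have "cos h / sin h \<le> 1 / h" if "h * cos h \<le> sin h" "sin h > 0" using that h by (simp add: field_simps)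
  moreover have "2 / x = 1 / h" using h by simp
  ultimately show ?thesis by simp
qed

text \<open>
  With z_n = C_n (z_n - z_(n+1)), where C_n = \<open>cot_coeff\<close> of the n-th difference, summation by parts leaves two boundary
  terms and the total variation of the cotangents. The differences increase, so the variation telescopes, and the
  three contributions add up to the cotangent of \<pi>\<theta>/2.
\<close>

lemma kusmin_landau_normalised:
  fixes f :: "nat \<Rightarrow> real"
  assumes "a \<le> b" "0 < \<theta>" "\<theta> \<le> 1/2"
    and \<delta>: "\<And>n. a \<le> n \<Longrightarrow> n < b \<Longrightarrow> \<theta> \<le> f (Suc n) - f n \<and> f (Suc n) - f n \<le> 1 - \<theta>"
    and mono: "\<And>n. a \<le> n \<Longrightarrow> Suc n < b \<Longrightarrow> f (Suc n) - f n \<le> f (Suc (Suc n)) - f (Suc n)"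
  shows "norm (\<Sum>n=a..b. cis (2 * pi * f n)) \<le> 2 / (pi * \<theta>)"
proof (cases "a = b")
  case True
  have "pi * \<theta> \<le> pi * (1/2)" using assms(3) by (rule mult_left_mono) simp
  then have "pi * \<theta> \<le> 2" using pi_less_4 by linarith
  then have "1 \<le> 2 / (pi * \<theta>)" using assms(2) by (subst le_divide_eq_1_pos) auto
  then show ?thesis using True by simp
next
  case False
  then have ab: "Suc a \<le> b" using assms by simp
  define z where "z n = cis (2 * pi * f n)" for n
  define C where "C n = cot_coeff (f (Suc n) - f n)" for n
  define ct where "ct n = cos (pi * (f (Suc n) - f n)) / sin (pi * (f (Suc n) - f n))" for n
  have zz: "C n * (z n - z (Suc n)) = z n" if "a \<le> n" "n < b" for n
  proof -
    have "z (Suc n) = z n * cis (2 * pi * (f (Suc n) - f n))"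
      unfolding z_def cis_mult by (simp add: algebra_simps)
    moreover have "sin (pi * (f (Suc n) - f n)) \<noteq> 0"
      using sin_pi_ge[of \<theta> "f (Suc n) - f n"] \<delta>[OF that] assms by linarith
    ultimately show ?thesis unfolding C_def using cot_coeff_mult[of "f (Suc n) - f n" "z n"] by (simp only: simp_thms)
  qed
  have step: "norm (C (Suc n) - C n) \<le> (ct n - ct (Suc n)) / 2" if "a \<le> n" "Suc n < b" for n
  proof -
    have "ct (Suc n) \<le> ct n" unfolding ct_def
      by (rule cot_pi_decreasing) (use \<delta>[of n] \<delta>[of "Suc n"] mono[of n] that assms(2) in auto)
    moreover have "C (Suc n) - C n = Complex 0 ((ct (Suc n) - ct n) / 2)"
      by (simp add: C_def ct_def cot_coeff_def complex_eq_iff field_simps)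
    ultimately show ?thesis by (simp add: cmod_def)
  qed
  \<comment> \<open>summation by parts, as an induction on the upper end\<close>
  have main: "norm ((\<Sum>n=a..m. z n) - (1 - C (m - 1)) * z m - C a * z a) \<le> (ct a - ct (m - 1)) / 2"
    if "Suc a \<le> m" "m \<le> b" for m using that
  proof (induction m rule: nat_induct_at_least)
    case base
    have "(\<Sum>n=a..Suc a. z n) - (1 - C a) * z (Suc a) - C a * z a = z a - C a * (z a - z (Suc a))"
      by (simp add: algebra_simps)
    then show ?case using zz[of a] base by simp
  next
    case (Suc m)
    have C: "C m * z (Suc m) = C m * z m - z m" using zz[of m] Suc by (simp add: algebra_simps)
    have m1: "Suc (m - 1) = m" using Suc by simp
    have "(\<Sum>n=a..Suc m. z n) - (1 - C m) * z (Suc m) - C a * z a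
        = ((\<Sum>n=a..m. z n) - (1 - C (m - 1)) * z m - C a * z a) + (C m - C (m - 1)) * z m"
      using Suc(1) C by (simp add: algebra_simps)
    also have "norm \<dots> \<le> (ct a - ct (m - 1)) / 2 + norm ((C m - C (m - 1)) * z m)"
      using Suc by (intro norm_triangle_mono) auto
    also have "norm ((C m - C (m - 1)) * z m) \<le> (ct (m - 1) - ct m) / 2"
      using step[of "m - 1"] Suc m1 by (simp add: norm_mult z_def)
    finally show ?case by (simp add: field_simps)
  qed
  have b1: "Suc (b - 1) = b" using ab by simp
  have db: "\<theta> \<le> f (Suc (b - 1)) - f (b - 1) \<and> f (Suc (b - 1)) - f (b - 1) \<le> 1 - \<theta>"
    using ab by (intro \<delta>) auto
  have sp: "sin (pi * \<theta>) > 0" using sin_pi_ge[of \<theta> \<theta>] assms by simp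
  have Ca: "norm (C a) \<le> 1 / (2 * sin (pi * \<theta>))"
    unfolding C_def using \<delta>[of a] ab assms by (intro norm_cot_coeff_le) auto
  have Cb: "norm (1 - C (b - 1)) \<le> 1 / (2 * sin (pi * \<theta>))"
    unfolding C_def using db assms(2) by (intro norm_cot_coeff_le) auto
  have cta: "ct a \<le> cos (pi * \<theta>) / sin (pi * \<theta>)"
    unfolding ct_def by (rule cot_pi_decreasing) (use \<delta>[of a] ab assms(2) in auto)
  have ctb: "- ct (b - 1) \<le> cos (pi * \<theta>) / sin (pi * \<theta>)"
  proof -
    have "cos (pi * (1 - \<theta>)) / sin (pi * (1 - \<theta>)) \<le> ct (b - 1)"
      unfolding ct_def by (rule cot_pi_decreasing) (use db assms(2,3) in linarith)+
    moreover have "pi * (1 - \<theta>) = pi - pi * \<theta>" by (simp add: algebra_simps)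
    ultimately show ?thesis by simp
  qed
  have "norm (\<Sum>n=a..b. z n) \<le> norm ((\<Sum>n=a..b. z n) - (1 - C (b - 1)) * z b - C a * z a) + norm ((1 - C (b - 1)) * z b) + norm (C a * z a)"
  proof -
    have "norm X \<le> norm (X - A - B) + norm A + norm B" for X A B :: complex
      using norm_triangle_ineq[of "X - A - B" A] norm_triangle_ineq[of "X - A - B + A" B] by simp
    then show ?thesis .
  qed
  also have "\<dots> \<le> (ct a - ct (b - 1)) / 2 + 1 / (2 * sin (pi * \<theta>)) + 1 / (2 * sin (pi * \<theta>))"
    using main[OF ab order_refl] Ca Cb by (intro add_mono) (auto simp: norm_mult z_def)
  also have "\<dots> \<le> (1 + cos (pi * \<theta>)) / sin (pi * \<theta>)"
  proof -
    have "(ct a - ct (b - 1)) / 2 + i / 2 + i / 2 \<le> i + q" if "ct a \<le> q" "- ct (b - 1) \<le> q" for i q :: real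
      using that by (simp add: field_simps)
    from this[OF cta ctb, of "1 / sin (pi * \<theta>)"] show ?thesis by (simp add: add_divide_distrib)
  qed
  also have "\<dots> \<le> 2 / (pi * \<theta>)" using assms by (intro half_angle_cot_le) (auto simp: field_simps)
  finally show ?thesis by (simp add: z_def)
qed

text \<open>
  Subtracting k n from f n changes no term of the sum.
\<close>

lemma kusmin_landau:
  fixes f :: "nat \<Rightarrow> real"
  assumes "a \<le> b" "0 < \<theta>" "\<theta> \<le> 1/2"
    and \<delta>: "\<And>n. a \<le> n \<Longrightarrow> n < b \<Longrightarrow> of_int k + \<theta> \<le> f (Suc n) - f n \<and> f (Suc n) - f n \<le> of_int k + 1 - \<theta>"
    and mono: "\<And>n. a \<le> n \<Longrightarrow> Suc n < b \<Longrightarrow> f (Suc n) - f n \<le> f (Suc (Suc n)) - f (Suc n)"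
  shows "norm (\<Sum>n=a..b. cis (2 * pi * f n)) \<le> 2 / (pi * \<theta>)"
proof -
  define g where "g n = f n - of_int k * real n" for n
  have "cis (2 * pi * f n) = cis (2 * pi * g n)" for n
  proof -
    have "2 * pi * f n = 2 * pi * g n + 2 * pi * of_int (k * int n)" by (simp add: g_def algebra_simps)
    then have "cis (2 * pi * f n) = cis (2 * pi * g n) * cis (2 * pi * of_int (k * int n))"
      by (simp only: cis_mult)
    also have "cis (2 * pi * of_int (k * int n)) = 1" by (rule cis_multiple_2pi) auto
    finally show ?thesis by simp
  qed
  moreover have "norm (\<Sum>n=a..b. cis (2 * pi * g n)) \<le> 2 / (pi * \<theta>)"
  proof (rule kusmin_landau_normalised[OF assms(1-3)])
    show "\<theta> \<le> g (Suc n) - g n \<and> g (Suc n) - g n \<le> 1 - \<theta>" if "a \<le> n" "n < b" for n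
      using \<delta>[OF that] by (simp add: g_def algebra_simps)
    show "g (Suc n) - g n \<le> g (Suc (Suc n)) - g (Suc n)" if "a \<le> n" "Suc n < b" for n
      using mono[OF that] by (simp add: g_def algebra_simps)
  qed
  ultimately show ?thesis by simp
qed

text \<open>
  With d_n = f(n+1) - f(n) and \<Delta> = \<surd>(lam/\<pi>), the terms are grouped by the integer k for which d_n lies in
  [k - \<Delta>, k + 1 - \<Delta>). In each group the n with |d_n - k| < \<Delta> number at most 2\<Delta>/lam + 1 because d_n grows by lam at each step;
  the remaining ones satisfy the hypotheses of \<open>kusmin_landau\<close> with \<theta> = \<Delta>. The choice of \<Delta> balances 2\<Delta>/lam
  against 2/(\<pi>\<Delta>). There are at most V + 2 groups.
\<close>

lemma van_der_corput:
  fixes f :: "nat \<Rightarrow> real"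
  assumes "a < b" "lam > 0"
    and gap: "\<And>n. a \<le> n \<Longrightarrow> Suc n < b \<Longrightarrow> f (Suc n) - f n + lam \<le> f (Suc (Suc n)) - f (Suc n)"
    and V: "(f b - f (b - 1)) - (f (Suc a) - f a) \<le> V"
  shows "norm (\<Sum>n=a..<b. cis (2 * pi * f n)) \<le> (V + 2) * (4 / sqrt (pi * lam) + 1)"
proof -
  define d where "d n = f (Suc n) - f n" for n
  define \<Delta> where "\<Delta> = sqrt (lam / pi)"
  have \<Delta>: "\<Delta> > 0" using assms by (simp add: \<Delta>_def)
  have grow: "d m + lam * real (n - m) \<le> d n" if "a \<le> m" "m \<le> n" "n < b" for m n
    using that(2,3)
  proof (induction n rule: dec_induct)
    case (step n)
    then have "d n + lam \<le> d (Suc n)" using gap[of n] that by (simp add: d_def)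
    then show ?case using step by (simp add: Suc_diff_le algebra_simps)
  qed simp
  have mono: "d m \<le> d n" if "a \<le> m" "m \<le> n" "n < b" for m n
    using grow[OF that] assms(2) by (smt (verit) mult_nonneg_nonneg of_nat_0_le_iff)
  \<comment> \<open>the group of n; the shift by \<Delta> keeps the differences close to one integer in the same group\<close>
  define key where "key n = \<lfloor>d n + \<Delta>\<rfloor>" for n
  define G where "G k = {n \<in> {a..<b}. key n = k}" for k
  have group: "norm (\<Sum>n\<in>G k. cis (2 * pi * f n)) \<le> 4 / sqrt (pi * lam) + 1" for k
  proof -
    have inG: "n \<in> G k \<longleftrightarrow> a \<le> n \<and> n < b \<and> of_int k - \<Delta> \<le> d n \<and> d n < of_int k + 1 - \<Delta>" for n
      unfolding G_def key_def by (auto simp: floor_eq_iff)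
    define G1 where "G1 = {n \<in> G k. d n < of_int k + \<Delta>}"
    define G2 where "G2 = {n \<in> G k. d n \<ge> of_int k + \<Delta>}"
    have fin: "finite (G k)" "finite G1" "finite G2" unfolding G1_def G2_def G_def by auto
    have un: "G k = G1 \<union> G2" "G1 \<inter> G2 = {}" unfolding G1_def G2_def by auto
    have "real (card G1) \<le> 2 * \<Delta> / lam + 1"
    proof (cases "G1 = {}")
      case False
      define p q where "p = Min G1" and "q = Max G1"
      have pq: "p \<in> G1" "q \<in> G1" "p \<le> q" using False fin by (auto simp: p_def q_def)
      have "G1 \<subseteq> {p..q}" using fin by (auto simp: p_def q_def)
      then have "card G1 \<le> q - p + 1" using card_mono[of "{p..q}" G1] pq by auto
      moreover have "lam * real (q - p) \<le> 2 * \<Delta>"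
        using grow[of p q] pq unfolding G1_def inG by auto
      moreover have "real (card G1) \<le> real (q - p) + 1" using \<open>card G1 \<le> q - p + 1\<close> by linarith
      moreover have "real (q - p) \<le> 2 * \<Delta> / lam"
        using \<open>lam * real (q - p) \<le> 2 * \<Delta>\<close> assms(2) by (simp add: pos_le_divide_eq mult.commute)
      ultimately show ?thesis by linarith
    qed (use \<Delta> assms in auto)
    then have "norm (\<Sum>n\<in>G1. cis (2 * pi * f n)) \<le> 2 * \<Delta> / lam + 1"
      using norm_sum[of "\<lambda>n. cis (2 * pi * f n)" G1] by simp
    moreover have "norm (\<Sum>n\<in>G2. cis (2 * pi * f n)) \<le> 2 / (pi * \<Delta>)"
    proof (cases "G2 = {}")
      case False
      define p q where "p = Min G2" and "q = Max G2"
      have pq: "p \<in> G2" "q \<in> G2" "p \<le> q" using False fin by (auto simp: p_def q_def)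
      have "G2 \<subseteq> {p..q}" using fin by (auto simp: p_def q_def)
      \<comment> \<open>the differences are monotone, so this part of the group is an interval\<close>
      moreover have "{p..q} \<subseteq> G2"
      proof
        fix n assume n: "n \<in> {p..q}"
        have "d p \<le> d n" "d n \<le> d q" using mono[of p n] mono[of n q] n pq unfolding G2_def inG by auto
        then show "n \<in> G2" using n pq unfolding G2_def inG by auto
      qed
      ultimately have "G2 = {p..q}" by auto
      moreover have "norm (\<Sum>n=p..q. cis (2 * pi * f n)) \<le> 2 / (pi * \<Delta>)"
      proof (rule kusmin_landau[OF pq(3) \<Delta>])
        show "\<Delta> \<le> 1/2" using pq unfolding G2_def inG by auto
        show "of_int k + \<Delta> \<le> f (Suc n) - f n \<and> f (Suc n) - f n \<le> of_int k + 1 - \<Delta>" if "p \<le> n" "n < q" for n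
        proof -
          have "n \<in> G2" using \<open>G2 = {p..q}\<close> that by auto
          then show ?thesis unfolding G2_def inG d_def by auto
        qed
        show "f (Suc n) - f n \<le> f (Suc (Suc n)) - f (Suc n)" if "p \<le> n" "Suc n < q" for n
          using mono[of n "Suc n"] pq that unfolding G2_def inG d_def by auto
      qed
      ultimately show ?thesis by simp
    qed (use \<Delta> in auto)
    moreover have "2 * \<Delta> / lam = 2 / sqrt (pi * lam)"
      using assms(2) real_sqrt_mult_self[of lam] unfolding \<Delta>_def by (simp add: real_sqrt_divide real_sqrt_mult field_simps)
    moreover have "2 / (pi * \<Delta>) = 2 / sqrt (pi * lam)"
    proof -
      have "pi * \<Delta> = sqrt pi * sqrt pi * (sqrt lam / sqrt pi)" by (simp add: \<Delta>_def real_sqrt_divide)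
      also have "\<dots> = sqrt (pi * lam)" by (simp add: real_sqrt_mult del: real_sqrt_mult_self)
      finally show ?thesis by simp
    qed
    ultimately show ?thesis
      using norm_triangle_ineq[of "\<Sum>n\<in>G1. cis (2 * pi * f n)" "\<Sum>n\<in>G2. cis (2 * pi * f n)"] un fin
      by (simp add: sum.union_disjoint)
  qed
  define K where "K = {key a..key (b - 1)}"
  have "(\<Sum>n=a..<b. cis (2 * pi * f n)) = (\<Sum>k\<in>K. \<Sum>n\<in>G k. cis (2 * pi * f n))"
    unfolding G_def
  proof (rule sum.group[symmetric])
    show "key ` {a..<b} \<subseteq> K"
      unfolding K_def key_def using mono by (auto intro!: floor_mono)
  qed (auto simp: K_def)
  then have "norm (\<Sum>n=a..<b. cis (2 * pi * f n)) \<le> (\<Sum>k\<in>K. 4 / sqrt (pi * lam) + 1)"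
    using group by (simp only:) (rule sum_norm_le)
  also have "\<dots> = real (card K) * (4 / sqrt (pi * lam) + 1)" by simp
  also have "\<dots> \<le> (V + 2) * (4 / sqrt (pi * lam) + 1)"
  proof (rule mult_right_mono)
    have Vd: "d (b - 1) - d a \<le> V" using V assms(1) by (simp add: d_def)
    have le: "key a \<le> key (b - 1)" unfolding key_def using mono[of a "b - 1"] assms(1) by (intro floor_mono) auto
    have "real (card K) = of_int (key (b - 1)) - of_int (key a) + 1" using le by (simp add: K_def)
    also have "\<dots> \<le> V + 2" using Vd unfolding key_def by linarith
    finally show "real (card K) \<le> V + 2" .
  qed (use assms in auto)
  finally show ?thesis .
qed

section \<open>Exponential sums with the phase T ln(1 + r/x)\<close>

text \<open>
  Both h - g and h + g are nondecreasing.
\<close>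

lemma deriv_dominated:
  fixes g h :: "real \<Rightarrow> real"
  assumes "a \<le> b" "continuous_on {a..b} g" "continuous_on {a..b} h"
    and g: "\<And>x. a < x \<Longrightarrow> x < b \<Longrightarrow> (g has_real_derivative g' x) (at x)"
    and h: "\<And>x. a < x \<Longrightarrow> x < b \<Longrightarrow> (h has_real_derivative h' x) (at x)"
    and le: "\<And>x. a < x \<Longrightarrow> x < b \<Longrightarrow> \<bar>g' x\<bar> \<le> h' x"
  shows "\<bar>g b - g a\<bar> \<le> h b - h a"
proof (cases "a = b")
  case False
  then have ab: "a < b" using assms by simp
  have "h a - g a \<le> h b - g b"
    by (rule DERIV_nonneg_imp_increasing_open[OF assms(1)])
       (use g h le in \<open>force intro!: continuous_intros assms derivative_intros\<close>)+
  moreover have "h a + g a \<le> h b + g b"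
    by (rule DERIV_nonneg_imp_increasing_open[OF assms(1)])
       (use g h le in \<open>force intro!: continuous_intros assms derivative_intros\<close>)+
  ultimately show ?thesis by linarith
qed simp

text \<open>
  The error as a function of the right end point b vanishes at a to second order; its derivatives are dominated by those of
  \<open>B (b - a)^3 / 12\<close>, so \<open>deriv_dominated\<close> applies twice.
\<close>

lemma trapezoid_error:
  fixes F :: "real \<Rightarrow> real"
  assumes ab: "a \<le> b"
    and F: "\<And>x. a \<le> x \<Longrightarrow> x \<le> b \<Longrightarrow> (F has_real_derivative F' x) (at x)"
    and F': "\<And>x. a \<le> x \<Longrightarrow> x \<le> b \<Longrightarrow> (F' has_real_derivative F'' x) (at x)"
    and B: "\<And>x. a \<le> x \<Longrightarrow> x \<le> b \<Longrightarrow> \<bar>F'' x\<bar> \<le> B"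
  shows "\<bar>integral {a..b} F - (b - a) / 2 * (F a + F b)\<bar> \<le> B * (b - a) ^ 3 / 12"
proof -
  have contF: "continuous_on {a..b} F" by (intro continuous_at_imp_continuous_on ballI DERIV_isCont[OF F]) auto
  have contF': "continuous_on {a..b} F'" by (intro continuous_at_imp_continuous_on ballI DERIV_isCont[OF F']) auto
  define g1 where "g1 x = (F x - F a) / 2 - (x - a) / 2 * F' x" for x
  have g1: "\<bar>g1 y\<bar> \<le> B * (y - a)\<^sup>2 / 4" if y: "a \<le> y" "y \<le> b" for y
  proof -
    have "\<bar>g1 y - g1 a\<bar> \<le> B * (y - a)\<^sup>2 / 4 - B * (a - a)\<^sup>2 / 4"
    proof (rule deriv_dominated[where g' = "\<lambda>x. - (x - a) / 2 * F'' x" and h' = "\<lambda>x. B * (x - a) / 2"])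
      show "continuous_on {a..y} g1" unfolding g1_def
        by (intro continuous_intros continuous_on_subset[OF contF] continuous_on_subset[OF contF']) (use y in auto)
      show "(g1 has_real_derivative - (x - a) / 2 * F'' x) (at x)" if "a < x" "x < y" for x
        unfolding g1_def by (rule derivative_eq_intros F F' refl | use that y in force)+ (simp add: field_simps)
      show "((\<lambda>x. B * (x - a)\<^sup>2 / 4) has_real_derivative B * (x - a) / 2) (at x)" if "a < x" "x < y" for x
        by (auto intro!: derivative_eq_intros simp: field_simps)
      show "\<bar>- (x - a) / 2 * F'' x\<bar> \<le> B * (x - a) / 2" if "a < x" "x < y" for x
        using B[of x] that y by (simp add: abs_mult mult.commute mult_right_mono)
    qed (use y in \<open>auto intro!: continuous_intros\<close>)
    then show ?thesis by (simp add: g1_def)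
  qed
  define g where "g x = integral {a..x} F - (x - a) / 2 * (F a + F x)" for x
  have "\<bar>g b - g a\<bar> \<le> B * (b - a) ^ 3 / 12 - B * (a - a) ^ 3 / 12"
  proof (rule deriv_dominated[where g' = g1 and h' = "\<lambda>x. B * (x - a)\<^sup>2 / 4"])
    show "continuous_on {a..b} g" unfolding g_def
      by (intro continuous_intros contF indefinite_integral_continuous_1 integrable_continuous_real) auto
    show "(g has_real_derivative g1 x) (at x)" if "a < x" "x < b" for x
    proof -
      have "((\<lambda>u. integral {a..u} F) has_real_derivative F x) (at x within {a..b})"
        using integral_has_real_derivative[OF contF, of x] that by auto
      then have "((\<lambda>u. integral {a..u} F) has_real_derivative F x) (at x)"
        using that by (simp add: at_within_Icc_at)
      moreover have "((\<lambda>x. (x - a) / 2 * (F a + F x)) has_real_derivative 1 / 2 * (F a + F x) + (0 + F' x) * ((x - a) / 2)) (at x)"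
        by (rule DERIV_mult[OF _ DERIV_add[OF DERIV_const F]]) (use that in \<open>auto intro!: derivative_eq_intros\<close>)
      ultimately have "(g has_real_derivative F x - (1 / 2 * (F a + F x) + (0 + F' x) * ((x - a) / 2))) (at x)"
        unfolding g_def[abs_def] by (rule DERIV_diff)
      moreover have "F x - (1 / 2 * (F a + F x) + (0 + F' x) * ((x - a) / 2)) = g1 x" by (simp add: g1_def field_simps)
      ultimately show ?thesis by simp
    qed
    show "((\<lambda>x. B * (x - a) ^ 3 / 12) has_real_derivative B * (x - a)\<^sup>2 / 4) (at x)" if "a < x" "x < b" for x
      by (auto intro!: derivative_eq_intros simp: field_simps)
  qed (use ab g1 in \<open>auto intro!: continuous_intros\<close>)
  then show ?thesis by (simp add: g_def)
qed

text \<open>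
  The phase in the product of the m-th and (m + r)-th terms of a Dirichlet polynomial at height T; it is followed by its
  first two derivatives.
\<close>

definition phase :: "real \<Rightarrow> real \<Rightarrow> real \<Rightarrow> real" where
  "phase T r x = T * ln (1 + r / x)"

definition phase' :: "real \<Rightarrow> real \<Rightarrow> real \<Rightarrow> real" where
  "phase' T r x = - (T * r) / (x * (x + r))"

definition phase'' :: "real \<Rightarrow> real \<Rightarrow> real \<Rightarrow> real" where
  "phase'' T r x = T * r * (2 * x + r) / (x\<^sup>2 * (x + r)\<^sup>2)"

lemma phase_deriv:
  assumes "r > 0" "x > 0"
  shows "(phase T r has_real_derivative phase' T r x) (at x)"
proof -
  have "1 + r / x > 0" using assms by (simp add: add_pos_pos)
  then have "((\<lambda>x. T * ln (1 + r / x)) has_real_derivative T * (1 / (1 + r / x) * (- r / x\<^sup>2))) (at x)"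
    using assms by (auto intro!: derivative_eq_intros simp: power2_eq_square)
  moreover have "T * (1 / (1 + r / x) * (- r / x\<^sup>2)) = phase' T r x"
    using assms unfolding phase'_def by (simp add: field_simps power2_eq_square)
  ultimately show ?thesis unfolding phase_def[abs_def] by simp
qed

lemma phase'_deriv:
  assumes "r > 0" "x > 0"
  shows "(phase' T r has_real_derivative phase'' T r x) (at x)"
proof -
  have nz: "x * (x + r) \<noteq> 0" using assms by simp
  have "((\<lambda>x. x * (x + r)) has_real_derivative 2 * x + r) (at x)"
    by (auto intro!: derivative_eq_intros)
  from DERIV_cmult[OF DERIV_inverse'[OF this nz], of "- (T * r)"]
  have "((\<lambda>x. - (T * r) / (x * (x + r))) has_real_derivative T * r * (2 * x + r) / (x * (x + r))\<^sup>2) (at x)"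
    by (simp add: divide_inverse power2_eq_square mult_ac)
  then show ?thesis unfolding phase'_def[abs_def] phase''_def by (simp add: power_mult_distrib)
qed

text \<open>
  The phase is convex, and for x much larger than r its second derivative is nearly 2 T r / x^3.
\<close>

lemma phase''_bounds:
  assumes "T \<ge> 0" "r > 0" "x > 0"
  shows "phase'' T r x \<ge> 0" "phase'' T r x \<le> 2 * T * r / x ^ 3"
    and "100 * r \<le> x \<Longrightarrow> phase'' T r x \<ge> 1.96 * T * r / x ^ 3"
proof -
  show "phase'' T r x \<ge> 0" using assms by (simp add: phase''_def)
  have e: "phase'' T r x = T * r * ((2 * x + r) * x / (x + r)\<^sup>2) / x ^ 3"
    using assms by (simp add: phase''_def frac_eq_eq) (simp add: power2_eq_square power3_eq_cube)
  have "(2 * x + r) * x / (x + r)\<^sup>2 \<le> 2"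
    using assms by (simp add: divide_le_eq) (simp add: power2_eq_square algebra_simps)
  then have "T * r * ((2 * x + r) * x / (x + r)\<^sup>2) \<le> T * r * 2" using assms by (intro mult_left_mono) auto
  also have "\<dots> = 2 * T * r" by simp
  finally show "phase'' T r x \<le> 2 * T * r / x ^ 3"
    unfolding e using assms by (intro divide_right_mono) auto
  assume r: "100 * r \<le> x"
  have "1.96 * (x + r)\<^sup>2 \<le> (2 * x + r) * x"
  proof -
    have "100 * (r * r) \<le> r * x" "100 * (r * x) \<le> x * x"
      using mult_left_mono[OF r, of r] mult_right_mono[OF r, of x] assms by simp_all
    moreover have "1.96 * (x + r)\<^sup>2 = 1.96 * (x * x) + 3.92 * (r * x) + 1.96 * (r * r)" "(2 * x + r) * x = 2 * (x * x) + r * x"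
      by (simp_all add: power2_eq_square algebra_simps)
    moreover have "73 * (r * x) + 49 * (r * r) \<le> x * x"
    proof -
      have "0 \<le> r * r" by simp
      then show ?thesis using \<open>100 * (r * r) \<le> r * x\<close> \<open>100 * (r * x) \<le> x * x\<close> by linarith
    qed
    ultimately show ?thesis by simp
  qed
  then have "1.96 \<le> (2 * x + r) * x / (x + r)\<^sup>2" using assms by (simp add: le_divide_eq)
  then have "T * r * 1.96 \<le> T * r * ((2 * x + r) * x / (x + r)\<^sup>2)" using assms by (intro mult_left_mono) auto
  moreover have "T * r * 1.96 = 1.96 * T * r" by simp
  ultimately have "1.96 * T * r \<le> T * r * ((2 * x + r) * x / (x + r)\<^sup>2)" by metis
  then show "phase'' T r x \<ge> 1.96 * T * r / x ^ 3"
    unfolding e using assms by (intro divide_right_mono) auto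
qed

lemma phase'_mono:
  assumes "T \<ge> 0" "r > 0" "0 < x" "x \<le> y"
  shows "phase' T r x \<le> phase' T r y"
proof -
  have "x * (x + r) \<le> y * (y + r)" using assms by (intro mult_mono) auto
  then have "T * r / (y * (y + r)) \<le> T * r / (x * (x + r))" using assms by (intro divide_left_mono) auto
  then show ?thesis by (simp add: phase'_def)
qed

lemma phase_diff_mean_value:
  assumes "r > 0" "n > (0 :: nat)"
  obtains z where "real n < z" "z < real (Suc n)" "phase T r (real (Suc n)) - phase T r (real n) = phase' T r z"
proof -
  have "\<exists>z. real n < z \<and> z < real (Suc n) \<and>
    phase T r (real (Suc n)) - phase T r (real n) = (real (Suc n) - real n) * phase' T r z"
    by (rule MVT2) (use assms in \<open>auto intro!: phase_deriv\<close>)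
  then show ?thesis using that by auto
qed

text \<open>
  Half-open ranges, so that sums over consecutive ranges add up.
\<close>

definition nats_in :: "real \<Rightarrow> real \<Rightarrow> nat set" where
  "nats_in u v = {m. u < real m \<and> real m \<le> v}"

lemma finite_nats_in [simp]: "finite (nats_in u v)"
proof (rule finite_subset)
  show "nats_in u v \<subseteq> {..nat \<lceil>v\<rceil>}" unfolding nats_in_def by (auto simp: le_nat_iff) linarith
qed simp

lemma nats_in_split:
  assumes "u \<le> v" "v \<le> w"
  shows "(\<Sum>m\<in>nats_in u w. f m) = (\<Sum>m\<in>nats_in u v. f m) + (\<Sum>m\<in>nats_in v w. f m)"
proof -
  have "nats_in u w = nats_in u v \<union> nats_in v w" "nats_in u v \<inter> nats_in v w = {}"
    using assms unfolding nats_in_def by auto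
  then show ?thesis by (simp add: sum.union_disjoint)
qed

lemma nats_in_interval:
  assumes "nats_in u v \<noteq> {}"
  obtains a b where "nats_in u v = {a..b}" "a \<le> b" "u < real a" "real b \<le> v"
proof -
  define a b where "a = Min (nats_in u v)" and "b = Max (nats_in u v)"
  have ab: "a \<in> nats_in u v" "b \<in> nats_in u v" "a \<le> b" using assms by (auto simp: a_def b_def)
  have "nats_in u v \<subseteq> {a..b}" by (auto simp: a_def b_def)
  moreover have "{a..b} \<subseteq> nats_in u v"
  proof
    fix m assume "m \<in> {a..b}"
    then have "real a \<le> real m" "real m \<le> real b" by auto
    then show "m \<in> nats_in u v" using ab unfolding nats_in_def by auto
  qed
  ultimately have "nats_in u v = {a..b}" by (rule equalityI)
  moreover have "u < real a" "real b \<le> v" using ab(1,2) unfolding nats_in_def by auto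
  ultimately show ?thesis using that ab(3) by blast
qed

text \<open>
  Beyond the point where Tr = \<pi> x (x + r) the differences of phase/(2\<pi>) lie in [-1/2, 0), and they are at
  least \<theta> = T r / (2 \<pi> v (v + r)) away from the integer 0.
\<close>

lemma phase_sum_kusmin_landau:
  assumes "T > 0" "r > 0" "0 < u" "T * r \<le> pi * (u * (u + r))" "0 \<le> v"
  shows "norm (\<Sum>m\<in>nats_in u v. cis (phase T r (real m))) \<le> 4 * (v * (v + r)) / (T * r)"
proof (cases "nats_in u v = {}")
  case True
  then show ?thesis using assms by simp
next
  case False
  then obtain a b where ab: "nats_in u v = {a..b}" "a \<le> b" "u < real a" "real b \<le> v"
    by (rule nats_in_interval)
  define f where "f n = phase T r (real n) / (2 * pi)" for n
  define \<theta> where "\<theta> = T * r / (2 * pi * (real b * (real b + r)))"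
  have pos: "real a > 0" "real b > 0" using ab assms by (linarith, simp)
  have uv: "u * (u + r) \<le> real b * (real b + r)" using ab assms by (intro mult_mono) auto
  have \<theta>: "\<theta> > 0" "\<theta> \<le> 1/2"
  proof -
    show "\<theta> > 0" using assms pos by (simp add: \<theta>_def)
    have "T * r \<le> pi * (real b * (real b + r))" using assms(4) mult_left_mono[OF uv, of pi] pi_ge_zero by linarith
    then show "\<theta> \<le> 1/2" using pos assms by (simp add: \<theta>_def divide_le_eq)
  qed
  have diff: "- (1/2) \<le> f (Suc n) - f n \<and> f (Suc n) - f n \<le> - \<theta>" if n: "a \<le> n" "n < b" for n
  proof -
    obtain z where z: "real n < z" "z < real (Suc n)" "phase T r (real (Suc n)) - phase T r (real n) = phase' T r z"
      by (rule phase_diff_mean_value[of r n T]) (use assms n pos in auto)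
    have zu: "u \<le> z" "z \<le> real b" using z n ab by auto
    have f: "f (Suc n) - f n = phase' T r z / (2 * pi)" unfolding f_def z(3)[symmetric] by (simp add: diff_divide_distrib)
    have "phase' T r u \<le> phase' T r z" "phase' T r z \<le> phase' T r (real b)"
      using assms zu by (auto intro!: phase'_mono)
    moreover have "phase' T r u \<ge> - pi" using assms by (simp add: phase'_def divide_le_eq)
    moreover have "phase' T r (real b) = - \<theta> * (2 * pi)" using pos assms by (simp add: phase'_def \<theta>_def)
    ultimately show ?thesis unfolding f by (simp add: field_simps)
  qed
  have "norm (\<Sum>n=a..b. cis (2 * pi * f n)) \<le> 2 / (pi * \<theta>)"
  proof (rule kusmin_landau[OF ab(2) \<theta>, of "-1"])
    show "of_int (-1) + \<theta> \<le> f (Suc n) - f n \<and> f (Suc n) - f n \<le> of_int (-1) + 1 - \<theta>" if "a \<le> n" "n < b" for n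
      using diff[OF that] \<theta> by auto
    show "f (Suc n) - f n \<le> f (Suc (Suc n)) - f (Suc n)" if n: "a \<le> n" "Suc n < b" for n
    proof -
      obtain z where z: "real n < z" "z < real (Suc n)" "phase T r (real (Suc n)) - phase T r (real n) = phase' T r z"
        by (rule phase_diff_mean_value[of r n T]) (use assms n pos in auto)
      obtain y where y: "real (Suc n) < y" "phase T r (real (Suc (Suc n))) - phase T r (real (Suc n)) = phase' T r y"
        by (rule phase_diff_mean_value[of r "Suc n" T]) (use assms n pos in auto)
      have "phase' T r z \<le> phase' T r y" using z y assms n pos by (intro phase'_mono) auto
      then show ?thesis using z(3) y(2) unfolding f_def by (simp add: field_simps)
    qed
  qed
  also have "2 / (pi * \<theta>) = 4 * (real b * (real b + r)) / (T * r)" using pos assms by (simp add: \<theta>_def)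
  also have "\<dots> \<le> 4 * (v * (v + r)) / (T * r)"
    using ab pos assms by (intro divide_right_mono mult_left_mono mult_mono) auto
  finally show ?thesis unfolding ab(1) f_def by simp
qed

lemma phase_diff_deriv:
  assumes "r > 0" "x > 0"
  shows "((\<lambda>x. phase T r (x + 1) - phase T r x) has_real_derivative phase' T r (x + 1) - phase' T r x) (at x)"
proof -
  have "((\<lambda>x. phase T r (x + 1)) has_real_derivative phase' T r (x + 1)) (at x)"
    using DERIV_chain2[OF phase_deriv[of r "x + 1" T] DERIV_add[OF DERIV_ident DERIV_const]] assms by simp
  then show ?thesis using phase_deriv[OF assms] by (intro DERIV_diff)
qed

text \<open>
  A second difference is a value of the second derivative at a point of the range.
\<close>

lemma phase_second_difference_ge:
  assumes "T \<ge> 0" "r > 0" "n > (0 :: nat)" "real n + 2 \<le> w" "100 * r \<le> real n"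
  shows "(phase T r (real n + 2) - phase T r (real n + 1)) - (phase T r (real n + 1) - phase T r (real n)) \<ge> 1.96 * T * r / w ^ 3"
proof -
  define g where "g x = phase T r (x + 1) - phase T r x" for x
  have "\<exists>z. real n < z \<and> z < real n + 1 \<and> g (real n + 1) - g (real n) = (real n + 1 - real n) * (phase' T r (z + 1) - phase' T r z)"
    unfolding g_def by (rule MVT2) (use assms phase_diff_deriv in auto)
  then obtain z where z: "real n < z" "z < real n + 1" "g (real n + 1) - g (real n) = phase' T r (z + 1) - phase' T r z" by auto
  have "\<exists>y. z < y \<and> y < z + 1 \<and> phase' T r (z + 1) - phase' T r z = (z + 1 - z) * phase'' T r y"
    by (rule MVT2) (use assms z phase'_deriv in auto)
  then obtain y where y: "z < y" "y < z + 1" "phase' T r (z + 1) - phase' T r z = phase'' T r y" by auto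
  have yw: "y \<le> w" "y > 0" "100 * r \<le> y" using y z assms by auto
  have "1.96 * T * r / w ^ 3 \<le> 1.96 * T * r / y ^ 3"
    using yw assms by (intro divide_left_mono power_mono) auto
  also have "\<dots> \<le> phase'' T r y" using yw assms by (intro phase''_bounds(3)) auto
  finally have "g (real n + 1) - g (real n) \<ge> 1.96 * T * r / w ^ 3" using z y by simp
  then show ?thesis by (simp add: g_def algebra_simps)
qed

lemma phase'_variation:
  assumes "T \<ge> 0" "r > 0" "v > 0"
  shows "phase' T r (2 * v) - phase' T r v \<le> 3 / 4 * (T * r / v\<^sup>2)"
proof -
  have e: "phase' T r (2 * v) - phase' T r v = T * r * ((3 * v + r) / (2 * v * (v + r) * (2 * v + r)))"
    using assms unfolding phase'_def by (simp add: divide_simps) (simp add: algebra_simps)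
  have "(3 * v + r) / (2 * v * (v + r) * (2 * v + r)) \<le> 3 / (4 * v\<^sup>2)"
    using assms by (simp add: divide_simps) (simp add: algebra_simps power2_eq_square)
  then have "T * r * ((3 * v + r) / (2 * v * (v + r) * (2 * v + r))) \<le> T * r * (3 / (4 * v\<^sup>2))"
    using assms by (intro mult_left_mono) auto
  then show ?thesis unfolding e by simp
qed

text \<open>
  Van der Corput's inequality on a dyadic block. Here lam is 0.35^2 T r / (\<pi> v^3), the lower bound from \<open>phase_second_difference_ge\<close>
  divided by 2\<pi>, and V bounds the variation of its first difference.
\<close>

lemma phase_sum_block:
  assumes "T > 0" "r > 0" "100 * r \<le> v" "w \<le> 2 * v"
  defines "P \<equiv> sqrt (T * r)" and "q \<equiv> sqrt v"
  shows "norm (\<Sum>m\<in>nats_in v w. cis (phase T r (real m)))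
      \<le> 1.3645 * (P / q) + 0.1195 * (P\<^sup>2 / q ^ 4) + 22.86 * (q ^ 3 / P) + 3"
proof (cases "nats_in v w = {}")
  case True
  have "0 \<le> P" "0 \<le> q" using assms by (auto simp: P_def q_def)
  then show ?thesis using True by simp
next
  case False
  have v: "v > 0" using assms by auto
  have P: "P > 0" "P\<^sup>2 = T * r" using assms by (auto simp: P_def)
  have q: "q > 0" "q\<^sup>2 = v" using v by (auto simp: q_def)
  obtain a b where ab: "nats_in v w = {a..b}" "a \<le> b" "v < real a" "real b \<le> w"
    using False by (rule nats_in_interval)
  define f where "f n = phase T r (real n) / (2 * pi)" for n
  define lam where "lam = (0.35 * P / q ^ 3)\<^sup>2 / pi"
  define V where "V = 3 / (8 * pi) * (P\<^sup>2 / q ^ 4)"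
  have a0: "real a > 0" using ab v by linarith
  have lam0: "lam > 0" using P q by (simp add: lam_def)
  have lam: "lam \<le> 1.96 * T * r / (2 * v) ^ 3 / (2 * pi)"
  proof -
    have "(q ^ 3)\<^sup>2 = v ^ 3" using q(2) by (metis mult.commute power_mult)
    then have "lam = 0.1225 * (T * r) / v ^ 3 / pi"
      by (simp add: lam_def power_divide power_mult_distrib P(2))
    then show ?thesis by (simp add: power_mult_distrib)
  qed
  have V0: "V \<ge> 0" by (simp add: V_def)
  have Vle: "V \<le> 0.1195 * (P\<^sup>2 / q ^ 4)"
  proof -
    have "3 / (8 * pi) \<le> 3 / (8 * 3.14)" using pi_approx by (intro divide_left_mono) auto
    then have "3 / (8 * pi) \<le> 0.1195" by simp
    then show ?thesis unfolding V_def by (intro mult_right_mono) auto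
  qed
  have S: "norm (\<Sum>n=a..<b. cis (2 * pi * f n)) \<le> (V + 2) * (4 / sqrt (pi * lam) + 1)"
  proof (cases "a < b")
    case True
    show ?thesis
    proof (rule van_der_corput[OF True lam0])
      show "f (Suc n) - f n + lam \<le> f (Suc (Suc n)) - f (Suc n)" if n: "a \<le> n" "Suc n < b" for n
      proof -
        have "real n + 2 \<le> real b" using n by linarith
        then have "(phase T r (real n + 2) - phase T r (real n + 1)) - (phase T r (real n + 1) - phase T r (real n)) \<ge> 1.96 * T * r / (2 * v) ^ 3"
          using n ab assms a0 by (intro phase_second_difference_ge) auto
        then have "((phase T r (real n + 2) - phase T r (real n + 1)) - (phase T r (real n + 1) - phase T r (real n))) / (2 * pi) \<ge> lam"
          using lam by (meson divide_right_mono order_trans pi_ge_zero mult_nonneg_nonneg zero_le_numeral)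
        moreover have "real (Suc n) = real n + 1" "real (Suc (Suc n)) = real n + 2" by simp_all
        ultimately show ?thesis unfolding f_def by (simp only: diff_divide_distrib)
      qed
      show "(f b - f (b - 1)) - (f (Suc a) - f a) \<le> V"
      proof -
        obtain z where z: "real a < z" "phase T r (real (Suc a)) - phase T r (real a) = phase' T r z"
          by (rule phase_diff_mean_value[of r a T]) (use assms a0 in auto)
        obtain y where y: "real (b - 1) < y" "y < real (Suc (b - 1))" "phase T r (real (Suc (b - 1))) - phase T r (real (b - 1)) = phase' T r y"
          by (rule phase_diff_mean_value[of r "b - 1" T]) (use assms a0 True in auto)
        have b1: "Suc (b - 1) = b" using True by simp
        have "phase' T r y \<le> phase' T r (2 * v)"
        proof (rule phase'_mono)
          show "0 < y" using y(1) of_nat_0_le_iff[of "b - 1"] by linarith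
          show "y \<le> 2 * v" using y(2) b1 ab(4) assms(4) by simp
        qed (use assms in auto)
        moreover have "phase' T r v \<le> phase' T r z" using z ab assms v by (intro phase'_mono) auto
        ultimately have "phase' T r y - phase' T r z \<le> 3 / 4 * (T * r / v\<^sup>2)"
          using phase'_variation[of T r v] assms v by linarith
        then have "(phase' T r y - phase' T r z) / (2 * pi) \<le> 3 / 4 * (T * r / v\<^sup>2) / (2 * pi)"
          by (intro divide_right_mono) auto
        also have "\<dots> = V"
        proof -
          have "q ^ 4 = v\<^sup>2" using q(2) by (metis mult_2_right numeral_Bit0 power_add power2_eq_square)
          then show ?thesis by (simp add: V_def P(2))
        qed
        finally have "(phase' T r y - phase' T r z) / (2 * pi) \<le> V" .
        moreover have "f b - f (b - 1) = phase' T r y / (2 * pi)" "f (Suc a) - f a = phase' T r z / (2 * pi)"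
          unfolding f_def y(3)[symmetric] z(2)[symmetric] b1 by (simp_all add: diff_divide_distrib)
        ultimately show ?thesis by (simp add: diff_divide_distrib)
      qed
    qed
  qed (use V0 lam0 in auto)
  have sq: "sqrt (pi * lam) = 0.35 * P / q ^ 3" using P q by (simp add: lam_def real_sqrt_divide)
  have four: "4 / sqrt (pi * lam) \<le> 11.43 * (q ^ 3 / P)" unfolding sq using P q by (simp add: field_simps)
  have "norm (\<Sum>n=a..b. cis (2 * pi * f n)) \<le> (V + 2) * (4 / sqrt (pi * lam) + 1) + 1"
  proof -
    have "{a..b} = insert b {a..<b}" using ab(2) by auto
    then show ?thesis using S norm_triangle_ineq[of "cis (2 * pi * f b)" "\<Sum>n=a..<b. cis (2 * pi * f n)"] by simp
  qed
  also have "\<dots> \<le> (V + 2) * (11.43 * (q ^ 3 / P) + 1) + 1"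
    using four V0 by (intro add_mono mult_left_mono) auto
  also have "\<dots> = 11.43 * (V * (q ^ 3 / P)) + V + 22.86 * (q ^ 3 / P) + 3"
  proof -
    have "(V + 2) * (11.43 * X + 1) + 1 = 11.43 * (V * X) + V + 22.86 * X + 3" for X by (simp add: algebra_simps)
    then show ?thesis .
  qed
  also have "V * (q ^ 3 / P) = 3 / (8 * pi) * (P / q)"
  proof -
    have "P\<^sup>2 / q ^ 4 * (q ^ 3 / P) = P / q" using P(1) q(1) by (simp add: field_simps numeral_eq_Suc)
    then show ?thesis unfolding V_def mult.assoc by (simp only:)
  qed
  also have "11.43 * (3 / (8 * pi) * (P / q)) + V + 22.86 * (q ^ 3 / P) + 3 \<le> 1.3645 * (P / q) + 0.1195 * (P\<^sup>2 / q ^ 4) + 22.86 * (q ^ 3 / P) + 3"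
  proof -
    have "3 / (8 * pi) \<le> 3 / (8 * 3.1415)" using pi_approx by (intro divide_left_mono) auto
    then have "11.43 * (3 / (8 * pi)) \<le> 1.3645" by simp
    then have "11.43 * (3 / (8 * pi)) * (P / q) \<le> 1.3645 * (P / q)" using P q by (intro mult_right_mono) auto
    then show ?thesis using Vle by simp
  qed
  finally show ?thesis unfolding ab(1) f_def by simp
qed

text \<open>
  Induction over dyadic blocks. The constants 4.67, 0.16 and 12.6 are chosen so that the bound for the range
  from 2 v on, together with the bound for the block from v to 2 v, is again of the stated form: the three
  quantities change by the factors 1/\<surd>2, 1/4 and 2\<surd>2 when v is doubled. The negative term
  makes the last sum, whose terms grow with v, telescope towards its value at u.
\<close>

lemma phase_sum_dyadic:
  assumes T: "T > 0" "r > 0" and v: "100 * r \<le> v" "v \<le> u" "u \<le> 2 ^ j * v" and small: "(3000 * sqrt u)\<^sup>2 \<le> T * r"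
  defines "P \<equiv> sqrt (T * r)"
  shows "norm (\<Sum>m\<in>nats_in v u. cis (phase T r (real m)))
      \<le> 4.67 * (P / sqrt v) + 0.16 * (P\<^sup>2 / sqrt v ^ 4) + 35.5 * (sqrt u ^ 3 / P) - 12.6 * (sqrt v ^ 3 / P)"
  using v
proof (induction j arbitrary: v)
  case (0 v)
  then have "u = v" by simp
  then have "nats_in v u = {}" by (auto simp: nats_in_def)
  moreover have "P \<ge> 0" using T by (simp add: P_def)
  moreover have "v \<ge> 0" using 0 T by simp
  ultimately show ?case using \<open>u = v\<close> by (simp add: divide_nonneg_nonneg)
next
  case (Suc j v)
  define q where "q = sqrt v"
  have v: "v > 0" using Suc.prems T by linarith
  have q: "q > 0" using v by (simp add: q_def)
  have P: "P > 0" using T by (simp add: P_def)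
  have qu: "q \<le> sqrt u" using Suc.prems by (simp add: q_def)
  have "3000 * sqrt u \<le> P" using small T by (simp add: P_def real_le_rsqrt)
  then have "3000 * q \<le> P" using qu by linarith
  define A B C D where "A = P / q" and "B = P\<^sup>2 / q ^ 4" and "C = q ^ 3 / P" and "D = sqrt u ^ 3 / P"
  have nn: "A \<ge> 0" "B \<ge> 0" "C \<ge> 0" using P q by (auto simp: A_def B_def C_def)
  have three: "3000 \<le> A" using q \<open>3000 * q \<le> P\<close> by (simp add: A_def field_simps)
  have block: "norm (\<Sum>m\<in>nats_in v w. cis (phase T r (real m))) \<le> 1.3655 * A + 0.1195 * B + 22.86 * C" if "w \<le> 2 * v" for w
    using phase_sum_block[OF T Suc.prems(1) that, folded P_def q_def, folded A_def B_def C_def] three by simp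
  have CD: "C \<le> D" unfolding C_def D_def using qu q P by (intro divide_right_mono power_mono) auto
  have "norm (\<Sum>m\<in>nats_in v u. cis (phase T r (real m))) \<le> 4.67 * A + 0.16 * B + 35.5 * D - 12.6 * C"
  proof (cases "u \<le> 2 * v")
    case True
    then show ?thesis using block[OF True] nn CD by simp
  next
    case False
    have IH: "norm (\<Sum>m\<in>nats_in (2 * v) u. cis (phase T r (real m)))
      \<le> 4.67 * (P / sqrt (2 * v)) + 0.16 * (P\<^sup>2 / sqrt (2 * v) ^ 4) + 35.5 * D - 12.6 * (sqrt (2 * v) ^ 3 / P)"
      unfolding D_def using Suc.prems False v T by (intro Suc.IH) auto
    have sq2: "1.414 \<le> sqrt 2" by (rule real_le_rsqrt) (simp add: power2_eq_square)
    have "P / sqrt (2 * v) = (1 / sqrt 2) * A" by (simp add: real_sqrt_mult q_def A_def)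
    also have "\<dots> \<le> 0.7073 * A"
    proof (rule mult_right_mono)
      have "1 / sqrt 2 \<le> 1 / 1.414" using sq2 by (intro divide_left_mono) auto
      then show "1 / sqrt 2 \<le> 0.7073" by simp
    qed (use nn in auto)
    finally have a: "P / sqrt (2 * v) \<le> 0.7073 * A" .
    have "sqrt 2 ^ 4 = (4 :: real)" by (simp add: numeral_eq_Suc)
    then have b: "P\<^sup>2 / sqrt (2 * v) ^ 4 = B / 4" by (simp add: real_sqrt_mult q_def power_mult_distrib B_def)
    have "sqrt 2 ^ 3 = 2 * sqrt (2 :: real)" by (simp add: numeral_eq_Suc)
    then have "sqrt (2 * v) ^ 3 / P = 2 * sqrt 2 * C" by (simp add: real_sqrt_mult q_def power_mult_distrib C_def)
    also have "\<dots> \<ge> 2.828 * C" using sq2 nn by (intro mult_right_mono) auto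
    finally have c: "sqrt (2 * v) ^ 3 / P \<ge> 2.828 * C" .
    have "(\<Sum>m\<in>nats_in v u. cis (phase T r (real m))) = (\<Sum>m\<in>nats_in v (2 * v). cis (phase T r (real m))) + (\<Sum>m\<in>nats_in (2 * v) u. cis (phase T r (real m)))"
      using False v by (intro nats_in_split) auto
    then have "norm (\<Sum>m\<in>nats_in v u. cis (phase T r (real m))) \<le>
      norm (\<Sum>m\<in>nats_in v (2 * v). cis (phase T r (real m))) + norm (\<Sum>m\<in>nats_in (2 * v) u. cis (phase T r (real m)))"
      by (simp add: norm_triangle_ineq)
    moreover have "x \<le> 4.67 * A + 0.16 * B + 35.5 * D - 12.6 * C"
      if "x \<le> y + z" "y \<le> 1.3655 * A + 0.1195 * B + 22.86 * C" "z \<le> 4.67 * a + 0.16 * b + 35.5 * D - 12.6 * c"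
        "a \<le> 0.7073 * A" "b = B / 4" "c \<ge> 2.828 * C" for x y z a b c
      using that nn by simp
    ultimately show ?thesis using block[of "2 * v"] IH a b c by blast
  qed
  then show ?case unfolding A_def B_def C_def D_def q_def .
qed

text \<open>
  The block bounds in terms of \<xi>, with v \<ge> \<xi> r. Since u is at most \<surd>(Tr/\<pi>), the third quantity is of size (Tr)^(1/4).
\<close>

lemma phase_sum_van_der_corput:
  assumes T: "T > 0" "r > 0" "\<xi> \<ge> 100" "\<xi> * r \<le> v" "v \<le> u" "u\<^sup>2 \<le> T * r / pi" "10 ^ 15 \<le> T * r"
  shows "norm (\<Sum>m\<in>nats_in v u. cis (phase T r (real m)))
      \<le> 4.67 * sqrt (T / \<xi>) + 0.16 * (T / (\<xi>\<^sup>2 * r)) + 15.2 * (T * r) powr (1/4)"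
proof -
  define P where "P = sqrt (T * r)"
  have P: "P > 0" "P\<^sup>2 = T * r" using T by (auto simp: P_def)
  have v: "100 * r \<le> v" "v > 0"
  proof -
    have "100 * r \<le> \<xi> * r" using T by (intro mult_right_mono) auto
    then show "100 * r \<le> v" using T(4) by linarith
    then show "v > 0" using T(2) by linarith
  qed
  have u0: "u > 0" using v T by linarith
  have uP: "sqrt pi * u \<le> P"
  proof -
    have "pi * u\<^sup>2 \<le> T * r" using T by (simp add: field_simps)
    then have "(sqrt pi * u)\<^sup>2 \<le> T * r" by (simp add: power_mult_distrib)
    then show ?thesis unfolding P_def by (rule real_le_rsqrt)
  qed
  have sp: "sqrt pi \<ge> 1.77" using pi_approx by (intro real_le_rsqrt) (simp add: power2_eq_square)
  have uP': "1.77 * u \<le> P" using uP mult_right_mono[OF sp, of u] u0 by linarith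
  have P7: "P \<ge> 3 * 10 ^ 7" unfolding P_def using T by (intro real_le_rsqrt) (simp add: power2_eq_square)
  have small: "(3000 * sqrt u)\<^sup>2 \<le> T * r"
  proof -
    have "(3000 * sqrt u)\<^sup>2 = 9000000 * u" using u0 by (simp add: power_mult_distrib)
    also have "\<dots> \<le> 3 * 10 ^ 7 * P" using uP' u0 by simp
    also have "\<dots> \<le> P * P" using P7 P by (intro mult_right_mono) auto
    finally show ?thesis using P by (simp add: power2_eq_square)
  qed
  obtain j where j: "u / v < 2 ^ j" using real_arch_pow[of 2 "u / v"] by auto
  then have "u \<le> 2 ^ j * v" using v by (simp add: field_simps)
  from phase_sum_dyadic[OF T(1,2) v(1) T(5) this small, folded P_def]
  have "norm (\<Sum>m\<in>nats_in v u. cis (phase T r (real m)))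
      \<le> 4.67 * (P / sqrt v) + 0.16 * (P\<^sup>2 / sqrt v ^ 4) + 35.5 * (sqrt u ^ 3 / P) - 12.6 * (sqrt v ^ 3 / P)" .
  moreover have "sqrt v ^ 3 / P \<ge> 0" using v P by auto
  moreover have "P / sqrt v \<le> sqrt (T / \<xi>)"
  proof -
    have "P / sqrt v = sqrt (T * r / v)" by (simp add: P_def real_sqrt_divide)
    also have "T * r / v \<le> T * r / (\<xi> * r)" using T v by (intro divide_left_mono) auto
    also have "T * r / (\<xi> * r) = T / \<xi>" using T by simp
    finally show ?thesis by simp
  qed
  moreover have "P\<^sup>2 / sqrt v ^ 4 \<le> T / (\<xi>\<^sup>2 * r)"
  proof -
    have "sqrt v ^ 4 = v\<^sup>2" using v by (metis less_imp_le mult_2_right numeral_Bit0 power_add power2_eq_square real_sqrt_pow2)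
    then have "P\<^sup>2 / sqrt v ^ 4 = T * r / v\<^sup>2" using P by simp
    also have "\<dots> \<le> T * r / (\<xi> * r)\<^sup>2" using T v by (intro divide_left_mono power_mono) auto
    also have "\<dots> = T / (\<xi>\<^sup>2 * r)" using T by (simp add: power2_eq_square)
    finally show ?thesis .
  qed
  moreover have "sqrt u ^ 3 / P \<le> 0.4263 * (T * r) powr (1/4)"
  proof -
    define s where "s = sqrt P"
    have s: "s > 0" "s\<^sup>2 = P" using P by (auto simp: s_def)
    have "sqrt u \<le> sqrt (P / 1.77)" using uP' by simp
    also have "\<dots> = s / sqrt 1.77" unfolding s_def by (rule real_sqrt_divide)
    also have "\<dots> \<le> s / 1.33"
    proof (rule divide_left_mono)
      show "1.33 \<le> sqrt 1.77" by (rule real_le_rsqrt) (simp add: power2_eq_square)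
    qed (use s in auto)
    finally have "sqrt u ^ 3 \<le> (s / 1.33) ^ 3" using u0 by (intro power_mono) auto
    then have "sqrt u ^ 3 / P \<le> (s / 1.33) ^ 3 / P" using P by (intro divide_right_mono) auto
    also have "\<dots> = s / 1.33 ^ 3" using s P by (simp add: power_divide field_simps power2_eq_square power3_eq_cube)
    also have "\<dots> \<le> 0.4263 * s" using s by (simp add: power3_eq_cube)
    also have "s = (T * r) powr (1/4)" using T by (simp add: s_def P_def powr_powr flip: powr_half_sqrt)
    finally show ?thesis .
  qed
  moreover have "x \<le> 4.67 * A' + 0.16 * B' + 15.2 * D'"
    if "x \<le> 4.67 * A + 0.16 * B + 35.5 * D - 12.6 * C" "C \<ge> 0" "A \<le> A'" "B \<le> B'" "D \<le> 0.4263 * D'" "D' \<ge> 0"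
    for x A B C D A' B' D' :: real
    using that by simp
  ultimately show ?thesis using powr_ge_zero by blast
qed

section \<open>Sums of the sine compared with integrals\<close>

lemma sin_phase_deriv:
  assumes "r > 0" "x > 0"
  shows "((\<lambda>x. sin (phase T r x)) has_real_derivative cos (phase T r x) * phase' T r x) (at x)"
    and "((\<lambda>x. cos (phase T r x) * phase' T r x) has_real_derivative
           cos (phase T r x) * phase'' T r x - sin (phase T r x) * (phase' T r x)\<^sup>2) (at x)"
proof -
  note d = phase_deriv[OF assms, of T]
  show "((\<lambda>x. sin (phase T r x)) has_real_derivative cos (phase T r x) * phase' T r x) (at x)"
    by (rule DERIV_fun_sin[OF d])
  have "((\<lambda>x. cos (phase T r x) * phase' T r x) has_real_derivative
     (- sin (phase T r x) * phase' T r x) * phase' T r x + phase'' T r x * cos (phase T r x)) (at x)"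
    by (rule DERIV_mult[OF DERIV_fun_cos[OF d] phase'_deriv[OF assms]])
  then show "((\<lambda>x. cos (phase T r x) * phase' T r x) has_real_derivative
           cos (phase T r x) * phase'' T r x - sin (phase T r x) * (phase' T r x)\<^sup>2) (at x)"
    by (simp add: power2_eq_square algebra_simps)
qed

lemma continuous_on_sin_phase:
  assumes "r > 0" "\<And>x. x \<in> S \<Longrightarrow> x > 0"
  shows "continuous_on S (\<lambda>x. sin (phase T r x))"
  by (intro continuous_at_imp_continuous_on ballI DERIV_isCont[OF sin_phase_deriv(1)]) (use assms in auto)

text \<open>
  The first derivative test: the integrand is the derivative of a cosine divided by the derivative of the phase,
  which is monotone.
\<close>

lemma integral_sin_phase_le:
  assumes "T > 0" "r > 0" "0 < u" "u \<le> v"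
  shows "\<bar>integral {u..v} (\<lambda>x. sin (phase T r x))\<bar> \<le> 2 * (v * (v + r)) / (T * r)"
proof -
  define p where "p x = x * (x + r) / (T * r)" for x
  define F where "F x = sin (phase T r x)" for x
  have contF: "continuous_on {u..v} F" unfolding F_def using assms by (intro continuous_on_sin_phase) auto
  define g where "g x = integral {u..x} F - cos (phase T r x) * p x" for x
  have pd: "(p has_real_derivative (2 * x + r) / (T * r)) (at x)" for x
    unfolding p_def[abs_def] using assms by (auto intro!: derivative_eq_intros)
  have "\<bar>g v - g u\<bar> \<le> p v - p u"
  proof (rule deriv_dominated[where g' = "\<lambda>x. - cos (phase T r x) * ((2 * x + r) / (T * r))" and h' = "\<lambda>x. (2 * x + r) / (T * r)"])
    show cp: "continuous_on {u..v} p" unfolding p_def[abs_def] using assms by (intro continuous_intros) auto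
    have "continuous_on {u..v} (\<lambda>x. cos (phase T r x))"
      by (intro continuous_at_imp_continuous_on ballI DERIV_isCont[OF DERIV_fun_cos[OF phase_deriv]]) (use assms in auto)
    then show "continuous_on {u..v} g" unfolding g_def[abs_def]
      by (intro continuous_on_diff continuous_on_mult cp indefinite_integral_continuous_1 integrable_continuous_real contF)
    show "(g has_real_derivative - cos (phase T r x) * ((2 * x + r) / (T * r))) (at x)" if "u < x" "x < v" for x
    proof -
      have x: "x > 0" using that assms by simp
      have "((\<lambda>y. integral {u..y} F) has_real_derivative F x) (at x within {u..v})"
        using integral_has_real_derivative[OF contF, of x] that by auto
      then have "((\<lambda>y. integral {u..y} F) has_real_derivative F x) (at x)"
        using that by (simp add: at_within_Icc_at)
      from DERIV_diff[OF this DERIV_mult[OF DERIV_fun_cos[OF phase_deriv[OF assms(2) x]] pd]]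
      have "(g has_real_derivative F x - (- sin (phase T r x) * phase' T r x * p x + (2 * x + r) / (T * r) * cos (phase T r x))) (at x)"
        unfolding g_def[abs_def] .
      moreover have "phase' T r x * p x = - 1" using x assms by (simp add: phase'_def p_def)
      then have "F x - (- sin (phase T r x) * phase' T r x * p x + q * cos (phase T r x)) = - cos (phase T r x) * q" for q
        by (simp add: F_def mult.assoc mult.commute[of q])
      ultimately show ?thesis by (simp only:)
    qed
    show "\<bar>- cos (phase T r x) * ((2 * x + r) / (T * r))\<bar> \<le> (2 * x + r) / (T * r)" if "u < x" "x < v" for x
    proof -
      have "\<bar>cos (phase T r x)\<bar> * ((2 * x + r) / (T * r)) \<le> 1 * ((2 * x + r) / (T * r))"
        using that assms by (intro mult_right_mono) auto
      then show ?thesis using that assms by (simp add: abs_mult)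
    qed
  qed (use assms pd in auto)
  moreover have "\<bar>cos (phase T r u) * p u\<bar> \<le> p u" "\<bar>cos (phase T r v) * p v\<bar> \<le> p v"
    using assms by (auto simp: abs_mult p_def intro!: mult_left_le_one_le simp del: times_divide_eq_right)
  moreover have "g u = - (cos (phase T r u) * p u)" by (simp add: g_def)
  ultimately have "\<bar>integral {u..v} F\<bar> \<le> 2 * p v" unfolding g_def by linarith
  then show ?thesis by (simp add: F_def[abs_def] p_def)
qed

lemma inverse_power_sums:
  assumes "n \<ge> (1000 :: nat)" "n \<le> M"
  shows "(\<Sum>j=n..<M. 1 / real j ^ 4) \<le> 0.35 / real n ^ 3" "(\<Sum>j=n..<M. 1 / real j ^ 3) \<le> 0.51 / (real n)\<^sup>2"
proof -
  have key: "1 / x ^ 4 \<le> 0.35 * (1 / x ^ 3 - 1 / (x + 1) ^ 3) \<and> 1 / x ^ 3 \<le> 0.51 * (1 / x\<^sup>2 - 1 / (x + 1)\<^sup>2)" if "x \<ge> 1000" for x :: real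
  proof -
    define y where "y = x - 1000"
    have y: "y \<ge> 0" "x = y + 1000" using that by (auto simp: y_def)
    have a: "20 * (x + 1) ^ 3 \<le> 7 * x * ((x + 1) ^ 3 - x ^ 3)"
      unfolding y(2) using y(1) by (simp add: power3_eq_cube algebra_simps)
    have b: "100 * (x + 1)\<^sup>2 \<le> 51 * x * ((x + 1)\<^sup>2 - x\<^sup>2)"
      unfolding y(2) using y(1) by (simp add: power2_eq_square algebra_simps)
    show ?thesis
    proof
      show "1 / x ^ 4 \<le> 0.35 * (1 / x ^ 3 - 1 / (x + 1) ^ 3)"
      proof -
        have "0.35 * (1 / x ^ 3 - 1 / (x + 1) ^ 3) = 7 * x * ((x + 1) ^ 3 - x ^ 3) / (20 * (x + 1) ^ 3) / x ^ 4"
          using that by (simp add: field_simps) (simp add: numeral_eq_Suc algebra_simps)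
        moreover have "1 \<le> 7 * x * ((x + 1) ^ 3 - x ^ 3) / (20 * (x + 1) ^ 3)" using a that by (subst le_divide_eq_1_pos) auto
        ultimately show ?thesis using that by (simp only: divide_right_mono zero_le_power)
      qed
      show "1 / x ^ 3 \<le> 0.51 * (1 / x\<^sup>2 - 1 / (x + 1)\<^sup>2)"
      proof -
        have "0.51 * (1 / x\<^sup>2 - 1 / (x + 1)\<^sup>2) = 51 * x * ((x + 1)\<^sup>2 - x\<^sup>2) / (100 * (x + 1)\<^sup>2) / x ^ 3"
          using that by (simp add: field_simps) (simp add: numeral_eq_Suc algebra_simps)
        moreover have "1 \<le> 51 * x * ((x + 1)\<^sup>2 - x\<^sup>2) / (100 * (x + 1)\<^sup>2)" using b that by (subst le_divide_eq_1_pos) auto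
        ultimately show ?thesis using that by (simp only: divide_right_mono zero_le_power)
      qed
    qed
  qed
  have "(\<Sum>j=n..<M. 1 / real j ^ 4) \<le> 0.35 * (1 / real n ^ 3 - 1 / real M ^ 3) \<and>
     (\<Sum>j=n..<M. 1 / real j ^ 3) \<le> 0.51 * (1 / (real n)\<^sup>2 - 1 / (real M)\<^sup>2)"
    using assms(2)
  proof (induction M rule: dec_induct)
    case (step m)
    have "real m \<ge> 1000" using step assms by linarith
    from key[OF this] step show ?case by (simp add: add.commute)
  qed simp
  moreover have "0.35 * (1 / real n ^ 3 - 1 / real M ^ 3) \<le> 0.35 / real n ^ 3" "0.51 * (1 / (real n)\<^sup>2 - 1 / (real M)\<^sup>2) \<le> 0.51 / (real n)\<^sup>2"
    by auto
  ultimately show "(\<Sum>j=n..<M. 1 / real j ^ 4) \<le> 0.35 / real n ^ 3" "(\<Sum>j=n..<M. 1 / real j ^ 3) \<le> 0.51 / (real n)\<^sup>2"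
    by linarith+
qed

text \<open>
  The trapezoidal rule on unit intervals. The second derivative of the sine of the phase is at most (Tr)^2/j^4 + 2Tr/j^3
  on [j, j + 1]; the constant 3 absorbs the boundary terms and the incomplete first interval.
\<close>

lemma phase_sum_euler_maclaurin:
  assumes T: "T > 0" "r > 0" and u: "u \<ge> 1000" "u \<le> real M"
  shows "\<bar>(\<Sum>m\<in>nats_in u (real M). sin (phase T r (real m))) - integral {u..real M} (\<lambda>x. sin (phase T r x))\<bar>
    \<le> 3 + 0.03 * ((T * r)\<^sup>2 / u ^ 3) + 0.09 * (T * r / u\<^sup>2)"
proof -
  define F where "F x = sin (phase T r x)" for x
  \<comment> \<open>the first integer of the range; the piece from u to n is estimated trivially\<close>
  define n where "n = nat \<lceil>u\<rceil>"
  have n: "u \<le> real n" "real n < u + 1" "n \<ge> 1000" "n \<le> M"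
    using u unfolding n_def by linarith+
  have int: "F integrable_on {x..y}" if "x \<ge> u" for x y
    unfolding F_def using that u T by (intro integrable_continuous_real continuous_on_sin_phase) auto
  have b1: "\<bar>F x\<bar> \<le> 1" for x by (simp add: F_def)
  define e where "e j = (F (real j) + F (real (Suc j))) / 2 - integral {real j..real (Suc j)} F" for j
  have e: "\<bar>e j\<bar> \<le> ((T * r)\<^sup>2 * (1 / real j ^ 4) + 2 * (T * r) * (1 / real j ^ 3)) / 12" if "j \<ge> n" for j
  proof -
    have j0: "real j > 0" using that n by auto
    have "\<bar>integral {real j..real (Suc j)} F - (real (Suc j) - real j) / 2 * (F (real j) + F (real (Suc j)))\<bar>
        \<le> ((T * r)\<^sup>2 * (1 / real j ^ 4) + 2 * (T * r) * (1 / real j ^ 3)) * (real (Suc j) - real j) ^ 3 / 12"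
      unfolding F_def
    proof (rule trapezoid_error[OF _ sin_phase_deriv(1) sin_phase_deriv(2)])
      fix x assume x: "real j \<le> x"
      then have x0: "x > 0" using j0 by simp
      have "\<bar>phase' T r x\<bar> \<le> T * r / (real j)\<^sup>2"
      proof -
        have "(real j)\<^sup>2 \<le> x * (x + r)" using x j0 T by (simp add: power2_eq_square mult_mono)
        then have "T * r / (x * (x + r)) \<le> T * r / (real j)\<^sup>2" using x0 j0 T by (intro divide_left_mono) auto
        then show ?thesis using x0 T by (simp add: phase'_def)
      qed
      then have "\<bar>phase' T r x\<bar>\<^sup>2 \<le> (T * r / (real j)\<^sup>2)\<^sup>2" by (rule power_mono) simp
      then have A: "(phase' T r x)\<^sup>2 \<le> (T * r)\<^sup>2 * (1 / real j ^ 4)" by (simp add: power_divide flip: power_mult)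
      have "phase'' T r x \<le> 2 * T * r / x ^ 3" using T x0 by (intro phase''_bounds) auto
      also have "\<dots> \<le> 2 * T * r / real j ^ 3" using T x x0 j0 by (intro divide_left_mono power_mono) auto
      finally have B: "\<bar>phase'' T r x\<bar> \<le> 2 * (T * r) * (1 / real j ^ 3)" using T x0 phase''_bounds(1)[of T r x] by simp
      have "\<bar>cos (phase T r x) * phase'' T r x\<bar> \<le> \<bar>phase'' T r x\<bar>" "\<bar>sin (phase T r x) * (phase' T r x)\<^sup>2\<bar> \<le> (phase' T r x)\<^sup>2"
        by (auto simp: abs_mult intro!: mult_left_le_one_le mult_right_le_one_le)
      then show "\<bar>cos (phase T r x) * phase'' T r x - sin (phase T r x) * (phase' T r x)\<^sup>2\<bar>
          \<le> (T * r)\<^sup>2 * (1 / real j ^ 4) + 2 * (T * r) * (1 / real j ^ 3)"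
        using A B by linarith
    qed (use T j0 in auto)
    then show ?thesis unfolding e_def by (simp add: abs_minus_commute)
  qed
  have tele: "(\<Sum>j=n..<m. e j) = (\<Sum>j=n..m. F (real j)) - F (real n) / 2 - F (real m) / 2 - integral {real n..real m} F" if "n \<le> m" for m
    using that
  proof (induction m rule: dec_induct)
    case (step m)
    have "integral {real n..real (Suc m)} F = integral {real n..real m} F + integral {real m..real (Suc m)} F"
      using step n by (intro Henstock_Kurzweil_Integration.integral_combine[symmetric] int) auto
    then show ?case using step by (simp add: e_def field_simps)
  qed simp
  have "\<bar>\<Sum>j=n..<M. e j\<bar> \<le> (\<Sum>j=n..<M. ((T * r)\<^sup>2 * (1 / real j ^ 4) + 2 * (T * r) * (1 / real j ^ 3)) / 12)"
    using e by (intro order_trans[OF sum_abs] sum_mono) auto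
  also have "\<dots> = ((T * r)\<^sup>2 * (\<Sum>j=n..<M. 1 / real j ^ 4) + 2 * (T * r) * (\<Sum>j=n..<M. 1 / real j ^ 3)) / 12"
    by (simp only: sum_divide_distrib[symmetric] sum.distrib sum_distrib_left)
  also have "\<dots> \<le> ((T * r)\<^sup>2 * (0.35 / real n ^ 3) + 2 * (T * r) * (0.51 / (real n)\<^sup>2)) / 12"
    using T inverse_power_sums[OF n(3,4)] by (intro divide_right_mono add_mono mult_left_mono) auto
  also have "\<dots> \<le> ((T * r)\<^sup>2 * (0.35 / u ^ 3) + 2 * (T * r) * (0.51 / u\<^sup>2)) / 12"
    using T n u by (intro divide_right_mono add_mono mult_left_mono divide_left_mono power_mono) auto
  also have "\<dots> \<le> 0.03 * ((T * r)\<^sup>2 / u ^ 3) + 0.09 * (T * r / u\<^sup>2)"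
  proof -
    have "(A * 0.35 + 2 * B * 0.51) / 12 \<le> 0.03 * A + 0.09 * B" if "A \<ge> 0" "B \<ge> 0" for A B :: real
      using that by simp
    from this[of "(T * r)\<^sup>2 / u ^ 3" "T * r / u\<^sup>2"] show ?thesis using T u by simp
  qed
  finally have E: "\<bar>\<Sum>j=n..<M. e j\<bar> \<le> 0.03 * ((T * r)\<^sup>2 / u ^ 3) + 0.09 * (T * r / u\<^sup>2)" .
  have I: "integral {u..real M} F = integral {u..real n} F + integral {real n..real M} F"
    using n by (intro Henstock_Kurzweil_Integration.integral_combine[symmetric] int) auto
  have In: "\<bar>integral {u..real n} F\<bar> \<le> 1"
  proof -
    have "norm (integral {u..real n} F) \<le> 1 * (real n - u)"
      using n b1 by (intro integral_bound) (auto simp: F_def intro!: continuous_on_sin_phase T order.strict_trans2[OF _ u(1)])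
    then show ?thesis using n by simp
  qed
  have S: "\<bar>(\<Sum>m\<in>nats_in u (real M). F (real m)) - ((\<Sum>j=n..M. F (real j)) - F (real n) / 2)\<bar> \<le> 1/2"
  proof (cases "real n = u")
    case True
    then have "nats_in u (real M) = {Suc n..M}" unfolding nats_in_def by auto
    moreover have "(\<Sum>j=n..M. F (real j)) = F (real n) + (\<Sum>j=Suc n..M. F (real j))"
      using n by (simp add: sum.atLeast_Suc_atMost)
    ultimately show ?thesis using b1[of "real n"] by simp
  next
    case False
    have "nats_in u (real M) = {n..M}" unfolding nats_in_def using n False by auto
    then show ?thesis using b1[of "real n"] by simp
  qed
  show ?thesis using E tele[OF n(4)] I In S b1[of "real M"] unfolding F_def[symmetric] by linarith
qed

text \<open>
  The contribution of the range from \<xi> r to \<surd>(Tr/\<pi>), where the phase turns fast.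
\<close>

definition vdc_bound :: "real \<Rightarrow> real \<Rightarrow> real \<Rightarrow> real" where
  "vdc_bound T r \<xi> = 4.67 * sqrt (T / \<xi>) + 0.16 * (T / (\<xi>\<^sup>2 * r)) + 15.2 * (T * r) powr (1/4)"

text \<open>
  A bound for the difference of sum and integral of the sine from \<xi> r on. The first three terms come from
  the trapezoidal rule beyond N, the fourth from the range between \<surd>(Tr/\<pi>) and N, where the sum costs 4 and the
  integral 2 times N (N + r)/(T r), and the last from the range before. The cut point N is free; it will be chosen of size T^(2/3) \<surd>r.
\<close>

definition osc_bound :: "real \<Rightarrow> real \<Rightarrow> real \<Rightarrow> real \<Rightarrow> real" where
  "osc_bound T r \<xi> N = 3 + 0.03 * ((T * r)\<^sup>2 / (max N (\<xi> * r)) ^ 3) + 0.09 * (T * r / (max N (\<xi> * r))\<^sup>2)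
     + (if \<xi> * r < N then 6 * (N * (N + r)) / (T * r) else 0)
     + (if \<xi> * r < sqrt (T * r / pi) then vdc_bound T r \<xi> else 0)"

lemma abs_sum_sin_le_norm_sum_cis: "\<bar>\<Sum>m\<in>A. sin (f m)\<bar> \<le> norm (\<Sum>m\<in>A. cis (f m))"
  using abs_Im_le_cmod[of "\<Sum>m\<in>A. cis (f m)"] by (simp add: Im_sum)

text \<open>
  The range is cut at \<surd>(Tr/\<pi>) and at N. If v already lies beyond a cut point, the corresponding term is not incurred,
  which is why the bound contains conditionals.
\<close>

lemma osc_bound_valid:
  assumes T: "T > 0" "r > 0" and \<xi>: "\<xi> \<ge> 100" and N: "sqrt (T * r / pi) \<le> N" and large: "10 ^ 15 \<le> T * r"
    and v: "\<xi> * r \<le> v" "v \<ge> 1000" "v \<le> real M"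
  shows "\<bar>(\<Sum>m\<in>nats_in v (real M). sin (phase T r (real m))) - integral {v..real M} (\<lambda>x. sin (phase T r x))\<bar> \<le> osc_bound T r \<xi> N"
proof -
  define F where "F x = sin (phase T r x)" for x
  define S where "S a b = (\<Sum>m\<in>nats_in a b. F (real m))" for a b
  define I where "I a b = integral {a..b} F" for a b
  define D where "D = 3 + 0.03 * ((T * r)\<^sup>2 / (max N (\<xi> * r)) ^ 3) + 0.09 * (T * r / (max N (\<xi> * r))\<^sup>2)"
  define KL where "KL = N * (N + r) / (T * r)"
  define N0 where "N0 = sqrt (T * r / pi)"
  have N0: "N0 > 0" "N0\<^sup>2 = T * r / pi" "N0 \<le> N" using T N by (auto simp: N0_def)
  have \<xi>r: "\<xi> * r > 0" using T \<xi> by simp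
  have Npos: "N > 0" using N0 by simp
  have KL0: "KL \<ge> 0" using T Npos by (simp add: KL_def)
  have D0: "D \<ge> 0" using T Npos unfolding D_def by (intro add_nonneg_nonneg mult_nonneg_nonneg divide_nonneg_nonneg) auto
  have vd0: "vdc_bound T r \<xi> \<ge> 0" using T \<xi> unfolding vdc_bound_def by (intro add_nonneg_nonneg mult_nonneg_nonneg) auto
  have EM: "\<bar>S u (real M) - I u (real M)\<bar> \<le> D" if u: "u \<ge> 1000" "u \<le> real M" "max N (\<xi> * r) \<le> u" for u
  proof -
    have "\<bar>S u (real M) - I u (real M)\<bar> \<le> 3 + 0.03 * ((T * r)\<^sup>2 / u ^ 3) + 0.09 * (T * r / u\<^sup>2)"
      using phase_sum_euler_maclaurin[OF T u(1,2)] by (simp add: S_def I_def F_def[abs_def])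
    also have "\<dots> \<le> D" unfolding D_def using u T Npos
      by (intro add_mono mult_left_mono divide_left_mono power_mono mult_pos_pos zero_less_power) auto
    finally show ?thesis .
  qed
  have KLmono: "u * (u + r) / (T * r) \<le> KL" if "0 \<le> u" "u \<le> N" for u
    unfolding KL_def using that T by (intro divide_right_mono mult_mono) auto
  have Int: "\<bar>I a u\<bar> \<le> 2 * KL" if "0 < a" "a \<le> u" "u \<le> N" for a u
    using integral_sin_phase_le[OF T that(1,2)] KLmono[of u] that by (simp add: I_def F_def[abs_def])
  have Kus: "\<bar>S a u\<bar> \<le> 4 * KL" if "N0 \<le> a" "0 \<le> u" "u \<le> N" for a u
  proof -
    have "T * r = pi * N0\<^sup>2" using N0 by simp
    also have "N0\<^sup>2 \<le> a * (a + r)" unfolding power2_eq_square using that N0(1) T by (intro mult_mono) auto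
    finally have "T * r \<le> pi * (a * (a + r))" by simp
    then have "norm (\<Sum>m\<in>nats_in a u. cis (phase T r (real m))) \<le> 4 * (u * (u + r)) / (T * r)"
      using that N0 T by (intro phase_sum_kusmin_landau) auto
    then show ?thesis using KLmono[of u] that abs_sum_sin_le_norm_sum_cis[of "\<lambda>m. phase T r (real m)" "nats_in a u"]
      unfolding S_def F_def by linarith
  qed
  have vdC: "\<bar>S v u\<bar> \<le> vdc_bound T r \<xi>" if "v \<le> u" "u \<le> N0" for u
  proof -
    have "u\<^sup>2 \<le> N0\<^sup>2" using that v by (intro power_mono) auto
    then have "norm (\<Sum>m\<in>nats_in v u. cis (phase T r (real m))) \<le> vdc_bound T r \<xi>"
      unfolding vdc_bound_def using that v \<xi> T large N0 by (intro phase_sum_van_der_corput) auto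
    then show ?thesis using abs_sum_sin_le_norm_sum_cis[of "\<lambda>m. phase T r (real m)" "nats_in v u"]
      unfolding S_def F_def by linarith
  qed
  have split: "S a c = S a b + S b c" if "a \<le> b" "b \<le> c" for a b c
    unfolding S_def using that by (rule nats_in_split)
  have Isplit: "I a c = I a b + I b c" if "0 < a" "a \<le> b" "b \<le> c" for a b c
    unfolding I_def F_def using that T
    by (intro Henstock_Kurzweil_Integration.integral_combine[symmetric] integrable_continuous_real continuous_on_sin_phase) auto
  have "nats_in a a = {}" for a by (auto simp: nats_in_def)
  then have empty: "S a a = 0" "I a a = 0" for a unfolding S_def I_def by auto
  have ob: "osc_bound T r \<xi> N = D + (if \<xi> * r < N then 6 * KL else 0) + (if \<xi> * r < N0 then vdc_bound T r \<xi> else 0)"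
    by (simp add: osc_bound_def D_def KL_def N0_def)
  have "\<bar>S v (real M) - I v (real M)\<bar> \<le> osc_bound T r \<xi> N"
  proof (cases "N \<le> v")
    case True
    then have "\<bar>S v (real M) - I v (real M)\<bar> \<le> D" using v by (intro EM) auto
    then show ?thesis unfolding ob using KL0 vd0 by auto
  next
    case False
    \<comment> \<open>the end of the range where sum and integral are bounded separately\<close>
    define u where "u = min N (real M)"
    have u: "v \<le> u" "u \<le> N" "u \<le> real M" "0 < v" using False v by (auto simp: u_def)
    have rest: "\<bar>S u (real M) - I u (real M)\<bar> \<le> D"
    proof (cases "real M \<le> N")
      case True
      then have "u = real M" by (simp add: u_def)
      then show ?thesis using empty D0 by simp
    next
      case F: False
      then show ?thesis using False v u by (intro EM) (auto simp: u_def)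
    qed
    have "\<bar>S v u\<bar> \<le> 4 * KL + (if \<xi> * r < N0 then vdc_bound T r \<xi> else 0)"
    proof (cases "v < N0")
      case True
      define w where "w = min N0 u"
      have "S v u = S v w + S w u" using True u by (intro split) (auto simp: w_def)
      moreover have "\<bar>S v w\<bar> \<le> vdc_bound T r \<xi>" using True u by (intro vdC) (auto simp: w_def)
      moreover have "\<bar>S w u\<bar> \<le> 4 * KL"
      proof (cases "u \<le> N0")
        case True
        then have "w = u" by (simp add: w_def)
        then show ?thesis using empty KL0 by simp
      next
        case False
        then show ?thesis using u by (intro Kus) (auto simp: w_def)
      qed
      ultimately show ?thesis using True v by simp
    next
      case False
      then have "\<bar>S v u\<bar> \<le> 4 * KL" using u by (intro Kus) auto
      then show ?thesis using vd0 by auto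
    qed
    moreover have "\<bar>I v u\<bar> \<le> 2 * KL" using u by (intro Int) auto
    moreover have "S v (real M) = S v u + S u (real M)" "I v (real M) = I v u + I u (real M)"
      using u by (auto intro!: split Isplit)
    moreover have "\<xi> * r < N" using False v by simp
    ultimately show ?thesis using rest unfolding ob by simp
  qed
  then show ?thesis by (simp add: S_def I_def F_def[abs_def])
qed

section \<open>Partial summation against an increasing amplitude\<close>

text \<open>
  With R(v) the difference of sum and integral of F beyond v, Abel summation writes the left-hand side as A(X) R(X)
  plus the integral of A' R, and |R| \<le> B gives B (A(X) + A(M) - A(X)). The function R jumps at integers, so the
  identity is established on each unit interval with \<open>deriv_dominated\<close>, and the jumps supply the terms of the sum.
\<close>

lemma monotone_weight_sum:
  fixes A F :: "real \<Rightarrow> real"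
  assumes XM: "X \<le> M" and A0: "\<And>x. real X \<le> x \<Longrightarrow> x \<le> real M \<Longrightarrow> A x \<ge> 0"
    and A: "\<And>x. real X \<le> x \<Longrightarrow> x \<le> real M \<Longrightarrow> (A has_real_derivative A' x) (at x)"
    and A': "\<And>x. real X \<le> x \<Longrightarrow> x \<le> real M \<Longrightarrow> A' x \<ge> 0"
    and F: "continuous_on {real X..real M} F"
    and B: "\<And>v. real X \<le> v \<Longrightarrow> v \<le> real M \<Longrightarrow>
       \<bar>(\<Sum>m\<in>nats_in v (real M). F (real m)) - integral {v..real M} F\<bar> \<le> B"
  shows "\<bar>(\<Sum>m\<in>nats_in (real X) (real M). A (real m) * F (real m)) - integral {real X..real M} (\<lambda>x. A x * F x)\<bar> \<le> B * A (real M)"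
proof -
  define R where "R v = (\<Sum>m\<in>nats_in v (real M). F (real m)) - integral {v..real M} F" for v
  have contA: "continuous_on {real X..real M} A"
    by (intro continuous_at_imp_continuous_on ballI DERIV_isCont[OF A]) auto
  have contAF: "continuous_on {real X..real M} (\<lambda>x. A x * F x)" by (intro continuous_on_mult contA F)
  have cell: "\<bar>A (real (Suc j)) * (R (real (Suc j)) + F (real (Suc j))) - A (real j) * R (real j) - integral {real j..real (Suc j)} (\<lambda>x. A x * F x)\<bar>
      \<le> B * A (real (Suc j)) - B * A (real j)" if j: "X \<le> j" "j < M" for j
  proof -
    have sub: "{real j..real (Suc j)} \<subseteq> {real X..real M}" using j by auto
    define c where "c = (\<Sum>m\<in>nats_in (real j) (real M). F (real m)) - integral {real j..real M} F"
    have Fint: "F integrable_on {a..b}" if "real X \<le> a" "b \<le> real M" for a b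
      using that by (intro integrable_continuous_real continuous_on_subset[OF F]) auto
    \<comment> \<open>an antiderivative of A' R on the cell; R itself is discontinuous at its right end\<close>
    define Y where "Y v = A v * (c + integral {real j..v} F) - integral {real j..v} (\<lambda>x. A x * F x)" for v
    have Rv: "R v = c + integral {real j..v} F" if v: "real j \<le> v" "v < real (Suc j)" for v
    proof -
      have "nats_in v (real M) = nats_in (real j) (real M)" using v unfolding nats_in_def by auto
      moreover have "integral {real j..real M} F = integral {real j..v} F + integral {v..real M} F"
        using v j by (intro Henstock_Kurzweil_Integration.integral_combine[symmetric] Fint) auto
      ultimately show ?thesis by (simp add: R_def c_def)
    qed
    have R1: "R (real (Suc j)) + F (real (Suc j)) = c + integral {real j..real (Suc j)} F"
    proof -
      have "nats_in (real j) (real M) = insert (Suc j) (nats_in (real (Suc j)) (real M))"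
        using j unfolding nats_in_def by auto
      moreover have "Suc j \<notin> nats_in (real (Suc j)) (real M)" unfolding nats_in_def by simp
      moreover have "integral {real j..real M} F = integral {real j..real (Suc j)} F + integral {real (Suc j)..real M} F"
        using j by (intro Henstock_Kurzweil_Integration.integral_combine[symmetric] Fint) auto
      ultimately show ?thesis by (simp add: R_def c_def)
    qed
    have "\<bar>Y (real (Suc j)) - Y (real j)\<bar> \<le> B * A (real (Suc j)) - B * A (real j)"
    proof (rule deriv_dominated[where g' = "\<lambda>v. A' v * R v" and h' = "\<lambda>v. B * A' v"])
      show "continuous_on {real j..real (Suc j)} Y" unfolding Y_def[abs_def]
        by (intro continuous_on_diff continuous_on_mult continuous_on_add continuous_on_const indefinite_integral_continuous_1
            integrable_continuous_real continuous_on_subset[OF contA sub] continuous_on_subset[OF F sub] continuous_on_subset[OF contAF sub])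
      show "continuous_on {real j..real (Suc j)} (\<lambda>v. B * A v)"
        by (intro continuous_on_mult continuous_on_const continuous_on_subset[OF contA sub])
      fix v assume v: "real j < v" "v < real (Suc j)"
      then have vX: "real X \<le> v" "v \<le> real M" using sub by auto
      have d1: "((\<lambda>v. integral {real j..v} F) has_real_derivative F v) (at v)"
        using integral_has_real_derivative[OF continuous_on_subset[OF F sub], of v] v by (simp add: at_within_Icc_at)
      have d2: "((\<lambda>v. integral {real j..v} (\<lambda>x. A x * F x)) has_real_derivative A v * F v) (at v)"
        using integral_has_real_derivative[OF continuous_on_subset[OF contAF sub], of v] v by (simp add: at_within_Icc_at)
      have "(Y has_real_derivative (A' v * (c + integral {real j..v} F) + (0 + F v) * A v) - A v * F v) (at v)"
        unfolding Y_def[abs_def] by (intro DERIV_diff DERIV_mult A DERIV_add DERIV_const d1 d2 vX)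
      then show "(Y has_real_derivative A' v * R v) (at v)" using Rv[of v] v by (simp add: mult.commute)
      show "((\<lambda>v. B * A v) has_real_derivative B * A' v) (at v)" by (intro DERIV_cmult A vX)
      have "\<bar>R v\<bar> \<le> B" using B[OF vX] by (simp add: R_def)
      then show "\<bar>A' v * R v\<bar> \<le> B * A' v"
        using A'[OF vX] mult_left_mono[of "\<bar>R v\<bar>" B "A' v"] by (simp add: abs_mult mult.commute[of B])
    qed simp
    moreover have "Y (real (Suc j)) = A (real (Suc j)) * (R (real (Suc j)) + F (real (Suc j))) - integral {real j..real (Suc j)} (\<lambda>x. A x * F x)"
      unfolding Y_def R1 ..
    moreover have "Y (real j) = A (real j) * R (real j)" using Rv[of "real j"] by (simp add: Y_def)
    ultimately show ?thesis by linarith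
  qed
  have tele: "\<bar>(\<Sum>m\<in>nats_in (real X) (real n). A (real m) * F (real m)) - integral {real X..real n} (\<lambda>x. A x * F x)
      + A (real n) * R (real n) - A (real X) * R (real X)\<bar> \<le> B * A (real n) - B * A (real X)" if n: "X \<le> n" "n \<le> M" for n
    using n
  proof (induction n rule: dec_induct)
    case base
    have "nats_in (real X) (real X) = {}" by (auto simp: nats_in_def)
    then show ?case by simp
  next
    case (step n)
    have "nats_in (real X) (real (Suc n)) = insert (Suc n) (nats_in (real X) (real n))" "Suc n \<notin> nats_in (real X) (real n)"
      using step unfolding nats_in_def by auto
    then have a: "(\<Sum>m\<in>nats_in (real X) (real (Suc n)). A (real m) * F (real m))
        = A (real (Suc n)) * F (real (Suc n)) + (\<Sum>m\<in>nats_in (real X) (real n). A (real m) * F (real m))" by simp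
    have b: "integral {real X..real (Suc n)} (\<lambda>x. A x * F x) = integral {real X..real n} (\<lambda>x. A x * F x) + integral {real n..real (Suc n)} (\<lambda>x. A x * F x)"
      using step by (intro Henstock_Kurzweil_Integration.integral_combine[symmetric] integrable_continuous_real continuous_on_subset[OF contAF]) auto
    from step(3) step(4) have IH: "\<bar>(\<Sum>m\<in>nats_in (real X) (real n). A (real m) * F (real m)) - integral {real X..real n} (\<lambda>x. A x * F x)
      + A (real n) * R (real n) - A (real X) * R (real X)\<bar> \<le> B * A (real n) - B * A (real X)" by simp
    have S: "\<bar>A (real (Suc n)) * R (real (Suc n)) + A (real (Suc n)) * F (real (Suc n)) - A (real n) * R (real n) - integral {real n..real (Suc n)} (\<lambda>x. A x * F x)\<bar>
      \<le> B * A (real (Suc n)) - B * A (real n)" using cell[of n] step by (simp add: distrib_left)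
    show ?case unfolding a b using IH S by linarith
  qed
  have "nats_in (real M) (real M) = {}" by (auto simp: nats_in_def)
  then have "R (real M) = 0" unfolding R_def by simp
  moreover have "\<bar>A (real X) * R (real X)\<bar> \<le> A (real X) * B"
    using A0[of "real X"] B[of "real X"] XM by (simp add: abs_mult R_def mult_left_mono)
  ultimately show ?thesis using tele[OF XM order_refl] by (simp add: mult.commute[of B] abs_le_iff)
qed

text \<open>
  The factor of the kernel that does not oscillate, as a function of y = ln (1 + r/x): the Gaussian, and the factor that
  arises from \<open>(x (x + r))^(-1/2) = 2 sinh (y/2) / r\<close>.
\<close>

definition damped_sinhc :: "real \<Rightarrow> real \<Rightarrow> real" where
  "damped_sinhc \<sigma> y = 2 * sinh (y / 2) / y * exp (- (\<sigma> * y)\<^sup>2 / 2)"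

definition amplitude :: "real \<Rightarrow> real \<Rightarrow> real \<Rightarrow> real" where
  "amplitude \<sigma> r x = 2 / r * damped_sinhc \<sigma> (ln (1 + r / x))"

text \<open>
  The derivative of the left-hand side, (cosh z - z sinh z) exp (- z^2/2), is at most 1.
\<close>

lemma sinh_le_gauss:
  fixes z :: real
  assumes "z \<ge> 0" shows "sinh z * exp (- z\<^sup>2 / 2) \<le> z"
proof -
  have c: "cosh w - w * sinh w \<le> 1" if "w \<ge> 0" for w :: real
  proof -
    have "cosh w - w * sinh w \<le> cosh 0 - 0 * sinh (0 :: real)"
    proof (rule DERIV_nonpos_imp_nonincreasing[of 0 w "\<lambda>w. cosh w - w * sinh w"])
      fix x :: real assume "0 \<le> x"
      then show "\<exists>y. ((\<lambda>w. cosh w - w * sinh w) has_real_derivative y) (at x) \<and> y \<le> 0"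
        by (intro exI[of _ "- (x * cosh x)"]) (auto intro!: derivative_eq_intros mult_nonneg_nonneg simp: less_imp_le)
    qed (use that in auto)
    then show ?thesis by simp
  qed
  have "0 - sinh 0 * exp (- 0\<^sup>2 / 2) \<le> z - sinh z * exp (- z\<^sup>2 / 2)"
  proof (rule DERIV_nonneg_imp_nondecreasing[of 0 z "\<lambda>z. z - sinh z * exp (- z\<^sup>2 / 2)"])
    fix x :: real assume x: "0 \<le> x"
    have "(cosh x - x * sinh x) * exp (- x\<^sup>2 / 2) \<le> 1 * 1"
    proof (cases "cosh x - x * sinh x \<ge> 0")
      case True
      then show ?thesis using c[OF x] by (intro mult_mono) auto
    next
      case False
      then show ?thesis by (simp add: mult_nonpos_nonneg order_trans[OF mult_nonpos_nonneg])
    qed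
    then show "\<exists>y. ((\<lambda>z. z - sinh z * exp (- z\<^sup>2 / 2)) has_real_derivative y) (at x) \<and> y \<ge> 0"
      by (intro exI[of _ "1 - (cosh x - x * sinh x) * exp (- x\<^sup>2 / 2)"])
         (auto intro!: derivative_eq_intros simp: algebra_simps)
  qed (use assms in auto)
  then show ?thesis by simp
qed

lemma cosh_sinh_ineq:
  fixes z :: real
  assumes "z \<ge> 0" shows "z * cosh z - sinh z \<le> z\<^sup>2 * sinh z"
proof -
  have "0\<^sup>2 * sinh 0 - (0 * cosh 0 - sinh (0 :: real)) \<le> z\<^sup>2 * sinh z - (z * cosh z - sinh z)"
  proof (rule DERIV_nonneg_imp_nondecreasing[of 0 z "\<lambda>z. z\<^sup>2 * sinh z - (z * cosh z - sinh z)"])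
    fix x :: real assume x: "0 \<le> x"
    then show "\<exists>y. ((\<lambda>z. z\<^sup>2 * sinh z - (z * cosh z - sinh z)) has_real_derivative y) (at x) \<and> y \<ge> 0"
      by (intro exI[of _ "x * sinh x + x\<^sup>2 * cosh x"])
         (auto intro!: derivative_eq_intros add_nonneg_nonneg mult_nonneg_nonneg simp: less_imp_le algebra_simps power2_eq_square)
  qed (use assms in auto)
  then show ?thesis by simp
qed

definition damped_sinhc' :: "real \<Rightarrow> real \<Rightarrow> real" where
  "damped_sinhc' \<sigma> y = ((y * cosh (y / 2) - 2 * sinh (y / 2)) / y\<^sup>2 - \<sigma>\<^sup>2 * (2 * sinh (y / 2))) * exp (- (\<sigma> * y)\<^sup>2 / 2)"

lemma damped_sinhc_deriv:
  assumes "y > 0"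
  shows "(damped_sinhc \<sigma> has_real_derivative damped_sinhc' \<sigma> y) (at y)"
proof -
  have d1: "((\<lambda>y. 2 * sinh (y / 2) / y) has_real_derivative (y * cosh (y / 2) - 2 * sinh (y / 2)) / y\<^sup>2) (at y)"
    using assms by (auto intro!: derivative_eq_intros simp: power2_eq_square field_simps)
  have d2: "((\<lambda>y. exp (- (\<sigma> * y)\<^sup>2 / 2)) has_real_derivative exp (- (\<sigma> * y)\<^sup>2 / 2) * (- \<sigma>\<^sup>2 * y)) (at y)"
    by (auto intro!: derivative_eq_intros simp: power2_eq_square)
  have "(damped_sinhc \<sigma> has_real_derivative (y * cosh (y / 2) - 2 * sinh (y / 2)) / y\<^sup>2 * exp (- (\<sigma> * y)\<^sup>2 / 2)
      + exp (- (\<sigma> * y)\<^sup>2 / 2) * (- \<sigma>\<^sup>2 * y) * (2 * sinh (y / 2) / y)) (at y)"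
    unfolding damped_sinhc_def[abs_def] by (rule DERIV_mult[OF d1 d2])
  moreover have "(y * cosh (y / 2) - 2 * sinh (y / 2)) / y\<^sup>2 * exp (- (\<sigma> * y)\<^sup>2 / 2)
      + exp (- (\<sigma> * y)\<^sup>2 / 2) * (- \<sigma>\<^sup>2 * y) * (2 * sinh (y / 2) / y) = damped_sinhc' \<sigma> y"
  proof -
    have "a / y\<^sup>2 * e + e * (- s * y) * (b / y) = (a / y\<^sup>2 - s * b) * e" for a b s e :: real
      using assms by (simp add: field_simps)
    then show ?thesis unfolding damped_sinhc'_def .
  qed
  ultimately show ?thesis by simp
qed

text \<open>
  By \<open>cosh_sinh_ineq\<close> at y/2 the growth of sinh (y/2)/y is outweighed by the decay of the Gaussian.
\<close>

lemma damped_sinhc'_nonpos: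
  assumes "y > 0" "\<sigma> \<ge> 1" shows "damped_sinhc' \<sigma> y \<le> 0"
proof -
  have "y / 2 * cosh (y / 2) - sinh (y / 2) \<le> (y / 2)\<^sup>2 * sinh (y / 2)" using assms by (intro cosh_sinh_ineq) auto
  then have "(y * cosh (y / 2) - 2 * sinh (y / 2)) / y\<^sup>2 \<le> sinh (y / 2) / 2"
    using assms by (simp add: field_simps power2_eq_square)
  also have "\<dots> \<le> \<sigma>\<^sup>2 * (2 * sinh (y / 2))"
  proof -
    have "1 \<le> \<sigma>\<^sup>2" using assms by simp
    then have "1 * (2 * sinh (y / 2)) \<le> \<sigma>\<^sup>2 * (2 * sinh (y / 2))" using assms by (intro mult_right_mono) auto
    moreover have "sinh (y / 2) \<ge> 0" using assms by simp
    ultimately show ?thesis by linarith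
  qed
  finally show ?thesis unfolding damped_sinhc'_def by (simp add: mult_nonpos_nonneg)
qed

text \<open>
  A part \<open>exp (- y^2/8)\<close> of the Gaussian suffices to compensate \<open>sinh (y/2) / (y/2)\<close>.
\<close>

lemma damped_sinhc_le:
  assumes "y > 0" shows "0 \<le> damped_sinhc \<sigma> y" "damped_sinhc \<sigma> y \<le> exp (- (\<sigma>\<^sup>2 / 2 - 1 / 8) * y\<^sup>2)"
proof -
  show "0 \<le> damped_sinhc \<sigma> y" using assms unfolding damped_sinhc_def by simp
  have "sinh (y / 2) * exp (- (y / 2)\<^sup>2 / 2) \<le> y / 2" using assms by (intro sinh_le_gauss) auto
  then have a: "2 * sinh (y / 2) / y * exp (- (y / 2)\<^sup>2 / 2) \<le> 1" using assms by (simp add: field_simps)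
  have e: "exp (- (\<sigma> * y)\<^sup>2 / 2) = exp (- (y / 2)\<^sup>2 / 2) * exp (- (\<sigma>\<^sup>2 / 2 - 1 / 8) * y\<^sup>2)"
    unfolding exp_add[symmetric] by (simp add: power2_eq_square field_simps)
  have "damped_sinhc \<sigma> y = (2 * sinh (y / 2) / y * exp (- (y / 2)\<^sup>2 / 2)) * exp (- (\<sigma>\<^sup>2 / 2 - 1 / 8) * y\<^sup>2)"
    unfolding damped_sinhc_def e by (simp only: mult.assoc)
  also have "\<dots> \<le> 1 * exp (- (\<sigma>\<^sup>2 / 2 - 1 / 8) * y\<^sup>2)" using a by (intro mult_right_mono) auto
  finally show "damped_sinhc \<sigma> y \<le> exp (- (\<sigma>\<^sup>2 / 2 - 1 / 8) * y\<^sup>2)" by simp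
qed

lemma ln_ratio_pos: "r > 0 \<Longrightarrow> x > 0 \<Longrightarrow> ln (1 + r / x) > (0 :: real)"
  by (intro ln_gt_zero) auto

lemma amplitude_deriv:
  assumes "r > 0" "x > 0"
  shows "(amplitude \<sigma> r has_real_derivative 2 / r * (damped_sinhc' \<sigma> (ln (1 + r / x)) * phase' 1 r x)) (at x)"
proof -
  have "((\<lambda>x. ln (1 + r / x)) has_real_derivative phase' 1 r x) (at x)"
    using phase_deriv[OF assms, of 1] by (simp add: phase_def[abs_def])
  from DERIV_cmult[OF DERIV_chain2[OF damped_sinhc_deriv[OF ln_ratio_pos[OF assms]] this]]
  show ?thesis unfolding amplitude_def[abs_def] .
qed

text \<open>
  As x grows, y = ln (1 + r/x) decreases, and \<open>damped_sinhc\<close> is decreasing in y.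
\<close>

lemma amplitude_deriv_nonneg:
  assumes "r > 0" "x > 0" "\<sigma> \<ge> 1"
  shows "2 / r * (damped_sinhc' \<sigma> (ln (1 + r / x)) * phase' 1 r x) \<ge> 0"
proof -
  have "phase' 1 r x \<le> 0" using assms by (simp add: phase'_def)
  moreover have "damped_sinhc' \<sigma> (ln (1 + r / x)) \<le> 0" using assms ln_ratio_pos by (intro damped_sinhc'_nonpos) auto
  ultimately show ?thesis using assms by (intro mult_nonneg_nonneg mult_nonpos_nonpos) auto
qed

lemma amplitude_bounds:
  assumes "r > 0" "x > 0" "\<sigma> \<ge> 1"
  shows "0 \<le> amplitude \<sigma> r x" "amplitude \<sigma> r x \<le> 2 / r"
    "amplitude \<sigma> r x \<le> 2 / r * exp (- (\<sigma>\<^sup>2 / 2 - 1 / 8) * (ln (1 + r / x))\<^sup>2)"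
proof -
  note b = damped_sinhc_le[OF ln_ratio_pos[OF assms(1,2)], of \<sigma>]
  show "0 \<le> amplitude \<sigma> r x" unfolding amplitude_def using b assms by simp
  show 1: "amplitude \<sigma> r x \<le> 2 / r * exp (- (\<sigma>\<^sup>2 / 2 - 1 / 8) * (ln (1 + r / x))\<^sup>2)"
    unfolding amplitude_def using b assms by (intro mult_left_mono) auto
  have "1 \<le> \<sigma>\<^sup>2" using assms by simp
  then have "exp (- (\<sigma>\<^sup>2 / 2 - 1 / 8) * (ln (1 + r / x))\<^sup>2) \<le> 1"
  proof -
    have "- (\<sigma>\<^sup>2 / 2 - 1 / 8) * (ln (1 + r / x))\<^sup>2 \<le> 0"
      by (rule mult_nonpos_nonneg) (use \<open>1 \<le> \<sigma>\<^sup>2\<close> in auto)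
    then show ?thesis by simp
  qed
  then have "2 / r * exp (- (\<sigma>\<^sup>2 / 2 - 1 / 8) * (ln (1 + r / x))\<^sup>2) \<le> 2 / r * 1" using assms by (intro mult_left_mono) auto
  then show "amplitude \<sigma> r x \<le> 2 / r" using 1 by linarith
qed

lemma amplitude_mono:
  assumes "r > 0" "0 < x" "x \<le> y" "\<sigma> \<ge> 1"
  shows "amplitude \<sigma> r x \<le> amplitude \<sigma> r y"
proof (rule DERIV_nonneg_imp_nondecreasing[OF assms(3)])
  fix z assume "x \<le> z"
  then show "\<exists>d. (amplitude \<sigma> r has_real_derivative d) (at z) \<and> 0 \<le> d"
    using assms by (intro exI[of _ "2 / r * (damped_sinhc' \<sigma> (ln (1 + r / z)) * phase' 1 r z)"] conjI amplitude_deriv amplitude_deriv_nonneg) auto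
qed

section \<open>The kernel in the variable of ratios\<close>

text \<open>
  The Fourier transform of the weight at y = - ln (1 - u), times exp (y/2). With u = r/(m + r) this gives
  \<open>(m (m + r))^(-1/2) weight_ft (ln (1 + r/m)) = ratio_kernel u / (m + r)\<close>. The value 0 for u \<ge> 1 makes the function continuous at 1, by the
  Gaussian decay.
\<close>

definition ratio_kernel :: "real \<Rightarrow> real \<Rightarrow> real \<Rightarrow> real" where
  "ratio_kernel T \<sigma> u = (if u < 1 then weight_ft T \<sigma> (- ln (1 - u)) * exp (- ln (1 - u) / 2) else 0)"

lemma weight_ft_sinc: "weight_ft T \<sigma> y = 2 * T * sinc (T * y) * exp (- (\<sigma> * y)\<^sup>2 / 2)"
  by (cases "T = 0") (auto simp: weight_ft_def)

lemma continuous_on_weight_ft: "continuous_on A (weight_ft T \<sigma>)"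
proof -
  have "continuous_on A (\<lambda>y. sinc (T * y))" by (intro continuous_on_sinc continuous_intros)
  then show ?thesis unfolding weight_ft_sinc[abs_def] by (intro continuous_on_mult continuous_on_const continuous_intros) auto
qed

lemma abs_weight_ft_le:
  assumes "T \<ge> 0"
  shows "\<bar>weight_ft T \<sigma> y\<bar> \<le> 2 * T * exp (- (\<sigma> * y)\<^sup>2 / 2)"
    and "y > 0 \<Longrightarrow> \<bar>weight_ft T \<sigma> y\<bar> \<le> 2 / y * exp (- (\<sigma> * y)\<^sup>2 / 2)"
proof -
  have "\<bar>2 * sin (T * y) / y\<bar> \<le> 2 * T" if "y \<noteq> 0"
  proof -
    have "\<bar>sin (T * y)\<bar> \<le> \<bar>T * y\<bar>" by (rule abs_sin_x_le_abs_x)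
    then show ?thesis using that assms by (simp add: abs_mult field_simps)
  qed
  then show "\<bar>weight_ft T \<sigma> y\<bar> \<le> 2 * T * exp (- (\<sigma> * y)\<^sup>2 / 2)"
    using assms by (auto simp: weight_ft_def abs_mult intro!: mult_right_mono)
  assume "y > 0"
  then have "\<bar>2 * sin (T * y) / y\<bar> \<le> 2 / y" by (simp add: abs_mult divide_right_mono)
  then have "\<bar>2 * sin (T * y) / y\<bar> * exp (- (\<sigma> * y)\<^sup>2 / 2) \<le> 2 / y * exp (- (\<sigma> * y)\<^sup>2 / 2)"
    by (rule mult_right_mono) simp
  then show "\<bar>weight_ft T \<sigma> y\<bar> \<le> 2 / y * exp (- (\<sigma> * y)\<^sup>2 / 2)"
    using \<open>y > 0\<close> by (simp add: weight_ft_def abs_mult)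
qed

text \<open>
  The exponent is largest for \<sigma> = 2 and y = 3/8, where it equals 9/32.
\<close>

lemma gauss_exp_le:
  assumes "\<sigma> \<ge> (2 :: real)"
  shows "exp (3 / 2 * y - (\<sigma> * y)\<^sup>2 / 2) \<le> 3/2"
proof -
  have "(2 * y)\<^sup>2 \<le> (\<sigma> * y)\<^sup>2"
    using assms unfolding power_mult_distrib by (intro mult_right_mono power_mono) auto
  moreover have "3 / 2 * y - (2 * y)\<^sup>2 / 2 \<le> 9 / 32"
  proof -
    have "0 \<le> 2 * (y - 3/8)\<^sup>2" by simp
    then show ?thesis by (simp add: power2_eq_square algebra_simps)
  qed
  ultimately have "3 / 2 * y - (\<sigma> * y)\<^sup>2 / 2 \<le> 9 / 32" by linarith
  then have "exp (3 / 2 * y - (\<sigma> * y)\<^sup>2 / 2) \<le> exp (9/32)" by simp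
  also have "\<dots> \<le> 1 + 9/32 + (9/32)\<^sup>2" by (rule exp_bound) auto
  also have "\<dots> \<le> 3/2" by (simp add: power2_eq_square)
  finally show ?thesis .
qed

lemma abs_kernel_le:
  assumes "T \<ge> 0" "\<sigma> \<ge> 2" "u \<le> 1"
  shows "\<bar>ratio_kernel T \<sigma> u\<bar> \<le> 3 * T * (1 - u)"
proof (cases "u < 1")
  case True
  define y where "y = - ln (1 - u)"
  have ey: "exp (- y) = 1 - u" using True by (simp add: y_def)
  have "\<bar>ratio_kernel T \<sigma> u\<bar> = \<bar>weight_ft T \<sigma> y\<bar> * exp (y / 2)" using True by (simp add: ratio_kernel_def y_def abs_mult)
  also have "\<dots> \<le> 2 * T * exp (- (\<sigma> * y)\<^sup>2 / 2) * exp (y / 2)"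
    by (intro mult_right_mono abs_weight_ft_le assms) auto
  also have "\<dots> = 2 * T * exp (3 / 2 * y - (\<sigma> * y)\<^sup>2 / 2) * exp (- y)"
    unfolding mult.assoc exp_add[symmetric] by (simp add: algebra_simps)
  also have "\<dots> \<le> 2 * T * (3/2) * exp (- y)"
    using gauss_exp_le[OF assms(2)] assms(1) by (intro mult_right_mono mult_left_mono) auto
  finally show ?thesis by (simp add: ey)
qed (use assms in \<open>simp add: ratio_kernel_def\<close>)

lemma continuous_on_kernel:
  assumes "T \<ge> 0" "\<sigma> \<ge> 2"
  shows "continuous_on {0..1} (ratio_kernel T \<sigma>)"
  unfolding continuous_on_eq_continuous_within
proof
  fix u :: real assume u: "u \<in> {0..1}"
  show "continuous (at u within {0..1}) (ratio_kernel T \<sigma>)"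
  proof (cases "u < 1")
    case True
    have "continuous_on {..<1} (\<lambda>u. weight_ft T \<sigma> (- ln (1 - u)) * exp (- ln (1 - u) / 2))"
      by (intro continuous_intros continuous_on_compose2[OF continuous_on_weight_ft[of UNIV T \<sigma>]]) auto
    then have "continuous_on {..<1} (ratio_kernel T \<sigma>)"
      by (rule continuous_on_eq) (simp add: ratio_kernel_def)
    then have "isCont (ratio_kernel T \<sigma>) u" using True by (simp add: continuous_on_eq_continuous_at)
    then show ?thesis by (rule continuous_at_imp_continuous_at_within)
  next
    case False
    then have u1: "u = 1" using u by simp
    have "((\<lambda>u. 3 * T * (1 - u)) \<longlongrightarrow> 3 * T * (1 - 1)) (at 1 within {0..1})"
      by (intro tendsto_intros)
    then have "((\<lambda>u. 3 * T * (1 - u)) \<longlongrightarrow> 0) (at 1 within {0..1})" by simp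
    moreover have "\<forall>\<^sub>F u in at 1 within {0..1}. norm (ratio_kernel T \<sigma> u) \<le> 3 * T * (1 - u)"
      unfolding eventually_at_filter using abs_kernel_le[OF assms] by (auto intro!: always_eventually)
    ultimately have "((\<lambda>u. ratio_kernel T \<sigma> u) \<longlongrightarrow> 0) (at 1 within {0..1})"
      by (rule Lim_null_comparison[rotated])
    moreover have "ratio_kernel T \<sigma> 1 = 0" by (simp add: ratio_kernel_def)
    ultimately show ?thesis unfolding u1 continuous_within by simp
  qed
qed

lemma kernel_amplitude:
  assumes "r > 0" "x > 0"
  shows "ratio_kernel T \<sigma> (r / (x + r)) / (x + r) = amplitude \<sigma> r x * sin (phase T r x)"
proof -
  define y where "y = ln (1 + r / x)"
  have y: "y > 0" unfolding y_def by (rule ln_ratio_pos[OF assms])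
  have q: "1 - r / (x + r) = inverse (1 + r / x)" using assms by (simp add: field_simps)
  have u: "r / (x + r) < 1" "- ln (1 - r / (x + r)) = y" using assms unfolding q y_def
    by (auto simp: ln_inverse add_pos_pos)
  have ey: "exp (- y) = x / (x + r)" using assms unfolding y_def
    by (subst exp_minus, subst exp_ln) (auto simp: field_simps add_pos_pos)
  have "2 * sinh (y / 2) = exp (y / 2) * (1 - exp (- y))"
    by (simp add: sinh_field_def right_diff_distrib exp_add[symmetric])
  also have "1 - exp (- y) = r / (x + r)" unfolding ey using assms by (simp add: field_simps)
  finally have s: "2 * sinh (y / 2) / r = exp (y / 2) / (x + r)" using assms by (simp add: field_simps)
  have "ratio_kernel T \<sigma> (r / (x + r)) / (x + r) = weight_ft T \<sigma> y * (exp (y / 2) / (x + r))"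
    unfolding ratio_kernel_def u(2) using u(1) by simp
  also have "\<dots> = weight_ft T \<sigma> y * (2 * sinh (y / 2) / r)" by (simp only: s)
  also have "\<dots> = amplitude \<sigma> r x * sin (T * y)"
    using y unfolding amplitude_def damped_sinhc_def y_def[symmetric] by (simp add: weight_ft_def mult_ac)
  finally show ?thesis by (simp add: phase_def y_def)
qed

lemma continuous_on_shifted_kernel:
  assumes "T \<ge> 0" "\<sigma> \<ge> 2" "r > 0" "\<And>x. x \<in> S \<Longrightarrow> x \<ge> 0"
  shows "continuous_on S (\<lambda>x. ratio_kernel T \<sigma> (r / (x + r)) / (x + r))"
proof -
  have "continuous_on S (\<lambda>x. ratio_kernel T \<sigma> (r / (x + r)))"
    by (rule continuous_on_compose2[OF continuous_on_kernel[OF assms(1,2)], of S "\<lambda>x. r / (x + r)"])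
       (use assms in \<open>force intro!: continuous_intros simp: divide_le_eq_1\<close>)+
  then show ?thesis using assms by (intro continuous_on_divide continuous_intros) force+
qed

text \<open>
  Up to the first integer X beyond \<xi> r the amplitude is bounded by its value at X, which the Gaussian makes negligible; this part
  gives the second term. Beyond X, \<open>monotone_weight_sum\<close> with \<open>osc_bound_valid\<close> gives the first one, since the amplitude never
  exceeds 2/r.
\<close>

lemma shifted_sum_minus_integral:
  assumes T: "T > 0" and \<sigma>: "\<sigma> \<ge> 2" and r: "r \<ge> (1 :: real)" and \<xi>: "\<xi> \<ge> 1000"
    and N: "sqrt (T * r / pi) \<le> N" and large: "10 ^ 15 \<le> T * r"
  shows "\<bar>(\<Sum>m=1..M. ratio_kernel T \<sigma> (r / (real m + r)) / (real m + r)) - integral {0..real M} (\<lambda>x. ratio_kernel T \<sigma> (r / (x + r)) / (x + r))\<bar>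
    \<le> 2 / r * osc_bound T r \<xi> N + 4 * (\<xi> + 1) * exp (- (\<sigma>\<^sup>2 / 2 - 1 / 8) / (\<xi> + 2)\<^sup>2)"
proof -
  define g where "g x = ratio_kernel T \<sigma> (r / (x + r)) / (x + r)" for x
  define X where "X = nat \<lceil>\<xi> * r\<rceil>"
  define \<epsilon> where "\<epsilon> = 4 * (\<xi> + 1) * exp (- (\<sigma>\<^sup>2 / 2 - 1 / 8) / (\<xi> + 2)\<^sup>2)"
  have r0: "r > 0" using r by simp
  have \<xi>r: "\<xi> * r \<ge> 1000" using \<xi> r mult_mono[of 1000 \<xi> 1 r] by simp
  have X: "\<xi> * r \<le> real X" "real X \<le> \<xi> * r + 1" "real X \<ge> 1000" unfolding X_def using \<xi>r by linarith+
  have g: "g x = amplitude \<sigma> r x * sin (phase T r x)" if "x > 0" for x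
    unfolding g_def using kernel_amplitude[OF r0 that] by simp
  have \<sigma>1: "\<sigma> \<ge> 1" using \<sigma> by simp
  \<comment> \<open>the amplitude at X, times twice the length of the range up to X\<close>
  have ampX: "2 * (real X * amplitude \<sigma> r (real X)) \<le> \<epsilon>"
  proof -
    have "1 / (\<xi> + 2) \<le> ln (1 + r / real X)"
    proof -
      have Xr: "real X \<le> (\<xi> + 1) * r" using X(2) r by (simp add: algebra_simps)
      have "(\<xi> + 1) * r + r = (\<xi> + 2) * r" by (simp add: algebra_simps)
      then have "1 / (\<xi> + 2) = r / ((\<xi> + 1) * r + r)" using r0 \<xi> by simp
      also have "\<dots> \<le> r / (real X + r)" using Xr X r0 by (intro divide_left_mono) auto
      also have "\<dots> = (r / real X) / (1 + r / real X)" using X r0 by (simp add: field_simps)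
      also have "\<dots> \<le> ln (1 + r / real X)"
      proof -
        have "- ln (1 + z) \<le> inverse (1 + z) - 1" if "z > 0" for z :: real
          using ln_le_minus_one[of "inverse (1 + z)"] that by (simp add: ln_inverse)
        from this[of "r / real X"] have "1 - inverse (1 + r / real X) \<le> ln (1 + r / real X)" using X r0 by simp
        moreover have "1 - inverse (1 + r / real X) = (r / real X) / (1 + r / real X)"
        proof -
          have "1 - inverse (1 + z) = z / (1 + z)" if "z > 0" for z :: real using that by (simp add: field_simps)
          then show ?thesis using X r0 by simp
        qed
        ultimately show ?thesis by simp
      qed
      finally show ?thesis .
    qed
    then have "(1 / (\<xi> + 2))\<^sup>2 \<le> (ln (1 + r / real X))\<^sup>2" using \<xi> by (intro power_mono) auto
    moreover have "\<sigma>\<^sup>2 / 2 - 1 / 8 \<ge> 0" using power_mono[OF \<sigma>1, of 2] by simp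
    ultimately have "(\<sigma>\<^sup>2 / 2 - 1 / 8) * (1 / (\<xi> + 2))\<^sup>2 \<le> (\<sigma>\<^sup>2 / 2 - 1 / 8) * (ln (1 + r / real X))\<^sup>2" by (intro mult_left_mono)
    then have "(\<sigma>\<^sup>2 / 2 - 1 / 8) / (\<xi> + 2)\<^sup>2 \<le> (\<sigma>\<^sup>2 / 2 - 1 / 8) * (ln (1 + r / real X))\<^sup>2"
      by (simp add: power_divide)
    moreover have "exp (- c * l) \<le> exp (- c / q)" if "c / q \<le> c * l" for c l q :: real using that by simp
    ultimately have ex: "exp (- (\<sigma>\<^sup>2 / 2 - 1 / 8) * (ln (1 + r / real X))\<^sup>2) \<le> exp (- (\<sigma>\<^sup>2 / 2 - 1 / 8) / (\<xi> + 2)\<^sup>2)"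
      by blast
    have "amplitude \<sigma> r (real X) \<le> 2 / r * exp (- (\<sigma>\<^sup>2 / 2 - 1 / 8) * (ln (1 + r / real X))\<^sup>2)"
      using X r0 \<sigma>1 by (intro amplitude_bounds(3)) auto
    also have "\<dots> \<le> 2 / r * exp (- (\<sigma>\<^sup>2 / 2 - 1 / 8) / (\<xi> + 2)\<^sup>2)" using ex r0 by (intro mult_left_mono) auto
    finally have "real X * amplitude \<sigma> r (real X) \<le> real X * (2 / r * exp (- (\<sigma>\<^sup>2 / 2 - 1 / 8) / (\<xi> + 2)\<^sup>2))" by (intro mult_left_mono) auto
    also have "\<dots> = 2 * (real X / r) * exp (- (\<sigma>\<^sup>2 / 2 - 1 / 8) / (\<xi> + 2)\<^sup>2)" by simp
    also have "\<dots> \<le> 2 * (\<xi> + 1) * exp (- (\<sigma>\<^sup>2 / 2 - 1 / 8) / (\<xi> + 2)\<^sup>2)"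
    proof -
      have "real X \<le> (\<xi> + 1) * r" using X(2) r by (simp add: algebra_simps)
      then have "real X / r \<le> \<xi> + 1" using r0 by (simp add: field_simps)
      then show ?thesis by (intro mult_right_mono mult_left_mono) auto
    qed
    finally have "2 * (real X * amplitude \<sigma> r (real X)) \<le> 2 * (2 * (\<xi> + 1) * exp (- (\<sigma>\<^sup>2 / 2 - 1 / 8) / (\<xi> + 2)\<^sup>2))"
      by (intro mult_left_mono) auto
    also have "\<dots> = \<epsilon>" unfolding \<epsilon>_def by (simp only: mult.assoc[symmetric])
    finally show ?thesis .
  qed
  have aX0: "amplitude \<sigma> r (real X) \<ge> 0" using X r0 \<sigma>1 by (intro amplitude_bounds) auto
  have small: "\<bar>g x\<bar> \<le> amplitude \<sigma> r (real X)" if "0 \<le> x" "x \<le> real X" for x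
  proof (cases "x = 0")
    case True
    then show ?thesis using aX0 r0 by (simp add: g_def ratio_kernel_def)
  next
    case False
    then have x: "x > 0" using that by simp
    have "\<bar>g x\<bar> \<le> amplitude \<sigma> r x"
      unfolding g[OF x] using amplitude_bounds(1)[OF r0 x \<sigma>1] by (simp add: abs_mult mult_left_le)
    also have "\<dots> \<le> amplitude \<sigma> r (real X)" using x that r0 \<sigma>1 by (intro amplitude_mono) auto
    finally show ?thesis .
  qed
  have cont: "continuous_on {a..b} g" if "a \<ge> 0" for a b
    unfolding g_def[abs_def] using that T \<sigma> r0 by (intro continuous_on_shifted_kernel) auto
  have low: "\<bar>(\<Sum>m=1..n. g (real m)) - integral {0..real n} g\<bar> \<le> \<epsilon>" if n: "n \<le> X" for n
  proof -
    have "\<bar>\<Sum>m=1..n. g (real m)\<bar> \<le> (\<Sum>m=1..n. amplitude \<sigma> r (real X))"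
      using n by (intro order_trans[OF sum_abs] sum_mono small) auto
    moreover have "norm (integral {0..real n} g) \<le> amplitude \<sigma> r (real X) * (real n - 0)"
      using n cont small by (intro integral_bound) auto
    moreover have "real n * amplitude \<sigma> r (real X) \<le> real X * amplitude \<sigma> r (real X)"
      using n aX0 by (intro mult_right_mono) auto
    ultimately show ?thesis using ampX by (simp add: mult.commute)
  qed
  have osc0: "osc_bound T r \<xi> N \<ge> 0"
  proof -
    have "\<bar>(\<Sum>m\<in>nats_in (real X) (real X). sin (phase T r (real m))) - integral {real X..real X} (\<lambda>x. sin (phase T r x))\<bar> \<le> osc_bound T r \<xi> N"
      using T r0 \<xi> N large X by (intro osc_bound_valid) auto
    then show ?thesis by linarith
  qed
  have "\<bar>(\<Sum>m=1..M. g (real m)) - integral {0..real M} g\<bar> \<le> 2 / r * osc_bound T r \<xi> N + \<epsilon>"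
  proof (cases "M \<le> X")
    case True
    then have "\<bar>(\<Sum>m=1..M. g (real m)) - integral {0..real M} g\<bar> \<le> \<epsilon>" by (rule low)
    moreover have "2 / r * osc_bound T r \<xi> N \<ge> 0" using osc0 r0 by (intro mult_nonneg_nonneg) auto
    ultimately show ?thesis by linarith
  next
    case False
    have "\<bar>(\<Sum>m\<in>nats_in (real X) (real M). amplitude \<sigma> r (real m) * sin (phase T r (real m)))
        - integral {real X..real M} (\<lambda>x. amplitude \<sigma> r x * sin (phase T r x))\<bar> \<le> osc_bound T r \<xi> N * amplitude \<sigma> r (real M)"
    proof (rule monotone_weight_sum)
      fix x assume x: "real X \<le> x"
      then have x0: "x > 0" using X by linarith
      show "amplitude \<sigma> r x \<ge> 0" using amplitude_bounds(1)[OF r0 x0 \<sigma>1] .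
      show "(amplitude \<sigma> r has_real_derivative 2 / r * (damped_sinhc' \<sigma> (ln (1 + r / x)) * phase' 1 r x)) (at x)"
        by (rule amplitude_deriv[OF r0 x0])
      show "2 / r * (damped_sinhc' \<sigma> (ln (1 + r / x)) * phase' 1 r x) \<ge> 0" by (rule amplitude_deriv_nonneg[OF r0 x0 \<sigma>1])
      assume "x \<le> real M"
      then show "\<bar>(\<Sum>m\<in>nats_in x (real M). sin (phase T r (real m))) - integral {x..real M} (\<lambda>x. sin (phase T r x))\<bar> \<le> osc_bound T r \<xi> N"
        using x T r0 \<xi> N large X by (intro osc_bound_valid) auto
    next
      show "continuous_on {real X..real M} (\<lambda>x. sin (phase T r x))" using X r0 by (intro continuous_on_sin_phase) auto
    qed (use False in auto)
    also have "osc_bound T r \<xi> N * amplitude \<sigma> r (real M) \<le> osc_bound T r \<xi> N * (2 / r)"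
      using amplitude_bounds(2)[of r "real M" \<sigma>] r0 \<sigma>1 False osc0 by (intro mult_left_mono) auto
    finally have "\<bar>(\<Sum>m\<in>nats_in (real X) (real M). amplitude \<sigma> r (real m) * sin (phase T r (real m)))
        - integral {real X..real M} (\<lambda>x. amplitude \<sigma> r x * sin (phase T r x))\<bar> \<le> osc_bound T r \<xi> N * (2 / r)" .
    moreover have "(\<Sum>m\<in>nats_in (real X) (real M). g (real m)) = (\<Sum>m\<in>nats_in (real X) (real M). amplitude \<sigma> r (real m) * sin (phase T r (real m)))"
      by (intro sum.cong refl g) (use X in \<open>auto simp: nats_in_def\<close>)
    moreover have "integral {real X..real M} g = integral {real X..real M} (\<lambda>x. amplitude \<sigma> r x * sin (phase T r x))"
      by (intro Henstock_Kurzweil_Integration.integral_cong g) (use X in auto)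
    ultimately have high: "\<bar>(\<Sum>m\<in>nats_in (real X) (real M). g (real m)) - integral {real X..real M} g\<bar> \<le> 2 / r * osc_bound T r \<xi> N"
      by (simp only: mult.commute)
    have set: "{1..M} = {1..X} \<union> nats_in (real X) (real M)" "{1..X} \<inter> nats_in (real X) (real M) = {}"
      using False X unfolding nats_in_def by auto
    have "(\<Sum>m=1..M. g (real m)) = (\<Sum>m=1..X. g (real m)) + (\<Sum>m\<in>nats_in (real X) (real M). g (real m))"
      unfolding set(1) using set(2) by (intro sum.union_disjoint) auto
    moreover have "integral {0..real M} g = integral {0..real X} g + integral {real X..real M} g"
      using False by (intro Henstock_Kurzweil_Integration.integral_combine[symmetric] integrable_continuous_real cont) auto
    ultimately show ?thesis using high low[OF order_refl] by linarith
  qed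
  then show ?thesis by (simp add: g_def[abs_def] \<epsilon>_def)
qed

section \<open>The smoothed mean square of the truncated zeta function\<close>

text \<open>
  For nonnegative integrands, gauge integrals obtained from the fundamental theorem of calculus are Lebesgue integrals.
\<close>

lemma has_bochner_integral_of_has_integral:
  fixes f :: "real \<Rightarrow> real"
  assumes [measurable]: "f \<in> borel_measurable borel" and nn: "\<And>x. x \<in> {0<..<1} \<Longrightarrow> f x \<ge> 0"
    and I: "(f has_integral I) {0..1}"
  shows "has_bochner_integral lborel (\<lambda>x. indicator {0<..<1} x * f x) I"
proof -
  have "(f has_integral I) {0<..<1}" using I by (simp add: has_integral_Icc_iff_Ioo)
  then have "((\<lambda>x. if x \<in> {0<..<1} then f x else 0) has_integral I) UNIV" by (simp only: has_integral_restrict_UNIV)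
  moreover have "(\<lambda>x. if x \<in> {0<..<1} then f x else 0) = (\<lambda>x. indicator {0<..<1} x * f x)" by (auto simp: indicator_def)
  ultimately have i: "((\<lambda>x. indicator {0<..<1} x * f x) has_integral I) UNIV" by simp
  have nn': "indicator {0<..<1} x * f x \<ge> 0" for x using nn by (auto simp: indicator_def)
  have "(\<integral>\<^sup>+x. indicator {0<..<1} x * f x \<partial>lborel) = ennreal I"
    using nn_integral_has_integral_lborel[OF _ nn' i] by measurable
  moreover have "I \<ge> 0" using i nn' by (rule has_integral_nonneg)
  ultimately show ?thesis using nn' by (intro has_bochner_integral_nn_integral) auto
qed

lemma integral_inverse_sqrt: "((\<lambda>x. x powr (-1/2)) has_integral 2) {0..1 :: real}"
proof -
  have "((\<lambda>x. x powr (-1/2)) has_integral (2 * 1 powr (1/2) - 2 * 0 powr (1/2))) {0..1 :: real}"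
  proof (rule fundamental_theorem_of_calculus_interior)
    show "continuous_on {0..1} (\<lambda>x. 2 * x powr (1/2) :: real)" by (intro continuous_intros continuous_on_powr') auto
    show "((\<lambda>x. 2 * x powr (1/2)) has_vector_derivative x powr (-1/2)) (at x)" if "x \<in> {0<..<1}" for x :: real
      using that by (auto simp: has_real_derivative_iff_has_vector_derivative[symmetric] intro!: derivative_eq_intros)
  qed auto
  then show ?thesis by simp
qed

lemma integral_cube_root_singularity: "((\<lambda>x. (1 - x) powr (-2/3)) has_integral 3) {0..1 :: real}"
proof -
  have "((\<lambda>x. (1 - x) powr (-2/3)) has_integral (- 3 * (1 - 1) powr (1/3) - - 3 * (1 - 0) powr (1/3))) {0..1 :: real}"
  proof (rule fundamental_theorem_of_calculus_interior)
    show "continuous_on {0..1} (\<lambda>x. - 3 * (1 - x) powr (1/3) :: real)" by (intro continuous_intros continuous_on_powr') auto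
    show "((\<lambda>x. - 3 * (1 - x) powr (1/3)) has_vector_derivative (1 - x) powr (-2/3)) (at x)" if "x \<in> {0<..<1}" for x :: real
      using that by (auto simp: has_real_derivative_iff_has_vector_derivative[symmetric] intro!: derivative_eq_intros)
  qed auto
  then show ?thesis by simp
qed

lemma Re_of_real_powr:
  assumes "x > 0"
  shows "Re (of_real x powr z) = x powr Re z * cos (Im z * ln x)" "Im (of_real x powr z) = x powr Re z * sin (Im z * ln x)"
  using assms by (simp_all add: powr_def Re_exp Im_exp Ln_of_real mult.commute)

lemma integrable_inverse_sqrt: "integrable lborel (\<lambda>x :: real. indicator {0<..<1} x * x powr (-1/2))"
  using has_bochner_integral_of_has_integral[OF _ _ integral_inverse_sqrt] by (auto simp: has_bochner_integral_iff)

text \<open>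
  The real part of \<open>\<integral> x^(s-1) dx = 1/s\<close> over (0, 1), at s = 1/2 + i t.
\<close>

lemma mellin_inverse_sqrt:
  fixes t :: real
  shows "(LINT x|lborel. indicator {0<..<1} x * x powr (-1/2) * cos (t * ln x)) = (1/2) / (1/4 + t\<^sup>2)"
proof -
  define s where "s = Complex (1/2) t"
  have s0: "s \<noteq> 0" by (simp add: s_def complex_eq_iff)
  have "((\<lambda>x. of_real x powr (s - 1)) has_integral (of_real 1 powr s / s - of_real 0 powr s / s)) {0..1 :: real}"
  proof (rule fundamental_theorem_of_calculus_interior)
    show "continuous_on {0..1} (\<lambda>x. of_real x powr s / s)"
      using s0 by (intro continuous_intros) (auto simp: s_def)
    show "((\<lambda>x. of_real x powr s / s) has_vector_derivative of_real x powr (s - 1)) (at x)" if "x \<in> {0<..<1}" for x :: real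
    proof -
      have "of_real x \<notin> \<real>\<^sub>\<le>\<^sub>0" using that by (auto simp: complex_nonpos_Reals_iff)
      then have "((\<lambda>z. z powr s / s) has_field_derivative (of_real x powr (s - 1))) (at (of_real x))"
        using s0 by (auto intro!: derivative_eq_intros)
      then show ?thesis by (rule has_vector_derivative_real_field)
    qed
  qed auto
  from has_integral_Re[OF this]
  have "((\<lambda>x. Re (of_real x powr (s - 1))) has_integral Re (1 / s)) {0..1 :: real}" by simp
  then have "((\<lambda>x. Re (of_real x powr (s - 1))) has_integral Re (1 / s)) {0<..<1 :: real}"
    by (simp add: has_integral_Icc_iff_Ioo)
  then have "((\<lambda>x. if x \<in> {0<..<1} then Re (of_real x powr (s - 1)) else 0) has_integral Re (1 / s)) UNIV"
    by (simp only: has_integral_restrict_UNIV)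
  moreover have "(\<lambda>x. if x \<in> {0<..<1} then Re (of_real x powr (s - 1)) else 0) = (\<lambda>x. indicator {0<..<1} x * x powr (-1/2) * cos (t * ln x))"
    by (auto simp: Re_of_real_powr s_def indicator_def fun_eq_iff)
  ultimately have "((\<lambda>x. indicator {0<..<1} x * x powr (-1/2) * cos (t * ln x)) has_integral Re (1 / s)) UNIV" by simp
  moreover have "integrable lborel (\<lambda>x. indicator {0<..<1} x * x powr (-1/2) * cos (t * ln x))"
    by (rule Bochner_Integration.integrable_bound[OF integrable_inverse_sqrt]) (auto simp: abs_mult mult_left_le)
  then have "((\<lambda>x. indicator {0<..<1} x * x powr (-1/2) * cos (t * ln x)) has_integral
      (LINT x|lborel. indicator {0<..<1} x * x powr (-1/2) * cos (t * ln x))) UNIV" by (rule has_integral_integral_lborel)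
  ultimately have "(LINT x|lborel. indicator {0<..<1} x * x powr (-1/2) * cos (t * ln x)) = Re (1 / s)"
    by (rule has_integral_unique[rotated])
  also have "Re (1 / s) = (1/2) / (1/4 + t\<^sup>2)" by (simp add: s_def Re_divide power2_eq_square)
  finally show ?thesis .
qed

text \<open>
  The substitution u = 1 - x.
\<close>

lemma ratio_kernel_lebesgue:
  assumes "T \<ge> 0" "\<sigma> \<ge> 2"
  shows "(LINT x|lborel. indicator {0<..<1} x * x powr (-1/2) * weight_ft T \<sigma> (ln x)) = integral {0..1} (ratio_kernel T \<sigma>)"
proof -
  define h where "h x = indicator {0<..<1} x * x powr (-1/2) * weight_ft T \<sigma> (ln x)" for x
  have even: "weight_ft T \<sigma> (- y) = weight_ft T \<sigma> y" for y by (simp add: weight_ft_def)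
  have h: "h (1 + -1 * u) = indicator {0<..<1} u * ratio_kernel T \<sigma> u" for u
  proof (cases "0 < u \<and> u < 1")
    case True
    have "(1 - u) powr (-1/2) = exp (- ln (1 - u) / 2)" using True by (simp add: powr_def)
    then show ?thesis using True even[of "ln (1 - u)"] by (simp add: h_def ratio_kernel_def)
  qed (auto simp: h_def indicator_def)
  have "(LINT x|lborel. h x) = \<bar>-1\<bar> *\<^sub>R (LINT u|lborel. h (1 + -1 * u))"
    by (rule lborel_integral_real_affine) simp
  also have "\<dots> = (LINT u|lborel. indicator {0<..<1} u * ratio_kernel T \<sigma> u)" by (simp only: h abs_minus_cancel abs_one scaleR_one)
  also have "\<dots> = (LINT u:{0..1}|lborel. ratio_kernel T \<sigma> u)"
    unfolding set_lebesgue_integral_def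
  proof (rule integral_cong_AE)
    have "AE u in lborel. u \<noteq> (0::real)" "AE u in lborel. u \<noteq> (1::real)" by (auto intro: AE_lborel_singleton)
    then show "AE u in lborel. indicator {0<..<1} u * ratio_kernel T \<sigma> u = indicator {0..1} u *\<^sub>R ratio_kernel T \<sigma> u"
      by eventually_elim (auto simp: indicator_def)
  qed (unfold ratio_kernel_def weight_ft_def, measurable)
  also have "\<dots> = integral {0..1} (ratio_kernel T \<sigma>)"
    by (intro set_borel_integral_eq_integral borel_integrable_atLeastAtMost' continuous_on_kernel assms)
  finally show ?thesis by (simp add: h_def)
qed

lemma weight_ft_measurable [measurable]: "weight_ft T \<sigma> \<in> borel_measurable borel"
  unfolding weight_ft_def by measurable

text \<open>
  The weighted mean of the square of the polar term, apart from the factor N: \<open>mellin_inverse_sqrt\<close> writes it as an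
  integral of cosines, which \<open>weight_swap\<close> averages.
\<close>

lemma weight_pole_integral:
  assumes "T \<ge> 0" "\<sigma> \<ge> 2"
  shows "(LINT t|lborel. weight T \<sigma> t * (1 / (1/4 + t\<^sup>2))) = 2 * integral {0..1} (ratio_kernel T \<sigma>)"
proof -
  have "(LINT t|lborel. weight T \<sigma> t * (1 / (1/4 + t\<^sup>2)))
      = 2 * (LINT t|lborel. weight T \<sigma> t * (LINT x|lborel. indicator {0<..<1} x * x powr (-1/2) * cos (t * ln x)))"
  proof -
    have e: "w * (1 / q) = 2 * (w * ((1/2) / q))" for w q :: real by simp
    show ?thesis unfolding mellin_inverse_sqrt integral_mult_right_zero[symmetric]
      by (intro Bochner_Integration.integral_cong refl e)
  qed
  also have "(LINT t|lborel. weight T \<sigma> t * (LINT x|lborel. indicator {0<..<1} x * x powr (-1/2) * cos (t * ln x)))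
     = (LINT x|lborel. indicator {0<..<1} x * x powr (-1/2) * weight_ft T \<sigma> (ln x))"
    using assms by (intro weight_swap integrable_inverse_sqrt) auto
  finally show ?thesis unfolding ratio_kernel_lebesgue[OF assms] .
qed

text \<open>
  The kernel in the representation of \<open>\<zeta>_N(s) / s\<close> as a Mellin transform of the fractional part of N x.
\<close>

definition frac_kernel :: "nat \<Rightarrow> real \<Rightarrow> real" where
  "frac_kernel N x = indicator {0<..<1} x * (frac (real N * x) * x powr (-3/2))"

text \<open>
  The first upper bound is uniform in N, the second one is integrable at 0.
\<close>

lemma frac_kernel_bounds: "0 \<le> frac_kernel N x" "frac_kernel N x \<le> indicator {0<..<1} x * x powr (-3/2)"
  "frac_kernel N x \<le> real N * (indicator {0<..<1} x * x powr (-1/2))"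
proof -
  show "0 \<le> frac_kernel N x" by (auto simp: frac_kernel_def indicator_def frac_ge_0)
  have "frac (real N * x) * x powr (-3/2) \<le> 1 * x powr (-3/2)" by (intro mult_right_mono) (auto simp: less_imp_le[OF frac_lt_1])
  then show "frac_kernel N x \<le> indicator {0<..<1} x * x powr (-3/2)" by (auto simp: frac_kernel_def indicator_def)
  show "frac_kernel N x \<le> real N * (indicator {0<..<1} x * x powr (-1/2))"
  proof (cases "x \<in> {0<..<1}")
    case True
    have "frac (real N * x) \<le> real N * x" using True by (simp add: frac_def)
    then have "frac (real N * x) * x powr (-3/2) \<le> real N * x * x powr (-3/2)" by (intro mult_right_mono) auto
    also have "\<dots> = real N * (x * x powr (-3/2))" by (simp only: mult.assoc)
    also have "x * x powr (-3/2) = x powr (-1/2)" using True powr_add[of x 1 "-3/2"] by simp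
    finally show ?thesis using True by (simp add: frac_kernel_def)
  qed (simp add: frac_kernel_def)
qed

lemma frac_kernel_measurable [measurable]: "frac_kernel N \<in> borel_measurable borel"
  unfolding frac_kernel_def frac_def by measurable

lemma integrable_frac_kernel: "integrable lborel (frac_kernel N)"
  by (rule Bochner_Integration.integrable_bound[OF integrable_mult_right[OF integrable_inverse_sqrt, of "real N"]])
     (use frac_kernel_bounds(1,3)[of N] in \<open>auto simp: abs_mult\<close>)

text \<open>
  On the critical line the conjugate of N^(1-s)/(1 - s) is N^s/s. Summation by parts on the cells [j/N, (j+1)/N]
  gives \<open>\<zeta>_N(s) N^s / s = - \<integral> {N x} x^(-s-1) dx\<close> over (0, 1), and the real part is taken.
\<close>

lemma zeta_partial_pole_product:
  assumes "N \<ge> 1"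
  defines "V \<equiv> \<lambda>t. of_nat N powr (1 - Complex (1/2) t) / (1 - Complex (1/2) t)"
  shows "Re (zeta_partial N (Complex (1/2) t) * cnj (V t)) = - (LINT x|lborel. frac_kernel N x * cos (t * ln x))"
proof -
  define s where "s = Complex (1/2) t"
  have s0: "s \<noteq> 0" "1 - s \<noteq> 0" by (auto simp: s_def complex_eq_iff)
  have N0: "real N > 0" using assms by simp
  define G where "G j x = of_nat N / (1 - s) * of_real x powr (1 - s) + of_nat j / s * of_real x powr (- s)" for j and x :: real
  define f where "f j x = (of_nat N * of_real x - of_nat j) * of_real x powr (- s - 1)" for j and x :: real
  have cell: "(f j has_integral (G j (real (Suc j) / real N) - G j (real j / real N))) {real j / real N..real (Suc j) / real N}" for j
  proof (rule fundamental_theorem_of_calculus_interior)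
    show "real j / real N \<le> real (Suc j) / real N" by (intro divide_right_mono) auto
    show "(G j has_vector_derivative f j x) (at x)" if "x \<in> {real j / real N<..<real (Suc j) / real N}" for x
    proof -
      have x: "x > 0" using that N0 by (auto intro: le_less_trans[of 0 "real j / real N"])
      then have nz: "of_real x \<notin> \<real>\<^sub>\<le>\<^sub>0" by (auto simp: complex_nonpos_Reals_iff)
      have "((\<lambda>z. of_nat N / (1 - s) * z powr (1 - s) + of_nat j / s * z powr (- s)) has_field_derivative
          of_nat N / (1 - s) * ((1 - s) * of_real x powr (1 - s - 1)) + of_nat j / s * ((- s) * of_real x powr (- s - 1))) (at (of_real x))"
        by (intro DERIV_add DERIV_cmult has_field_derivative_powr nz)
      moreover have "of_nat N / (1 - s) * ((1 - s) * of_real x powr (1 - s - 1)) + of_nat j / s * ((- s) * of_real x powr (- s - 1)) = f j x"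
      proof -
        have "of_real x powr (1 - s - 1) = of_real x * of_real x powr (- s - 1)"
          using x powr_add[of "of_real x :: complex" 1 "- s - 1"] by simp
        moreover have "a / q * (q * (X * p)) + b / s * ((- s) * p) = (a * X - b) * p" if "q \<noteq> 0" for a b q X p :: complex
          using s0(1) that by (simp add: left_diff_distrib)
        ultimately show ?thesis unfolding f_def using s0(2) by (simp only: not_False_eq_True)
      qed
      ultimately have "((\<lambda>z. of_nat N / (1 - s) * z powr (1 - s) + of_nat j / s * z powr (- s)) has_field_derivative f j x) (at (of_real x))" by simp
      from has_vector_derivative_real_field[OF this] show ?thesis unfolding G_def[abs_def] .
    qed
    show "continuous_on {real j / real N..real (Suc j) / real N} (G j)"
    proof (cases "j = 0")
      case True
      then have "G j = (\<lambda>x. of_nat N / (1 - s) * of_real x powr (1 - s))" by (simp add: G_def fun_eq_iff)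
      moreover have "x \<ge> 0" if "x \<in> {real j / real N..real (Suc j) / real N}" for x
        using that order_trans[of 0 "real j / real N" x] by simp
      ultimately show ?thesis by (simp only:) (intro continuous_intros, auto simp: s_def)
    next
      case False
      then have "real j / real N > 0" using N0 by simp
      then show ?thesis unfolding G_def[abs_def] by (intro continuous_intros) (use False in \<open>auto simp: s_def\<close>)
    qed
  qed
  define g where "g x = of_real (frac (real N * x)) * of_real x powr (- s - 1)" for x :: real
  have cell': "(g has_integral (G j (real (Suc j) / real N) - G j (real j / real N))) {real j / real N..real (Suc j) / real N}" for j
  proof (rule has_integral_spike_finite[OF _ _ cell, of "{real (Suc j) / real N}"])
    fix x assume x: "x \<in> {real j / real N..real (Suc j) / real N} - {real (Suc j) / real N}"
    then have "real j \<le> real N * x" "real N * x < real (Suc j)" using N0 by (auto simp: field_simps)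
    then have "\<lfloor>real N * x\<rfloor> = int j" by (auto simp: floor_eq_iff)
    then show "g x = f j x" by (simp add: g_def f_def frac_def)
  qed simp
  have all: "(g has_integral (\<Sum>j<n. G j (real (Suc j) / real N) - G j (real j / real N))) {0..real n / real N}" for n
  proof (induction n)
    case (Suc n)
    have "(g has_integral ((\<Sum>j<n. G j (real (Suc j) / real N) - G j (real j / real N)) + (G n (real (Suc n) / real N) - G n (real n / real N)))) {0..real (Suc n) / real N}"
      by (rule has_integral_combine[OF _ _ Suc cell']) (use N0 in \<open>auto simp: divide_right_mono\<close>)
    then show ?case by simp
  next
    case 0
    then show ?case using has_integral_refl(1)[of g 0] by simp
  qed
  have sum: "(\<Sum>j<n. G j (real (Suc j) / real N) - G j (real j / real N))
      = of_nat N / (1 - s) * of_real (real n / real N) powr (1 - s) + of_nat n / s * of_real (real n / real N) powr (- s)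
        - 1 / s * (\<Sum>m=1..n. of_real (real m / real N) powr (- s))" for n
  proof (induction n)
    case (Suc n)
    then show ?case by (simp add: G_def ring_distribs add_divide_distrib)
  qed simp
  have val: "of_nat N / (1 - s) + of_nat N / s - 1 / s * (\<Sum>m=1..N. of_real (real m / real N) powr (- s))
      = - (zeta_partial N s * (of_nat N powr s / s))"
  proof -
    have p: "of_real (real m / real N) powr (- s) = of_nat m powr (- s) * of_nat N powr s" if "m \<ge> 1" for m
    proof -
      have L: "of_real x powr z = exp (z * of_real (ln x))" if "x > 0" for x :: real and z :: complex
        using that by (simp add: powr_def Ln_of_real)
      have "of_real (real m / real N) powr (- s) = exp (- s * of_real (ln (real m / real N)))"
        using that N0 by (intro L) simp
      also have "\<dots> = exp (- s * of_real (ln (real m))) * exp (s * of_real (ln (real N)))"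
        using that N0 by (simp add: ln_div exp_add[symmetric] algebra_simps)
      also have "\<dots> = of_real (real m) powr (- s) * of_real (real N) powr s"
        using that N0 L[of "real m" "- s"] L[of "real N" s] by simp
      finally show ?thesis by simp
    qed
    have s1: "(\<Sum>m=1..N. of_real (real m / real N) powr (- s)) = (\<Sum>m=1..N. of_nat m powr (- s)) * of_nat N powr s"
      unfolding sum_distrib_right by (intro sum.cong refl p) auto
    have s2: "of_nat N powr (1 - s) * of_nat N powr s = (of_nat N :: complex)"
      using N0 powr_add[of "of_nat N :: complex" "1 - s" s] by simp
    \<comment> \<open>the partial fraction 1/(1 - s) + 1/s = 1/(s (1 - s))\<close>
    have s3: "a / c + a / s - 1 / s * (S * p) = - ((S - q / c) * (p / s))" if "q * p = a" "c \<noteq> 0" "c + s = 1" for a c S p q :: complex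
    proof -
      have "a / c + a / s = (a * s + a * c) / (c * s)" using that(2) s0(1) by (simp add: add_frac_eq)
      also have "a * s + a * c = a" using that(3) by (metis add.commute distrib_left mult.right_neutral)
      finally have "a / c + a / s = a / (c * s)" .
      moreover have "(S - q / c) * (p / s) = S * (p / s) - (q * p) / (c * s)" by (simp add: left_diff_distrib diff_divide_distrib)
      ultimately show ?thesis unfolding that(1) by simp
    qed
    show ?thesis unfolding zeta_partial_def s1 by (rule s3[OF s2 s0(2)]) simp
  qed
  have "(g has_integral - (zeta_partial N s * (of_nat N powr s / s))) {0..1}"
    using all[of N] N0 unfolding sum val[symmetric] by simp
  from has_integral_Re[OF this]
  have "((\<lambda>x. Re (g x)) has_integral - Re (zeta_partial N s * (of_nat N powr s / s))) {0<..<1}"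
    by (simp only: has_integral_Icc_iff_Ioo uminus_complex.simps)
  then have "((\<lambda>x. if x \<in> {0<..<1} then Re (g x) else 0) has_integral - Re (zeta_partial N s * (of_nat N powr s / s))) UNIV"
    by (simp only: has_integral_restrict_UNIV)
  moreover have "(\<lambda>x. if x \<in> {0<..<1} then Re (g x) else 0) = (\<lambda>x. frac_kernel N x * cos (t * ln x))"
    by (auto simp: frac_kernel_def Re_of_real_powr s_def g_def fun_eq_iff)
  moreover have "integrable lborel (\<lambda>x. frac_kernel N x * cos (t * ln x))"
    by (rule Bochner_Integration.integrable_bound[OF integrable_frac_kernel[of N]]) (auto simp: abs_mult mult_left_le)
  then have "((\<lambda>x. frac_kernel N x * cos (t * ln x)) has_integral (LINT x|lborel. frac_kernel N x * cos (t * ln x))) UNIV"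
    by (rule has_integral_integral_lborel)
  ultimately have "(LINT x|lborel. frac_kernel N x * cos (t * ln x)) = - Re (zeta_partial N s * (of_nat N powr s / s))"
    using has_integral_unique by (simp only:)
  moreover have "cnj (V t) = of_nat N powr s / s"
  proof -
    have c: "cnj (1 - Complex (1/2) t) = s" by (simp add: s_def complex_eq_iff)
    have "cnj (of_nat N powr (1 - Complex (1/2) t)) = of_nat N powr s"
      using N0 cnj_powr[of "of_nat N" "1 - Complex (1/2) t"] unfolding c by simp
    then show ?thesis unfolding V_def complex_cnj_divide c by simp
  qed
  ultimately show ?thesis by (simp add: s_def)
qed

text \<open>
  From |sin z| \<le> z^(1/3) for z > 0 one gets |sin (T y)/y| \<le> T^(1/3) y^(-2/3), which is integrable and of the order of magnitude that is permitted
  in the end.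
\<close>

lemma abs_frac_kernel_weight_ft_le:
  assumes "T > 0" "\<sigma> \<ge> 2"
  shows "\<bar>frac_kernel N x * weight_ft T \<sigma> (ln x)\<bar> \<le> 3 * T powr (1/3) * (indicator {0<..<1} x * (1 - x) powr (-2/3))"
proof (cases "x \<in> {0<..<1}")
  case True
  define y where "y = - ln x"
  have y: "y > 0" "1 - x \<le> y" using True ln_le_minus_one[of x] by (auto simp: y_def)
  have xe: "x powr (-3/2) = exp (3/2 * y)" using True by (simp add: powr_def y_def)
  have "weight_ft T \<sigma> (ln x) = weight_ft T \<sigma> y" by (simp add: weight_ft_def y_def)
  then have w: "\<bar>weight_ft T \<sigma> (ln x)\<bar> = \<bar>2 * sin (T * y) / y\<bar> * exp (- (\<sigma> * y)\<^sup>2 / 2)"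
    using y by (simp add: weight_ft_def abs_mult)
  \<comment> \<open>for T y \<le> 1 use |sin z| \<le> z, otherwise |sin z| \<le> 1\<close>
  have "\<bar>sin (T * y)\<bar> \<le> (T * y) powr (1/3)"
  proof (cases "T * y \<le> 1")
    case True
    have "\<bar>sin (T * y)\<bar> \<le> T * y" using abs_sin_x_le_abs_x[of "T * y"] y assms by simp
    also have "\<dots> = (T * y) powr 1" using y assms by simp
    also have "\<dots> \<le> (T * y) powr (1/3)" using True y assms by (intro powr_mono') auto
    finally show ?thesis .
  next
    case False
    then have "1 \<le> (T * y) powr (1/3)" by (intro ge_one_powr_ge_zero) auto
    then show ?thesis using abs_sin_le_one[of "T * y"] by linarith
  qed
  also have "\<dots> = T powr (1/3) * y powr (1/3)" using y assms by (simp add: powr_mult)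
  finally have "\<bar>sin (T * y)\<bar> / y \<le> T powr (1/3) * y powr (1/3) / y" using y by (intro divide_right_mono) auto
  also have "T powr (1/3) * y powr (1/3) / y = T powr (1/3) * y powr (-2/3)"
    using y powr_diff[of y "1/3" 1] by simp
  also have "\<dots> \<le> T powr (1/3) * (1 - x) powr (-2/3)"
    using y True by (intro mult_left_mono powr_mono2') auto
  finally have "\<bar>2 * sin (T * y) / y\<bar> \<le> 2 * (T powr (1/3) * (1 - x) powr (-2/3))"
    using y by (simp add: abs_mult)
  then have b: "\<bar>weight_ft T \<sigma> (ln x)\<bar> \<le> 2 * (T powr (1/3) * (1 - x) powr (-2/3)) * exp (- (\<sigma> * y)\<^sup>2 / 2)"
    unfolding w by (rule mult_right_mono) simp
  have fk: "frac_kernel N x \<le> exp (3/2 * y)"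
    unfolding xe[symmetric] using frac_kernel_bounds(2)[of N x] True by simp
  have "\<bar>frac_kernel N x * weight_ft T \<sigma> (ln x)\<bar> = frac_kernel N x * \<bar>weight_ft T \<sigma> (ln x)\<bar>"
    using frac_kernel_bounds(1) by (simp add: abs_mult)
  also have "\<dots> \<le> exp (3/2 * y) * (2 * (T powr (1/3) * (1 - x) powr (-2/3)) * exp (- (\<sigma> * y)\<^sup>2 / 2))"
    using fk b by (intro mult_mono) auto
  also have "\<dots> = 2 * (T powr (1/3) * (1 - x) powr (-2/3)) * exp (3/2 * y - (\<sigma> * y)\<^sup>2 / 2)"
  proof -
    have "3/2 * y - (\<sigma> * y)\<^sup>2 / 2 = 3/2 * y + (- (\<sigma> * y)\<^sup>2 / 2)" by simp
    then show ?thesis by (simp only: exp_add mult_ac)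
  qed
  also have "\<dots> \<le> 2 * (T powr (1/3) * (1 - x) powr (-2/3)) * (3/2)"
    using assms by (intro mult_left_mono gauss_exp_le) auto
  finally show ?thesis using True by simp
qed (simp add: frac_kernel_def)

lemma abs_cross_term_le:
  assumes "T > 0" "\<sigma> \<ge> 2"
  shows "\<bar>LINT x|lborel. frac_kernel N x * weight_ft T \<sigma> (ln x)\<bar> \<le> 9 * T powr (1/3)"
proof -
  have hb: "has_bochner_integral lborel (\<lambda>x :: real. indicator {0<..<1} x * (1 - x) powr (-2/3)) 3"
    by (rule has_bochner_integral_of_has_integral[OF _ _ integral_cube_root_singularity]) auto
  then have hi: "integrable lborel (\<lambda>x :: real. 3 * T powr (1/3) * (indicator {0<..<1} x * (1 - x) powr (-2/3)))"
    by (auto simp: has_bochner_integral_iff)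
  have "\<bar>LINT x|lborel. frac_kernel N x * weight_ft T \<sigma> (ln x)\<bar> \<le> (LINT x|lborel. \<bar>frac_kernel N x * weight_ft T \<sigma> (ln x)\<bar>)"
    by (rule integral_abs_bound)
  also have "\<dots> \<le> (LINT x|lborel. 3 * T powr (1/3) * (indicator {0<..<1} x * (1 - x) powr (-2/3)))"
  proof (rule integral_mono)
    show "integrable lborel (\<lambda>x. \<bar>frac_kernel N x * weight_ft T \<sigma> (ln x)\<bar>)"
      by (rule Bochner_Integration.integrable_bound[OF hi])
         (use abs_frac_kernel_weight_ft_le[OF assms] in \<open>auto intro!: AE_I2 order_trans[OF _ abs_ge_self]\<close>)
  qed (use hi abs_frac_kernel_weight_ft_le[OF assms] in auto)
  also have "\<dots> = 9 * T powr (1/3)" using hb by (simp add: has_bochner_integral_iff)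
  finally show ?thesis .
qed

definition zeta_dirichlet :: "nat \<Rightarrow> real \<Rightarrow> complex" where
  "zeta_dirichlet N t = (\<Sum>m=1..N. of_nat m powr (- Complex (1/2) t))"

lemma norm_dirichlet_square:
  "(cmod (zeta_dirichlet N t))\<^sup>2
    = (\<Sum>m=1..N. \<Sum>n=1..N. (real m * real n) powr (-1/2) * cos (t * (ln (real n) - ln (real m))))"
proof -
  have "of_real ((cmod (zeta_dirichlet N t))\<^sup>2) = zeta_dirichlet N t * cnj (zeta_dirichlet N t)"
    by (simp add: complex_norm_square del: of_real_power)
  then have "(cmod (zeta_dirichlet N t))\<^sup>2 = Re (zeta_dirichlet N t * cnj (zeta_dirichlet N t))"
    by (metis Re_complex_of_real)
  also have "\<dots> = (\<Sum>m=1..N. \<Sum>n=1..N. Re (of_nat m powr (- Complex (1/2) t) * cnj (of_nat n powr (- Complex (1/2) t))))"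
    unfolding zeta_dirichlet_def cnj_sum sum_product Re_sum ..
  also have "\<dots> = (\<Sum>m=1..N. \<Sum>n=1..N. (real m * real n) powr (-1/2) * cos (t * (ln (real n) - ln (real m))))"
  proof (intro sum.cong refl)
    fix m n assume mn: "m \<in> {1..N}" "n \<in> {1..N}"
    have ReIm: "Re (of_nat k powr (- Complex (1/2) t)) = real k powr (-1/2) * cos (t * ln (real k))"
      "Im (of_nat k powr (- Complex (1/2) t)) = - (real k powr (-1/2) * sin (t * ln (real k)))" if "k \<ge> 1" for k
      using Re_of_real_powr[of "real k" "- Complex (1/2) t"] that by simp_all
    have "Re (of_nat m powr (- Complex (1/2) t) * cnj (of_nat n powr (- Complex (1/2) t)))
       = real m powr (-1/2) * real n powr (-1/2) * (cos (t * ln (real n)) * cos (t * ln (real m)) + sin (t * ln (real n)) * sin (t * ln (real m)))"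
      using ReIm[of m] ReIm[of n] mn by (simp add: algebra_simps)
    also have "\<dots> = (real m * real n) powr (-1/2) * cos (t * (ln (real n) - ln (real m)))"
      using mn by (simp add: powr_mult cos_diff right_diff_distrib)
    finally show "Re (of_nat m powr (- Complex (1/2) t) * cnj (of_nat n powr (- Complex (1/2) t)))
       = (real m * real n) powr (-1/2) * cos (t * (ln (real n) - ln (real m)))" .
  qed
  finally show ?thesis .
qed

lemma weighted_dirichlet_square:
  assumes "\<sigma> > 0" "T \<ge> 0"
  shows "(LINT t|lborel. weight T \<sigma> t * (cmod (zeta_dirichlet N t))\<^sup>2)
    = (\<Sum>m=1..N. \<Sum>n=1..N. (real m * real n) powr (-1/2) * weight_ft T \<sigma> (ln (real n) - ln (real m)))"
    and "integrable lborel (\<lambda>t. weight T \<sigma> t * (cmod (zeta_dirichlet N t))\<^sup>2)"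
proof -
  have int: "integrable lborel (\<lambda>t. weight T \<sigma> t * cos (t * y))" for y
    by (rule Bochner_Integration.integrable_bound[OF weight_integrable[OF assms(1), of T]])
       (auto simp: abs_mult weight_nonneg mult_left_le)
  have e: "weight T \<sigma> t * (cmod (zeta_dirichlet N t))\<^sup>2
     = (\<Sum>m=1..N. \<Sum>n=1..N. (real m * real n) powr (-1/2) * (weight T \<sigma> t * cos (t * (ln (real n) - ln (real m)))))" for t
    unfolding norm_dirichlet_square sum_distrib_left by (intro sum.cong refl) (simp only: mult.left_commute)
  show "(LINT t|lborel. weight T \<sigma> t * (cmod (zeta_dirichlet N t))\<^sup>2)
    = (\<Sum>m=1..N. \<Sum>n=1..N. (real m * real n) powr (-1/2) * weight_ft T \<sigma> (ln (real n) - ln (real m)))"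
    unfolding e using int by (simp add: Bochner_Integration.integral_sum weight_cos assms)
  show "integrable lborel (\<lambda>t. weight T \<sigma> t * (cmod (zeta_dirichlet N t))\<^sup>2)"
    unfolding e using int by simp
qed

text \<open>
  Pairs above and below the diagonal contribute equally.
\<close>

lemma sum_pairs_by_difference:
  fixes f :: "nat \<Rightarrow> nat \<Rightarrow> real"
  assumes "\<And>m n. f m n = f n m"
  shows "(\<Sum>m=1..N. \<Sum>n=1..N. f m n) = (\<Sum>m=1..N. f m m) + 2 * (\<Sum>r=1..<N. \<Sum>m=1..N-r. f m (m + r))"
proof -
  have "(\<Sum>m=1..N. \<Sum>n=1..N. f m n) = (\<Sum>(m, n)\<in>{1..N}\<times>{1..N}. f m n)" by (simp add: sum.cartesian_product)
  also have "{1..N}\<times>{1..N} = (\<lambda>m. (m, m)) ` {1..N} \<union> ({(m, n). 1 \<le> m \<and> m < n \<and> n \<le> N} \<union> {(m, n). 1 \<le> n \<and> n < m \<and> m \<le> N})"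
    by (auto simp: image_iff)
  also have "(\<Sum>(m, n)\<in>\<dots>. f m n) = (\<Sum>(m, n)\<in>(\<lambda>m. (m, m)) ` {1..N}. f m n)
      + ((\<Sum>(m, n)\<in>{(m, n). 1 \<le> m \<and> m < n \<and> n \<le> N}. f m n) + (\<Sum>(m, n)\<in>{(m, n). 1 \<le> n \<and> n < m \<and> m \<le> N}. f m n))"
  proof -
    have fin: "finite {(m, n). 1 \<le> m \<and> m < n \<and> n \<le> N}" "finite {(m, n). 1 \<le> n \<and> n < m \<and> m \<le> N}"
      by (rule finite_subset[of _ "{1..N}\<times>{1..N}"]; auto)+
    then show ?thesis by (subst sum.union_disjoint; (subst sum.union_disjoint)?) auto
  qed
  also have "(\<Sum>(m, n)\<in>(\<lambda>m. (m, m)) ` {1..N}. f m n) = (\<Sum>m=1..N. f m m)"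
    by (subst sum.reindex) (auto simp: inj_on_def)
  also have "(\<Sum>(m, n)\<in>{(m, n). 1 \<le> n \<and> n < m \<and> m \<le> N}. f m n) = (\<Sum>(m, n)\<in>{(m, n). 1 \<le> m \<and> m < n \<and> n \<le> N}. f m n)"
    by (rule sum.reindex_bij_witness[of _ prod.swap prod.swap]) (auto simp: assms)
  also have "(\<Sum>(m, n)\<in>{(m, n). 1 \<le> m \<and> m < n \<and> n \<le> N}. f m n) = (\<Sum>(r, m)\<in>Sigma {1..<N} (\<lambda>r. {1..N-r}). f m (m + r))"
    by (rule sum.reindex_bij_witness[of _ "\<lambda>(r, m). (m, m + r)" "\<lambda>(m, n). (n - m, m)"]) auto
  also have "\<dots> = (\<Sum>r=1..<N. \<Sum>m=1..N-r. f m (m + r))" by (rule sum.Sigma[symmetric]) auto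
  finally show ?thesis by simp
qed

text \<open>
  Let U be the Dirichlet polynomial, V the polar term and \<zeta>_N = U - V. With W the conjugate of V one has
  |\<zeta>_N|^2 = |U|^2 - |V|^2 - 2 Re (\<zeta>_N W). Pairing V with \<zeta>_N and not with U is what makes the last term small. The three averages are the double sum, the integral
  of the kernel, and the cross term, which is bounded by \<open>abs_cross_term_le\<close>.
\<close>

lemma weighted_partial_square:
  assumes "T > 0" "\<sigma> \<ge> 2" "N \<ge> 1"
  shows "\<bar>(LINT t|lborel. weight T \<sigma> t * (cmod (zeta_partial N (Complex (1/2) t)))\<^sup>2)
     - (2 * T * harm N + 2 * (\<Sum>r=1..<N. \<Sum>m=1..N-r. ratio_kernel T \<sigma> (real r / (real m + real r)) / (real m + real r))
        - 2 * real N * integral {0..1} (ratio_kernel T \<sigma>))\<bar> \<le> 18 * T powr (1/3)"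
    and "integrable lborel (\<lambda>t. weight T \<sigma> t * (cmod (zeta_partial N (Complex (1/2) t)))\<^sup>2)"
proof -
  have \<sigma>: "\<sigma> > 0" "T \<ge> 0" using assms by auto
  define V where "V t = of_nat N powr (1 - Complex (1/2) t) / (1 - Complex (1/2) t)" for t
  define C where "C t = (LINT x|lborel. frac_kernel N x * cos (t * ln x))" for t
  have nV: "(cmod (V t))\<^sup>2 = real N * (1 / (1/4 + t\<^sup>2))" for t
  proof -
    have "cmod (of_nat N powr (1 - Complex (1/2) t)) = real N powr (1/2)" using assms by (subst norm_of_nat_powr) auto
    moreover have "(cmod (1 - Complex (1/2) t))\<^sup>2 = 1/4 + t\<^sup>2" by (simp add: cmod_power2 power_divide)
    ultimately show ?thesis using assms by (simp add: V_def norm_divide power_divide powr_half_sqrt)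
  qed
  have sq: "(cmod (zeta_partial N (Complex (1/2) t)))\<^sup>2 = (cmod (zeta_dirichlet N t))\<^sup>2 - real N * (1 / (1/4 + t\<^sup>2)) + 2 * C t" for t
  proof -
    have "zeta_dirichlet N t = zeta_partial N (Complex (1/2) t) + V t"
      by (simp add: zeta_dirichlet_def zeta_partial_def V_def)
    moreover have "(cmod (a + b))\<^sup>2 = (cmod a)\<^sup>2 + (cmod b)\<^sup>2 + 2 * Re (a * cnj b)" for a b
      unfolding cmod_power2 by (simp add: power2_eq_square algebra_simps)
    ultimately have "(cmod (zeta_dirichlet N t))\<^sup>2 = (cmod (zeta_partial N (Complex (1/2) t)))\<^sup>2 + (cmod (V t))\<^sup>2 + 2 * Re (zeta_partial N (Complex (1/2) t) * cnj (V t))"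
      by simp
    also have "Re (zeta_partial N (Complex (1/2) t) * cnj (V t)) = - C t"
      unfolding V_def C_def by (rule zeta_partial_pole_product[OF assms(3)])
    finally show ?thesis by (simp add: nV)
  qed
  have Cbound: "\<bar>C t\<bar> \<le> (LINT x|lborel. frac_kernel N x)" for t
  proof -
    have i: "integrable lborel (\<lambda>x. frac_kernel N x * cos (t * ln x))"
      by (rule Bochner_Integration.integrable_bound[OF integrable_frac_kernel[of N]]) (auto simp: abs_mult mult_left_le)
    have "\<bar>C t\<bar> \<le> (LINT x|lborel. \<bar>frac_kernel N x * cos (t * ln x)\<bar>)" unfolding C_def by (rule integral_abs_bound)
    also have "\<dots> \<le> (LINT x|lborel. frac_kernel N x)"
      by (intro integral_mono integrable_frac_kernel integrable_abs i)
         (use frac_kernel_bounds(1)[of N] in \<open>auto simp: abs_mult mult_left_le\<close>)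
    finally show ?thesis .
  qed
  have Cmeas [measurable]: "C \<in> borel_measurable borel" unfolding C_def by measurable
  have iC: "integrable lborel (\<lambda>t. weight T \<sigma> t * C t)"
  proof (rule weight_integral(1)[OF \<sigma>(1) Cmeas])
    fix t
    have "(LINT x|lborel. frac_kernel N x) * 1 \<le> (LINT x|lborel. frac_kernel N x) * (1 + t\<^sup>2)"
      using Cbound[of 0] by (intro mult_left_mono) auto
    then show "\<bar>C t\<bar> \<le> (LINT x|lborel. frac_kernel N x) * (1 + t\<^sup>2)" using Cbound[of t] by simp
  qed
  have iV: "integrable lborel (\<lambda>t. weight T \<sigma> t * (1 / (1/4 + t\<^sup>2)))"
  proof (rule weight_integral(1)[OF \<sigma>(1), of _ 4])
    fix t :: real
    have "1 / (1/4 + t\<^sup>2) \<le> 1 / (1/4)" by (intro divide_left_mono) (auto intro!: mult_pos_pos add_pos_nonneg)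
    moreover have "\<bar>1 / (1/4 + t\<^sup>2)\<bar> = 1 / (1/4 + t\<^sup>2)" by simp
    moreover have "1 / (1/4) \<le> 4 * (1 + t\<^sup>2)" by simp
    ultimately show "\<bar>1 / (1/4 + t\<^sup>2)\<bar> \<le> 4 * (1 + t\<^sup>2)" by linarith
  qed measurable
  note iU = weighted_dirichlet_square(2)[OF \<sigma>, of N]
  have e: "weight T \<sigma> t * (cmod (zeta_partial N (Complex (1/2) t)))\<^sup>2
     = weight T \<sigma> t * (cmod (zeta_dirichlet N t))\<^sup>2 - real N * (weight T \<sigma> t * (1 / (1/4 + t\<^sup>2))) + 2 * (weight T \<sigma> t * C t)" for t
    unfolding sq by (simp add: algebra_simps)
  show "integrable lborel (\<lambda>t. weight T \<sigma> t * (cmod (zeta_partial N (Complex (1/2) t)))\<^sup>2)"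
    unfolding e by (intro Bochner_Integration.integrable_add Bochner_Integration.integrable_diff integrable_mult_right iU iV iC)
  have "(LINT t|lborel. weight T \<sigma> t * (cmod (zeta_partial N (Complex (1/2) t)))\<^sup>2)
     = (LINT t|lborel. weight T \<sigma> t * (cmod (zeta_dirichlet N t))\<^sup>2) - real N * (LINT t|lborel. weight T \<sigma> t * (1 / (1/4 + t\<^sup>2)))
       + 2 * (LINT t|lborel. weight T \<sigma> t * C t)"
    unfolding e using has_bochner_integral_add[OF has_bochner_integral_diff[OF has_bochner_integral_integrable[OF iU]
        has_bochner_integral_mult_right[OF has_bochner_integral_integrable[OF iV], of "real N"]]
        has_bochner_integral_mult_right[OF has_bochner_integral_integrable[OF iC], of 2]]
    by (rule has_bochner_integral_integral_eq)
  moreover have "(LINT t|lborel. weight T \<sigma> t * C t) = (LINT x|lborel. frac_kernel N x * weight_ft T \<sigma> (ln x))"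
    unfolding C_def using \<sigma> by (intro weight_swap integrable_frac_kernel) auto
  moreover have "(LINT t|lborel. weight T \<sigma> t * (1 / (1/4 + t\<^sup>2))) = 2 * integral {0..1} (ratio_kernel T \<sigma>)"
    using \<sigma> assms by (intro weight_pole_integral) auto
  moreover have "(LINT t|lborel. weight T \<sigma> t * (cmod (zeta_dirichlet N t))\<^sup>2)
     = 2 * T * harm N + 2 * (\<Sum>r=1..<N. \<Sum>m=1..N-r. ratio_kernel T \<sigma> (real r / (real m + real r)) / (real m + real r))"
  proof -
    define f where "f m n = (real m * real n) powr (-1/2) * weight_ft T \<sigma> (ln (real n) - ln (real m))" for m n
    have sym: "f m n = f n m" for m n
    proof -
      have "weight_ft T \<sigma> (- y) = weight_ft T \<sigma> y" for y by (simp add: weight_ft_def)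
      from this[of "ln (real n) - ln (real m)"] show ?thesis by (simp add: f_def mult.commute)
    qed
    have "(\<Sum>m=1..N. f m m) = (\<Sum>m=1..N. 2 * T * inverse (real m))"
    proof (intro sum.cong refl)
      fix m assume "m \<in> {1..N}"
      then have "(real m * real m) powr (-1/2) = inverse (real m)"
        by (simp add: powr_mult powr_minus powr_half_sqrt real_sqrt_mult_self flip: inverse_mult_distrib)
      then show "f m m = 2 * T * inverse (real m)" by (simp add: f_def weight_ft_def)
    qed
    also have "\<dots> = 2 * T * harm N" by (simp add: harm_def sum_distrib_left)
    finally have diag: "(\<Sum>m=1..N. f m m) = 2 * T * harm N" .
    \<comment> \<open>here u = r/(m + r), so 1 - u = m/(m + r)\<close>
    have off: "f m (m + r) = ratio_kernel T \<sigma> (real r / (real m + real r)) / (real m + real r)" if "m \<ge> 1" "r \<ge> 1" for m r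
    proof -
      have pos: "real m > 0" "real r > 0" "real m + real r > 0" using that by auto
      have u: "1 - real r / (real m + real r) = real m / (real m + real r)" using pos by (simp add: field_simps)
      have l: "- ln (1 - real r / (real m + real r)) = ln (real m + real r) - ln (real m)"
        unfolding u using pos by (simp add: ln_div)
      have "(real m * (real m + real r)) powr (-1/2) = exp ((ln (real m + real r) - ln (real m)) / 2) / (real m + real r)"
      proof -
        define a b where "a = ln (real m)" and "b = ln (real m + real r)"
        have "(real m * (real m + real r)) powr (-1/2) = exp (-1/2 * (a + b))"
          using pos by (simp add: powr_def ln_mult a_def b_def)
        also have "-1/2 * (a + b) = (b - a) / 2 - b" by (simp add: field_simps)
        also have "exp ((b - a) / 2 - b) = exp ((b - a) / 2) / exp b" by (rule exp_diff)
        also have "exp b = real m + real r" using pos by (simp add: b_def)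
        finally show ?thesis by (simp only: a_def b_def)
      qed
      then show ?thesis using pos l unfolding f_def ratio_kernel_def by simp
    qed
    have "(LINT t|lborel. weight T \<sigma> t * (cmod (zeta_dirichlet N t))\<^sup>2) = (\<Sum>m=1..N. \<Sum>n=1..N. f m n)"
      unfolding weighted_dirichlet_square(1)[OF \<sigma>] f_def ..
    also have "\<dots> = (\<Sum>m=1..N. f m m) + 2 * (\<Sum>r=1..<N. \<Sum>m=1..N-r. f m (m + r))"
      by (rule sum_pairs_by_difference[OF sym])
    also have "(\<Sum>r=1..<N. \<Sum>m=1..N-r. f m (m + r)) = (\<Sum>r=1..<N. \<Sum>m=1..N-r. ratio_kernel T \<sigma> (real r / (real m + real r)) / (real m + real r))"
      by (intro sum.cong refl off) auto
    finally show ?thesis unfolding diag .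
  qed
  ultimately show "\<bar>(LINT t|lborel. weight T \<sigma> t * (cmod (zeta_partial N (Complex (1/2) t)))\<^sup>2)
     - (2 * T * harm N + 2 * (\<Sum>r=1..<N. \<Sum>m=1..N-r. ratio_kernel T \<sigma> (real r / (real m + real r)) / (real m + real r))
        - 2 * real N * integral {0..1} (ratio_kernel T \<sigma>))\<bar> \<le> 18 * T powr (1/3)"
    using abs_cross_term_le[OF assms(1,2), of N] by (simp add: algebra_simps)
qed

section \<open>Summation of the kernel tails\<close>

lemma abs_cos_sin_le: "\<bar>z * cos z - sin z\<bar> \<le> z\<^sup>2 / 2" if "z \<ge> 0" for z :: real
proof -
  have "\<bar>(z * cos z - sin z) - (0 * cos 0 - sin 0)\<bar> \<le> z\<^sup>2 / 2 - 0\<^sup>2 / (2 :: real)"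
  proof (rule deriv_dominated[where g' = "\<lambda>z. - (z * sin z)" and h' = "\<lambda>z. z"])
    show "\<bar>- (x * sin x)\<bar> \<le> x" if "0 < x" for x :: real using that by (simp add: abs_mult mult_left_le)
  qed (use that in \<open>auto intro!: continuous_intros derivative_eq_intros\<close>)
  then show ?thesis by simp
qed

text \<open>
  The derivative of 2 sin(Ty)/y is at most T^2, and the Gaussian absorbs all exponential factors that the change of variable
  introduces.
\<close>

lemma ratio_kernel_lipschitz:
  assumes T: "T \<ge> 10" "\<sigma> \<ge> 2" "\<sigma>\<^sup>2 \<le> T" and uv: "0 \<le> u" "u \<le> v" "v \<le> 1"
  shows "\<bar>ratio_kernel T \<sigma> v - ratio_kernel T \<sigma> u\<bar> \<le> 8 * T\<^sup>2 * (v - u)"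
proof -
  define f where "f y = 2 * sin (T * y) / y" for y :: real
  define f' where "f' y = 2 * (T * y * cos (T * y) - sin (T * y)) / y\<^sup>2" for y :: real
  define G where "G y = exp (- (\<sigma> * y)\<^sup>2 / 2)" for y :: real
  define g' where "g' x = (let y = - ln (1 - x) in ((f' y * G y + G y * (- \<sigma>\<^sup>2 * y) * f y) + f y * G y / 2) * exp (y / 2) * exp y)" for x
  have "\<bar>ratio_kernel T \<sigma> v - ratio_kernel T \<sigma> u\<bar> \<le> 8 * T\<^sup>2 * v - 8 * T\<^sup>2 * u"
  proof (rule deriv_dominated[where g' = g' and h' = "\<lambda>x. 8 * T\<^sup>2"])
    show "continuous_on {u..v} (ratio_kernel T \<sigma>)"
      by (rule continuous_on_subset[OF continuous_on_kernel]) (use assms in auto)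
    fix x assume x: "u < x" "x < v"
    define y where "y = - ln (1 - x)"
    have x01: "0 < x" "x < 1" using x uv by auto
    have y: "y > 0" using x01 by (simp add: y_def)
    have fd: "(f has_real_derivative f' y) (at y)"
      unfolding f_def[abs_def] f'_def using y by (auto intro!: derivative_eq_intros simp: power2_eq_square field_simps)
    have Gd: "(G has_real_derivative G y * (- \<sigma>\<^sup>2 * y)) (at y)"
      unfolding G_def[abs_def] by (auto intro!: derivative_eq_intros simp: power2_eq_square)
    have ed: "((\<lambda>y. exp (y / 2)) has_real_derivative exp (y / 2) / 2) (at y)"
      by (auto intro!: derivative_eq_intros)
    have yd: "((\<lambda>x. - ln (1 - x)) has_real_derivative exp y) (at x)"
      using x01 by (auto intro!: derivative_eq_intros simp: y_def exp_minus field_simps)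
    have "((\<lambda>y. f y * G y * exp (y / 2)) has_real_derivative
        (f' y * G y + G y * (- \<sigma>\<^sup>2 * y) * f y) * exp (y / 2) + exp (y / 2) / 2 * (f y * G y)) (at y)"
      by (intro DERIV_mult fd Gd ed)
    from DERIV_chain2[OF this[unfolded y_def] yd[unfolded y_def]]
    have "((\<lambda>x. f (- ln (1 - x)) * G (- ln (1 - x)) * exp (- ln (1 - x) / 2)) has_real_derivative
        ((f' y * G y + G y * (- \<sigma>\<^sup>2 * y) * f y) * exp (y / 2) + exp (y / 2) / 2 * (f y * G y)) * exp y) (at x)"
      by (simp only: y_def)
    moreover have "((f' y * G y + G y * (- \<sigma>\<^sup>2 * y) * f y) * exp (y / 2) + exp (y / 2) / 2 * (f y * G y)) * exp y = g' x"
    proof -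
      have "(A * e + e / 2 * B) * d = (A + B / 2) * e * d" for A B d e :: real by (simp add: algebra_simps)
      then show ?thesis unfolding g'_def Let_def y_def[symmetric] .
    qed
    moreover have "\<forall>\<^sub>F z in nhds x. f (- ln (1 - z)) * G (- ln (1 - z)) * exp (- ln (1 - z) / 2) = ratio_kernel T \<sigma> z"
    proof -
      have "\<forall>\<^sub>F z in nhds x. z \<in> {0<..<1}" using x01 by (intro eventually_nhds_in_open) auto
      then show ?thesis
        by eventually_elim (auto simp: ratio_kernel_def weight_ft_def f_def G_def)
    qed
    ultimately show "(ratio_kernel T \<sigma> has_real_derivative g' x) (at x)"
      by (simp add: DERIV_cong_ev)
    have G0: "G y > 0" by (simp add: G_def)
    have e1: "G y * exp (3/2 * y) \<le> 3/2"
      using gauss_exp_le[OF T(2), of y] unfolding G_def exp_add[symmetric] by (simp add: algebra_simps)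
    have e2: "G y * exp (3/2 * y) * y \<le> 5/2"
    proof -
      have "y \<le> exp y" using exp_ge_add_one_self[of y] by linarith
      then have "G y * exp (3/2 * y) * y \<le> G y * exp (3/2 * y) * exp y" using G0 by (intro mult_left_mono) auto
      also have "\<dots> = exp (5/2 * y - (\<sigma> * y)\<^sup>2 / 2)" unfolding G_def exp_add[symmetric] by (simp add: algebra_simps)
      also have "\<dots> \<le> exp (25/32)"
      proof -
        have "(2 * y)\<^sup>2 \<le> (\<sigma> * y)\<^sup>2" using T unfolding power_mult_distrib by (intro mult_right_mono power_mono) auto
        moreover have "5/2 * y - (2 * y)\<^sup>2 / 2 \<le> 25 / 32"
        proof -
          have "0 \<le> 2 * (y - 5/8)\<^sup>2" by simp
          then show ?thesis by (simp add: power2_eq_square algebra_simps)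
        qed
        ultimately have "5/2 * y - (\<sigma> * y)\<^sup>2 / 2 \<le> 25 / 32" by linarith
        then show ?thesis by simp
      qed
      also have "exp (25/32 :: real) \<le> 1 + 25/32 + (25/32)\<^sup>2" by (rule exp_bound) auto
      also have "\<dots> \<le> 5/2" by (simp add: power2_eq_square)
      finally show ?thesis .
    qed
    have f1: "\<bar>f y\<bar> \<le> 2 * T"
      using abs_sin_x_le_abs_x[of "T * y"] y T by (simp add: f_def abs_mult field_simps)
    have f2: "\<bar>f' y\<bar> \<le> T\<^sup>2"
    proof -
      have "\<bar>f' y\<bar> = 2 * \<bar>T * y * cos (T * y) - sin (T * y)\<bar> / y\<^sup>2"
        unfolding f'_def abs_divide abs_mult by simp
      also have "\<dots> \<le> (T * y)\<^sup>2 / y\<^sup>2" using abs_cos_sin_le[of "T * y"] y T by (intro divide_right_mono) auto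
      also have "\<dots> = T\<^sup>2" using y by (simp add: power_mult_distrib)
      finally show ?thesis .
    qed
    have "\<bar>f' y * G y + G y * (- \<sigma>\<^sup>2 * y) * f y + f y * G y / 2\<bar> \<le> G y * (T\<^sup>2 + \<sigma>\<^sup>2 * y * (2 * T) + T)"
    proof -
      have "\<bar>f' y + (- \<sigma>\<^sup>2 * y) * f y + f y / 2\<bar> \<le> \<bar>f' y\<bar> + \<sigma>\<^sup>2 * y * \<bar>f y\<bar> + \<bar>f y\<bar> / 2"
        using y abs_triangle_ineq[of "f' y + (- \<sigma>\<^sup>2 * y) * f y" "f y / 2"] abs_triangle_ineq[of "f' y" "(- \<sigma>\<^sup>2 * y) * f y"]
        by (simp add: abs_mult)
      also have "\<dots> \<le> T\<^sup>2 + \<sigma>\<^sup>2 * y * (2 * T) + T"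
        using f1 f2 y by (intro add_mono mult_left_mono) auto
      finally have "G y * \<bar>f' y + (- \<sigma>\<^sup>2 * y) * f y + f y / 2\<bar> \<le> G y * (T\<^sup>2 + \<sigma>\<^sup>2 * y * (2 * T) + T)"
        using G0 by (intro mult_left_mono) auto
      moreover have "f' y * G y + G y * (- \<sigma>\<^sup>2 * y) * f y + f y * G y / 2 = G y * (f' y + (- \<sigma>\<^sup>2 * y) * f y + f y / 2)"
        by (simp add: algebra_simps)
      ultimately show ?thesis using G0 by (simp add: abs_mult)
    qed
    then have "\<bar>g' x\<bar> \<le> G y * (T\<^sup>2 + \<sigma>\<^sup>2 * y * (2 * T) + T) * exp (y / 2) * exp y"
      unfolding g'_def Let_def y_def[symmetric] by (simp add: abs_mult mult_right_mono)
    also have "\<dots> = (T\<^sup>2 + T) * (G y * exp (3/2 * y)) + \<sigma>\<^sup>2 * (2 * T) * (G y * exp (3/2 * y) * y)"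
    proof -
      have P: "exp (y / 2) * exp y = exp (3/2 * y)" unfolding exp_add[symmetric] by simp
      have Q: "g * (A + s * y * B + T) * e * d = (A + T) * (g * (e * d)) + s * B * (g * (e * d) * y)" for g A s B e d :: real
        by (simp add: algebra_simps)
      show ?thesis unfolding P[symmetric] by (rule Q)
    qed
    also have "\<dots> \<le> (T\<^sup>2 + T) * (3/2) + \<sigma>\<^sup>2 * (2 * T) * (5/2)"
      using e1 e2 T by (intro add_mono mult_left_mono) auto
    also have "\<dots> \<le> (T\<^sup>2 + T) * (3/2) + T * (2 * T) * (5/2)"
      using T by (intro add_left_mono mult_right_mono) auto
    also have "\<dots> \<le> 8 * T\<^sup>2"
    proof -
      have "10 * T \<le> T * T" using T by (intro mult_right_mono) auto
      then show ?thesis using T by (simp add: power2_eq_square algebra_simps)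
    qed
    finally show "\<bar>g' x\<bar> \<le> 8 * T\<^sup>2" .
    show "((\<lambda>x. 8 * T\<^sup>2 * x) has_real_derivative 8 * T\<^sup>2) (at x)" by (auto intro!: derivative_eq_intros)
  qed (use uv in \<open>auto intro!: continuous_intros\<close>)
  then show ?thesis by (simp add: right_diff_distrib)
qed

text \<open>
  What the sum over m for the shift r becomes when it is replaced by an integral, with v = r/N.
\<close>

definition kernel_tail :: "real \<Rightarrow> real \<Rightarrow> real \<Rightarrow> real" where
  "kernel_tail T \<sigma> v = integral {v..1} (\<lambda>u. ratio_kernel T \<sigma> u / u)"

text \<open>
  The substitution u = r/(x + r).
\<close>

lemma integral_shifted_kernel:
  assumes "T \<ge> 0" "\<sigma> \<ge> 2" "1 \<le> r" "r \<le> N"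
  shows "integral {0..real (N - r)} (\<lambda>x. ratio_kernel T \<sigma> (real r / (x + real r)) / (x + real r)) = kernel_tail T \<sigma> (real r / real N)"
proof -
  define g where "g x = real r / (x + real r)" for x
  define f where "f u = ratio_kernel T \<sigma> u / u" for u
  have r0: "real r > 0" using assms by simp
  have g0: "g 0 = 1" "g (real (N - r)) = real r / real N" using assms r0 by (auto simp: g_def of_nat_diff)
  have le: "real r / real N \<le> 1" using assms by simp
  have "((\<lambda>x. - (real r / (x + real r)\<^sup>2) *\<^sub>R f (g x)) has_integral (integral {g 0..g (real (N - r))} f - integral {g (real (N - r))..g 0} f)) {0..real (N - r)}"
  proof (rule has_integral_substitution_general[of "{}" 0 "real (N - r)" g "real r / real N" 1])
    show "continuous_on {0..real (N - r)} g" unfolding g_def[abs_def] using r0 by (intro continuous_intros) auto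
    show "g ` {0..real (N - r)} \<subseteq> {real r / real N..1}"
    proof (rule image_subsetI)
      fix x assume "x \<in> {0..real (N - r)}"
      then have x: "x + real r \<le> real N" "x \<ge> 0" using assms by (auto simp: of_nat_diff)
      have "real r / real N \<le> real r / (x + real r)" using x r0 by (intro divide_left_mono) auto
      moreover have "real r / (x + real r) \<le> 1" using x r0 by simp
      ultimately show "g x \<in> {real r / real N..1}" by (simp add: g_def)
    qed
    show "continuous_on {real r / real N..1} f"
    proof -
      have "real r / real N > 0" using assms by simp
      then show ?thesis unfolding f_def[abs_def]
        by (intro continuous_on_divide continuous_on_subset[OF continuous_on_kernel[OF assms(1,2)]] continuous_intros) auto
    qed
    show "(g has_real_derivative - (real r / (x + real r)\<^sup>2)) (at x within {0..real (N - r)})" if "x \<in> {0..real (N - r)} - {}" for x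
      unfolding g_def[abs_def] using that r0 by (auto intro!: derivative_eq_intros simp: power2_eq_square)
  qed auto
  moreover have "integral {g 0..g (real (N - r))} f = 0"
  proof (cases "real r = real N")
    case True
    then show ?thesis unfolding g0 by simp
  next
    case False
    then have "real r / real N < 1" using le assms by simp
    then show ?thesis unfolding g0 by simp
  qed
  ultimately have "((\<lambda>x. - (real r / (x + real r)\<^sup>2) *\<^sub>R f (g x)) has_integral - kernel_tail T \<sigma> (real r / real N)) {0..real (N - r)}"
    unfolding g0 kernel_tail_def f_def[abs_def] by simp
  from has_integral_neg[OF this]
  have "((\<lambda>x. (real r / (x + real r)\<^sup>2) * f (g x)) has_integral kernel_tail T \<sigma> (real r / real N)) {0..real (N - r)}" by simp
  moreover have "(real r / (x + real r)\<^sup>2) * f (g x) = ratio_kernel T \<sigma> (real r / (x + real r)) / (x + real r)" if "x \<in> {0..real (N - r)}" for x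
    using that r0 by (simp add: f_def g_def power2_eq_square)
  ultimately have "((\<lambda>x. ratio_kernel T \<sigma> (real r / (x + real r)) / (x + real r)) has_integral kernel_tail T \<sigma> (real r / real N)) {0..real (N - r)}"
    by (rule has_integral_eq[rotated])
  then show ?thesis by (rule integral_unique)
qed

text \<open>
  The defect in Stirling's formula, with limit ln (2 \<pi>)/2.
\<close>

definition stirling_seq :: "nat \<Rightarrow> real" where
  "stirling_seq n = ln (fact n) + real n - (real n + 1/2) * ln (real n)"

definition stirling_step :: "nat \<Rightarrow> real" where
  "stirling_step j = 1 - (real j + 1/2) * ln ((real j + 1) / real j)"

lemma stirling_seq_Suc: "n \<ge> 1 \<Longrightarrow> stirling_seq (Suc n) = stirling_seq n + stirling_step n"
proof -
  assume n: "n \<ge> 1"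
  have "ln (fact (Suc n) :: real) = ln (real (Suc n)) + ln (fact n)"
    by (subst fact_Suc, subst ln_mult) auto
  then show ?thesis using n by (simp add: stirling_seq_def stirling_step_def ln_div algebra_simps del: fact_Suc)
qed

lemma stirling_seq_sum: "N \<ge> 1 \<Longrightarrow> stirling_seq N = 1 + (\<Sum>j=1..<N. stirling_step j)"
proof (induction N rule: nat_induct_at_least)
  case base
  then show ?case by (simp add: stirling_seq_def)
qed (simp add: stirling_seq_Suc)

text \<open>
  The factor N u - j runs from 0 to 1 on the cell and has mean 1/2. Near u = j/N the function K(u)/u is K(0)/u plus a
  function that varies by at most 2L/j. The integral of (N u - j - 1/2)/u is the j-th difference
  of \<open>stirling_seq\<close>.
\<close>

lemma cell_integral:
  fixes K :: "real \<Rightarrow> real"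
  assumes N: "N \<ge> (1 :: nat)" and j: "1 \<le> j" "j < N"
    and lip: "\<And>u v. 0 \<le> u \<Longrightarrow> u \<le> v \<Longrightarrow> v \<le> 1 \<Longrightarrow> \<bar>K v - K u\<bar> \<le> L * (v - u)" and L: "L \<ge> 0"
    and cont: "continuous_on {0..1} K"
  defines "a \<equiv> real j / real N" and "b \<equiv> real (Suc j) / real N"
  shows "\<bar>integral {a..b} (\<lambda>u. (real N * u - real j) * (K u / u)) - integral {a..b} (\<lambda>u. K u / u) / 2 - K 0 * stirling_step j\<bar>
     \<le> L / (real N * real j)"
proof -
  have N0: "real N > 0" "real j > 0" using N j by auto
  have ab: "0 < a" "a < b" "b \<le> 1" "b - a = 1 / real N"
    using N0 j by (auto simp: a_def b_def divide_strict_right_mono diff_divide_distrib[symmetric])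
  have Na: "real N * a = real j" "real N * b = real j + 1" using N0 by (auto simp: a_def b_def)
  \<comment> \<open>K(u)/u without its pole, and the factor N u - j without its mean\<close>
  define K1 where "K1 u = (K u - K 0) / u" for u
  define p where "p u = real N * u - real j - 1/2" for u
  have cK: "continuous_on {a..b} K" by (rule continuous_on_subset[OF cont]) (use ab in auto)
  have cK1: "continuous_on {a..b} K1" unfolding K1_def[abs_def] using ab by (intro continuous_intros cK) auto
  have cp: "continuous_on {a..b} p" unfolding p_def[abs_def] by (intro continuous_intros)
  have ip: "(p has_integral 0) {a..b}"
  proof -
    have "(p has_integral ((real N * b - real j - 1/2)\<^sup>2 / (2 * real N) - (real N * a - real j - 1/2)\<^sup>2 / (2 * real N))) {a..b}"
      by (rule fundamental_theorem_of_calculus)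
         (use ab N0 in \<open>auto intro!: derivative_eq_intros simp: p_def power2_eq_square has_real_derivative_iff_has_vector_derivative[symmetric] field_simps\<close>)
    then show ?thesis unfolding Na by (simp add: power2_eq_square)
  qed
  have ipu: "((\<lambda>u. p u / u) has_integral stirling_step j) {a..b}"
  proof -
    have "((\<lambda>u. p u / u) has_integral ((real N * b - (real j + 1/2) * ln b) - (real N * a - (real j + 1/2) * ln a))) {a..b}"
      by (rule fundamental_theorem_of_calculus)
         (use ab N0 in \<open>auto intro!: derivative_eq_intros simp: p_def has_real_derivative_iff_has_vector_derivative[symmetric] field_simps\<close>)
    moreover have "b / a = (real j + 1) / real j" using N0 by (simp add: a_def b_def add.commute)
    then have "ln b - ln a = ln ((real j + 1) / real j)" using ln_div[of b a] ab by simp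
    then have "(real N * b - (real j + 1/2) * ln b) - (real N * a - (real j + 1/2) * ln a) = stirling_step j"
      unfolding Na stirling_step_def by (simp add: algebra_simps)
    ultimately show ?thesis by simp
  qed
  have dec: "(real N * u - real j) * (K u / u) = p u * (K1 u - K1 a) + K1 a * p u + K 0 * (p u / u) + (K u / u) / 2" if "u \<in> {a..b}" for u
    using that ab unfolding p_def K1_def by (simp add: field_simps)
  have i1: "((\<lambda>u. p u * (K1 u - K1 a)) has_integral integral {a..b} (\<lambda>u. p u * (K1 u - K1 a))) {a..b}"
    by (intro integrable_integral integrable_continuous_real continuous_intros cp cK1)
  have i4: "((\<lambda>u. (K u / u) / 2) has_integral integral {a..b} (\<lambda>u. K u / u) / 2) {a..b}"
    using ab by (intro has_integral_divide integrable_integral integrable_continuous_real continuous_intros cK) auto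
  have "((\<lambda>u. p u * (K1 u - K1 a) + K1 a * p u + K 0 * (p u / u) + (K u / u) / 2) has_integral
     (integral {a..b} (\<lambda>u. p u * (K1 u - K1 a)) + K1 a * 0 + K 0 * stirling_step j + integral {a..b} (\<lambda>u. K u / u) / 2)) {a..b}"
    by (intro has_integral_add has_integral_mult_right i1 ip ipu i4)
  then have "((\<lambda>u. (real N * u - real j) * (K u / u)) has_integral
     (integral {a..b} (\<lambda>u. p u * (K1 u - K1 a)) + K1 a * 0 + K 0 * stirling_step j + integral {a..b} (\<lambda>u. K u / u) / 2)) {a..b}"
    by (rule has_integral_eq[rotated]) (rule dec[symmetric])
  then have "integral {a..b} (\<lambda>u. (real N * u - real j) * (K u / u)) - integral {a..b} (\<lambda>u. K u / u) / 2 - K 0 * stirling_step j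
     = integral {a..b} (\<lambda>u. p u * (K1 u - K1 a))" by (simp add: integral_unique)
  also have "norm \<dots> \<le> (1/2 * (2 * L / real j)) * (b - a)"
  proof (rule integral_bound)
    show "continuous_on {a..b} (\<lambda>u. p u * (K1 u - K1 a))" by (intro continuous_intros cp cK1)
    fix u assume u: "u \<in> {a..b}"
    have u0: "u > 0" using u ab by simp
    have "real N * a \<le> real N * u" "real N * u \<le> real N * b" using u N0 by auto
    then have "\<bar>p u\<bar> \<le> 1/2" unfolding Na p_def by linarith
    moreover have "\<bar>K1 u - K1 a\<bar> \<le> 2 * L / real j"
    proof -
      have "K1 u - K1 a = (K u - K a) / u + (K a - K 0) * (1 / u - 1 / a)" using u0 ab by (simp add: K1_def field_simps)
      moreover have "\<bar>(K u - K a) / u\<bar> \<le> L / real j"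
      proof -
        have "\<bar>K u - K a\<bar> \<le> L * (u - a)" using lip[of a u] u ab by auto
        also have "\<dots> \<le> L * (1 / real N)" using u ab L by (intro mult_left_mono) auto
        finally have "\<bar>K u - K a\<bar> / u \<le> L * (1 / real N) / a" using u ab u0 L by (intro frac_le) auto
        also have "\<dots> = L / real j" using N0 by (simp add: a_def)
        finally show ?thesis using u0 by (simp add: abs_divide)
      qed
      moreover have "\<bar>(K a - K 0) * (1 / u - 1 / a)\<bar> \<le> L / real j"
      proof -
        have "\<bar>K a - K 0\<bar> \<le> L * a" using lip[of 0 a] ab by auto
        moreover have "\<bar>1 / u - 1 / a\<bar> \<le> (1 / real N) / (a * a)"
        proof -
          have "1 / a - 1 / u = (u - a) / (a * u)" using u0 ab by (simp add: field_simps)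
          also have "\<dots> \<le> (1 / real N) / (a * a)" using u ab N0 by (intro frac_le mult_left_mono) auto
          finally have "1 / a - 1 / u \<le> (1 / real N) / (a * a)" .
          moreover have "1 / u \<le> 1 / a" using u ab by (intro divide_left_mono) auto
          ultimately show ?thesis by simp
        qed
        ultimately have "\<bar>K a - K 0\<bar> * \<bar>1 / u - 1 / a\<bar> \<le> (L * a) * ((1 / real N) / (a * a))"
          using L ab by (intro mult_mono) auto
        also have "\<dots> = L / real j" using N0 by (simp add: a_def)
        finally show ?thesis by (simp add: abs_mult)
      qed
      ultimately show ?thesis using abs_triangle_ineq[of "(K u - K a) / u" "(K a - K 0) * (1 / u - 1 / a)"] by simp
    qed
    ultimately show "norm (p u * (K1 u - K1 a)) \<le> 1/2 * (2 * L / real j)"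
      unfolding real_norm_def abs_mult by (rule mult_mono) auto
  qed (use ab in auto)
  also have "\<dots> = L / (real N * real j)" unfolding ab(4) by simp
  finally show ?thesis by (simp only: real_norm_def)
qed

text \<open>
  The sum of all tails is \<open>\<Sum>j. j \<integral> K(u)/u\<close> over the cells [j/N, (j+1)/N], to be compared with \<open>N \<integral> K = \<Sum>j. \<integral> N u K(u)/u\<close>. On each cell
  \<open>cell_integral\<close> evaluates the difference, and the first cell contributes K(0) = 2T.
\<close>

lemma sum_kernel_tails:
  assumes N: "N \<ge> 1" and T: "T \<ge> 10" "\<sigma> \<ge> 2" "\<sigma>\<^sup>2 \<le> T"
  shows "\<bar>(\<Sum>r=1..<N. kernel_tail T \<sigma> (real r / real N)) - real N * integral {0..1} (ratio_kernel T \<sigma>)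
     + 2 * T * stirling_seq N + kernel_tail T \<sigma> (1 / real N) / 2\<bar> \<le> 8 * T\<^sup>2 * (harm N + 1) / real N"
proof -
  define K where "K = ratio_kernel T \<sigma>"
  define L where "L = 8 * T\<^sup>2"
  have N0: "real N > 0" using N by simp
  have lip: "\<bar>K v - K u\<bar> \<le> L * (v - u)" if "0 \<le> u" "u \<le> v" "v \<le> 1" for u v
    unfolding K_def L_def using ratio_kernel_lipschitz[OF T that] .
  have cont: "continuous_on {0..1} K" unfolding K_def using T by (intro continuous_on_kernel) auto
  have K0: "K 0 = 2 * T" by (simp add: K_def ratio_kernel_def weight_ft_def)
  define c where "c j = real j / real N" for j
  have c: "c 0 = 0" "c N = 1" "\<And>i j. i \<le> j \<Longrightarrow> c i \<le> c j" using N0 by (auto simp: c_def divide_right_mono)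
  define \<rho> where "\<rho> j = integral {c j..c (Suc j)} (\<lambda>u. K u / u)" for j
  define \<kappa> where "\<kappa> j = integral {c j..c (Suc j)} K" for j
  have iK: "K integrable_on {c i..c j}" if "j \<le> N" for i j
    using c(3)[of j N] c(3)[of 0 i] that c by (intro integrable_continuous_real continuous_on_subset[OF cont]) auto
  have iKu: "(\<lambda>u. K u / u) integrable_on {c i..c j}" if "j \<le> N" "i \<ge> 1" for i j
  proof -
    have "c i > 0" using that N0 by (simp add: c_def)
    then show ?thesis using c(3)[of j N] that c
      by (intro integrable_continuous_real continuous_on_divide continuous_on_subset[OF cont] continuous_intros) auto
  qed
  have intK: "integral {0..c n} K = (\<Sum>j<n. \<kappa> j)" if "n \<le> N" for n using that
  proof (induction n)
    case (Suc n)
    have "integral {0..c (Suc n)} K = integral {0..c n} K + \<kappa> n"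
      unfolding \<kappa>_def using iK[of "Suc n" 0] Suc c(3)[of 0 n] c(3)[of n "Suc n"] c(1)
      by (intro Henstock_Kurzweil_Integration.integral_combine[symmetric]) auto
    then show ?case using Suc by simp
  qed (simp add: c)
  have tail: "kernel_tail T \<sigma> (c r) = (\<Sum>j=r..<N. \<rho> j)" if "1 \<le> r" "r \<le> N" for r
    using that(2,1)
  proof (induction r rule: inc_induct)
    case base
    then show ?case by (simp add: kernel_tail_def c)
  next
    case (step n)
    have "kernel_tail T \<sigma> (c n) = \<rho> n + kernel_tail T \<sigma> (c (Suc n))"
      unfolding \<rho>_def kernel_tail_def K_def[symmetric] using iKu[of N n] step c(3)[of n "Suc n"] c(3)[of "Suc n" N] c(2)
      by (intro Henstock_Kurzweil_Integration.integral_combine[symmetric]) auto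
    moreover have "(\<Sum>j=n..<N. \<rho> j) = \<rho> n + (\<Sum>j=Suc n..<N. \<rho> j)" using step by (simp add: sum.atLeast_Suc_lessThan)
    ultimately show ?case using step by simp
  qed
  \<comment> \<open>the cell [j/N, (j+1)/N] belongs to the tails of r = 1, ..., j\<close>
  have tails: "(\<Sum>r=1..<N. kernel_tail T \<sigma> (c r)) = (\<Sum>j=1..<N. real j * \<rho> j)"
  proof -
    have "(\<Sum>r=1..<N. kernel_tail T \<sigma> (c r)) = (\<Sum>r=1..<N. \<Sum>j=r..<N. \<rho> j)" by (intro sum.cong refl tail) auto
    also have "\<dots> = (\<Sum>(r, j)\<in>Sigma {1..<N} (\<lambda>r. {r..<N}). \<rho> j)" by (simp add: sum.Sigma)
    also have "\<dots> = (\<Sum>(j, r)\<in>Sigma {1..<N} (\<lambda>j. {1..j}). \<rho> j)"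
      by (rule sum.reindex_bij_witness[of _ prod.swap prod.swap]) auto
    also have "\<dots> = (\<Sum>j=1..<N. \<Sum>r\<in>{1..j}. \<rho> j)" by (rule sum.Sigma[symmetric]) auto
    finally show ?thesis by simp
  qed
  define e where "e j = real N * \<kappa> j - real j * \<rho> j - \<rho> j / 2 - 2 * T * stirling_step j" for j
  have e: "\<bar>e j\<bar> \<le> L / (real N * real j)" if "1 \<le> j" "j < N" for j
  proof -
    have pos: "c j > 0" using that N0 by (simp add: c_def)
    have "integral {c j..c (Suc j)} (\<lambda>u. (real N * u - real j) * (K u / u)) = real N * \<kappa> j - real j * \<rho> j"
    proof -
      have "integral {c j..c (Suc j)} (\<lambda>u. (real N * u - real j) * (K u / u)) = integral {c j..c (Suc j)} (\<lambda>u. real N * K u - real j * (K u / u))"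
        using pos by (intro Henstock_Kurzweil_Integration.integral_cong) (auto simp: field_simps)
      also have "\<dots> = real N * \<kappa> j - real j * \<rho> j"
        unfolding \<kappa>_def \<rho>_def using iK[of "Suc j" j] iKu[of "Suc j" j] that
        by (intro integral_unique has_integral_diff has_integral_mult_right integrable_integral) auto
      finally show ?thesis .
    qed
    then show ?thesis using cell_integral[OF N that lip _ cont] unfolding e_def K0[symmetric] c_def \<rho>_def by (simp add: L_def)
  qed
  have e0: "\<bar>real N * \<kappa> 0 - 2 * T\<bar> \<le> L / real N"
  proof -
    have "norm (integral {c 0..c 1} (\<lambda>u. K u - K 0)) \<le> L / real N * (c 1 - c 0)"
    proof (rule integral_bound)
      show "continuous_on {c 0..c 1} (\<lambda>u. K u - K 0)"
        using c(3)[of 1 N] c N by (intro continuous_intros continuous_on_subset[OF cont]) auto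
      fix u assume u: "u \<in> {c 0..c 1}"
      then have "\<bar>K u - K 0\<bar> \<le> L * (u - 0)" using c(3)[of 1 N] c N by (intro lip) auto
      also have "\<dots> \<le> L * (1 / real N)" using u by (intro mult_left_mono) (auto simp: c_def L_def)
      finally show "norm (K u - K 0) \<le> L / real N" by simp
    qed (use c(3)[of 0 1] in auto)
    moreover have "integral {c 0..c 1} (\<lambda>u. K u - K 0) = \<kappa> 0 - 2 * T / real N"
      unfolding \<kappa>_def using iK[of 1 0] N N0 by (subst Henstock_Kurzweil_Integration.integral_diff) (auto simp: K0 c_def)
    ultimately have "real N * \<bar>\<kappa> 0 - 2 * T / real N\<bar> \<le> real N * (L / real N * (1 / real N))"
      using N0 by (intro mult_left_mono) (auto simp: c_def)
    moreover have "real N * \<bar>\<kappa> 0 - 2 * T / real N\<bar> = \<bar>real N * \<kappa> 0 - 2 * T\<bar>"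
      using N0 abs_mult[of "real N" "\<kappa> 0 - 2 * T / real N"] by (simp add: right_diff_distrib)
    ultimately show ?thesis using N0 by simp
  qed
  have set: "{..<N} = insert 0 {1..<N}" using N by auto
  have "(\<Sum>r=1..<N. kernel_tail T \<sigma> (c r)) - real N * integral {0..1} K + 2 * T * stirling_seq N + kernel_tail T \<sigma> (c 1) / 2
     = - (\<Sum>j=1..<N. e j) - (real N * \<kappa> 0 - 2 * T)"
  proof -
    have "integral {0..1} K = \<kappa> 0 + (\<Sum>j=1..<N. \<kappa> j)" using intK[of N] unfolding c(2) set by simp
    moreover have "(\<Sum>j=1..<N. e j) = real N * (\<Sum>j=1..<N. \<kappa> j) - (\<Sum>j=1..<N. real j * \<rho> j) - (\<Sum>j=1..<N. \<rho> j) / 2 - 2 * T * (\<Sum>j=1..<N. stirling_step j)"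
      unfolding e_def by (simp only: sum_subtractf sum_distrib_left sum_divide_distrib)
    ultimately show ?thesis using tails tail[of 1] N stirling_seq_sum[OF N] by (simp add: algebra_simps)
  qed
  moreover have "\<bar>\<Sum>j=1..<N. e j\<bar> \<le> L * harm N / real N"
  proof -
    have "\<bar>\<Sum>j=1..<N. e j\<bar> \<le> (\<Sum>j=1..<N. L / (real N * real j))" using e by (intro order_trans[OF sum_abs] sum_mono) auto
    also have "\<dots> \<le> (\<Sum>j=1..N. L / (real N * real j))" by (intro sum_mono2) (auto simp: L_def)
    also have "\<dots> = L / real N * (\<Sum>j=1..N. inverse (real j))" unfolding sum_distrib_left by (intro sum.cong refl) (simp add: field_simps)
    finally show ?thesis by (simp add: harm_def)
  qed
  moreover have "8 * T\<^sup>2 * (harm N + 1) / real N = L * harm N / real N + L / real N" unfolding L_def by (simp add: add_divide_distrib ring_distribs)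
  ultimately show ?thesis using e0 unfolding c_def K_def by simp
qed

section \<open>Stirling's constant\<close>

text \<open>
  They follow from 2h/(2 + h) \<le> ln (1 + h) \<le> h - h^2/2 + h^3/3 for h = 1/j.
\<close>

lemma stirling_step_bounds:
  assumes "j \<ge> 1"
  shows "- 1 / (real j)\<^sup>2 \<le> stirling_step j" "stirling_step j \<le> 0"
proof -
  define h where "h = 1 / real j"
  have h: "0 < h" "h \<le> 1" "real j = 1 / h" using assms by (auto simp: h_def)
  have hj: "(real j + 1) / real j = 1 + h" using assms by (simp add: h_def field_simps)
  have "0 \<le> ln (1 + h) - 2 * h / (2 + h)"
  proof -
    have "ln (1 + 0) - 2 * 0 / (2 + 0) \<le> ln (1 + h) - 2 * h / (2 + h)"
    proof (rule DERIV_nonneg_imp_nondecreasing[of 0 h "\<lambda>x. ln (1 + x) - 2 * x / (2 + x)"])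
      fix x :: real assume x: "0 \<le> x"
      have "((\<lambda>x. ln (1 + x) - 2 * x / (2 + x)) has_real_derivative 1 / (1 + x) - 4 / (2 + x)\<^sup>2) (at x)"
        using x by (auto intro!: derivative_eq_intros simp: power2_eq_square)
      moreover have "4 / (2 + x)\<^sup>2 \<le> 1 / (1 + x)" 
      proof -
        have "4 * (1 + x) \<le> (2 + x)\<^sup>2" using x by (simp add: power2_eq_square algebra_simps)
        then have "4 / (2 + x)\<^sup>2 \<le> 4 / (4 * (1 + x))" using x by (intro divide_left_mono mult_pos_pos) auto
        also have "4 / (4 * (1 + x)) = 1 / (1 + x)" using mult_divide_mult_cancel_left[of 4 1 "1 + x"] by (simp only: mult_1_right)
        finally show ?thesis .
      qed
      ultimately show "\<exists>y. ((\<lambda>x. ln (1 + x) - 2 * x / (2 + x)) has_real_derivative y) (at x) \<and> 0 \<le> y" by force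
    qed (use h in auto)
    then show ?thesis by simp
  qed
  then have "(1 / h + 1 / 2) * (2 * h / (2 + h)) \<le> (1 / h + 1 / 2) * ln (1 + h)" using h by (intro mult_left_mono) auto
  moreover have "(1 / h + 1 / 2) * (2 * h / (2 + h)) = 1"
  proof -
    have "1 / h + 1 / 2 = (2 + h) / (2 * h)" using h by (simp add: add_divide_distrib)
    then show ?thesis using h by (simp add: divide_simps)
  qed
  ultimately show "stirling_step j \<le> 0" unfolding stirling_step_def hj unfolding h(3) by linarith
  have "ln (1 + h) - h + h\<^sup>2 / 2 - h ^ 3 / 3 \<le> ln (1 + 0) - 0 + 0\<^sup>2 / 2 - 0 ^ 3 / 3"
  proof (rule DERIV_nonpos_imp_nonincreasing[of 0 h "\<lambda>x. ln (1 + x) - x + x\<^sup>2 / 2 - x ^ 3 / 3"])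
    fix x :: real assume x: "0 \<le> x"
    have "((\<lambda>x. ln (1 + x) - x + x\<^sup>2 / 2 - x ^ 3 / 3) has_real_derivative 1 / (1 + x) - 1 + x - x\<^sup>2) (at x)"
      using x by (auto intro!: derivative_eq_intros)
    moreover have "1 / (1 + x) \<le> 1 - x + x\<^sup>2" using x by (simp add: field_simps power2_eq_square)
    ultimately show "\<exists>y. ((\<lambda>x. ln (1 + x) - x + x\<^sup>2 / 2 - x ^ 3 / 3) has_real_derivative y) (at x) \<and> y \<le> 0" by force
  qed (use h in auto)
  then have "(1 / h + 1 / 2) * ln (1 + h) \<le> (1 / h + 1 / 2) * (h - h\<^sup>2 / 2 + h ^ 3 / 3)" using h by (intro mult_left_mono) auto
  also have "\<dots> = 1 + h\<^sup>2 / 12 + h ^ 3 / 6" using h by (simp add: field_simps power2_eq_square power3_eq_cube)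
  also have "\<dots> \<le> 1 + h\<^sup>2"
  proof -
    have "h ^ 3 \<le> h\<^sup>2" using h by (intro power_decreasing) auto
    moreover have "h\<^sup>2 \<ge> 0" by simp
    ultimately show ?thesis by linarith
  qed
  finally show "- 1 / (real j)\<^sup>2 \<le> stirling_step j" unfolding stirling_step_def hj by (simp add: h_def power_divide)
qed

lemma stirling_seq_minus_mono:
  assumes "1 \<le> m" "m \<le> n"
  shows "stirling_seq m - 2 / real m \<le> stirling_seq n - 2 / real n"
  using assms(2)
proof (induction n rule: dec_induct)
  case (step n)
  have n: "real n \<ge> 1" using step assms by simp
  have "1 / (real n)\<^sup>2 \<le> 2 / real n - 2 / real (Suc n)"
  proof -
    have "2 / real n - 2 / real (Suc n) = 2 / (real n * (real n + 1))" using n by (simp add: field_simps)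
    moreover have "2 / (real n * (2 * real n)) \<le> 2 / (real n * (real n + 1))"
      using n by (intro divide_left_mono mult_left_mono mult_pos_pos) auto
    moreover have "2 / (real n * (2 * real n)) = 1 / (real n)\<^sup>2" by (simp add: power2_eq_square)
    ultimately show ?thesis by simp
  qed
  moreover have "stirling_seq (Suc n) = stirling_seq n + stirling_step n" "- 1 / (real n)\<^sup>2 \<le> stirling_step n"
    using n stirling_step_bounds(1)[of n] by (simp_all add: stirling_seq_Suc)
  ultimately show ?case using step by linarith
qed simp

text \<open>
  The sequence decreases and is bounded below by \<open>stirling_seq_minus_mono\<close>. Wallis's product, written as
  a combination of its terms at n and 2 n, determines the limit.
\<close>

lemma stirling_limit: "stirling_seq \<longlonglongrightarrow> ln (2 * pi) / 2"
proof -
  have dec: "stirling_seq (Suc (Suc n)) \<le> stirling_seq (Suc n)" for n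
    using stirling_seq_Suc[of "Suc n"] stirling_step_bounds[of "Suc n"] by simp
  have "bdd_below (range (\<lambda>n. stirling_seq (Suc n)))"
  proof (rule bdd_belowI2)
    fix n
    have "2 / real (Suc n) \<ge> 0" by simp
    moreover have "stirling_seq 1 = 1" by (simp add: stirling_seq_def)
    ultimately show "-1 \<le> stirling_seq (Suc n)" using stirling_seq_minus_mono[of 1 "Suc n"] by linarith
  qed
  then have "(\<lambda>n. stirling_seq (Suc n)) \<longlonglongrightarrow> (INF n. stirling_seq (Suc n))"
    using dec by (intro LIMSEQ_decseq_INF) (auto simp: decseq_Suc_iff)
  then obtain l where l: "stirling_seq \<longlonglongrightarrow> l" by (auto simp: filterlim_sequentially_Suc)
  \<comment> \<open>the partial Wallis product, expressed by factorials, by induction on n\<close>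
  have wall: "ln (\<Prod>k=1..n. (4 * real k ^ 2) / (4 * real k ^ 2 - 1)) = 4 * stirling_seq n - 2 * stirling_seq (2 * n) - ln 2 + ln (real n / (2 * real n + 1))"
    if "n \<ge> 1" for n using that
  proof (induction n rule: nat_induct_at_least)
    case base
    have "ln (4 / 3 :: real) = ln 4 - ln 3" by (simp add: ln_div)
    moreover have "ln (4 :: real) = 2 * ln 2" using ln_realpow[of 2 2] by simp
    moreover have "ln (1 / 3 :: real) = - ln 3" by (simp add: ln_div)
    ultimately show ?case by (simp add: stirling_seq_def numeral_eq_Suc algebra_simps)
  next
    case (Suc n)
    define A B C D where "A = ln (real n + 1)" and "B = ln (real n)" and "C = ln (2 * real n + 1)" and "D = ln (2 * real n + 3)"
    have n: "real n \<ge> 1" using Suc by simp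
    have pos: "(\<Prod>k=1..n. (4 * real k ^ 2) / (4 * real k ^ 2 - 1)) > 0"
    proof (rule prod_pos)
      fix k assume "k \<in> {1..n}"
      then have "1 \<le> (real k)\<^sup>2" by simp
      then show "0 < 4 * (real k)\<^sup>2 / (4 * (real k)\<^sup>2 - 1)" by (intro divide_pos_pos) linarith+
    qed
    have f: "4 * real (Suc n) ^ 2 / (4 * real (Suc n) ^ 2 - 1) = (2 * (real n + 1))\<^sup>2 / ((2 * real n + 1) * (2 * real n + 3))"
      by (simp add: power2_eq_square algebra_simps)
    have "ln ((2 * (real n + 1))\<^sup>2 / ((2 * real n + 1) * (2 * real n + 3))) = 2 * (ln 2 + A) - (C + D)"
    proof -
      have "ln (2 * (real n + 1)) = ln 2 + A" using n unfolding A_def by (subst ln_mult_pos) auto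
      then have "ln ((2 * (real n + 1))\<^sup>2) = 2 * (ln 2 + A)" using n by (subst ln_realpow) auto
      moreover have "ln ((2 * real n + 1) * (2 * real n + 3)) = C + D" using n unfolding C_def D_def by (subst ln_mult_pos) auto
      moreover have "ln ((2 * (real n + 1))\<^sup>2 / ((2 * real n + 1) * (2 * real n + 3))) = ln ((2 * (real n + 1))\<^sup>2) - ln ((2 * real n + 1) * (2 * real n + 3))"
        using n by (subst ln_div) auto
      ultimately show ?thesis by simp
    qed
    then have "ln (\<Prod>k=1..Suc n. (4 * real k ^ 2) / (4 * real k ^ 2 - 1)) = 4 * stirling_seq n - 2 * stirling_seq (2 * n) - ln 2 + ln (real n / (2 * real n + 1)) + (2 * (ln 2 + A) - (C + D))"
    proof -
      have "(\<Prod>k=1..Suc n. (4 * real k ^ 2) / (4 * real k ^ 2 - 1)) = (\<Prod>k=1..n. (4 * real k ^ 2) / (4 * real k ^ 2 - 1)) * ((2 * (real n + 1))\<^sup>2 / ((2 * real n + 1) * (2 * real n + 3)))"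
        using f by (simp add: prod.cl_ivl_Suc)
      moreover have "(2 * (real n + 1))\<^sup>2 / ((2 * real n + 1) * (2 * real n + 3)) > 0" using n by (intro divide_pos_pos mult_pos_pos) auto
      ultimately have "ln (\<Prod>k=1..Suc n. (4 * real k ^ 2) / (4 * real k ^ 2 - 1)) = ln (\<Prod>k=1..n. (4 * real k ^ 2) / (4 * real k ^ 2 - 1)) + ln ((2 * (real n + 1))\<^sup>2 / ((2 * real n + 1) * (2 * real n + 3)))"
        using pos by (simp only: ln_mult_pos)
      then show ?thesis using Suc(2) \<open>ln ((2 * (real n + 1))\<^sup>2 / ((2 * real n + 1) * (2 * real n + 3))) = 2 * (ln 2 + A) - (C + D)\<close>
        by linarith
    qed
    moreover have "ln (real n / (2 * real n + 1)) = B - C" using n by (simp add: ln_div B_def C_def)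
    moreover have "ln (real (Suc n) / (2 * real (Suc n) + 1)) = A - D" using n by (simp add: ln_div A_def D_def add.commute)
    moreover have "stirling_step n = 1 - (real n + 1/2) * (A - B)" using n by (simp add: stirling_step_def ln_div A_def B_def)
    moreover have "stirling_step (2 * n) = 1 - (2 * real n + 1/2) * (C - (ln 2 + B))"
      using n by (simp add: stirling_step_def ln_div ln_mult C_def B_def)
    moreover have "stirling_step (Suc (2 * n)) = 1 - (2 * real n + 3/2) * (ln 2 + A - C)"
    proof -
      have "real (Suc (2 * n)) + 1 = 2 * (real n + 1)" "real (Suc (2 * n)) = 2 * real n + 1" by simp_all
      moreover have "ln (2 * (real n + 1) / (2 * real n + 1)) = ln 2 + A - C"
      proof -
        have "ln (2 * (real n + 1)) = ln 2 + A" using n unfolding A_def by (subst ln_mult_pos) auto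
        moreover have "ln (2 * (real n + 1) / (2 * real n + 1)) = ln (2 * (real n + 1)) - ln (2 * real n + 1)"
          using n by (subst ln_div) auto
        ultimately show ?thesis by (simp add: C_def)
      qed
      ultimately show ?thesis unfolding stirling_step_def by (simp only:)  simp
    qed
    moreover have "stirling_seq (Suc n) = stirling_seq n + stirling_step n"
      "stirling_seq (2 * Suc n) = stirling_seq (2 * n) + stirling_step (2 * n) + stirling_step (Suc (2 * n))"
      using Suc by (simp_all add: stirling_seq_Suc)
    ultimately show ?case by (simp only:) argo
  qed
  have "(\<lambda>n. ln (\<Prod>k=1..n. (4 * real k ^ 2) / (4 * real k ^ 2 - 1))) \<longlonglongrightarrow> ln (pi / 2)"
    by (intro tendsto_ln wallis) simp
  moreover have "(\<lambda>n. ln (\<Prod>k=1..n. (4 * real k ^ 2) / (4 * real k ^ 2 - 1))) \<longlonglongrightarrow> 4 * l - 2 * l - ln 2 + ln (1 / 2)"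
  proof -
    have "(\<lambda>n. stirling_seq (2 * n)) \<longlonglongrightarrow> l"
      using LIMSEQ_subseq_LIMSEQ[OF l, of "\<lambda>n. 2 * n"] by (auto simp: strict_mono_def o_def)
    moreover have "(\<lambda>n. ln (real n / (2 * real n + 1))) \<longlonglongrightarrow> ln (1 / 2)" by (rule tendsto_ln) (real_asymp, simp)
    ultimately have "(\<lambda>n. 4 * stirling_seq n - 2 * stirling_seq (2 * n) - ln 2 + ln (real n / (2 * real n + 1))) \<longlonglongrightarrow> 4 * l - 2 * l - ln 2 + ln (1 / 2)"
      using l by (intro tendsto_add tendsto_diff tendsto_mult tendsto_const)
    moreover have "\<forall>\<^sub>F n in sequentially. 4 * stirling_seq n - 2 * stirling_seq (2 * n) - ln 2 + ln (real n / (2 * real n + 1)) = ln (\<Prod>k=1..n. (4 * real k ^ 2) / (4 * real k ^ 2 - 1))"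
      using eventually_ge_at_top[of 1] by eventually_elim (simp only: wall)
    ultimately show ?thesis by (rule Lim_transform_eventually)
  qed
  ultimately have "ln (pi / 2) = 4 * l - 2 * l - ln 2 + ln (1 / 2)" by (rule LIMSEQ_unique)
  then have "l = ln (2 * pi) / 2" by (simp add: ln_div ln_mult)
  then show ?thesis using l by (simp only:)
qed

lemma stirling_error:
  assumes "N \<ge> 1"
  shows "\<bar>stirling_seq N - ln (2 * pi) / 2\<bar> \<le> 2 / real N"
proof -
  have "stirling_seq N - 2 / real N \<le> ln (2 * pi) / 2 - 0"
  proof (rule tendsto_lowerbound)
    show "(\<lambda>n. stirling_seq n - 2 / real n) \<longlonglongrightarrow> ln (2 * pi) / 2 - 0"
      by (intro tendsto_diff stirling_limit) real_asymp
    show "\<forall>\<^sub>F n in sequentially. stirling_seq N - 2 / real N \<le> stirling_seq n - 2 / real n"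
      using eventually_ge_at_top[of N] by eventually_elim (rule stirling_seq_minus_mono[OF assms])
  qed simp
  moreover have "ln (2 * pi) / 2 \<le> stirling_seq N"
  proof (rule tendsto_upperbound[OF stirling_limit])
    have *: "stirling_seq n \<le> stirling_seq N" if "n \<ge> N" for n using that
    proof (induction n rule: dec_induct)
      case (step n)
      then show ?case using stirling_seq_Suc[of n] stirling_step_bounds[of n] assms by simp
    qed simp
    show "\<forall>\<^sub>F n in sequentially. stirling_seq n \<le> stirling_seq N"
      using eventually_ge_at_top[of N] by eventually_elim (rule *)
  qed simp
  ultimately show ?thesis by simp
qed

section \<open>Evaluation of a kernel tail\<close>

text \<open>
  Bounded functions are integrable on the rectangle.
\<close>

lemma unit_interval_fubini:
  fixes F :: "real \<Rightarrow> real \<Rightarrow> real"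
  assumes m[measurable]: "(\<lambda>(v, x). F v x) \<in> borel_measurable (lborel \<Otimes>\<^sub>M lborel)"
    and b: "\<And>v x. v \<in> {0..\<tau>} \<Longrightarrow> x \<in> {0<..<1} \<Longrightarrow> \<bar>F v x\<bar> \<le> B"
  shows "(LINT x|lborel. indicator {0<..<1} x * (LINT v|lborel. indicator {0..\<tau>} v * F v x))
     = (LINT v|lborel. indicator {0..\<tau>} v * (LINT x|lborel. indicator {0<..<1} x * F v x))"
proof -
  have A: "integrable (lborel \<Otimes>\<^sub>M lborel) (\<lambda>z :: real \<times> real. B * indicator ({0..\<tau>} \<times> {0<..<1}) z)"
  proof (intro integrable_mult_right integrable_real_indicator)
    show "emeasure (lborel \<Otimes>\<^sub>M lborel) ({0..\<tau>} \<times> {0<..<1 :: real}) < \<infinity>"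
      by (subst lborel.emeasure_pair_measure_Times) (auto simp: emeasure_lborel_Icc_eq ennreal_mult_less_top)
  qed auto
  have I: "integrable (lborel \<Otimes>\<^sub>M lborel) (\<lambda>(v, x). indicator {0..\<tau>} v * (indicator {0<..<1} x * F v x))"
  proof (rule Bochner_Integration.integrable_bound[OF A])
    show "AE z in lborel \<Otimes>\<^sub>M lborel. norm (case z of (v, x) \<Rightarrow> indicator {0..\<tau>} v * (indicator {0<..<1} x * F v x)) \<le> norm (B * indicator ({0..\<tau>} \<times> {0<..<1 :: real}) z)"
    proof (rule AE_I2)
      fix z :: "real \<times> real"
      show "norm (case z of (v, x) \<Rightarrow> indicator {0..\<tau>} v * (indicator {0<..<1} x * F v x)) \<le> norm (B * indicator ({0..\<tau>} \<times> {0<..<1}) z)"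
        using b[of "fst z" "snd z"] abs_ge_self[of B] by (cases z) (auto simp: indicator_def intro: order_trans)
    qed
  qed measurable
  have "(LINT x|lborel. LINT v|lborel. indicator {0..\<tau>} v * (indicator {0<..<1} x * F v x))
     = (LINT v|lborel. LINT x|lborel. indicator {0..\<tau>} v * (indicator {0<..<1} x * F v x))"
    by (rule lborel_pair.Fubini_integral[OF I])
  moreover have "(LINT v|lborel. indicator {0..\<tau>} v * (indicator {0<..<1} x * F v x)) = indicator {0<..<1} x * (LINT v|lborel. indicator {0..\<tau>} v * F v x)" for x
    unfolding integral_mult_right_zero[symmetric] by (simp only: mult.left_commute)
  ultimately show ?thesis unfolding integral_mult_right_zero by simp
qed

lemma integral_unit_interval_powr: "v \<ge> 0 \<Longrightarrow> (LINT x|lborel. indicator {0<..<1} x * x powr v) = 1 / (v + 1)" for v :: real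
proof -
  assume v: "v \<ge> 0"
  have "((\<lambda>x. x powr v) has_integral (1 powr (v + 1) / (v + 1) - 0 powr (v + 1) / (v + 1))) {0..1 :: real}"
  proof (rule fundamental_theorem_of_calculus_interior)
    show "continuous_on {0..1} (\<lambda>x. x powr (v + 1) / (v + 1) :: real)"
      using v by (intro continuous_on_divide continuous_on_powr' continuous_intros) auto
    show "((\<lambda>x. x powr (v + 1) / (v + 1)) has_vector_derivative x powr v) (at x)" if "x \<in> {0<..<1}" for x :: real
      using that v by (auto simp: has_real_derivative_iff_has_vector_derivative[symmetric] intro!: derivative_eq_intros)
  qed auto
  then show ?thesis using v has_bochner_integral_of_has_integral[of "\<lambda>x. x powr v" "1 / (v + 1)"]
    by (auto simp: has_bochner_integral_iff)
qed

text \<open>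
  An antiderivative is x (sin (- v ln x) + v cos (- v ln x))/(1 + v^2). The constant 1 is added to
  the integrand to make it nonnegative and is subtracted at the end.
\<close>

lemma integral_unit_interval_sin:
  fixes v :: real
  shows "(LINT x|lborel. indicator {0<..<1} x * sin (v * (- ln x))) = v / (1 + v\<^sup>2)"
proof -
  have v: "1 + v\<^sup>2 > 0" by (simp add: add_pos_nonneg)
  define g where "g x = x + x * (sin (v * - ln x) + v * cos (v * - ln x)) / (1 + v\<^sup>2)" for x
  have "((\<lambda>x. 1 + sin (v * (- ln x))) has_integral (g 1 - g 0)) {0..1}"
  proof (rule fundamental_theorem_of_calculus_interior)
    have lim: "((\<lambda>x. x * (sin (v * - ln x) + v * cos (v * - ln x))) \<longlongrightarrow> 0) (at 0 within {0..1})"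
    proof (rule Lim_null_comparison)
      have "norm (x * (sin (v * - ln x) + v * cos (v * - ln x))) \<le> \<bar>x\<bar> * (1 + \<bar>v\<bar>)" for x
      proof -
        have "\<bar>sin (v * - ln x) + v * cos (v * - ln x)\<bar> \<le> \<bar>sin (v * - ln x)\<bar> + \<bar>v\<bar> * \<bar>cos (v * - ln x)\<bar>"
          by (rule order_trans[OF abs_triangle_ineq]) (simp add: abs_mult)
        also have "\<dots> \<le> 1 + \<bar>v\<bar> * 1" by (intro add_mono mult_left_mono abs_sin_le_one abs_cos_le_one) auto
        finally show ?thesis unfolding real_norm_def abs_mult by (intro mult_left_mono) auto
      qed
      then show "\<forall>\<^sub>F x in at 0 within {0..1}. norm (x * (sin (v * - ln x) + v * cos (v * - ln x))) \<le> \<bar>x\<bar> * (1 + \<bar>v\<bar>)" by simp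
      show "((\<lambda>x. \<bar>x\<bar> * (1 + \<bar>v\<bar>)) \<longlongrightarrow> 0) (at 0 within {0..1 :: real})"
        by (rule tendsto_eq_intros refl | simp)+
    qed
    show "continuous_on {0..1} g"
      unfolding continuous_on_eq_continuous_within
    proof
      fix x :: real assume x: "x \<in> {0..1}"
      show "continuous (at x within {0..1}) g"
      proof (cases "x = 0")
        case True
        have "(g \<longlongrightarrow> 0 + 0 / (1 + v\<^sup>2)) (at 0 within {0..1})"
          unfolding g_def by (intro tendsto_add tendsto_divide lim tendsto_ident_at tendsto_const) (use v in auto)
        then show ?thesis using True by (simp add: continuous_within g_def)
      next
        case False
        have "isCont g x" unfolding g_def using False v x by (intro continuous_intros) auto
        then show ?thesis by (rule continuous_at_imp_continuous_at_within)
      qed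
    qed
    fix x :: real assume x: "x \<in> {0<..<1}"
    have "(g has_real_derivative 1 + ((sin (v * - ln x) + v * cos (v * - ln x)) + x * (cos (v * - ln x) * (v * - (1 / x)) - v * (sin (v * - ln x) * (v * - (1/x))))) / (1 + v\<^sup>2)) (at x)"
      unfolding g_def using x v by (auto intro!: derivative_eq_intros simp: divide_simps)
    moreover have "1 + ((sin (v * - ln x) + v * cos (v * - ln x)) + x * (cos (v * - ln x) * (v * - (1 / x)) - v * (sin (v * - ln x) * (v * - (1/x))))) / (1 + v\<^sup>2) = 1 + sin (v * - ln x)"
    proof -
      have "(s + v * c) + x * (c * (v * - (1 / x)) - v * (s * (v * - (1/x)))) = s * (1 + v\<^sup>2)" for s c
        using x by (simp add: field_simps power2_eq_square)
      from this[of "sin (v * - ln x)" "cos (v * - ln x)"] show ?thesis using v by (simp only:) simp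
    qed
    ultimately show "(g has_vector_derivative 1 + sin (v * - ln x)) (at x)"
      by (simp add: has_real_derivative_iff_has_vector_derivative)
  qed auto
  then have hb: "has_bochner_integral lborel (\<lambda>x. indicator {0<..<1} x * (1 + sin (v * (- ln x)))) (g 1 - g 0)"
    by (intro has_bochner_integral_of_has_integral) (auto simp: add.commute intro: order_trans[OF _ add_left_mono[OF sin_ge_minus_one]])
  have h1: "has_bochner_integral lborel (indicator {0<..<1} :: real \<Rightarrow> real) 1"
    using has_bochner_integral_real_indicator[of "{0<..<1 :: real}" lborel] by simp
  from has_bochner_integral_diff[OF hb h1]
  have "has_bochner_integral lborel (\<lambda>x. indicator {0<..<1} x * sin (v * (- ln x))) (g 1 - g 0 - 1)"
    by (simp add: algebra_simps)
  then show ?thesis by (simp add: has_bochner_integral_iff g_def)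
qed

text \<open>
  Equivalently 1 - x \<le> - ln x \<le> (1 - x)/x.
\<close>

lemma pole_difference_bounds:
  fixes x :: real
  assumes "0 < x" "x < 1"
  shows "0 \<le> 1 / (1 - x) - 1 / (- ln x)" "1 / (1 - x) - 1 / (- ln x) \<le> 1"
proof -
  have l: "- ln x > 0" using assms by simp
  have "1 - x \<le> - ln x" using ln_le_minus_one[of x] assms by simp
  then have "1 / (- ln x) \<le> 1 / (1 - x)" using assms l by (intro divide_left_mono mult_pos_pos) auto
  then show "0 \<le> 1 / (1 - x) - 1 / (- ln x)" by simp
  have "- ln x \<le> (1 - x) / x" using ln_le_minus_one[of "1 / x"] assms by (simp add: ln_div diff_divide_distrib)
  then have "1 / ((1 - x) / x) \<le> 1 / (- ln x)" using assms l by (intro divide_left_mono mult_pos_pos divide_pos_pos) auto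
  moreover have "1 / ((1 - x) / x) = 1 / (1 - x) - 1" using assms by (simp add: field_simps)
  ultimately show "1 / (1 - x) - 1 / (- ln x) \<le> 1" by linarith
qed

lemma integrable_unit_interval_bounded:
  fixes f :: "real \<Rightarrow> real"
  assumes [measurable]: "f \<in> borel_measurable borel" "A \<in> sets borel" and A: "A \<subseteq> {0<..<1}" and b: "\<And>x. x \<in> A \<Longrightarrow> \<bar>f x\<bar> \<le> B"
  shows "integrable lborel (\<lambda>x. indicator A x * f x)"
proof (rule Bochner_Integration.integrable_bound)
  show "integrable lborel (\<lambda>x :: real. B * indicator {0<..<1} x :: real)" by simp
  show "AE x in lborel. norm (indicator A x * f x) \<le> norm (B * indicator {0<..<1} x :: real)"
  proof (rule AE_I2)
    fix x
    show "norm (indicator A x * f x) \<le> norm (B * indicator {0<..<1} x :: real)"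
      using A b[of x] abs_ge_self[of B] by (cases "x \<in> A") (auto intro: order_trans)
  qed
qed measurable

text \<open>
  With the factor 1 - x^n the two parts have the integrals \<open>harm n\<close> and ln (n + 1): the first is a geometric
  sum, the second follows by integrating x^v over v from 0 to n. The factor changes the integral by at most
  1/(n + 1).
\<close>

lemma euler_mascheroni_integral:
  "(LINT x|lborel. indicator {0<..<1} x * (1 / (1 - x) - 1 / (- ln x))) = (euler_mascheroni :: real)"
proof -
  define d where "d x = 1 / (1 - x) - 1 / (- ln x)" for x :: real
  have [measurable]: "d \<in> borel_measurable borel" unfolding d_def by measurable
  define I where "I = (LINT x|lborel. indicator {0<..<1} x * d x)"
  have intd: "integrable lborel (\<lambda>x. indicator {0<..<1} x * d x)"
    using pole_difference_bounds by (intro integrable_unit_interval_bounded[where B = 1]) (auto simp: d_def)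
  have intp: "integrable lborel (\<lambda>x :: real. indicator {0<..<1} x * x ^ n)" for n
    by (intro integrable_unit_interval_bounded[where B = 1]) (auto simp: power_le_one)
  have pow: "(LINT x|lborel. indicator {0<..<1} x * x ^ n) = 1 / (real n + 1)" for n
  proof -
    have "(LINT x|lborel. indicator {0<..<1} x * x ^ n) = (LINT x|lborel. indicator {0<..<1} x * x powr real n)"
      by (intro Bochner_Integration.integral_cong refl) (auto simp: indicator_def powr_realpow)
    then show ?thesis by (simp add: integral_unit_interval_powr)
  qed
  have h: "(LINT x|lborel. indicator {0<..<1} x * ((1 - x ^ n) / (1 - x :: real))) = (harm n :: real)"
    "integrable lborel (\<lambda>x :: real. indicator {0<..<1} x * ((1 - x ^ n) / (1 - x)))" for n
  proof -
    have e: "indicator {0<..<1} x * ((1 - x ^ n) / (1 - x)) = (\<Sum>i<n. indicator {0<..<1} x * x ^ i)" for x :: real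
      by (auto simp: indicator_def sum_gp_strict sum_distrib_left[symmetric])
    show "integrable lborel (\<lambda>x :: real. indicator {0<..<1} x * ((1 - x ^ n) / (1 - x)))"
      unfolding e using intp by (intro Bochner_Integration.integrable_sum) auto
    have "(LINT x|lborel. indicator {0<..<1} x * ((1 - x ^ n) / (1 - x :: real))) = (\<Sum>i<n. 1 / (real i + 1))"
      unfolding e by (subst Bochner_Integration.integral_sum) (auto intro!: intp simp: pow)
    also have "\<dots> = harm n" by (induction n) (simp_all add: harm_Suc inverse_eq_divide add.commute harm_expand)
    finally show "(LINT x|lborel. indicator {0<..<1} x * ((1 - x ^ n) / (1 - x :: real))) = (harm n :: real)" .
  qed
  have l: "(LINT x|lborel. indicator {0<..<1} x * ((1 - x ^ n) / (- ln x))) = ln (real n + 1)" for n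
  proof -
    have inner: "indicator {0<..<1} x * (LINT v|lborel. indicator {0..real n} v * x powr v) = indicator {0<..<1} x * ((1 - x ^ n) / (- ln x))" for x :: real
    proof (cases "x \<in> {0<..<1}")
      case True
      have e: "x powr v = exp (v * ln x)" for v using True by (simp add: powr_def)
      have "(LINT v|lborel. indicator {0..real n} v *\<^sub>R x powr v) = x powr real n / ln x - x powr 0 / ln x"
        unfolding e by (rule integral_FTC_atLeastAtMost[where F = "\<lambda>v. exp (v * ln x) / ln x"])
           (use True in \<open>auto intro!: derivative_eq_intros continuous_intros simp: has_real_derivative_iff_has_vector_derivative[symmetric]\<close>)
      then show ?thesis using True by (simp add: powr_realpow diff_divide_distrib)
    qed simp
    have outer: "indicator {0..real n} v * (LINT x|lborel. indicator {0<..<1} x * x powr v) = indicator {0..real n} v * (1 / (v + 1))" for v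
      by (cases "v \<in> {0..real n}") (auto simp: integral_unit_interval_powr)
    have "(LINT x|lborel. indicator {0<..<1} x * (LINT v|lborel. indicator {0..real n} v * x powr v))
       = (LINT v|lborel. indicator {0..real n} v * (LINT x|lborel. indicator {0<..<1} x * x powr v))"
      by (rule unit_interval_fubini[where B = 1]) (auto simp: powr_le1)
    then have "(LINT x|lborel. indicator {0<..<1} x * ((1 - x ^ n) / (- ln x))) = (LINT v|lborel. indicator {0..real n} v * (1 / (v + 1)))"
      unfolding inner outer .
    also have "\<dots> = ln (real n + 1)"
    proof -
      have "(LINT v|lborel. indicator {0..real n} v *\<^sub>R (1 / (v + 1))) = ln (real n + 1) - ln (0 + 1)"
        by (rule integral_FTC_atLeastAtMost)
           (auto intro!: derivative_eq_intros continuous_intros simp: has_real_derivative_iff_has_vector_derivative[symmetric])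
      then show ?thesis by simp
    qed
    finally show ?thesis .
  qed
  have bound: "\<bar>I - (harm n - ln (real n + 1))\<bar> \<le> 1 / (real n + 1)" for n
  proof -
    have e: "indicator {0<..<1} x * d x - indicator {0<..<1} x * (x ^ n * d x) = indicator {0<..<1} x * ((1 - x ^ n) / (1 - x)) - indicator {0<..<1} x * ((1 - x ^ n) / (- ln x))" for x :: real
      by (simp add: d_def algebra_simps diff_divide_distrib)
    have b: "\<bar>x ^ n * d x\<bar> \<le> x ^ n" if "x \<in> {0<..<1}" for x
    proof -
      have "\<bar>d x\<bar> \<le> 1" using pole_difference_bounds[of x] that by (simp add: d_def)
      then have "x ^ n * \<bar>d x\<bar> \<le> x ^ n * 1" using that by (intro mult_left_mono) auto
      then show ?thesis using that by (simp add: abs_mult)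
    qed
    have i: "integrable lborel (\<lambda>x. indicator {0<..<1} x * (x ^ n * d x))"
    proof (rule integrable_unit_interval_bounded[where B = 1])
      show "\<bar>x ^ n * d x\<bar> \<le> 1" if "x \<in> {0<..<1}" for x
        using b[OF that] power_le_one[of x n] that by simp
    qed auto
    have "integrable lborel (\<lambda>x :: real. indicator {0<..<1} x * ((1 - x ^ n) / (- ln x)))"
    proof -
      have "indicator {0<..<1} x * ((1 - x ^ n) / (- ln x)) = indicator {0<..<1} x * ((1 - x ^ n) / (1 - x)) - (indicator {0<..<1} x * d x - indicator {0<..<1} x * (x ^ n * d x))" for x :: real
        unfolding e by simp
      then show ?thesis by (simp only:) (intro Bochner_Integration.integrable_diff h(2) intd i)
    qed
    then have "(LINT x|lborel. indicator {0<..<1} x * d x - indicator {0<..<1} x * (x ^ n * d x)) = harm n - ln (real n + 1)"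
      unfolding e using h l by (subst Bochner_Integration.integral_diff) auto
    then have "I - (LINT x|lborel. indicator {0<..<1} x * (x ^ n * d x)) = harm n - ln (real n + 1)"
      unfolding I_def using intd i by simp
    moreover have "\<bar>LINT x|lborel. indicator {0<..<1} x * (x ^ n * d x)\<bar> \<le> 1 / (real n + 1)"
    proof -
      have "\<bar>LINT x|lborel. indicator {0<..<1} x * (x ^ n * d x)\<bar> \<le> (LINT x|lborel. \<bar>indicator {0<..<1} x * (x ^ n * d x)\<bar>)" by (rule integral_abs_bound)
      also have "\<dots> \<le> (LINT x|lborel. indicator {0<..<1} x * x ^ n)"
        using i intp b by (intro integral_mono integrable_abs) (auto simp: indicator_def)
      finally show ?thesis by (simp add: pow)
    qed
    ultimately show ?thesis by linarith
  qed
  have "(\<lambda>n. I - (harm n - ln (real n + 1))) \<longlonglongrightarrow> 0"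
  proof (rule Lim_null_comparison)
    show "\<forall>\<^sub>F n in sequentially. norm (I - (harm n - ln (real n + 1))) \<le> 1 / (real n + 1)" using bound by simp
    show "(\<lambda>n. 1 / (real n + 1)) \<longlonglongrightarrow> 0" by real_asymp
  qed
  moreover have "(\<lambda>n. I - (harm n - ln (real n + 1))) \<longlonglongrightarrow> I - euler_mascheroni"
  proof -
    have "(\<lambda>n. (harm n - ln (real n)) - (ln (real n + 1) - ln (real n))) \<longlonglongrightarrow> euler_mascheroni - 0"
      by (intro tendsto_diff euler_mascheroni_LIMSEQ) real_asymp
    then show ?thesis by (intro tendsto_diff tendsto_const) simp
  qed
  ultimately have "I - euler_mascheroni = 0" by (blast intro: LIMSEQ_unique)
  then show ?thesis by (simp add: I_def d_def)
qed

text \<open>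
  The integrand K(u)/u in the variable x = 1 - u.
\<close>

definition tail_density :: "real \<Rightarrow> real \<Rightarrow> real \<Rightarrow> real" where
  "tail_density T \<sigma> x = weight_ft T \<sigma> (ln x) * x powr (-1/2) / (1 - x)"

lemma kernel_tail_lebesgue:
  assumes "T \<ge> 0" "\<sigma> \<ge> 2" "0 < \<delta>" "\<delta> < 1"
  shows "(LINT x|lborel. indicator {0<..1 - \<delta>} x * tail_density T \<sigma> x) = kernel_tail T \<sigma> \<delta>"
proof -
  define h where "h x = indicator {0<..1 - \<delta>} x * tail_density T \<sigma> x" for x
  have h: "h (1 + -1 * u) = indicator {\<delta>..1} u * (ratio_kernel T \<sigma> u / u)" for u
  proof (cases "\<delta> \<le> u \<and> u < 1")
    case True
    have "(1 - u) powr (-1/2) = exp (- ln (1 - u) / 2)" using True by (simp add: powr_def)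
    moreover have "weight_ft T \<sigma> (- y) = weight_ft T \<sigma> y" for y by (simp add: weight_ft_def)
    ultimately show ?thesis using True by (simp add: h_def ratio_kernel_def tail_density_def)
  qed (auto simp: h_def indicator_def ratio_kernel_def)
  have "(LINT x|lborel. h x) = \<bar>-1\<bar> *\<^sub>R (LINT u|lborel. h (1 + -1 * u))" by (rule lborel_integral_real_affine) simp
  also have "\<dots> = (LINT u|lborel. indicator {\<delta>..1} u *\<^sub>R (ratio_kernel T \<sigma> u / u))" unfolding h by simp
  also have "\<dots> = kernel_tail T \<sigma> \<delta>"
  proof -
    have "continuous_on {\<delta>..1} (\<lambda>u. ratio_kernel T \<sigma> u / u)"
      using assms by (intro continuous_on_divide continuous_on_subset[OF continuous_on_kernel] continuous_intros) auto
    from set_borel_integral_eq_integral(2)[OF borel_integrable_atLeastAtMost'[OF this]]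
    show ?thesis by (simp add: set_lebesgue_integral_def kernel_tail_def)
  qed
  finally show ?thesis unfolding h_def .
qed

text \<open>
  A bound by min(1, z) that can be integrated in closed form.
\<close>

lemma one_minus_exp_le: "1 - exp (- z) \<le> 2 * z / (1 + z)" if "z \<ge> 0" for z :: real
proof (cases "z \<le> 1")
  case True
  have "z * (1 + z) \<le> z * 2" using True that by (intro mult_left_mono) auto
  then have "z \<le> 2 * z / (1 + z)" using that by (simp add: field_simps)
  moreover have "1 - z \<le> exp (- z)" using exp_ge_add_one_self[of "- z"] by simp
  ultimately show ?thesis by linarith
next
  case False
  then have "1 \<le> 2 * z / (1 + z)" by simp
  moreover have "exp (- z) > 0" by simp
  ultimately show ?thesis by linarith
qed

text \<open>
  The factor x^(-1/2)/(1 - x) equals 1/y up to 3/2 exp(y/2), and the Gaussian equals 1 up to \<open>one_minus_exp_le\<close>.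
  The bound is written in terms of 1 - x \<le> y so that it has an elementary antiderivative, and its
  integral is of order \<sigma>.
\<close>

lemma tail_density_approx:
  assumes T: "T > 0" and \<sigma>: "\<sigma> \<ge> 2" and x: "0 < x" "x < 1"
  defines "y \<equiv> - ln x"
  shows "\<bar>tail_density T \<sigma> x - 2 * sin (T * y) / y\<^sup>2\<bar> \<le> 2 * \<sigma>\<^sup>2 / (1 + \<sigma>\<^sup>2 * (1 - x)\<^sup>2 / 2) + 9 / (1 / T + (1 - x))"
proof -
  define G where "G = exp (- (\<sigma> * y)\<^sup>2 / 2)"
  define P where "P = x powr (-1/2) / (1 - x)"
  have y: "y > 0" using x by (simp add: y_def)
  have xy: "1 - x \<le> y" using ln_le_minus_one[of x] x by (simp add: y_def)
  have G: "0 < G" "G \<le> 1" by (auto simp: G_def)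
  have xp: "x powr (-1/2) = exp (y / 2)" using x by (simp add: powr_def y_def)
  have P1: "1 / y \<le> P"
  proof -
    have "1 / y \<le> 1 / (1 - x)" using pole_difference_bounds(1)[OF x] by (simp add: y_def)
    also have "\<dots> \<le> P" unfolding P_def xp using x y by (intro divide_right_mono) auto
    finally show ?thesis .
  qed
  have P2: "P - 1 / y \<le> 3/2 * exp (y / 2)"
  proof -
    have "P \<le> exp (y / 2) * (1 / y + 1)"
    proof -
      have "P = exp (y / 2) * (1 / (1 - x))" unfolding P_def xp by simp
      also have "\<dots> \<le> exp (y / 2) * (1 / y + 1)" using pole_difference_bounds(2)[OF x] by (intro mult_left_mono) (auto simp: y_def)
      finally show ?thesis .
    qed
    moreover have "exp (y / 2) / y - 1 / y \<le> exp (y / 2) / 2"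
    proof -
      have "1 - y / 2 \<le> exp (- (y / 2))" using exp_ge_add_one_self[of "- (y / 2)"] by simp
      then have "exp (y / 2) * (1 - y / 2) \<le> exp (y / 2) * exp (- (y / 2))" by (intro mult_left_mono) auto
      also have "\<dots> = 1" by (simp add: exp_add[symmetric] del: exp_minus)
      finally have "(exp (y / 2) - 1) / y \<le> (exp (y / 2) * (y / 2)) / y" using y by (intro divide_right_mono) (auto simp: algebra_simps)
      then show ?thesis using y by (simp add: diff_divide_distrib)
    qed
    ultimately show ?thesis by (simp add: algebra_simps)
  qed
  have e: "tail_density T \<sigma> x - 2 * sin (T * y) / y\<^sup>2 = 2 * sin (T * y) / y * (G * (P - 1 / y) - (1 - G) / y)"
  proof -
    have "weight_ft T \<sigma> (ln x) = 2 * sin (T * y) / y * G" using x y by (simp add: weight_ft_def G_def y_def)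
    then have "tail_density T \<sigma> x = 2 * sin (T * y) / y * G * P" by (simp add: tail_density_def P_def)
    moreover have "2 * sin (T * y) / y\<^sup>2 = 2 * sin (T * y) / y * (1 / y)" by (simp add: power2_eq_square)
    moreover have "G * (P - 1 / y) - (1 - G) / y = G * P - 1 / y" by (simp add: right_diff_distrib diff_divide_distrib)
    ultimately show ?thesis by (simp only: right_diff_distrib mult.assoc)
  qed
  define S where "S = \<bar>2 * sin (T * y) / y\<bar>"
  have S0: "S \<ge> 0" by (simp add: S_def)
  have S1: "S \<le> 2 / y" using y by (simp add: S_def abs_mult divide_right_mono)
  have S2: "S \<le> 2 * T"
  proof -
    have "\<bar>sin (T * y)\<bar> \<le> \<bar>T * y\<bar>" by (rule abs_sin_x_le_abs_x)
    then show ?thesis using y T by (simp add: S_def abs_mult field_simps)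
  qed
  \<comment> \<open>the minimum of T and 1/y, in a form with an elementary antiderivative\<close>
  have S3: "S \<le> 4 / (1 / T + (1 - x))"
  proof -
    have p: "1 / T + (1 - x) > 0" using T x by (simp add: add_pos_pos)
    have "S * (1 / T) \<le> 2" using mult_right_mono[OF S2, of "1 / T"] T by simp
    moreover have "S * (1 - x) \<le> 2"
    proof -
      have "S * (1 - x) \<le> 2 / y * y" using S1 S0 xy y x by (intro mult_mono) auto
      then show ?thesis using y by simp
    qed
    ultimately have "S * (1 / T + (1 - x)) \<le> 4" by (simp add: distrib_left)
    then show ?thesis using p by (simp add: pos_le_divide_eq)
  qed
  have "\<bar>G * (P - 1 / y) - (1 - G) / y\<bar> \<le> G * (P - 1 / y) + (1 - G) / y"
  proof -
    have "0 \<le> G * (P - 1 / y)" "0 \<le> (1 - G) / y" using G P1 y by auto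
    then show ?thesis by linarith
  qed
  then have "\<bar>tail_density T \<sigma> x - 2 * sin (T * y) / y\<^sup>2\<bar> \<le> S * (G * (P - 1 / y) + (1 - G) / y)"
    unfolding e abs_mult S_def[symmetric] using S0 by (intro mult_left_mono)
  moreover have "S * (G * (P - 1 / y)) \<le> 9 / (1 / T + (1 - x))"
  proof -
    have "G * (P - 1 / y) \<le> G * (3/2 * exp (y / 2))" using P2 G by (intro mult_left_mono) auto
    also have "\<dots> = 3/2 * (exp (y / 2) * G)" by simp
    also have "\<dots> \<le> 3/2 * (exp (3/2 * y) * G)" using y G by (intro mult_left_mono mult_right_mono) auto
    also have "exp (3/2 * y) * G = exp (3/2 * y - (\<sigma> * y)\<^sup>2 / 2)" unfolding G_def exp_add[symmetric] by simp
    also have "3/2 * \<dots> \<le> 9/4" using gauss_exp_le[OF \<sigma>, of y] by simp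
    finally have "S * (G * (P - 1 / y)) \<le> 4 / (1 / T + (1 - x)) * (9/4)" using S3 S0 G P1 T x by (intro mult_mono) auto
    also have "4 / p * (9/4) = 9 / p" for p :: real by simp
    finally show ?thesis .
  qed
  moreover have "S * ((1 - G) / y) \<le> 2 * \<sigma>\<^sup>2 / (1 + \<sigma>\<^sup>2 * (1 - x)\<^sup>2 / 2)"
  proof -
    define z where "z = \<sigma>\<^sup>2 * y\<^sup>2 / 2"
    have z: "z \<ge> 0" by (simp add: z_def)
    have "1 - G \<le> 2 * z / (1 + z)" using one_minus_exp_le[OF z] by (simp add: G_def z_def power_mult_distrib)
    then have "S * ((1 - G) / y) \<le> 2 / y * ((2 * z / (1 + z)) / y)"
      using S1 S0 y G by (intro mult_mono divide_right_mono) auto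
    also have "\<dots> = 2 * \<sigma>\<^sup>2 / (1 + z)"
    proof -
      have "2 / y * ((2 * z / (1 + z)) / y) = (4 * z / y\<^sup>2) / (1 + z)" by (simp add: power2_eq_square)
      moreover have "4 * z / y\<^sup>2 = 2 * \<sigma>\<^sup>2" using y by (simp add: z_def)
      ultimately show ?thesis by simp
    qed
    also have "\<dots> \<le> 2 * \<sigma>\<^sup>2 / (1 + \<sigma>\<^sup>2 * (1 - x)\<^sup>2 / 2)"
    proof (rule divide_left_mono)
      have "(1 - x)\<^sup>2 \<le> y\<^sup>2" using xy x by (intro power_mono) auto
      then show "1 + \<sigma>\<^sup>2 * (1 - x)\<^sup>2 / 2 \<le> 1 + z" unfolding z_def by (intro add_left_mono divide_right_mono mult_left_mono) auto
      show "0 < (1 + z) * (1 + \<sigma>\<^sup>2 * (1 - x)\<^sup>2 / 2)" using z by (intro mult_pos_pos add_pos_nonneg) auto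
    qed auto
    finally show ?thesis .
  qed
  ultimately show ?thesis by (simp add: distrib_left)
qed

lemma majorant_integral:
  fixes T \<sigma> :: real
  assumes T: "T > 0" and \<sigma>: "\<sigma> > 0"
  defines "m \<equiv> \<lambda>x. 2 * \<sigma>\<^sup>2 / (1 + \<sigma>\<^sup>2 * (1 - x)\<^sup>2 / 2) + 9 / (1 / T + (1 - x))"
  shows "integrable lborel (\<lambda>x. indicator {0<..<1} x * m x)"
    and "(LINT x|lborel. indicator {0<..<1} x * m x) \<le> 9/2 * \<sigma> + 9 * ln (1 + T)"
proof -
  define F where "F x = - (2 * sqrt 2 * \<sigma>) * arctan (\<sigma> * (1 - x) / sqrt 2) - 9 * ln (1 / T + (1 - x))" for x
  have "(m has_integral (F 1 - F 0)) {0..1}"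
  proof (rule fundamental_theorem_of_calculus)
    fix x :: real assume x: "x \<in> {0..1}"
    have p: "1 / T + (1 - x) > 0" using T x by (simp add: add_pos_nonneg)
    define q where "q = 1 + (\<sigma> * (1 - x) / sqrt 2)\<^sup>2"
    have q: "q = 1 + \<sigma>\<^sup>2 * (1 - x)\<^sup>2 / 2" by (simp add: q_def power_mult_distrib power_divide)
    have q0: "q \<noteq> 0" unfolding q_def using zero_le_power2[of "\<sigma> * (1 - x) / sqrt 2"] by linarith
    have "((\<lambda>x. arctan (\<sigma> * (1 - x) / sqrt 2)) has_real_derivative - (\<sigma> / sqrt 2) / q) (at x)"
      by (auto intro!: derivative_eq_intros simp: q_def divide_inverse)
    from DERIV_cmult[OF this, of "- (2 * sqrt 2 * \<sigma>)"]
    have "((\<lambda>x. - (2 * sqrt 2 * \<sigma>) * arctan (\<sigma> * (1 - x) / sqrt 2)) has_real_derivative 2 * \<sigma>\<^sup>2 / q) (at x)"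
      by (simp add: power2_eq_square)
    moreover have "((\<lambda>x. 9 * ln (1 / T + (1 - x))) has_real_derivative - (9 / (1 / T + (1 - x)))) (at x)"
      using p by (auto intro!: derivative_eq_intros)
    ultimately have "(F has_real_derivative (2 * \<sigma>\<^sup>2 / q - - (9 / (1 / T + (1 - x))))) (at x)"
      unfolding F_def by (rule DERIV_diff)
    then show "(F has_vector_derivative m x) (at x within {0..1})"
      unfolding m_def q by (auto simp: has_real_derivative_iff_has_vector_derivative[symmetric] intro: has_field_derivative_at_within)
  qed simp
  moreover have nn: "m x \<ge> 0" if "x \<in> {0<..<1}" for x
    unfolding m_def using T that by (intro add_nonneg_nonneg divide_nonneg_nonneg mult_nonneg_nonneg) auto
  moreover have "m \<in> borel_measurable borel" unfolding m_def by measurable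
  ultimately have hb: "has_bochner_integral lborel (\<lambda>x. indicator {0<..<1} x * m x) (F 1 - F 0)"
    by (intro has_bochner_integral_of_has_integral) auto
  then show "integrable lborel (\<lambda>x. indicator {0<..<1} x * m x)" by (simp add: has_bochner_integral_iff)
  have "(LINT x|lborel. indicator {0<..<1} x * m x) = F 1 - F 0" using hb by (simp add: has_bochner_integral_iff)
  also have "\<dots> = 2 * sqrt 2 * \<sigma> * arctan (\<sigma> / sqrt 2) + 9 * (ln (1 / T + 1) - ln (1 / T))" by (simp add: F_def)
  also have "ln (1 / T + 1) - ln (1 / T) = ln (1 + T)"
  proof -
    have "1 / T + 1 = (1 + T) / T" using T by (simp add: field_simps)
    then show ?thesis using T by (simp add: ln_div)
  qed
  also have "2 * sqrt 2 * \<sigma> * arctan (\<sigma> / sqrt 2) \<le> 2 * sqrt 2 * \<sigma> * (pi / 2)"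
    using \<sigma> arctan_bounded[of "\<sigma> / sqrt 2"] by (intro mult_left_mono) auto
  also have "\<dots> \<le> 9/2 * \<sigma>"
  proof -
    have "sqrt 2 \<le> 1.4143" by (rule real_le_lsqrt) (simp_all add: power2_eq_square)
    then have "sqrt 2 * pi \<le> 1.4143 * 3.1416" using pi_approx by (intro mult_mono) auto
    then have "sqrt 2 * pi * \<sigma> \<le> 9/2 * \<sigma>" using \<sigma> by (intro mult_right_mono) auto
    then show ?thesis by (simp add: algebra_simps)
  qed
  finally show "(LINT x|lborel. indicator {0<..<1} x * m x) \<le> 9/2 * \<sigma> + 9 * ln (1 + T)" by simp
qed

lemma unit_interval_truncate:
  fixes f :: "real \<Rightarrow> real"
  assumes [measurable]: "f \<in> borel_measurable borel" and b: "\<And>x. x \<in> {0<..<1} \<Longrightarrow> \<bar>f x\<bar> \<le> B" and \<delta>: "0 < \<delta>" "\<delta> < 1"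
  shows "\<bar>(LINT x|lborel. indicator {0<..1 - \<delta>} x * f x) - (LINT x|lborel. indicator {0<..<1} x * f x)\<bar> \<le> B * \<delta>"
proof -
  have i: "integrable lborel (\<lambda>x. indicator A x * f x)" if "A \<in> sets borel" "A \<subseteq> {0<..<1}" for A
    using that b by (intro integrable_unit_interval_bounded[where B = B]) auto
  have e: "indicator {0<..1 - \<delta>} x * f x - indicator {0<..<1} x * f x = - (indicator {1 - \<delta><..<1} x * f x)" for x
    using \<delta> by (auto simp: indicator_def)
  have "(LINT x|lborel. indicator {0<..1 - \<delta>} x * f x) - (LINT x|lborel. indicator {0<..<1} x * f x) = - (LINT x|lborel. indicator {1 - \<delta><..<1} x * f x)"
    unfolding Bochner_Integration.integral_minus[symmetric] e[symmetric]
    by (rule Bochner_Integration.integral_diff[symmetric]) (use \<delta> in \<open>auto intro!: i\<close>)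
  moreover have "\<bar>LINT x|lborel. indicator {1 - \<delta><..<1} x * f x\<bar> \<le> (LINT x|lborel. \<bar>indicator {1 - \<delta><..<1} x * f x\<bar>)"
    by (rule integral_abs_bound)
  moreover have "\<dots> \<le> (LINT x|lborel. B * indicator {1 - \<delta><..<1} x)"
  proof (intro integral_mono integrable_abs i)
    show "integrable lborel (\<lambda>x :: real. B * indicator {1 - \<delta><..<1} x :: real)"
      using \<delta> by (intro integrable_mult_right integrable_real_indicator) auto
  qed (use \<delta> b in \<open>auto simp: indicator_def\<close>)
  moreover have "(LINT x|lborel. B * indicator {1 - \<delta><..<1} x) = B * \<delta>" using \<delta> by simp
  ultimately show ?thesis by linarith
qed

text \<open>
  By the fundamental theorem T/y - sin(T y)/y^2 is the integral of (T - v) sin(v y) over v from 0 to T. Fubini's theorem and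
  \<open>integral_unit_interval_sin\<close> leave the integral of (T - v) v/(1 + v^2).
\<close>

lemma integral_sine_defect:
  fixes T :: real
  assumes T: "T > 0"
  defines "P \<equiv> \<lambda>x. T / (- ln x) - sin (T * (- ln x)) / (ln x)\<^sup>2"
  shows "x \<in> {0<..<1} \<Longrightarrow> \<bar>P x\<bar> \<le> T\<^sup>2"
    and "(LINT x|lborel. indicator {0<..<1} x * P x) = T * ln (1 + T\<^sup>2) / 2 - T + arctan T"
proof -
  have inner: "(LINT v|lborel. indicator {0..T} v * ((T - v) * sin (v * (- ln x)))) = P x" if "x \<in> {0<..<1}" for x
  proof -
    define y where "y = - ln x"
    have y: "y \<noteq> 0" "ln x = - y" using that by (auto simp: y_def)
    define c where "c = 1 / y"
    have c: "y * c = 1" using y by (simp add: c_def)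
    define F where "F v = - (T - v) * cos (v * y) * c - sin (v * y) * c\<^sup>2" for v
    have "(LINT v|lborel. indicator {0..T} v *\<^sub>R ((T - v) * sin (v * y))) = F T - F 0"
    proof (rule integral_FTC_atLeastAtMost)
      fix v
      have "(F has_real_derivative (cos (v * y) + (T - v) * (sin (v * y) * y)) * c - cos (v * y) * y * c\<^sup>2) (at v within {0..T})"
        unfolding F_def by (auto intro!: derivative_eq_intros simp: algebra_simps)
      moreover have "(cos (v * y) + (T - v) * (sin (v * y) * y)) * c - cos (v * y) * y * c\<^sup>2 = (T - v) * sin (v * y)"
      proof -
        have "(a + u * (b * y)) * c - a * y * c\<^sup>2 = a * c * (1 - y * c) + u * b * (y * c)" for a b u by (simp add: algebra_simps power2_eq_square)
        then show ?thesis unfolding c by simp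
      qed
      ultimately show "(F has_vector_derivative (T - v) * sin (v * y)) (at v within {0..T})"
        by (simp add: has_real_derivative_iff_has_vector_derivative)
    qed (use T in \<open>auto intro!: continuous_intros\<close>)
    then show ?thesis using y by (simp add: F_def P_def c_def power_divide)
  qed
  have ind: "integrable lborel (\<lambda>v :: real. indicator {0..T} v * T)"
    using T by (intro integrable_mult_left integrable_real_indicator) auto
  show "\<bar>P x\<bar> \<le> T\<^sup>2" if x: "x \<in> {0<..<1}"
  proof -
    have b: "\<bar>indicator {0..T} v * ((T - v) * sin (v * (- ln x)))\<bar> \<le> indicator {0..T} v * T" for v
    proof -
      have "\<bar>(T - v) * sin (v * (- ln x))\<bar> \<le> T * 1" if "v \<in> {0..T}"
        unfolding abs_mult using that by (intro mult_mono abs_sin_le_one) auto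
      then show ?thesis by (simp add: indicator_def)
    qed
    have i: "integrable lborel (\<lambda>v. indicator {0..T} v * ((T - v) * sin (v * (- ln x))))"
      by (rule Bochner_Integration.integrable_bound[OF ind]) (use b T in \<open>auto intro: order_trans[OF b]\<close>)
    have "\<bar>P x\<bar> \<le> (LINT v|lborel. \<bar>indicator {0..T} v * ((T - v) * sin (v * (- ln x)))\<bar>)"
      unfolding inner[OF x, symmetric] by (rule integral_abs_bound)
    also have "\<dots> \<le> (LINT v|lborel. indicator {0..T} v * T)" using b by (intro integral_mono integrable_abs i ind) auto
    also have "\<dots> = T\<^sup>2" using T by (simp add: power2_eq_square)
    finally show ?thesis .
  qed
  have "(LINT x|lborel. indicator {0<..<1} x * P x)
      = (LINT x|lborel. indicator {0<..<1} x * (LINT v|lborel. indicator {0..T} v * ((T - v) * sin (v * (- ln x)))))"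
  proof (intro Bochner_Integration.integral_cong refl)
    fix x :: real
    show "indicator {0<..<1} x * P x = indicator {0<..<1} x * (LINT v|lborel. indicator {0..T} v * ((T - v) * sin (v * (- ln x))))"
      using inner[of x] by (cases "x \<in> {0<..<1}") auto
  qed
  also have "\<dots> = (LINT v|lborel. indicator {0..T} v * (LINT x|lborel. indicator {0<..<1} x * ((T - v) * sin (v * (- ln x)))))"
  proof (rule unit_interval_fubini)
    show "\<bar>(T - v) * sin (v * (- ln x))\<bar> \<le> T * 1" if "v \<in> {0..T}" for v x
      unfolding abs_mult using that by (intro mult_mono abs_sin_le_one) auto
  qed measurable
  also have "\<dots> = (LINT v|lborel. indicator {0..T} v *\<^sub>R ((T - v) * (v / (1 + v\<^sup>2))))"
  proof -
    have "(LINT x|lborel. indicator {0<..<1} x * ((T - v) * sin (v * (- ln x)))) = (T - v) * (v / (1 + v\<^sup>2))" for v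
      unfolding integral_unit_interval_sin[symmetric] integral_mult_right_zero[symmetric] by (simp only: mult.left_commute)
    then show ?thesis by simp
  qed
  also have "\<dots> = (T * ln (1 + T\<^sup>2) / 2 - T + arctan T) - (T * ln (1 + 0\<^sup>2) / 2 - 0 + arctan 0)"
  proof (rule integral_FTC_atLeastAtMost[where F = "\<lambda>v. T * ln (1 + v\<^sup>2) / 2 - v + arctan v"])
    have p: "1 + v\<^sup>2 \<noteq> 0" for v :: real using zero_le_power2[of v] by linarith
    have p': "1 + v\<^sup>2 > 0" for v :: real using zero_le_power2[of v] by linarith
    show "continuous_on {0..T} (\<lambda>v. (T - v) * (v / (1 + v\<^sup>2)))" using p by (intro continuous_intros) auto
    fix v
    have "((\<lambda>v. ln (1 + v\<^sup>2)) has_real_derivative (2 * v) * inverse (1 + v\<^sup>2)) (at v)"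
      using p'[of v] by (auto intro!: derivative_eq_intros simp: divide_inverse)
    then have "((\<lambda>v. T / 2 * ln (1 + v\<^sup>2) - v + arctan v) has_real_derivative T / 2 * ((2 * v) * inverse (1 + v\<^sup>2)) - 1 + inverse (1 + v\<^sup>2)) (at v)"
      by (intro DERIV_add DERIV_diff DERIV_cmult DERIV_ident DERIV_arctan)
    then have "((\<lambda>v. T * ln (1 + v\<^sup>2) / 2 - v + arctan v) has_real_derivative T / 2 * ((2 * v) * inverse (1 + v\<^sup>2)) - 1 + inverse (1 + v\<^sup>2)) (at v within {0..T})"
      by (simp add: has_field_derivative_at_within)
    moreover have "T / 2 * ((2 * v) * inverse (1 + v\<^sup>2)) - 1 + inverse (1 + v\<^sup>2) = (T - v) * (v / (1 + v\<^sup>2))"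
    proof -
      define q where "q = inverse (1 + v\<^sup>2)"
      have "q + v\<^sup>2 * q = 1" using p[of v] by (simp add: q_def field_simps)
      then show ?thesis unfolding divide_inverse q_def[symmetric] by (simp add: algebra_simps power2_eq_square)
    qed
    ultimately show "((\<lambda>v. T * ln (1 + v\<^sup>2) / 2 - v + arctan v) has_vector_derivative (T - v) * (v / (1 + v\<^sup>2))) (at v within {0..T})"
      by (simp add: has_real_derivative_iff_has_vector_derivative)
  qed (use T in auto)
  finally show "(LINT x|lborel. indicator {0<..<1} x * P x) = T * ln (1 + T\<^sup>2) / 2 - T + arctan T" by simp
qed

text \<open>
  The density is split into the difference of \<open>tail_density_approx\<close> and 2 sin(T y)/y^2. The latter is 2T/(1 - x), with integral
  2T ln N, minus 2T times the integrand for Euler's constant, minus twice the integrand of \<open>integral_sine_defect\<close>.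
\<close>

lemma kernel_tail_evaluation:
  assumes T: "T > 0" and \<sigma>: "\<sigma> \<ge> 2" and N: "N \<ge> 2"
  shows "\<bar>kernel_tail T \<sigma> (1 / real N) - (2 * T * ln (real N) - 2 * T * euler_mascheroni - (T * ln (1 + T\<^sup>2) - 2 * T + 2 * arctan T))\<bar>
     \<le> 9/2 * \<sigma> + 9 * ln (1 + T) + 2 * T * (1 + T) / real N"
proof -
  define \<delta> where "\<delta> = 1 / real N"
  have \<delta>: "0 < \<delta>" "\<delta> < 1" using N by (auto simp: \<delta>_def)
  define I where "I f = (LINT x|lborel. indicator {0<..1 - \<delta>} x * f x)" for f :: "real \<Rightarrow> real"
  define P where "P x = T / (- ln x) - sin (T * (- ln x)) / (ln x)\<^sup>2" for x
  define d where "d x = 1 / (1 - x) - 1 / (- ln x)" for x :: real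
  define D where "D x = tail_density T \<sigma> x - 2 * sin (T * (- ln x)) / (- ln x)\<^sup>2" for x
  define m where "m x = 2 * \<sigma>\<^sup>2 / (1 + \<sigma>\<^sup>2 * (1 - x)\<^sup>2 / 2) + 9 / (1 / T + (1 - x))" for x
  have [measurable]: "P \<in> borel_measurable borel" "d \<in> borel_measurable borel" "D \<in> borel_measurable borel" "m \<in> borel_measurable borel"
    unfolding P_def d_def D_def m_def tail_density_def by measurable
  have Dm: "\<bar>indicator {0<..1 - \<delta>} x * D x\<bar> \<le> indicator {0<..<1} x * m x" for x
  proof (cases "x \<in> {0<..<1}")
    case True
    then have "\<bar>D x\<bar> \<le> m x" using tail_density_approx[OF T \<sigma>, of x] by (simp add: D_def m_def)
    moreover from this have "0 \<le> m x" by linarith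
    ultimately show ?thesis using True by (simp add: indicator_def)
  qed (use \<delta> in auto)
  note mi = majorant_integral[OF T, of \<sigma>, folded m_def]
  have iD: "integrable lborel (\<lambda>x. indicator {0<..1 - \<delta>} x * D x)"
    by (rule Bochner_Integration.integrable_bound[OF mi(1)]) (use \<sigma> in \<open>auto intro!: AE_I2 order_trans[OF Dm]\<close>)
  have ID: "\<bar>I D\<bar> \<le> 9/2 * \<sigma> + 9 * ln (1 + T)"
  proof -
    have "\<bar>I D\<bar> \<le> (LINT x|lborel. \<bar>indicator {0<..1 - \<delta>} x * D x\<bar>)" unfolding I_def by (rule integral_abs_bound)
    also have "\<dots> \<le> (LINT x|lborel. indicator {0<..<1} x * m x)" using Dm \<sigma> by (intro integral_mono integrable_abs iD mi) auto
    finally show ?thesis using mi(2) \<sigma> by linarith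
  qed
  have bd: "\<bar>d x\<bar> \<le> 1" if "x \<in> {0<..<1}" for x using pole_difference_bounds[of x] that by (simp add: d_def)
  have bP: "\<bar>P x\<bar> \<le> T\<^sup>2" if "x \<in> {0<..<1}" for x unfolding P_def by (rule integral_sine_defect(1)[OF T that])
  have id: "integrable lborel (\<lambda>x. indicator {0<..1 - \<delta>} x * d x)"
    by (rule integrable_unit_interval_bounded[where B = 1]) (use \<delta> bd in auto)
  have iP: "integrable lborel (\<lambda>x. indicator {0<..1 - \<delta>} x * P x)"
    by (rule integrable_unit_interval_bounded[where B = "T\<^sup>2"]) (use \<delta> bP in auto)
  have i1: "integrable lborel (\<lambda>x. indicator {0<..1 - \<delta>} x * (1 / (1 - x)))"
  proof (rule integrable_unit_interval_bounded[where B = "1 / \<delta>"])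
    show "\<bar>1 / (1 - x)\<bar> \<le> 1 / \<delta>" if "x \<in> {0<..1 - \<delta>}" for x using that \<delta> by (auto simp: frac_le)
  qed (use \<delta> in auto)
  have Id: "\<bar>I d - euler_mascheroni\<bar> \<le> \<delta>"
    using unit_interval_truncate[of d 1 \<delta>] bd \<delta> euler_mascheroni_integral[folded d_def] by (simp add: I_def)
  have IP: "\<bar>I P - (T * ln (1 + T\<^sup>2) / 2 - T + arctan T)\<bar> \<le> T\<^sup>2 * \<delta>"
    using unit_interval_truncate[of P "T\<^sup>2" \<delta>] bP \<delta> integral_sine_defect(2)[OF T, folded P_def] by (simp add: I_def)
  have I1: "I (\<lambda>x. 1 / (1 - x)) = ln (real N)"
  proof -
    have "(LINT x|lborel. indicator {0..1 - \<delta>} x *\<^sub>R (1 / (1 - x))) = - ln (1 - (1 - \<delta>)) - - ln (1 - 0)"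
      by (rule integral_FTC_atLeastAtMost[where F = "\<lambda>x. - ln (1 - x)"])
         (use \<delta> in \<open>auto intro!: derivative_eq_intros continuous_intros simp: has_real_derivative_iff_has_vector_derivative[symmetric]\<close>)
    moreover have "I (\<lambda>x. 1 / (1 - x)) = (LINT x|lborel. indicator {0..1 - \<delta>} x *\<^sub>R (1 / (1 - x)))"
      unfolding I_def
    proof (rule integral_cong_AE)
      have "AE x in lborel. x \<noteq> (0 :: real)" by (rule AE_lborel_singleton)
      then show "AE x in lborel. indicator {0<..1 - \<delta>} x * (1 / (1 - x)) = indicator {0..1 - \<delta>} x *\<^sub>R (1 / (1 - x))"
        by eventually_elim (auto simp: indicator_def)
    qed measurable
    ultimately show ?thesis using N by (simp add: \<delta>_def ln_div)
  qed
  have "kernel_tail T \<sigma> \<delta> = I D - 2 * T * I d + 2 * T * I (\<lambda>x. 1 / (1 - x)) - 2 * I P"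
  proof -
    have e: "indicator {0<..1 - \<delta>} x * tail_density T \<sigma> x = indicator {0<..1 - \<delta>} x * D x - 2 * T * (indicator {0<..1 - \<delta>} x * d x)
      + 2 * T * (indicator {0<..1 - \<delta>} x * (1 / (1 - x))) - 2 * (indicator {0<..1 - \<delta>} x * P x)" for x
    proof -
      have "t = (t - 2 * s / q) - 2 * T * (a - b) + 2 * T * a - 2 * (T * b - s / q)" for t s q a b :: real
        by (simp add: algebra_simps)
      from this[of "tail_density T \<sigma> x" "sin (T * (- ln x))" "(ln x)\<^sup>2" "1 / (1 - x)" "1 / (- ln x)"]
      show ?thesis by (auto simp: indicator_def D_def d_def P_def)
    qed
    have hb: "has_bochner_integral lborel (\<lambda>x. indicator {0<..1 - \<delta>} x * f x) (I f)" if "integrable lborel (\<lambda>x. indicator {0<..1 - \<delta>} x * f x)" for f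
      unfolding I_def using that by (rule has_bochner_integral_integrable)
    have "has_bochner_integral lborel (\<lambda>x. indicator {0<..1 - \<delta>} x * tail_density T \<sigma> x) (I D - 2 * T * I d + 2 * T * I (\<lambda>x. 1 / (1 - x)) - 2 * I P)"
      unfolding e by (intro has_bochner_integral_diff has_bochner_integral_add has_bochner_integral_mult_right hb iD id iP i1)
    then show ?thesis using kernel_tail_lebesgue[OF _ \<sigma> \<delta>, of T] T by (simp add: has_bochner_integral_iff)
  qed
  then have eq: "kernel_tail T \<sigma> \<delta> - (2 * T * ln (real N) - 2 * T * euler_mascheroni - (T * ln (1 + T\<^sup>2) - 2 * T + 2 * arctan T))
     = I D - 2 * T * (I d - euler_mascheroni) - 2 * (I P - (T * ln (1 + T\<^sup>2) / 2 - T + arctan T))"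
    using I1 by (simp add: algebra_simps)
  have tri: "\<bar>a - b - 2 * c\<bar> \<le> A + B + 2 * C" if "\<bar>a\<bar> \<le> A" "\<bar>b\<bar> \<le> B" "\<bar>c\<bar> \<le> C" for a b c A B C :: real
    using that by linarith
  have "\<bar>2 * T * (I d - euler_mascheroni)\<bar> \<le> 2 * T * \<delta>" using Id T unfolding abs_mult by (intro mult_mono) auto
  from tri[OF ID this IP]
  have "\<bar>kernel_tail T \<sigma> \<delta> - (2 * T * ln (real N) - 2 * T * euler_mascheroni - (T * ln (1 + T\<^sup>2) - 2 * T + 2 * arctan T))\<bar>
    \<le> 9/2 * \<sigma> + 9 * ln (1 + T) + 2 * T * \<delta> + 2 * (T\<^sup>2 * \<delta>)" unfolding eq .
  also have "\<dots> = 9/2 * \<sigma> + 9 * ln (1 + T) + 2 * T * (1 + T) / real N"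
    by (simp add: \<delta>_def power2_eq_square algebra_simps add_divide_distrib)
  finally show ?thesis unfolding \<delta>_def .
qed

section \<open>The error of a single shift\<close>

text \<open>
  The bound for 2/r times \<open>osc_bound\<close>, with T = Q^3 and the cut point 0.4 Q^2 \<surd>r. For r \<le> 21 u^2 Q the cutoff is \<xi> = Q/(2.5 u), beyond
  that it is Q/(8 u). The smaller cutoff keeps the Gaussian factor negligible even after summation over
  very many r, and 21 u^2 Q > 64 u^2 Q/\<pi> guarantees that the van der Corput range is then empty; the larger one is affordable for
  few r and improves \<surd>(T/\<xi>), the leading term. At r = 10.24 (u Q)^2 the point \<xi> r passes the cut point.
\<close>

definition shift_majorant :: "real \<Rightarrow> real \<Rightarrow> real \<Rightarrow> real" where
  "shift_majorant Q u r = 6 / r + 2 / (Q * r)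
     + (if r \<le> 10.24 * (u * Q)\<^sup>2 then 0.94 / sqrt r + 1.92 * Q / r + 4.8 / (Q * sqrt r) else 30.72 * (u * Q) ^ 3 / r\<^sup>2)
     + (if r \<le> 21 * u\<^sup>2 * Q then 5.14 * u * Q / r + 2 * u\<^sup>2 * Q / r\<^sup>2 + 30.4 * Q powr (3/4) * r powr (-3/4) else 0)"

lemma trapezoid_terms_le:
  fixes Q s :: real
  assumes Q: "Q \<ge> 1" and s: "s \<ge> 1" and m: "m \<ge> 0.4 * Q\<^sup>2 * s"
  shows "2 / s\<^sup>2 * (0.03 * ((Q ^ 3 * s\<^sup>2)\<^sup>2 / m ^ 3)) \<le> 0.94 / s"
    and "2 / s\<^sup>2 * (0.09 * (Q ^ 3 * s\<^sup>2 / m\<^sup>2)) \<le> 2 / (Q * s\<^sup>2)"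
    and "2 / s\<^sup>2 * (6 * ((0.4 * Q\<^sup>2 * s) * (0.4 * Q\<^sup>2 * s + s\<^sup>2)) / (Q ^ 3 * s\<^sup>2)) = 1.92 * Q / s\<^sup>2 + 4.8 / (Q * s)"
proof -
  define n where "n = 0.4 * Q\<^sup>2 * s"
  have n: "n > 0" "n \<le> m" using assms by (auto simp: n_def)
  have "(Q ^ 3 * s\<^sup>2)\<^sup>2 / m ^ 3 \<le> (Q ^ 3 * s\<^sup>2)\<^sup>2 / n ^ 3"
    using n by (intro divide_left_mono power_mono mult_pos_pos zero_less_power) auto
  then have "2 / s\<^sup>2 * (0.03 * ((Q ^ 3 * s\<^sup>2)\<^sup>2 / m ^ 3)) \<le> 2 / s\<^sup>2 * (0.03 * ((Q ^ 3 * s\<^sup>2)\<^sup>2 / n ^ 3))"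
    by (intro mult_left_mono) auto
  also have "\<dots> = 0.9375 / s"
    using Q s by (simp add: n_def field_simps eval_nat_numeral)
  also have "\<dots> \<le> 0.94 / s" using s by (intro divide_right_mono) auto
  finally show "2 / s\<^sup>2 * (0.03 * ((Q ^ 3 * s\<^sup>2)\<^sup>2 / m ^ 3)) \<le> 0.94 / s" .
  have "Q ^ 3 * s\<^sup>2 / m\<^sup>2 \<le> Q ^ 3 * s\<^sup>2 / n\<^sup>2"
    using n Q by (intro divide_left_mono power_mono mult_pos_pos zero_less_power mult_nonneg_nonneg) auto
  then have "2 / s\<^sup>2 * (0.09 * (Q ^ 3 * s\<^sup>2 / m\<^sup>2)) \<le> 2 / s\<^sup>2 * (0.09 * (Q ^ 3 * s\<^sup>2 / n\<^sup>2))"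
    by (intro mult_left_mono) auto
  also have "\<dots> = 1.125 / (Q * s\<^sup>2)"
    using Q s by (simp add: n_def field_simps eval_nat_numeral)
  also have "\<dots> \<le> 2 / (Q * s\<^sup>2)" using Q s by (intro divide_right_mono) auto
  finally show "2 / s\<^sup>2 * (0.09 * (Q ^ 3 * s\<^sup>2 / m\<^sup>2)) \<le> 2 / (Q * s\<^sup>2)" .
  show "2 / s\<^sup>2 * (6 * ((0.4 * Q\<^sup>2 * s) * (0.4 * Q\<^sup>2 * s + s\<^sup>2)) / (Q ^ 3 * s\<^sup>2)) = 1.92 * Q / s\<^sup>2 + 4.8 / (Q * s)"
    using Q s by (simp add: field_simps eval_nat_numeral)
qed

lemma vdc_bound_le:
  fixes Q u r :: real
  assumes Q: "Q \<ge> 1" and u: "u \<ge> 8.3" and r: "r \<ge> 1"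
  shows "2 / r * vdc_bound (Q ^ 3) r (Q / (2.5 * u)) \<le> 5.14 * u * Q / r + 2 * u\<^sup>2 * Q / r\<^sup>2 + 30.4 * Q powr (3/4) * r powr (-3/4)"
proof -
  have "Q ^ 3 / (Q / (2.5 * u)) = 2.5 * u * Q\<^sup>2" using Q u by (simp add: field_simps eval_nat_numeral)
  then have a: "sqrt (Q ^ 3 / (Q / (2.5 * u))) \<le> 0.55 * u * Q"
  proof (simp only:, intro real_le_lsqrt)
    have "2.5 * u \<le> (0.3025 * u) * u" using u by (intro mult_right_mono[of "2.5" "0.3025 * u"]) auto
    then have "2.5 * u * Q\<^sup>2 \<le> ((0.3025 * u) * u) * Q\<^sup>2" by (rule mult_right_mono) simp
    also have "\<dots> = (0.55 * u * Q)\<^sup>2" by (simp add: power2_eq_square)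
    finally show "2.5 * u * Q\<^sup>2 \<le> (0.55 * u * Q)\<^sup>2" .
  qed (use Q u in auto)
  have b: "Q ^ 3 / ((Q / (2.5 * u))\<^sup>2 * r) = 6.25 * u\<^sup>2 * Q / r" using Q u r by (simp add: field_simps eval_nat_numeral)
  have c: "2 / r * (Q ^ 3 * r) powr (1/4) = 2 * (Q powr (3/4) * r powr (-3/4))"
  proof -
    have "(Q ^ 3 * r) powr (1/4) = Q powr (3/4) * r powr (1/4)"
    proof -
      have "Q powr 3 = Q ^ 3" using Q by simp
      then have "(Q ^ 3 * r) powr (1/4) = (Q powr 3) powr (1/4) * r powr (1/4)" using Q r by (simp only: powr_mult)
      then show ?thesis by (simp add: powr_powr)
    qed
    moreover have "r powr (1/4) / r = r powr (-3/4)" using r powr_diff[of r "1/4" 1] by simp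
    moreover have "2 / r * (Q powr (3/4) * r powr (1/4)) = 2 * (Q powr (3/4) * (r powr (1/4) / r))" by simp
    ultimately show ?thesis by simp
  qed
  have "2 / r * vdc_bound (Q ^ 3) r (Q / (2.5 * u))
     = 2 / r * (4.67 * sqrt (Q ^ 3 / (Q / (2.5 * u)))) + 2 / r * (0.16 * (6.25 * u\<^sup>2 * Q / r)) + 15.2 * (2 / r * (Q ^ 3 * r) powr (1/4))"
    unfolding vdc_bound_def b by (simp only: distrib_left mult.left_commute)
  also have "2 / r * (4.67 * sqrt (Q ^ 3 / (Q / (2.5 * u)))) \<le> 2 / r * (4.67 * (0.55 * u * Q))"
    using r a by (intro mult_left_mono) auto
  also have "\<dots> \<le> 5.14 * u * Q / r"
  proof -
    have "0 \<le> u * Q / r" using Q u r by simp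
    then have "5.137 * (u * Q / r) \<le> 5.14 * (u * Q / r)" by (intro mult_right_mono) auto
    moreover have "2 / r * (4.67 * (0.55 * u * Q)) = 5.137 * (u * Q / r)" "5.14 * u * Q / r = 5.14 * (u * Q / r)" by simp_all
    ultimately show ?thesis by (simp only:)
  qed
  also have "2 / r * (0.16 * (6.25 * u\<^sup>2 * Q / r)) = 2 * u\<^sup>2 * Q / r\<^sup>2" by (simp add: power2_eq_square)
  finally show ?thesis unfolding c by simp
qed

text \<open>
  Each term of \<open>osc_bound\<close> becomes a power of r; what has to be checked is which of the conditional terms
  are present in which range of r.
\<close>

lemma osc_bound_le_majorant:
  fixes Q u r :: real
  assumes Q: "Q \<ge> 10 ^ 9" and u: "u \<ge> 8.3" and r: "r \<ge> 1"
  defines "\<xi> \<equiv> if r \<le> 21 * u\<^sup>2 * Q then Q / (2.5 * u) else Q / (8 * u)"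
  shows "2 / r * osc_bound (Q ^ 3) r \<xi> (0.4 * Q\<^sup>2 * sqrt r) \<le> shift_majorant Q u r"
proof -
  define s where "s = sqrt r"
  have s: "s \<ge> 1" "r = s\<^sup>2" using r by (auto simp: s_def)
  define n where "n = 0.4 * Q\<^sup>2 * s"
  have Q1: "Q \<ge> 1" using Q by simp
  have n0: "n > 0" using Q1 s by (simp add: n_def)
  define m where "m = max n (\<xi> * r)"
  have m: "m \<ge> n" "m \<ge> \<xi> * r" by (auto simp: m_def)
  note t = trapezoid_terms_le[OF Q1 s(1), of m, folded n_def s(2), OF m(1)]
  define A where "A = 2 / r * (0.03 * ((Q ^ 3 * r)\<^sup>2 / m ^ 3))"
  define B where "B = 2 / r * (if \<xi> * r < n then 6 * (n * (n + r)) / (Q ^ 3 * r) else 0)"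
  define C where "C = 2 / r * (if \<xi> * r < sqrt (Q ^ 3 * r / pi) then vdc_bound (Q ^ 3) r \<xi> else 0)"
  have B0: "0 \<le> 6 * (n * (n + r)) / (Q ^ 3 * r)" using n0 Q1 r by simp
  have split: "2 / r * osc_bound (Q ^ 3) r \<xi> (0.4 * Q\<^sup>2 * sqrt r) = 6 / r + A + 2 / r * (0.09 * (Q ^ 3 * r / m\<^sup>2)) + B + C"
    unfolding osc_bound_def A_def B_def C_def s_def[symmetric] n_def[symmetric] m_def[symmetric]
    by (simp only: distrib_left)
  have AB: "A + B \<le> (if r \<le> 10.24 * (u * Q)\<^sup>2 then 0.94 / s + 1.92 * Q / r + 4.8 / (Q * s) else 30.72 * (u * Q) ^ 3 / r\<^sup>2)"
  proof (cases "r \<le> 10.24 * (u * Q)\<^sup>2")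
    case True
    have "B \<le> 2 / r * (6 * (n * (n + r)) / (Q ^ 3 * r))" unfolding B_def using r B0 by (intro mult_left_mono) auto
    then show ?thesis using t True unfolding A_def by simp
  next
    case False
    have "21 * u\<^sup>2 * Q \<le> 10.24 * (u * Q)\<^sup>2"
    proof -
      have "21 * (u\<^sup>2 * Q) \<le> (10.24 * Q) * (u\<^sup>2 * Q)" using Q u by (intro mult_right_mono) auto
      then show ?thesis by (simp add: power2_eq_square mult.commute mult.left_commute)
    qed
    then have \<xi>: "\<xi> = Q / (8 * u)" using False by (simp add: \<xi>_def)
    have "3.2 * (u * Q) \<le> s"
    proof (rule power2_le_imp_le)
      show "(3.2 * (u * Q))\<^sup>2 \<le> s\<^sup>2" using False unfolding power_mult_distrib[of "3.2"] s(2) by (simp add: power2_eq_square)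
    qed (use s in auto)
    then have "(0.125 * Q / u * s) * (3.2 * (u * Q)) \<le> (0.125 * Q / u * s) * s" using Q1 u s by (intro mult_left_mono) auto
    then have "n \<le> \<xi> * r" unfolding n_def \<xi> s(2) using u by (simp add: field_simps power2_eq_square)
    then have "B = 0" by (simp add: B_def)
    moreover have "A \<le> 30.72 * (u * Q) ^ 3 / r\<^sup>2"
    proof -
      have "0 < \<xi>" "0 < \<xi> * r" using Q1 u r by (simp_all add: \<xi>)
      have "A \<le> 2 / r * (0.03 * ((Q ^ 3 * r)\<^sup>2 / (\<xi> * r) ^ 3))" unfolding A_def
        using r m less_le_trans[OF \<open>0 < \<xi> * r\<close> m(2)] \<open>0 < \<xi>\<close> by (intro mult_left_mono divide_left_mono power_mono mult_pos_pos zero_less_power) auto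
      also have "\<dots> = 30.72 * (u * Q) ^ 3 / r\<^sup>2" unfolding \<xi> using Q1 u r by (simp add: field_simps eval_nat_numeral)
      finally show ?thesis .
    qed
    ultimately show ?thesis using False by simp
  qed
  have C: "C \<le> (if r \<le> 21 * u\<^sup>2 * Q then 5.14 * u * Q / r + 2 * u\<^sup>2 * Q / r\<^sup>2 + 30.4 * Q powr (3/4) * r powr (-3/4) else 0)"
  proof (cases "r \<le> 21 * u\<^sup>2 * Q")
    case True
    have v0: "0 \<le> vdc_bound (Q ^ 3) r \<xi>" using True Q1 u r unfolding vdc_bound_def \<xi>_def
      by (intro add_nonneg_nonneg mult_nonneg_nonneg real_sqrt_ge_zero divide_nonneg_nonneg) auto
    then have "C \<le> 2 / r * vdc_bound (Q ^ 3) r \<xi>" unfolding C_def using r by (intro mult_left_mono) auto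
    then show ?thesis using vdc_bound_le[OF Q1 u r] True by (simp add: \<xi>_def)
  next
    case False
    then have \<xi>: "\<xi> = Q / (8 * u)" by (simp add: \<xi>_def)
    have "sqrt (Q ^ 3 * r / pi) \<le> \<xi> * r"
    proof (rule real_le_lsqrt)
      have "64 \<le> 21 * pi" using pi_approx by simp
      then have "64 * (u\<^sup>2 * Q) \<le> (21 * pi) * (u\<^sup>2 * Q)" using Q1 by (intro mult_right_mono) auto
      also have "\<dots> \<le> r * pi" using False by (simp add: mult.commute mult.left_commute)
      finally have "64 * u\<^sup>2 * Q / pi \<le> r" by (simp add: field_simps)
      then have "(Q\<^sup>2 * r / (64 * u\<^sup>2)) * (64 * u\<^sup>2 * Q / pi) \<le> (Q\<^sup>2 * r / (64 * u\<^sup>2)) * r"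
        using Q1 r by (intro mult_left_mono) auto
      moreover have "(Q\<^sup>2 * r / (64 * u\<^sup>2)) * (64 * u\<^sup>2 * Q / pi) = Q ^ 3 * r / pi" using u by (simp add: field_simps eval_nat_numeral)
      moreover have "(Q\<^sup>2 * r / (64 * u\<^sup>2)) * r = (\<xi> * r)\<^sup>2" unfolding \<xi> by (simp add: power2_eq_square)
      ultimately show "Q ^ 3 * r / pi \<le> (\<xi> * r)\<^sup>2" by simp
    qed (use Q1 u r in \<open>auto simp: \<xi>\<close>)
    then show ?thesis using False by (simp add: C_def)
  qed
  have "6 / r + A + x + B + C \<le> 6 / r + z + a + c" if "x \<le> z" "A + B \<le> a" "C \<le> c" for x z a c using that by linarith
  from this[OF t(2) AB C] show ?thesis unfolding split unfolding shift_majorant_def s_def[symmetric] .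
qed

section \<open>Summation of the errors over all shifts\<close>

text \<open>
  Telescoping, with a comparison function that is defined for real arguments so that the range of summation may end at
  a real number.
\<close>

lemma sum_le_primitive:
  fixes f :: "nat \<Rightarrow> real" and F :: "real \<Rightarrow> real"
  assumes step: "\<And>r. r \<ge> 1 \<Longrightarrow> f r \<le> F (real r) - F (real r - 1)" and nn: "\<And>r. f r \<ge> 0"
    and mono: "\<And>x y. 0 \<le> x \<Longrightarrow> x \<le> y \<Longrightarrow> F x \<le> F y" and R: "R \<ge> 0"
  shows "(\<Sum>r=1..<N. if real r \<le> R then f r else 0) \<le> F R - F 0"
proof -
  define M where "M = nat \<lfloor>R\<rfloor>"
  have "(\<Sum>r=1..<N. if real r \<le> R then f r else 0) = (\<Sum>r\<in>{r\<in>{1..<N}. real r \<le> R}. f r)"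
    by (rule sum.inter_filter[symmetric]) simp
  also have "\<dots> \<le> (\<Sum>r=1..M. f r)"
    by (rule sum_mono2) (auto simp: M_def nn le_nat_floor)
  also have "\<dots> \<le> F (real M) - F 0"
  proof (induction M)
    case (Suc M)
    then show ?case using step[of "Suc M"] by simp
  qed simp
  also have "F (real M) \<le> F R" using R by (intro mono) (auto simp: M_def)
  finally show ?thesis by simp
qed

lemma sum_inverse_le:
  assumes "R \<ge> 1"
  shows "(\<Sum>r=1..<N. if real r \<le> R then 1 / real r else 0) \<le> 1 + ln R"
proof -
  define F where "F x = (if x < 1 then x else 1 + ln x)" for x :: real
  have "(\<Sum>r=1..<N. if real r \<le> R then 1 / real r else 0) \<le> F R - F 0"
  proof (rule sum_le_primitive)
    show "1 / real r \<le> F (real r) - F (real r - 1)" if "r \<ge> 1" for r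
    proof (cases "r = 1")
      case False
      then have r: "real r \<ge> 2" using that by simp
      then have "ln ((real r - 1) / real r) \<le> (real r - 1) / real r - 1" by (intro ln_le_minus_one) simp
      moreover have "ln ((real r - 1) / real r) = ln (real r - 1) - ln (real r)" using r by (subst ln_div) auto
      moreover have "(real r - 1) / real r - 1 = - (1 / real r)" using r by (simp add: diff_divide_distrib)
      ultimately have "1 / real r \<le> ln (real r) - ln (real r - 1)" by linarith
      then show ?thesis using r by (simp add: F_def)
    qed (simp add: F_def)
    show "F x \<le> F y" if "0 \<le> x" "x \<le> y" for x y
    proof -
      have "x \<le> 1 + ln y" if "x < 1" "\<not> y < 1" using that by (simp add: add_increasing2)
      moreover have "ln x \<le> ln y" if "\<not> x < 1" using that \<open>x \<le> y\<close> by simp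
      ultimately show ?thesis using that by (auto simp: F_def)
    qed
  qed (use assms in auto)
  then show ?thesis using assms by (simp add: F_def)
qed

lemma sum_inverse_sqrt_le:
  assumes "R \<ge> 0"
  shows "(\<Sum>r=1..<N. if real r \<le> R then 1 / sqrt (real r) else 0) \<le> 2 * sqrt R"
proof -
  have "(\<Sum>r=1..<N. if real r \<le> R then 1 / sqrt (real r) else 0) \<le> 2 * sqrt R - 2 * sqrt 0"
  proof (rule sum_le_primitive)
    show "1 / sqrt (real r) \<le> 2 * sqrt (real r) - 2 * sqrt (real r - 1)" if "r \<ge> 1" for r
    proof -
      define a b where "a = sqrt (real r)" and "b = sqrt (real r - 1)"
      have ab: "a > 0" "b \<ge> 0" "b \<le> a" "a\<^sup>2 - b\<^sup>2 = 1" using that by (auto simp: a_def b_def)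
      have "1 = (a - b) * (a + b)" using ab(4) by (simp add: power2_eq_square algebra_simps)
      also have "\<dots> \<le> (a - b) * (2 * a)" using ab by (intro mult_left_mono) auto
      finally have "1 / a \<le> 2 * (a - b)" using ab by (simp add: field_simps)
      then show ?thesis by (simp add: a_def b_def)
    qed
  qed (use assms in auto)
  then show ?thesis by simp
qed

lemma sum_powr_three_quarters_le:
  assumes "R \<ge> 0"
  shows "(\<Sum>r=1..<N. if real r \<le> R then real r powr (-3/4) else 0) \<le> 4 * R powr (1/4)"
proof -
  have "(\<Sum>r=1..<N. if real r \<le> R then real r powr (-3/4) else 0) \<le> 4 * R powr (1/4) - 4 * 0 powr (1/4)"
  proof (rule sum_le_primitive)
    show "real r powr (-3/4) \<le> 4 * real r powr (1/4) - 4 * (real r - 1) powr (1/4)" if "r \<ge> 1" for r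
    proof -
      define a b where "a = real r powr (1/4)" and "b = (real r - 1) powr (1/4)"
      have ab: "a > 0" "b \<ge> 0" "b \<le> a" using that by (auto simp: a_def b_def intro!: powr_mono2)
      have p: "x ^ 4 = y" if "x = y powr (1/4)" "y \<ge> 0" for x y :: real
        using that by (cases "y = 0") (simp_all add: powr_powr flip: powr_realpow)
      have "a ^ 4 = real r" "b ^ 4 = real r - 1" using that by (auto intro!: p simp: a_def b_def)
      then have "1 = a ^ 4 - b ^ 4" by simp
      also have "\<dots> = (a - b) * (a ^ 3 + a\<^sup>2 * b + a * b\<^sup>2 + b ^ 3)" by (simp add: algebra_simps eval_nat_numeral)
      also have "\<dots> \<le> (a - b) * (4 * a ^ 3)"
      proof (rule mult_left_mono)
        have "a\<^sup>2 * b \<le> a\<^sup>2 * a" "a * b\<^sup>2 \<le> a * a\<^sup>2" "b ^ 3 \<le> a ^ 3"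
          using ab by (auto intro!: mult_left_mono power_mono)
        then show "a ^ 3 + a\<^sup>2 * b + a * b\<^sup>2 + b ^ 3 \<le> 4 * a ^ 3" by (simp add: eval_nat_numeral)
      qed (use ab in simp)
      finally have "1 / a ^ 3 \<le> 4 * (a - b)" using ab by (simp add: field_simps)
      moreover have "real r powr (-3/4) = 1 / a ^ 3"
      proof -
        have "a ^ 3 = real r powr (3/4)" using that by (simp add: a_def powr_powr flip: powr_realpow)
        then show ?thesis using powr_minus_divide[of "real r" "3/4"] by simp
      qed
      ultimately show ?thesis by (simp add: a_def b_def)
    qed
    show "4 * x powr (1/4) \<le> 4 * y powr (1/4)" if "0 \<le> x" "x \<le> y" for x y :: real
      using that by (simp add: powr_mono2)
  qed (use assms in auto)
  then show ?thesis by simp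
qed

lemma sum_inverse_square_le: "(\<Sum>r=1..<N. if real r \<le> R then 1 / (real r)\<^sup>2 else 0) \<le> 2"
proof (cases "R \<ge> 0")
  case True
  define F where "F x = (if x < 1 then x else 2 - 1 / x)" for x :: real
  have "(\<Sum>r=1..<N. if real r \<le> R then 1 / (real r)\<^sup>2 else 0) \<le> F R - F 0"
  proof (rule sum_le_primitive)
    show "1 / (real r)\<^sup>2 \<le> F (real r) - F (real r - 1)" if "r \<ge> 1" for r
    proof (cases "r = 1")
      case False
      then have r: "real r \<ge> 2" using that by simp
      then have "1 / (real r)\<^sup>2 \<le> 1 / (real r * (real r - 1))" by (intro divide_left_mono) (auto simp: power2_eq_square)
      also have "\<dots> = 1 / (real r - 1) - 1 / real r" using r by (simp add: field_simps)
      finally show ?thesis using r by (simp add: F_def)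
    qed (simp add: F_def)
    show "F x \<le> F y" if "0 \<le> x" "x \<le> y" for x y
    proof -
      have "1 / x \<ge> 1 / y" if "x \<ge> 1" using that \<open>x \<le> y\<close> by (intro divide_left_mono) auto
      moreover have "x \<le> 2 - 1 / y" if "x < 1" "y \<ge> 1"
      proof -
        have "1 / y \<le> 1" using that by simp
        then show ?thesis using that by linarith
      qed
      ultimately show ?thesis using \<open>x \<le> y\<close> unfolding F_def by (cases "x < 1"; cases "y < 1") auto
    qed
  qed (use True in auto)
  also have "\<dots> \<le> 2" using True by (simp add: F_def)
  finally show ?thesis .
next
  case False
  then have "\<not> real r \<le> R" for r by simp
  then show ?thesis by simp
qed

text \<open>
  The factor 2 accounts for rounding R down to an integer.
\<close>

lemma sum_inverse_square_tail_le:
  assumes "R \<ge> 1"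
  shows "(\<Sum>r=1..<N. if real r \<le> R then 0 else 1 / (real r)\<^sup>2) \<le> 2 / R"
proof -
  define M where "M = nat \<lfloor>R\<rfloor>"
  have M: "M \<ge> 1" "real M \<le> R" "R < real M + 1" using assms by (auto simp: M_def le_nat_floor)
  have "(\<Sum>r=1..<n. if real r \<le> R then 0 else 1 / (real r)\<^sup>2) \<le> 1 / real M - 1 / real (max M (n - 1))" for n
  proof (induction n)
    case (Suc n)
    show ?case
    proof (cases "n \<le> M")
      case True
      then have "real n \<le> R" "max M n = M" "max M (n - 1) = M" using M by auto
      then show ?thesis using Suc by (cases "n = 0") auto
    next
      case False
      then have n: "real n \<ge> real M + 1" by simp
      then have "1 / (real n)\<^sup>2 \<le> 1 / (real n * (real n - 1))" using M by (intro divide_left_mono) (auto simp: power2_eq_square)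
      also have "\<dots> = 1 / (real n - 1) - 1 / real n" using n M by (simp add: field_simps)
      finally have "1 / (real n)\<^sup>2 \<le> 1 / (real n - 1) - 1 / real n" .
      moreover have "max M n = n" "max M (n - 1) = n - 1" "real (n - 1) = real n - 1" "\<not> real n \<le> R" "n \<ge> 1" using n M by auto
      ultimately show ?thesis using Suc by simp
    qed
  qed simp
  from this[of N] have "(\<Sum>r=1..<N. if real r \<le> R then 0 else 1 / (real r)\<^sup>2) \<le> 1 / real M"
    by (rule order_trans) simp
  also have "\<dots> \<le> 2 / R"
  proof -
    have "real M \<ge> 1" using M(1) by simp
    then have "R \<le> 2 * real M" using M by linarith
    then have "2 / (2 * real M) \<le> 2 / R" using assms by (intro divide_left_mono) auto
    then show ?thesis by simp
  qed
  finally show ?thesis .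
qed

text \<open>
  The terms of the majorant are summed separately. Logarithms of R1 and R2 are compared with u^2 by the tangent of the
  logarithm at exp 7. The numerical contributions, in units of u^3 Q, are 2.34 for the harmonic sum from van der
  Corput's bound, 1.32 for the quarter powers, 0.48 for the inverse squares, 0.18 for Kusmin--Landau and 0.18 for the
  trapezoidal rule.
\<close>

lemma sum_shift_majorant_le:
  fixes Q u :: real
  assumes Q: "Q \<ge> 10 ^ 10" and u: "u \<ge> 8.3" "ln Q = u\<^sup>2 / 3" and N: "N \<ge> 1" "real N \<le> 2 * Q ^ 18"
  shows "(\<Sum>r=1..<N. shift_majorant Q u (real r)) \<le> 4.51 * u ^ 3 * Q"
proof -
  have Q0: "Q > 0" "Q \<ge> 1" using Q by auto
  define R1 R2 where "R1 = 21 * u\<^sup>2 * Q" and "R2 = 10.24 * (u * Q)\<^sup>2"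
  have uu: "u\<^sup>2 \<ge> 68.89" using power_mono[OF u(1), of 2] by (simp add: power2_eq_square)
  have R1: "R1 \<ge> 1" unfolding R1_def using uu Q0 mult_mono[of 1 "21 * u\<^sup>2" 1 Q] by simp
  have R2: "R2 \<ge> 1" unfolding R2_def power_mult_distrib using uu Q0 mult_mono[of 1 "u\<^sup>2" 1 "Q\<^sup>2"] one_le_power[of Q 2] by simp
  have sR2: "sqrt R2 = 3.2 * u * Q" unfolding R2_def using Q0 u by (intro real_sqrt_unique) (auto simp: power2_eq_square)
  have e7: "(1070 :: real) \<le> exp 7"
  proof -
    have "1 + 1/8 + (1/8)\<^sup>2 / 2 \<le> exp (1/8 :: real)" by (rule exp_lower_Taylor_quadratic) simp
    then have "(1 + 1/8 + (1/8)\<^sup>2 / 2) ^ 56 \<le> exp (1/8 :: real) ^ 56" by (rule power_mono) simp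
    moreover have "exp (1/8 :: real) ^ 56 = exp 7" by (simp flip: exp_of_nat_mult)
    moreover have "(1070 :: real) \<le> (1 + 1/8 + (1/8)\<^sup>2 / 2) ^ 56" by (simp add: power2_eq_square eval_nat_numeral)
    ultimately show ?thesis by linarith
  qed
  \<comment> \<open>the tangent of the logarithm at exp 7, which is close to the arguments that occur\<close>
  have ln7: "1 + ln z \<le> z / 1070 + 7" if "z > 0" for z :: real
  proof -
    have "ln (z / exp 7) \<le> z / exp 7 - 1" using that by (intro ln_le_minus_one) simp
    moreover have "ln (z / exp 7) = ln z - 7" using that by (simp add: ln_div)
    moreover have "z / exp 7 \<le> z / 1070" using e7 that by (intro divide_left_mono) auto
    ultimately show ?thesis by linarith
  qed
  have H1: "1 + ln R1 \<le> 0.455 * u\<^sup>2"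
  proof -
    have "ln R1 = ln (21 * u\<^sup>2) + u\<^sup>2 / 3" unfolding R1_def u(2)[symmetric] using Q0 u by (subst ln_mult_pos) auto
    then show ?thesis using ln7[of "21 * u\<^sup>2"] u uu by simp
  qed
  have H2: "1 + ln R2 \<le> 0.78 * u\<^sup>2"
  proof -
    have "ln R2 = ln (10.24 * u\<^sup>2) + 2 * (u\<^sup>2 / 3)" unfolding R2_def power_mult_distrib mult.assoc[symmetric] u(2)[symmetric]
      using Q0 u by (subst ln_mult_pos) (auto simp: ln_realpow)
    then show ?thesis using ln7[of "10.24 * u\<^sup>2"] u uu by simp
  qed
  have HN: "1 + ln (real N) \<le> 7 * u\<^sup>2"
  proof -
    have "ln (real N) \<le> ln (2 * Q ^ 18)" using N by (subst ln_le_cancel_iff) auto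
    also have "\<dots> = ln 2 + 18 * (u\<^sup>2 / 3)" unfolding u(2)[symmetric] using Q0 by (subst ln_mult_pos) (auto simp: ln_realpow)
    also have "ln 2 \<le> (1 :: real)" using ln_le_minus_one[of 2] by simp
    finally show ?thesis using uu by simp
  qed
  \<comment> \<open>0.745 is just above (21/68.89)^(1/4)\<close>
  have qr: "Q powr (3/4) * R1 powr (1/4) \<le> 0.745 * u * Q"
  proof -
    have "R1 powr (1/4) \<le> ((0.745 * u) ^ 4 * Q) powr (1/4)"
    proof (rule powr_mono2)
      have "21 \<le> 0.745 ^ 4 * u\<^sup>2" using uu by (simp add: eval_nat_numeral)
      then have "21 * (u\<^sup>2 * Q) \<le> (0.745 ^ 4 * u\<^sup>2) * (u\<^sup>2 * Q)" using Q0 by (intro mult_right_mono) auto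
      then show "R1 \<le> (0.745 * u) ^ 4 * Q" by (simp add: R1_def power_mult_distrib eval_nat_numeral mult_ac)
    qed (use R1 in auto)
    also have "\<dots> = 0.745 * u * Q powr (1/4)"
    proof -
      have v: "v ^ 4 = v powr 4" if "v > 0" for v :: real using that by simp
      have w: "(v powr 4) powr (1/4) = v" if "v > 0" for v :: real unfolding powr_powr using that by simp
      define y where "y = 0.745 * u"
      have "y > 0" using u by (simp add: y_def)
      then show ?thesis unfolding y_def[symmetric] by (simp only: powr_mult v w)
    qed
    finally have "Q powr (3/4) * R1 powr (1/4) \<le> Q powr (3/4) * (0.745 * u * Q powr (1/4))" by (intro mult_left_mono) auto
    also have "\<dots> = 0.745 * u * (Q powr (3/4) * Q powr (1/4))" by simp
    also have "Q powr (3/4) * Q powr (1/4) = Q" using Q0 by (simp flip: powr_add)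
    finally show ?thesis .
  qed
  define \<Sigma> where "\<Sigma> f = (\<Sum>r=1..<N. f (real r))" for f :: "real \<Rightarrow> real"
  have lin: "\<Sigma> (\<lambda>r. f r + g r) = \<Sigma> f + \<Sigma> g" "\<Sigma> (\<lambda>r. c * f r) = c * \<Sigma> f" for f g c
    by (simp_all add: \<Sigma>_def sum.distrib sum_distrib_left)
  define I1 I2 where "I1 f r = (if r \<le> R1 then f r else 0)" and "I2 f r = (if r \<le> R2 then f r else 0)" for f :: "real \<Rightarrow> real" and r :: real
  have split: "shift_majorant Q u r = (6 + 2 / Q) * (1 / r) + (0.94 + 4.8 / Q) * I2 (\<lambda>r. 1 / sqrt r) r + 1.92 * Q * I2 (\<lambda>r. 1 / r) r
     + 30.72 * (u * Q) ^ 3 * (if r \<le> R2 then 0 else 1 / r\<^sup>2)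
     + 5.14 * u * Q * I1 (\<lambda>r. 1 / r) r + 2 * u\<^sup>2 * Q * I1 (\<lambda>r. 1 / r\<^sup>2) r + 30.4 * Q powr (3/4) * I1 (\<lambda>r. r powr (-3/4)) r" for r
  proof -
    have e1: "6 / r + 2 / (Q * r) = (6 + 2 / Q) * (1 / r)" by (simp add: add_divide_distrib)
    have e2: "0.94 / sqrt r + 1.92 * Q / r + 4.8 / (Q * sqrt r) = (0.94 + 4.8 / Q) * (1 / sqrt r) + 1.92 * Q * (1 / r)"
      by (simp add: add_divide_distrib)
    have e3: "5.14 * u * Q / r + 2 * u\<^sup>2 * Q / r\<^sup>2 + 30.4 * Q powr (3/4) * r powr (-3/4)
       = 5.14 * u * Q * (1 / r) + 2 * u\<^sup>2 * Q * (1 / r\<^sup>2) + 30.4 * Q powr (3/4) * r powr (-3/4)" by simp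
    have e4: "30.72 * (u * Q) ^ 3 / r\<^sup>2 = 30.72 * (u * Q) ^ 3 * (1 / r\<^sup>2)" by simp
    show ?thesis unfolding shift_majorant_def e1 e2 e3 e4 I1_def I2_def R1_def R2_def
      by (cases "r \<le> 10.24 * (u * Q)\<^sup>2"; cases "r \<le> 21 * u\<^sup>2 * Q")
         (simp_all only: if_True if_False mult_zero_right add_0_right add_0_left add.assoc)
  qed
  have "\<Sigma> (shift_majorant Q u) = (6 + 2 / Q) * \<Sigma> (\<lambda>r. 1 / r) + (0.94 + 4.8 / Q) * \<Sigma> (I2 (\<lambda>r. 1 / sqrt r)) + 1.92 * Q * \<Sigma> (I2 (\<lambda>r. 1 / r))
     + 30.72 * (u * Q) ^ 3 * \<Sigma> (\<lambda>r. if r \<le> R2 then 0 else 1 / r\<^sup>2)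
     + 5.14 * u * Q * \<Sigma> (I1 (\<lambda>r. 1 / r)) + 2 * u\<^sup>2 * Q * \<Sigma> (I1 (\<lambda>r. 1 / r\<^sup>2)) + 30.4 * Q powr (3/4) * \<Sigma> (I1 (\<lambda>r. r powr (-3/4)))"
    unfolding split lin ..
  also have "\<dots> \<le> 7 * (7 * u\<^sup>2) + 0.95 * (2 * (3.2 * u * Q)) + 1.92 * Q * (0.78 * u\<^sup>2)
     + 30.72 * (u * Q) ^ 3 * (2 / R2)
     + 5.14 * u * Q * (0.455 * u\<^sup>2) + 2 * u\<^sup>2 * Q * 2 + 30.4 * Q powr (3/4) * (4 * R1 powr (1/4))"
  proof (intro add_mono mult_mono)
    have "\<Sigma> (\<lambda>r. 1 / r) = (\<Sum>r=1..<N. if real r \<le> real N then 1 / real r else 0)" unfolding \<Sigma>_def by (intro sum.cong refl) auto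
    also have "\<dots> \<le> 1 + ln (real N)" using N by (intro sum_inverse_le) simp
    finally show "\<Sigma> (\<lambda>r. 1 / r) \<le> 7 * u\<^sup>2" using HN by simp
    have q: "1 / Q \<le> 0.001" using Q by (simp add: field_simps)
    then show "6 + 2 / Q \<le> 7" "0.94 + 4.8 / Q \<le> 0.95" by simp_all
    show "\<Sigma> (I2 (\<lambda>r. 1 / sqrt r)) \<le> 2 * (3.2 * u * Q)"
      unfolding \<Sigma>_def I2_def sR2[symmetric] using R2 by (intro sum_inverse_sqrt_le) simp
    show "\<Sigma> (I2 (\<lambda>r. 1 / r)) \<le> 0.78 * u\<^sup>2"
      unfolding \<Sigma>_def I2_def using R2 H2 by (intro order_trans[OF sum_inverse_le]) auto
    show "\<Sigma> (I1 (\<lambda>r. 1 / r)) \<le> 0.455 * u\<^sup>2"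
      unfolding \<Sigma>_def I1_def using R1 H1 by (intro order_trans[OF sum_inverse_le]) auto
    show "\<Sigma> (\<lambda>r. if r \<le> R2 then 0 else 1 / r\<^sup>2) \<le> 2 / R2" unfolding \<Sigma>_def by (rule sum_inverse_square_tail_le[OF R2])
    show "\<Sigma> (I1 (\<lambda>r. 1 / r\<^sup>2)) \<le> 2" unfolding \<Sigma>_def I1_def by (rule sum_inverse_square_le)
    show "\<Sigma> (I1 (\<lambda>r. r powr (-3/4))) \<le> 4 * R1 powr (1/4)" unfolding \<Sigma>_def I1_def using R1 by (intro sum_powr_three_quarters_le) simp
  qed (use Q0 u in \<open>auto simp: \<Sigma>_def I1_def I2_def intro!: sum_nonneg\<close>)
  also have "30.72 * (u * Q) ^ 3 * (2 / R2) = 6 * u * Q"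
    unfolding R2_def using Q0 u by (simp add: field_simps eval_nat_numeral)
  also have "30.4 * Q powr (3/4) * (4 * R1 powr (1/4)) \<le> 121.6 * (0.745 * u * Q)"
  proof -
    have "30.4 * Q powr (3/4) * (4 * R1 powr (1/4)) = 121.6 * (Q powr (3/4) * R1 powr (1/4))" by simp
    also have "\<dots> \<le> 121.6 * (0.745 * u * Q)" by (intro mult_left_mono qr) auto
    finally show ?thesis .
  qed
  finally have fin: "\<Sigma> (shift_majorant Q u) \<le> 49 * u\<^sup>2 + 12.08 * (u * Q) + 1.4976 * (u\<^sup>2 * Q) + 2.3387 * (u ^ 3 * Q) + 4 * (u\<^sup>2 * Q) + 90.592 * (u * Q)"
    by (simp add: power2_eq_square power3_eq_cube mult_ac)
  define z where "z = u ^ 3 * Q"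
  have a1: "u\<^sup>2 * Q \<le> z / 8.3"
  proof -
    have "8.3 * (u\<^sup>2 * Q) \<le> u * (u\<^sup>2 * Q)" using u Q0 by (intro mult_right_mono) auto
    then show ?thesis by (simp add: z_def power2_eq_square power3_eq_cube)
  qed
  have a2: "u * Q \<le> z / 68.89"
  proof -
    have "68.89 * (u * Q) \<le> u\<^sup>2 * (u * Q)" using u uu Q0 by (intro mult_right_mono) auto
    then show ?thesis by (simp add: z_def power2_eq_square power3_eq_cube)
  qed
  have a3: "u\<^sup>2 \<le> u\<^sup>2 * Q / 10 ^ 10" using Q by (simp add: mult_left_mono)
  have "S \<le> 4.51 * z" if "S \<le> 49 * c + 12.08 * a + 1.4976 * b + 2.3387 * z + 4 * b + 90.592 * a" "b \<le> z / 8.3" "a \<le> z / 68.89" "c \<le> b / 10 ^ 10" "0 \<le> z"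
    for S a b c :: real using that by simp
  from this[OF fin[folded z_def] a1 a2 a3] have "\<Sigma> (shift_majorant Q u) \<le> 4.51 * z" using u Q0 by (simp add: z_def)
  then show ?thesis by (simp add: \<Sigma>_def z_def)
qed

text \<open>
  Since \<sigma>/\<xi> is about 0.49 c u, the exponent is about 0.12 c^2 u^2, and exp (- k u^2/3) = Q^(-k).
\<close>

lemma cutoff_exponent_le:
  fixes Q u \<sigma> c :: real and k :: nat
  assumes Q: "Q \<ge> 10 ^ 10" and u: "u > 0" "ln Q = u\<^sup>2 / 3" and \<sigma>: "\<sigma> \<ge> 0.49 * Q"
    and c: "c > 0" "Q / (c * u) \<ge> 1000" and k: "1.0041 * real k \<le> 0.36 * c\<^sup>2"
  shows "exp (- (\<sigma>\<^sup>2 / 2 - 1 / 8) / (Q / (c * u) + 2)\<^sup>2) \<le> 1 / Q ^ k"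
proof -
  define \<xi> where "\<xi> = Q / (c * u)"
  have Q0: "Q > 0" using Q by simp
  have "(0.49 * Q)\<^sup>2 \<le> \<sigma>\<^sup>2" using \<sigma> Q by (intro power_mono) auto
  then have "0.2401 * Q\<^sup>2 \<le> \<sigma>\<^sup>2" by (simp add: power_mult_distrib power2_eq_square)
  moreover have "10000 \<le> Q\<^sup>2" using power_mono[of 100 Q 2] Q by simp
  ultimately have a: "0.12 * Q\<^sup>2 \<le> \<sigma>\<^sup>2 / 2 - 1 / 8" by simp
  have "(\<xi> + 2)\<^sup>2 \<le> (1.002 * \<xi>)\<^sup>2" using c unfolding \<xi>_def[symmetric] by (intro power_mono) auto
  also have "\<dots> = 1.002\<^sup>2 * \<xi>\<^sup>2" by (rule power_mult_distrib)
  also have "\<dots> \<le> 1.0041 * \<xi>\<^sup>2" by (rule mult_right_mono) (auto simp: power2_eq_square)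
  finally have "(\<xi> + 2)\<^sup>2 \<le> 1.0041 * \<xi>\<^sup>2" .
  then have "(real k * u\<^sup>2 / 3) * (\<xi> + 2)\<^sup>2 \<le> (real k * u\<^sup>2 / 3) * (1.0041 * \<xi>\<^sup>2)" by (intro mult_left_mono) auto
  also have "\<dots> = (1.0041 * real k) * (Q\<^sup>2 / (3 * c\<^sup>2))" unfolding \<xi>_def using c u by (simp add: field_simps)
  also have "\<dots> \<le> (0.36 * c\<^sup>2) * (Q\<^sup>2 / (3 * c\<^sup>2))" using k by (intro mult_right_mono) auto
  also have "\<dots> = 0.12 * Q\<^sup>2" using c by simp
  also note a
  finally have "real k * u\<^sup>2 / 3 \<le> (\<sigma>\<^sup>2 / 2 - 1 / 8) / (\<xi> + 2)\<^sup>2" using c by (simp add: \<xi>_def pos_le_divide_eq zero_less_power add_pos_pos)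
  then have "exp (- (\<sigma>\<^sup>2 / 2 - 1 / 8) / (\<xi> + 2)\<^sup>2) \<le> exp (- (real k * ln Q))"
    unfolding minus_divide_left[symmetric] exp_le_cancel_iff neg_le_iff_le by (simp only: u(2) times_divide_eq_right)
  also have "\<dots> = 1 / Q ^ k" using Q0 by (simp add: exp_minus exp_of_nat_mult divide_inverse)
  finally show ?thesis by (simp add: \<xi>_def)
qed

lemma sqrt_log_le:
  fixes Q u :: real
  assumes Q: "Q \<ge> 10 ^ 10" and u: "u > 0" "ln Q = u\<^sup>2 / 3"
  shows "8000 * u \<le> Q"
proof (rule power2_le_imp_le)
  have "u\<^sup>2 \<le> 3 * Q" using ln_le_minus_one[of Q] Q u by simp
  then have "(8000 * u)\<^sup>2 \<le> 192000000 * Q" by (simp add: power_mult_distrib)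
  also have "\<dots> \<le> Q * Q" using Q by (intro mult_right_mono) auto
  finally show "(8000 * u)\<^sup>2 \<le> Q\<^sup>2" by (simp add: power2_eq_square)
qed (use Q in simp)

text \<open>
  The cutoff terms of \<open>shifted_sum_minus_integral\<close> are at most 4/Q for the about L Q small shifts and 4/Q^20 for the others, of
  which there are at most 2 Q^18. The rest is \<open>sum_shift_majorant_le\<close>.
\<close>

lemma shifted_sums_minus_tails:
  fixes Q u \<sigma> :: real
  assumes Q: "Q \<ge> 10 ^ 10" and u: "u \<ge> 8.3" "ln Q = u\<^sup>2 / 3" and \<sigma>: "\<sigma> \<ge> 0.49 * Q" and N: "N \<ge> 1" "real N \<le> 2 * Q ^ 18"
  shows "\<bar>(\<Sum>r=1..<N. \<Sum>m=1..N-r. ratio_kernel (Q ^ 3) \<sigma> (real r / (real m + real r)) / (real m + real r))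
     - (\<Sum>r=1..<N. kernel_tail (Q ^ 3) \<sigma> (real r / real N))\<bar> \<le> 4.52 * u ^ 3 * Q"
proof -
  have Q0: "Q > 0" "Q \<ge> 1" and u0: "u > 0" using Q u by auto
  have uQ: "8000 * u \<le> Q" by (rule sqrt_log_le[OF Q u0 u(2)])
  \<comment> \<open>above R1 the smaller cutoff is used\<close>
  define R1 where "R1 = 21 * u\<^sup>2 * Q"
  have R1: "R1 \<ge> 0" using Q0 by (simp add: R1_def)
  define d where "d r = (\<Sum>m=1..N-r. ratio_kernel (Q ^ 3) \<sigma> (real r / (real m + real r)) / (real m + real r)) - kernel_tail (Q ^ 3) \<sigma> (real r / real N)" for r
  have d: "\<bar>d r\<bar> \<le> shift_majorant Q u (real r) + ((if real r \<le> R1 then 4 / Q else 0) + 4 / Q ^ 20)" if r: "r \<in> {1..<N}" for r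
  proof -
    define \<xi> where "\<xi> = (if real r \<le> R1 then Q / (2.5 * u) else Q / (8 * u))"
    have r1: "real r \<ge> 1" using r by simp
    have x8: "1000 \<le> Q / (8 * u)" using uQ u0 by (simp add: field_simps)
    also have "Q / (8 * u) \<le> Q / (2.5 * u)" using Q0 u0 by (intro divide_left_mono) auto
    finally have x25: "Q / (2.5 * u) \<ge> 1000" by simp
    have \<xi>: "\<xi> \<ge> 1000" using x8 x25 by (simp add: \<xi>_def)
    have "\<bar>d r\<bar> \<le> 2 / real r * osc_bound (Q ^ 3) (real r) \<xi> (0.4 * Q\<^sup>2 * sqrt (real r)) + 4 * (\<xi> + 1) * exp (- (\<sigma>\<^sup>2 / 2 - 1 / 8) / (\<xi> + 2)\<^sup>2)"
    proof -
      have \<sigma>2: "\<sigma> \<ge> 2" using \<sigma> Q by simp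
      have "sqrt (Q ^ 3 * real r / pi) \<le> 0.4 * Q\<^sup>2 * sqrt (real r)"
      proof (rule real_le_lsqrt)
        have "Q ^ 3 * real r / pi \<le> Q ^ 3 * real r / 1" using pi_gt3 Q0 by (intro divide_left_mono) auto
        also have "\<dots> = 1 * (Q ^ 3 * real r)" by simp
        also have "\<dots> \<le> (0.16 * Q) * (Q ^ 3 * real r)" using Q by (intro mult_right_mono) auto
        also have "\<dots> = (0.4 * Q\<^sup>2 * sqrt (real r))\<^sup>2" by (simp add: power_mult_distrib eval_nat_numeral)
        finally show "Q ^ 3 * real r / pi \<le> (0.4 * Q\<^sup>2 * sqrt (real r))\<^sup>2" .
      qed auto
      moreover have "10 ^ 15 \<le> Q ^ 3 * real r"
      proof -
        have "(10 ^ 10) ^ 3 * 1 \<le> Q ^ 3 * real r" using Q r1 by (intro mult_mono power_mono) auto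
        then show ?thesis by simp
      qed
      moreover have "integral {0..real (N - r)} (\<lambda>x. ratio_kernel (Q ^ 3) \<sigma> (real r / (x + real r)) / (x + real r)) = kernel_tail (Q ^ 3) \<sigma> (real r / real N)"
        using r Q0 \<sigma>2 by (intro integral_shifted_kernel) auto
      ultimately show ?thesis
        using shifted_sum_minus_integral[of "Q ^ 3" \<sigma> "real r" \<xi> "0.4 * Q\<^sup>2 * sqrt (real r)" "N - r"] \<sigma>2 r1 \<xi> Q0 by (simp add: d_def)
    qed
    moreover have "2 / real r * osc_bound (Q ^ 3) (real r) \<xi> (0.4 * Q\<^sup>2 * sqrt (real r)) \<le> shift_majorant Q u (real r)"
      using osc_bound_le_majorant[of Q u "real r"] Q u r1 by (simp add: \<xi>_def R1_def)
    moreover have "4 * (\<xi> + 1) * exp (- (\<sigma>\<^sup>2 / 2 - 1 / 8) / (\<xi> + 2)\<^sup>2) \<le> (if real r \<le> R1 then 4 / Q else 0) + 4 / Q ^ 20"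
    proof -
      have "\<xi> \<le> Q / 2"
      proof -
        have "Q / (2.5 * u) \<le> Q / 2" by (rule divide_left_mono) (use Q0 u in auto)
        moreover have "Q / (8 * u) \<le> Q / 2" by (rule divide_left_mono) (use Q0 u in auto)
        ultimately show ?thesis by (simp add: \<xi>_def)
      qed
      then have \<xi>Q: "4 * (\<xi> + 1) \<le> 4 * Q" using Q by simp
      show ?thesis
      proof (cases "real r \<le> R1")
        case True
        have "exp (- (\<sigma>\<^sup>2 / 2 - 1 / 8) / (Q / (2.5 * u) + 2)\<^sup>2) \<le> 1 / Q ^ 2"
          by (rule cutoff_exponent_le[OF Q u0 u(2) \<sigma>]) (use x25 in \<open>auto simp: power2_eq_square\<close>)
        then have "4 * (\<xi> + 1) * exp (- (\<sigma>\<^sup>2 / 2 - 1 / 8) / (\<xi> + 2)\<^sup>2) \<le> 4 * Q * (1 / Q ^ 2)"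
          using \<xi>Q \<xi> True Q0 by (intro mult_mono) (auto simp: \<xi>_def)
        also have "\<dots> = 4 / Q" using Q0 by (simp add: power2_eq_square)
        finally have "4 * (\<xi> + 1) * exp (- (\<sigma>\<^sup>2 / 2 - 1 / 8) / (\<xi> + 2)\<^sup>2) \<le> 4 / Q" .
        moreover have "0 \<le> 4 / Q ^ 20" using Q0 by simp
        ultimately show ?thesis unfolding if_P[OF True] by linarith
      next
        case False
        have "exp (- (\<sigma>\<^sup>2 / 2 - 1 / 8) / (Q / (8 * u) + 2)\<^sup>2) \<le> 1 / Q ^ 21"
          by (rule cutoff_exponent_le[OF Q u0 u(2) \<sigma>]) (use x8 in \<open>auto simp: power2_eq_square\<close>)
        then have "4 * (\<xi> + 1) * exp (- (\<sigma>\<^sup>2 / 2 - 1 / 8) / (\<xi> + 2)\<^sup>2) \<le> 4 * Q * (1 / Q ^ 21)"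
          using \<xi>Q \<xi> False Q0 by (intro mult_mono) (auto simp: \<xi>_def)
        also have "\<dots> = 4 / Q ^ 20" using Q0 by (simp add: eval_nat_numeral)
        finally show ?thesis using False by simp
      qed
    qed
    ultimately show ?thesis by linarith
  qed
  have "\<bar>\<Sum>r=1..<N. d r\<bar> \<le> (\<Sum>r=1..<N. shift_majorant Q u (real r) + ((if real r \<le> R1 then 4 / Q else 0) + 4 / Q ^ 20))"
    using d by (intro order_trans[OF sum_abs] sum_mono)
  also have "\<dots> = (\<Sum>r=1..<N. shift_majorant Q u (real r)) + ((\<Sum>r=1..<N. if real r \<le> R1 then 4 / Q else 0) + real (N - 1) * (4 / Q ^ 20))"
    by (simp add: sum.distrib)
  also have "\<dots> \<le> 4.51 * u ^ 3 * Q + (84 * u\<^sup>2 + 1)"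
  proof (intro add_mono sum_shift_majorant_le Q u N)
    have "(\<Sum>r=1..<N. if real r \<le> R1 then 4 / Q else 0) \<le> 4 / Q * R1 - 4 / Q * 0"
      by (rule sum_le_primitive) (use Q0 R1 in \<open>auto simp: right_diff_distrib divide_right_mono\<close>)
    also have "\<dots> = 84 * u\<^sup>2" using Q0 by (simp add: R1_def)
    finally show "(\<Sum>r=1..<N. if real r \<le> R1 then 4 / Q else 0) \<le> 84 * u\<^sup>2" .
    have "real (N - 1) * (4 / Q ^ 20) \<le> (2 * Q ^ 18) * (4 / Q ^ 20)" using N Q0 by (intro mult_right_mono) auto
    also have "\<dots> = 8 / Q\<^sup>2" using Q0 by (simp add: eval_nat_numeral)
    also have "\<dots> \<le> 1" using power_mono[of 10 Q 2] Q by simp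
    finally show "real (N - 1) * (4 / Q ^ 20) \<le> 1" .
  qed
  also have "\<dots> \<le> 4.52 * u ^ 3 * Q"
  proof -
    have "u\<^sup>2 \<ge> 1" using u by (intro one_le_power) auto
    then have "84 * u\<^sup>2 + 1 \<le> 85 * u\<^sup>2 * 1" by simp
    also have "\<dots> \<le> 85 * u\<^sup>2 * (u * (Q / 10 ^ 10))"
    proof (intro mult_left_mono)
      have "1 * 1 \<le> u * (Q / 10 ^ 10)" using u Q by (intro mult_mono) auto
      then show "1 \<le> u * (Q / 10 ^ 10)" by simp
    qed auto
    also have "\<dots> = 85 / 10 ^ 10 * (u ^ 3 * Q)" by (simp add: power2_eq_square power3_eq_cube)
    also have "\<dots> \<le> 0.01 * (u ^ 3 * Q)" using u0 Q0 by (intro mult_right_mono) auto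
    finally have "84 * u\<^sup>2 + 1 \<le> 0.01 * (u ^ 3 * Q)" .
    moreover have "4.52 * u ^ 3 * Q = 4.51 * u ^ 3 * Q + 0.01 * (u ^ 3 * Q)" by simp
    ultimately show ?thesis by (simp only: add_le_cancel_left)
  qed
  finally show ?thesis by (simp add: d_def sum_subtractf)
qed

section \<open>The smoothed mean square of the zeta function\<close>

definition mean_square_main :: "real \<Rightarrow> real" where
  "mean_square_main T = T * (ln T + 2 * euler_mascheroni - 1 - ln (2 * pi))"

lemma harm_minus_ln_bounds:
  assumes "n \<ge> 1"
  shows "\<bar>harm n - ln (real n) - euler_mascheroni\<bar> \<le> 1 / real n"
proof -
  have n: "real n \<ge> 1" using assms by simp
  have "ln (real (Suc n)) - ln (real n) \<le> 1 / real n"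
    using ln_diff_le_inverse[of "real n"] n by (simp add: add.commute)
  moreover have "ln (real n) \<le> ln (real (Suc n))" using n by simp
  moreover have "inverse (real (2 * n)) \<le> 1 / real n" "0 \<le> inverse (real (2 * (n + 1)))" using n by (auto simp: field_simps)
  moreover have "euler_mascheroni \<in> {harm n - ln (real (Suc n)) + inverse (real (2 * (n + 1)))..harm n - ln (real (Suc n)) + inverse (real (2 * n))}"
    using euler_mascheroni_bounds[OF assms] by simp
  ultimately show ?thesis unfolding atLeastAtMost_iff by linarith
qed

lemma half_ln_one_plus_square:
  assumes "T \<ge> (1 :: real)"
  shows "\<bar>T * ln (1 + T\<^sup>2) / 2 - T * ln T\<bar> \<le> 1"
proof -
  have e: "1 + T\<^sup>2 = T\<^sup>2 * (1 + 1 / T\<^sup>2)" using assms by (simp add: distrib_left)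
  have p: "1 + 1 / T\<^sup>2 > 0" by (simp add: add_pos_nonneg)
  have "ln (1 + T\<^sup>2) = 2 * ln T + ln (1 + 1 / T\<^sup>2)"
    unfolding e using assms p by (subst ln_mult_pos) (auto simp: ln_realpow)
  moreover have "ln (1 + 1 / T\<^sup>2) \<le> 1 / T\<^sup>2" by (rule ln_add_one_self_le_self) simp
  moreover have "0 \<le> ln (1 + 1 / T\<^sup>2)" by simp
  moreover have "1 / T\<^sup>2 \<le> 1 / T"
    using assms by (intro divide_left_mono) (auto simp: power2_eq_square)
  ultimately have "T * ln (1 + T\<^sup>2) / 2 - T * ln T = T * ln (1 + 1 / T\<^sup>2) / 2" "0 \<le> ln (1 + 1 / T\<^sup>2)" "ln (1 + 1 / T\<^sup>2) \<le> 1 / T"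
    by (auto simp: algebra_simps)
  moreover from this have "0 \<le> T * ln (1 + 1 / T\<^sup>2)" using assms by (intro mult_nonneg_nonneg) auto
  moreover from calculation have "T * ln (1 + 1 / T\<^sup>2) \<le> T * (1 / T)" using assms by (intro mult_left_mono) auto
  moreover have "T * (1 / T) = 1" using assms by simp
  ultimately show ?thesis by linarith
qed

text \<open>
  The pieces are put together: the main terms in ln N cancel between the diagonal, the tails and Stirling's formula.
  All errors other than those of the shifts are O(Q).
\<close>

lemma partial_mean_square:
  fixes Q u \<sigma> :: real
  assumes Q: "Q \<ge> 10 ^ 10" and u: "u \<ge> 8.3" "ln Q = u\<^sup>2 / 3" and \<sigma>: "0.49 * Q \<le> \<sigma>" "\<sigma> \<le> 0.51 * Q" and N: "Q ^ 18 \<le> real N" "real N \<le> 2 * Q ^ 18"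
  shows "\<bar>(LINT t|lborel. weight (Q ^ 3) \<sigma> t * (cmod (zeta_partial N (Complex (1/2) t)))\<^sup>2) / 2 - mean_square_main (Q ^ 3)\<bar> \<le> 4.56 * u ^ 3 * Q"
proof -
  define T where "T = Q ^ 3"
  have Q0: "Q > 0" "Q \<ge> 1" and u0: "u > 0" using Q u by auto
  have T10: "T \<ge> 10" using power_mono[of "10 ^ 10" Q 3] Q by (simp add: T_def)
  have \<sigma>2: "\<sigma> \<ge> 2" using \<sigma> Q by simp
  have \<sigma>T: "\<sigma>\<^sup>2 \<le> T"
  proof -
    have "\<sigma>\<^sup>2 \<le> Q\<^sup>2" using \<sigma> \<sigma>2 Q0 by (intro power_mono) auto
    also have "\<dots> \<le> T" using Q0 by (simp add: T_def power_increasing)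
    finally show ?thesis .
  qed
  have T6: "T ^ 6 \<le> real N" using N by (simp add: T_def flip: power_mult)
  have N1: "N \<ge> 1" and N2: "N \<ge> 2"
  proof -
    have "10 ^ 6 \<le> T ^ 6" using T10 by (intro power_mono) auto
    then have "real N \<ge> 2" using T6 by simp
    then show "N \<ge> 1" "N \<ge> 2" by auto
  qed
  have T26: "8 * T\<^sup>2 \<le> T ^ 4" 
  proof -
    have "8 * T\<^sup>2 \<le> T\<^sup>2 * T\<^sup>2" using power_mono[of 10 T 2] T10 by (intro mult_right_mono) auto
    then show ?thesis by (simp flip: power_add)
  qed
  have TN: "8 * T\<^sup>2 / real N \<le> 1 / T\<^sup>2"
  proof -
    have "8 * T\<^sup>2 / real N \<le> T ^ 4 / T ^ 6" using T26 T6 T10 by (intro frac_le) auto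
    also have "\<dots> = 1 / T\<^sup>2" using T10 by (simp add: eval_nat_numeral)
    finally show ?thesis .
  qed
  have T2: "T\<^sup>2 \<ge> T" using T10 by (simp add: power2_eq_square)
  have iT: "1 / T\<^sup>2 \<le> 1 / T" using T2 T10 by (intro divide_left_mono) auto
  define L where "L = u\<^sup>2"
  have lnT: "ln T = L" unfolding T_def L_def using u Q0 by (simp add: ln_realpow)
  have lnN: "ln (real N) \<le> 1 + 6 * L"
  proof -
    have "ln (real N) \<le> ln (2 * Q ^ 18)" using N N1 by (subst ln_le_cancel_iff) auto
    also have "\<dots> = ln 2 + 18 * (u\<^sup>2 / 3)" unfolding u(2)[symmetric] using Q0 by (subst ln_mult_pos) (auto simp: ln_realpow)
    also have "ln 2 \<le> (1 :: real)" using ln_le_minus_one[of 2] by simp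
    finally show ?thesis by (simp add: L_def)
  qed
  have T12: "ln (1 + T) \<le> 1 + L"
  proof -
    have "ln (1 + T) \<le> ln (2 * T)" using T10 by simp
    also have "\<dots> = ln 2 + L" unfolding lnT[symmetric] using T10 by (subst ln_mult_pos) auto
    also have "ln 2 \<le> (1 :: real)" using ln_le_minus_one[of 2] by simp
    finally show ?thesis by simp
  qed
  define M where "M = (LINT t|lborel. weight T \<sigma> t * (cmod (zeta_partial N (Complex (1/2) t)))\<^sup>2)"
  define SS where "SS = (\<Sum>r=1..<N. \<Sum>m=1..N-r. ratio_kernel T \<sigma> (real r / (real m + real r)) / (real m + real r))"
  define SW where "SW = (\<Sum>r=1..<N. kernel_tail T \<sigma> (real r / real N))"
  define NK where "NK = real N * integral {0..1} (ratio_kernel T \<sigma>)"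
  define W where "W = kernel_tail T \<sigma> (1 / real N)"
  define st where "st = stirling_seq N"
  define h where "h = (harm N :: real)"
  define l where "l = ln (real N)"
  define g where "g = (euler_mascheroni :: real)"
  have e1: "\<bar>M - (2 * T * h + 2 * SS - 2 * NK)\<bar> \<le> 18 * Q"
  proof -
    have "T powr (1/3) = Q"
    proof -
      have "T = Q powr 3" using Q0 by (simp add: T_def)
      then show ?thesis using Q0 by (simp only: powr_powr) simp
    qed
    then show ?thesis using weighted_partial_square(1)[of T \<sigma> N] T10 \<sigma>2 N1 by (simp add: M_def SS_def NK_def h_def mult.assoc)
  qed
  have e2: "\<bar>SS - SW\<bar> \<le> 4.52 * u ^ 3 * Q"
    unfolding SS_def SW_def T_def using shifted_sums_minus_tails[OF Q u \<sigma>(1) N1 N(2)] .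
  have e3: "\<bar>SW - NK + 2 * T * st + W / 2\<bar> \<le> 8 * T\<^sup>2 * (h + 1) / real N"
    unfolding SW_def NK_def st_def W_def h_def by (rule sum_kernel_tails[OF N1 T10 \<sigma>2 \<sigma>T])
  have e4: "\<bar>st - ln (2 * pi) / 2\<bar> \<le> 2 / real N" unfolding st_def by (rule stirling_error[OF N1])
  have e5: "\<bar>W - (2 * T * l - 2 * T * g - (T * ln (1 + T\<^sup>2) - 2 * T + 2 * arctan T))\<bar> \<le> 9/2 * \<sigma> + 9 * ln (1 + T) + 2 * T * (1 + T) / real N"
    unfolding W_def l_def g_def using T10 by (intro kernel_tail_evaluation \<sigma>2 N2) auto
  have e6: "\<bar>h - l - g\<bar> \<le> 1 / real N" unfolding h_def l_def g_def by (rule harm_minus_ln_bounds[OF N1])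
  have e7: "\<bar>T * ln (1 + T\<^sup>2) / 2 - T * ln T\<bar> \<le> 1" using T10 by (intro half_ln_one_plus_square) auto
  have e8: "\<bar>arctan T\<bar> \<le> 2" using arctan_bounded[of T] pi_less_4 by auto
  have L: "L \<ge> 68" "L \<le> 3 * T"
  proof -
    have "8.3\<^sup>2 \<le> L" unfolding L_def using u by (intro power_mono) auto
    then show "L \<ge> 68" by (simp add: power2_eq_square)
    show "L \<le> 3 * T" using ln_le_minus_one[of T] T10 by (simp add: lnT)
  qed
  have N0: "real N > 0" using N1 by simp
  have b1: "\<bar>T * (h - l - g)\<bar> \<le> 1"
  proof -
    have "\<bar>T * (h - l - g)\<bar> \<le> T * (1 / real N)" unfolding abs_mult using e6 T10 by (intro mult_mono) auto
    also have "\<dots> \<le> 8 * T\<^sup>2 / real N" using T2 T10 N0 by (simp add: divide_right_mono)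
    also have "\<dots> \<le> 1 / T\<^sup>2" by (rule TN)
    also have "\<dots> \<le> 1" using T10 by simp
    finally show ?thesis .
  qed
  have b2: "\<bar>2 * T * (st - ln (2 * pi) / 2)\<bar> \<le> 1"
  proof -
    have "\<bar>2 * T * (st - ln (2 * pi) / 2)\<bar> \<le> 2 * T * (2 / real N)" unfolding abs_mult[of "2 * T"] using e4 T10 by (intro mult_mono) auto
    also have "\<dots> \<le> 8 * T\<^sup>2 / real N" using T2 T10 N0 by (simp add: divide_right_mono)
    also have "\<dots> \<le> 1 / T\<^sup>2" by (rule TN)
    also have "\<dots> \<le> 1" using T10 by simp
    finally show ?thesis .
  qed
  have b3: "8 * T\<^sup>2 * (h + 1) / real N \<le> 21"
  proof -
    have "1 / real N \<le> 1" using N1 by simp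
    moreover have "l \<le> 1 + 6 * L" using lnN by (simp add: l_def)
    moreover have "g \<le> 1"
    proof -
      have "harm 1 - ln (real 1) = (1 :: real)" by (simp add: harm_def)
      then show ?thesis using harm_minus_ln_bounds[of 1] euler_mascheroni_pos euler_mascheroni_bounds[of 1] ln2_ge_two_thirds by (simp add: g_def harm_def)
    qed
    ultimately have "h + 1 \<le> 7 * L" using e6 L by linarith
    also have "\<dots> \<le> 21 * T" using L by linarith
    finally have "8 * T\<^sup>2 / real N * (h + 1) \<le> 8 * T\<^sup>2 / real N * (21 * T)" using N0 by (intro mult_left_mono) auto
    also have "\<dots> \<le> 1 / T * (21 * T)" using TN iT T10 by (intro mult_right_mono) auto
    finally show ?thesis using T10 by simp
  qed
  have b4: "2 * T * (1 + T) / real N \<le> 1"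
  proof -
    have "2 * T * (1 + T) \<le> 8 * T\<^sup>2" using T2 T10 by (simp add: distrib_left power2_eq_square)
    then have "2 * T * (1 + T) / real N \<le> 8 * T\<^sup>2 / real N" using N0 by (intro divide_right_mono) auto
    also have "\<dots> \<le> 1 / T\<^sup>2" by (rule TN)
    also have "\<dots> \<le> 1" using T10 by simp
    finally show ?thesis .
  qed
  have main: "mean_square_main T = T * ln T + 2 * (T * g) - T - T * ln (2 * pi)"
    unfolding mean_square_main_def g_def by (simp add: algebra_simps)
  define x where "x = u ^ 3 * Q"
  \<comment> \<open>all errors of order Q and smaller, compared with u^3 Q \<ge> 571 Q\<close>
  have small: "12 * Q + 200 + 5 * L \<le> 0.035 * x"
  proof -
    have "u\<^sup>2 \<le> Q"
    proof -
      have "L = 3 * ln Q" using u by (simp add: L_def)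
      also have "ln Q = 2 * ln (sqrt Q)" using Q0 by (simp add: ln_sqrt)
      also have "ln (sqrt Q) \<le> sqrt Q" using ln_le_minus_one[of "sqrt Q"] Q0 by simp
      finally have "L \<le> 6 * sqrt Q" by simp
      also have "6 * sqrt Q \<le> sqrt Q * sqrt Q" using Q by (intro mult_right_mono real_le_rsqrt) auto
      finally show ?thesis using Q0 by (simp add: L_def)
    qed
    then have "12 * Q + 200 + 5 * L \<le> 18 * Q" using Q by (simp add: L_def)
    also have "\<dots> \<le> 0.035 * 571 * Q" using Q0 by simp
    also have "\<dots> \<le> 0.035 * u ^ 3 * Q"
    proof -
      have "571 \<le> u ^ 3" using power_mono[OF u(1), of 3] by (simp add: eval_nat_numeral)
      then show ?thesis using Q0 by (intro mult_right_mono mult_left_mono) auto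
    qed
    finally show ?thesis by (simp add: x_def)
  qed
  define B where "B = W - (2 * T * l - 2 * T * g - (T * ln (1 + T\<^sup>2) - 2 * T + 2 * arctan T))"
  have eq: "M / 2 - mean_square_main T = (M / 2 - (T * h + SS - NK)) + (SS - SW) + (SW - NK + 2 * T * st + W / 2)
     - 2 * T * (st - ln (2 * pi) / 2) - B / 2 + T * (h - l - g) + (T * ln (1 + T\<^sup>2) / 2 - T * ln T) + arctan T"
    unfolding main B_def by (simp add: algebra_simps add_divide_distrib diff_divide_distrib)
  have m1: "\<bar>M / 2 - (T * h + SS - NK)\<bar> \<le> 9 * Q"
  proof -
    have "M / 2 - (T * h + SS - NK) = (M - (2 * T * h + 2 * SS - 2 * NK)) / 2" by (simp add: field_simps)
    then show ?thesis using e1 by simp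
  qed
  have mB: "\<bar>B\<bar> \<le> 9/2 * Q + 9 * (1 + L) + 1"
  proof -
    have "\<sigma> \<le> Q" using \<sigma> Q0 by simp
    then have "9/2 * \<sigma> + 9 * ln (1 + T) + 2 * T * (1 + T) / real N \<le> 9/2 * Q + 9 * (1 + L) + 1"
      using T12 b4 by (intro add_mono mult_left_mono) auto
    with e5 show ?thesis unfolding B_def[symmetric] by (rule order_trans)
  qed
  have tri: "\<bar>a1 + a2 + a3 - a4 - a5 / 2 + a6 + a7 + a8\<bar> \<le> 12 * Q + 200 + 5 * L + y"
    if "\<bar>a1\<bar> \<le> 9 * Q" "\<bar>a2\<bar> \<le> y" "\<bar>a3\<bar> \<le> 21" "\<bar>a4\<bar> \<le> 1" "\<bar>a5\<bar> \<le> 9/2 * Q + 9 * (1 + L) + 1" "\<bar>a6\<bar> \<le> 1" "\<bar>a7\<bar> \<le> 1" "\<bar>a8\<bar> \<le> 2"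
    for a1 a2 a3 a4 a5 a6 a7 a8 y
  proof -
    have "0 \<le> Q" "0 \<le> L" using L Q0 by auto
    then show ?thesis using that unfolding abs_le_iff by auto
  qed
  from tri[OF m1 e2 order_trans[OF e3 b3] b2 mB b1 e7 e8]
  have "\<bar>M / 2 - mean_square_main T\<bar> \<le> 12 * Q + 200 + 5 * L + 4.52 * u ^ 3 * Q"
    unfolding eq .
  also have "\<dots> \<le> 0.035 * x + 4.52 * u ^ 3 * Q" using small by simp
  also have "\<dots> \<le> 4.56 * u ^ 3 * Q" using u0 Q0 by (simp add: x_def)
  finally show ?thesis unfolding M_def T_def .
qed

lemma weight_quadratic_moment_le:
  assumes "\<sigma> > 0" "T \<ge> 0"
  shows "integrable lborel (\<lambda>t. weight T \<sigma> t * (1 + t\<^sup>2))"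
    and "(LINT t|lborel. weight T \<sigma> t * (1 + t\<^sup>2)) \<le> 2 * T * (1 + T\<^sup>2 + \<sigma>\<^sup>2)"
proof -
  have b: "\<bar>1 + t\<^sup>2\<bar> \<le> 1 * (1 + t\<^sup>2)" for t :: real by simp
  show "integrable lborel (\<lambda>t. weight T \<sigma> t * (1 + t\<^sup>2))"
    by (rule weight_integral(1)[OF assms(1) _ b]) simp
  have "(LINT t|lborel. weight T \<sigma> t * (1 + t\<^sup>2)) = (LINT \<tau>|lborel. indicator {-T..T} \<tau> * (LINT t|lborel. normal_density \<tau> \<sigma> t * (1 + t\<^sup>2)))"
    by (rule weight_integral(2)[OF assms(1) _ b]) simp
  also have "\<dots> = (LINT \<tau>|lborel. indicator {-T..T} \<tau> *\<^sub>R (1 + \<tau>\<^sup>2 + \<sigma>\<^sup>2))"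
    using normal_quadratic_moment[OF assms(1)] by (simp add: has_bochner_integral_iff)
  also have "\<dots> \<le> (LINT \<tau>|lborel. indicator {-T..T} \<tau> *\<^sub>R (1 + T\<^sup>2 + \<sigma>\<^sup>2))"
  proof (rule integral_mono)
    show "integrable lborel (\<lambda>\<tau>. indicator {-T..T} \<tau> *\<^sub>R (1 + \<tau>\<^sup>2 + \<sigma>\<^sup>2))"
      by (rule borel_integrable_atLeastAtMost'[unfolded set_integrable_def]) (intro continuous_intros)
    show "integrable lborel (\<lambda>\<tau>. indicator {-T..T} \<tau> *\<^sub>R (1 + T\<^sup>2 + \<sigma>\<^sup>2))"
      by (rule borel_integrable_atLeastAtMost'[unfolded set_integrable_def]) (intro continuous_intros)
    show "indicator {-T..T} \<tau> *\<^sub>R (1 + \<tau>\<^sup>2 + \<sigma>\<^sup>2) \<le> indicator {-T..T} \<tau> *\<^sub>R (1 + T\<^sup>2 + \<sigma>\<^sup>2)" for \<tau>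
    proof (cases "\<tau> \<in> {-T..T}")
      case True
      then have "\<tau>\<^sup>2 \<le> T\<^sup>2" by (intro abs_le_square_iff[THEN iffD1]) auto
      then show ?thesis using True by simp
    qed simp
  qed
  also have "\<dots> = 2 * T * (1 + T\<^sup>2 + \<sigma>\<^sup>2)" using assms by simp
  finally show "(LINT t|lborel. weight T \<sigma> t * (1 + t\<^sup>2)) \<le> 2 * T * (1 + T\<^sup>2 + \<sigma>\<^sup>2)" .
qed

lemma zeta_square_le: "(cmod (zeta (Complex (1/2) t)))\<^sup>2 \<le> 72 * (1 + t\<^sup>2)"
proof -
  have "(cmod (zeta (Complex (1/2) t)))\<^sup>2 \<le> (6 * (1 + \<bar>t\<bar>))\<^sup>2" by (intro power_mono norm_zeta_half_le) auto
  also have "\<dots> = 72 * (1 + t\<^sup>2) - 36 * (1 - \<bar>t\<bar>)\<^sup>2" by (simp add: power2_eq_square algebra_simps)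
  finally show ?thesis using zero_le_power2[of "1 - \<bar>t\<bar>"] by linarith
qed

lemma zeta_square_measurable [measurable]: "(\<lambda>t. (cmod (zeta (Complex (1/2) t)))\<^sup>2) \<in> borel_measurable borel"
  by (intro borel_measurable_continuous_onI continuous_intros continuous_on_zeta_half)

lemma weighted_zeta_square_integrable:
  "\<sigma> > 0 \<Longrightarrow> integrable lborel (\<lambda>t. weight T \<sigma> t * (cmod (zeta (Complex (1/2) t)))\<^sup>2)"
  by (rule weight_integral(1)[where C = 72]) (use zeta_square_le in auto)

text \<open>
  For N \<ge> T^6 the truncation error is O((1 + |t|)/T^3), which is small against the crude bound for \<open>\<zeta>\<close> even after integration.
\<close>

lemma zeta_square_minus_partial_square_le:
  assumes T: "T \<ge> 1" and N: "T ^ 6 \<le> real N"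
  shows "\<bar>(cmod (zeta (Complex (1/2) t)))\<^sup>2 - (cmod (zeta_partial N (Complex (1/2) t)))\<^sup>2\<bar> \<le> 128 / T ^ 3 * (1 + t\<^sup>2)"
proof -
  let ?s = "Complex (1/2) t"
  define Z P where "Z = cmod (zeta ?s)" and "P = cmod (zeta_partial N ?s)"
  define a where "a = 1 + \<bar>t\<bar>"
  define D where "D = cmod (zeta ?s - zeta_partial N ?s)"
  have "1 ^ 6 \<le> T ^ 6" using T by (intro power_mono) auto
  then have N1: "N \<ge> 1" using N by simp
  have N3: "T ^ 3 \<le> sqrt (real N)" using N by (intro real_le_rsqrt) (simp flip: power_mult)
  have a1: "a \<ge> 1" by (simp add: a_def)
  have D: "D \<le> 4 * a / T ^ 3"
  proof -
    have "D \<le> (4 * norm ?s + 1) / sqrt (real N)" unfolding D_def by (rule norm_zeta_minus_partial_le) (use N1 in auto)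
    also have "\<dots> \<le> (4 * a) / T ^ 3"
    proof (rule frac_le)
      have "norm ?s \<le> 1/2 + \<bar>t\<bar>" by (rule order_trans[OF cmod_le]) simp
      then show "4 * norm ?s + 1 \<le> 4 * a" by (simp add: a_def)
    qed (use N3 T a1 in auto)
    finally show ?thesis .
  qed
  have D4: "D \<le> 4 * a"
  proof -
    have "4 * a / T ^ 3 \<le> 4 * a / 1" using T a1 one_le_power[of T 3] by (intro divide_left_mono) auto
    then show ?thesis using D by simp
  qed
  have Z: "Z \<le> 6 * a" unfolding Z_def a_def by (rule norm_zeta_half_le)
  have ZP: "\<bar>Z - P\<bar> \<le> D" unfolding Z_def P_def D_def by (rule norm_triangle_ineq3)
  have nn: "Z \<ge> 0" "P \<ge> 0" by (auto simp: Z_def P_def)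
  have "Z\<^sup>2 - P\<^sup>2 = (Z - P) * (Z + P)" by (simp add: power2_eq_square algebra_simps)
  then have "\<bar>Z\<^sup>2 - P\<^sup>2\<bar> = \<bar>Z - P\<bar> * (Z + P)" using nn by (simp add: abs_mult)
  also have "\<dots> \<le> (4 * a / T ^ 3) * (16 * a)" using ZP D D4 Z nn T a1 by (intro mult_mono) auto
  also have "\<dots> = 64 / T ^ 3 * a\<^sup>2" by (simp add: power2_eq_square)
  also have "\<dots> \<le> 64 / T ^ 3 * (2 * (1 + t\<^sup>2))"
  proof (rule mult_left_mono)
    have "a\<^sup>2 = 2 * (1 + t\<^sup>2) - (1 - \<bar>t\<bar>)\<^sup>2" by (simp add: a_def power2_eq_square algebra_simps)
    then show "a\<^sup>2 \<le> 2 * (1 + t\<^sup>2)" using zero_le_power2[of "1 - \<bar>t\<bar>"] by linarith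
  qed (use T in simp)
  finally show ?thesis by (simp add: Z_def P_def)
qed

lemma smoothed_mean_square:
  fixes Q u \<sigma> :: real
  assumes Q: "Q \<ge> 10 ^ 10" and u: "u \<ge> 8.3" "ln Q = u\<^sup>2 / 3" and \<sigma>: "0.49 * Q \<le> \<sigma>" "\<sigma> \<le> 0.51 * Q"
  shows "\<bar>(LINT t|lborel. weight (Q ^ 3) \<sigma> t * (cmod (zeta (Complex (1/2) t)))\<^sup>2) / 2 - mean_square_main (Q ^ 3)\<bar> \<le> 4.57 * u ^ 3 * Q"
proof -
  define T where "T = Q ^ 3"
  define N where "N = nat \<lceil>Q ^ 18\<rceil>"
  have Q0: "Q > 0" "Q \<ge> 1" using Q by auto
  have q18: "Q ^ 18 \<ge> 1" using Q0 by simp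
  have N: "Q ^ 18 \<le> real N" "real N \<le> 2 * Q ^ 18" using q18 unfolding N_def by (auto intro: real_nat_ceiling_ge) linarith
  have T: "T \<ge> 1" "T ^ 6 \<le> real N" using N Q0 by (simp_all add: T_def flip: power_mult)
  have N1: "N \<ge> 1" using N q18 by simp
  have \<sigma>2: "\<sigma> \<ge> 2" "\<sigma> \<le> T"
  proof -
    show "\<sigma> \<ge> 2" using \<sigma> Q by simp
    have "\<sigma> \<le> Q ^ 1" using \<sigma> Q0 by simp
    also have "\<dots> \<le> T" unfolding T_def using Q0 by (intro power_increasing) auto
    finally show "\<sigma> \<le> T" .
  qed
  define A where "A t = (cmod (zeta (Complex (1/2) t)))\<^sup>2" for t
  define B where "B t = (cmod (zeta_partial N (Complex (1/2) t)))\<^sup>2" for t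
  have iA: "integrable lborel (\<lambda>t. weight T \<sigma> t * A t)" unfolding A_def by (rule weighted_zeta_square_integrable) (use \<sigma>2 in simp)
  have iB: "integrable lborel (\<lambda>t. weight T \<sigma> t * B t)" unfolding B_def by (rule weighted_partial_square(2)) (use T \<sigma>2 N1 in auto)
  have iM: "integrable lborel (\<lambda>t. 128 / T ^ 3 * (weight T \<sigma> t * (1 + t\<^sup>2)))"
    using weight_quadratic_moment_le(1)[of \<sigma> T] \<sigma>2 T by (intro integrable_mult_right) auto
  have "\<bar>(LINT t|lborel. weight T \<sigma> t * A t) - (LINT t|lborel. weight T \<sigma> t * B t)\<bar> = \<bar>LINT t|lborel. weight T \<sigma> t * A t - weight T \<sigma> t * B t\<bar>"
    using iA iB by simp
  also have "\<dots> \<le> (LINT t|lborel. \<bar>weight T \<sigma> t * A t - weight T \<sigma> t * B t\<bar>)" by (rule integral_abs_bound)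
  also have "\<dots> \<le> (LINT t|lborel. 128 / T ^ 3 * (weight T \<sigma> t * (1 + t\<^sup>2)))"
  proof (intro integral_mono integrable_abs Bochner_Integration.integrable_diff iA iB iM)
    fix t
    have "\<bar>weight T \<sigma> t * A t - weight T \<sigma> t * B t\<bar> = weight T \<sigma> t * \<bar>A t - B t\<bar>"
      by (simp add: weight_nonneg abs_mult flip: right_diff_distrib)
    also have "\<dots> \<le> weight T \<sigma> t * (128 / T ^ 3 * (1 + t\<^sup>2))"
      unfolding A_def B_def by (intro mult_left_mono zeta_square_minus_partial_square_le T weight_nonneg)
    finally show "\<bar>weight T \<sigma> t * A t - weight T \<sigma> t * B t\<bar> \<le> 128 / T ^ 3 * (weight T \<sigma> t * (1 + t\<^sup>2))" by (simp only: mult.left_commute)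
  qed
  also have "\<dots> = 128 / T ^ 3 * (LINT t|lborel. weight T \<sigma> t * (1 + t\<^sup>2))" by (rule integral_mult_right_zero)
  also have "\<dots> \<le> 128 / T ^ 3 * (6 * T ^ 3)"
  proof (rule mult_left_mono)
    have "1 + T\<^sup>2 + \<sigma>\<^sup>2 \<le> 3 * T\<^sup>2" 
    proof -
      have "\<sigma>\<^sup>2 \<le> T\<^sup>2" using \<sigma>2 by (intro power_mono) auto
      moreover have "1 \<le> T\<^sup>2" using T by simp
      ultimately show ?thesis by linarith
    qed
    then have "2 * T * (1 + T\<^sup>2 + \<sigma>\<^sup>2) \<le> 2 * T * (3 * T\<^sup>2)" using T by (intro mult_left_mono) auto
    also have "\<dots> = 6 * T ^ 3" by (simp add: eval_nat_numeral)
    finally show "(LINT t|lborel. weight T \<sigma> t * (1 + t\<^sup>2)) \<le> 6 * T ^ 3"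
      using weight_quadratic_moment_le(2)[of \<sigma> T] \<sigma>2 T by simp
  qed (use T in simp)
  also have "\<dots> = 768" using T by simp
  finally have diff: "\<bar>(LINT t|lborel. weight T \<sigma> t * A t) - (LINT t|lborel. weight T \<sigma> t * B t)\<bar> \<le> 768" .
  have "\<bar>(LINT t|lborel. weight T \<sigma> t * B t) / 2 - mean_square_main T\<bar> \<le> 4.56 * u ^ 3 * Q"
    unfolding T_def B_def by (rule partial_mean_square[OF Q u \<sigma> N])
  then have "\<bar>(LINT t|lborel. weight T \<sigma> t * A t) / 2 - mean_square_main T\<bar> \<le> 4.56 * u ^ 3 * Q + 384" using diff by linarith
  also have "384 \<le> 0.01 * u ^ 3 * Q"
  proof -
    have "1 * 10 ^ 10 \<le> u ^ 3 * Q" using u Q by (intro mult_mono one_le_power) auto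
    then show ?thesis by simp
  qed
  also have "4.56 * u ^ 3 * Q + 0.01 * u ^ 3 * Q = 4.57 * u ^ 3 * Q" by simp
  finally show ?thesis unfolding T_def A_def by simp
qed

section \<open>Removal of the smoothing\<close>

text \<open>
  The truncations commute with complex conjugation, and they converge to \<open>\<zeta>\<close> on the critical line.
\<close>

lemma norm_zeta_half_minus: "cmod (zeta (Complex (1/2) (- t))) = cmod (zeta (Complex (1/2) t))"
proof -
  have lim: "(\<lambda>N. cmod (zeta_partial N (Complex (1/2) t))) \<longlonglongrightarrow> cmod (zeta (Complex (1/2) t))" for t
  proof -
    let ?s = "Complex (1/2) t"
    have "(\<lambda>N. zeta ?s - zeta_partial N ?s) \<longlonglongrightarrow> 0"
    proof (rule Lim_null_comparison)
      show "\<forall>\<^sub>F N in sequentially. norm (zeta ?s - zeta_partial N ?s) \<le> (4 * norm ?s + 1) / sqrt (real N)"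
        using eventually_ge_at_top[of 1] by eventually_elim (rule norm_zeta_minus_partial_le, simp_all)
      show "(\<lambda>N. (4 * norm ?s + 1) / sqrt (real N)) \<longlonglongrightarrow> 0" by real_asymp
    qed
    from tendsto_diff[OF tendsto_const[of "zeta ?s"] this] have "(\<lambda>N. zeta_partial N ?s) \<longlonglongrightarrow> zeta ?s" by simp
    then show ?thesis by (rule tendsto_norm)
  qed
  have c: "zeta_partial N (cnj s) = cnj (zeta_partial N s)" for N s
    unfolding zeta_partial_def by (simp add: cnj_powr)
  have "Complex (1/2) (- t) = cnj (Complex (1/2) t)" by (simp add: complex_eq_iff)
  then have "cmod (zeta_partial N (Complex (1/2) (- t))) = cmod (zeta_partial N (Complex (1/2) t))" for N
    by (simp only: c complex_mod_cnj)
  then show ?thesis using lim[of t] lim[of "- t"] by (simp add: LIMSEQ_unique)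
qed

lemma symmetric_mean_square:
  assumes "T \<ge> 0"
  shows "(LINT t|lborel. indicator {-T..T} t * (cmod (zeta (Complex (1/2) t)))\<^sup>2) = 2 * integral {0..T} (\<lambda>t. (cmod (zeta (Complex (1/2) t)))\<^sup>2)"
    and "integrable lborel (\<lambda>t. indicator {-T..T} t * (cmod (zeta (Complex (1/2) t)))\<^sup>2)"
proof -
  define Z where "Z t = (cmod (zeta (Complex (1/2) t)))\<^sup>2" for t
  have cont: "continuous_on A Z" for A unfolding Z_def by (intro continuous_intros continuous_on_zeta_half)
  have even: "Z (- t) = Z t" for t by (simp add: Z_def norm_zeta_half_minus)
  have i: "set_integrable lborel {a..b} Z" for a b by (rule borel_integrable_atLeastAtMost'[OF cont])
  have HK: "integral {a..b} Z = (LINT t:{a..b}|lborel. Z t)" for a b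
    using set_borel_integral_eq_integral(2)[OF i] by simp
  have "integral {-T..T} Z = integral {-T..0} Z + integral {0..T} Z"
    using assms by (intro Henstock_Kurzweil_Integration.integral_combine[symmetric] integrable_continuous_real cont) auto
  moreover have "integral {-T..0} Z = integral {0..T} Z"
  proof -
    have "integral {-T..-0} (\<lambda>x. Z (- x)) = integral {0..T} Z" by (rule Henstock_Kurzweil_Integration.integral_reflect_real)
    then show ?thesis by (simp only: even minus_zero)
  qed
  ultimately have "(LINT t:{-T..T}|lborel. Z t) = 2 * integral {0..T} Z" by (simp add: HK)
  then show "(LINT t|lborel. indicator {-T..T} t * (cmod (zeta (Complex (1/2) t)))\<^sup>2) = 2 * integral {0..T} (\<lambda>t. (cmod (zeta (Complex (1/2) t)))\<^sup>2)"
    by (simp add: set_lebesgue_integral_def Z_def[abs_def])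
  show "integrable lborel (\<lambda>t. indicator {-T..T} t * (cmod (zeta (Complex (1/2) t)))\<^sup>2)"
    using i[of "-T" T] by (simp add: set_integrable_def Z_def)
qed

text \<open>
  On [-T, T] the weight for T + a is at least 1 - 2 exp(- a^2/(2\<sigma>^2)). The defect, at most 2/T^3, is multiplied by the
  crude bound 144 T^3 for the mean square.
\<close>

lemma mean_square_le_smoothed:
  assumes T: "T \<ge> 1" and \<sigma>: "\<sigma> > 0" and a: "a \<ge> 0" "exp (- a\<^sup>2 / (2 * \<sigma>\<^sup>2)) \<le> 1 / T ^ 3"
  shows "integral {0..T} (\<lambda>t. (cmod (zeta (Complex (1/2) t)))\<^sup>2)
    \<le> (LINT t|lborel. weight (T + a) \<sigma> t * (cmod (zeta (Complex (1/2) t)))\<^sup>2) / 2 + 288"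
proof -
  define Z where "Z t = (cmod (zeta (Complex (1/2) t)))\<^sup>2" for t
  define \<eta> where "\<eta> = exp (- a\<^sup>2 / (2 * \<sigma>\<^sup>2))"
  have Z0: "Z t \<ge> 0" for t by (simp add: Z_def)
  note S = symmetric_mean_square[of T, folded Z_def]
  have iw: "integrable lborel (\<lambda>t. weight (T + a) \<sigma> t * Z t)" unfolding Z_def by (rule weighted_zeta_square_integrable[OF \<sigma>])
  have "(LINT t|lborel. (1 - 2 * \<eta>) * (indicator {-T..T} t * Z t)) \<le> (LINT t|lborel. weight (T + a) \<sigma> t * Z t)"
  proof (intro integral_mono integrable_mult_right S(2) iw)
    show "(1 - 2 * \<eta>) * (indicator {-T..T} t * Z t) \<le> weight (T + a) \<sigma> t * Z t" for t
    proof (cases "t \<in> {-T..T}")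
      case True
      then have "weight (T + a) \<sigma> t \<ge> 1 - 2 * \<eta>" unfolding \<eta>_def using a by (intro weight_ge \<sigma>) auto
      then show ?thesis using True Z0[of t] by (simp add: mult_right_mono)
    next
      case False
      then show ?thesis using weight_nonneg[of "T + a" \<sigma> t] Z0[of t] by simp
    qed
  qed (use T in auto)
  then have 1: "(1 - 2 * \<eta>) * (2 * integral {0..T} Z) \<le> (LINT t|lborel. weight (T + a) \<sigma> t * Z t)"
    using S(1) T by simp
  have "integral {0..T} Z \<le> integral {0..T} (\<lambda>t. 144 * T\<^sup>2)"
  proof (rule integral_le)
    show "Z integrable_on {0..T}" unfolding Z_def by (intro integrable_continuous_real continuous_intros continuous_on_zeta_half)
    show "Z t \<le> 144 * T\<^sup>2" if "t \<in> {0..T}" for t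
    proof -
      have "t\<^sup>2 \<le> T\<^sup>2" using that by (intro power_mono) auto
      moreover have "1 \<le> T\<^sup>2" using T by simp
      ultimately have "72 * (1 + t\<^sup>2) \<le> 144 * T\<^sup>2" by simp
      with zeta_square_le[of t] show ?thesis unfolding Z_def by (rule order_trans)
    qed
  qed auto
  also have "\<dots> = 144 * T ^ 3" using T by (simp add: power2_eq_square power3_eq_cube)
  finally have "\<eta> * integral {0..T} Z \<le> 1 / T ^ 3 * (144 * T ^ 3)"
    using a T Z0 by (intro mult_mono integral_nonneg integrable_continuous_real) (auto simp: \<eta>_def Z_def intro!: continuous_intros continuous_on_zeta_half)
  also have "\<dots> = 144" using T by simp
  finally show ?thesis using 1 unfolding Z_def[symmetric] by (simp add: algebra_simps)
qed

text \<open>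
  The weight for T - a is at most 1 on [-T, T], and outside its Gaussian decay yields
  a factor exp(- a^2/(2\<sigma>^2)) times normal densities centred at T and -T, against which the crude bound for |\<zeta>|^2 is integrated.
\<close>

lemma smoothed_le_mean_square:
  assumes T: "T \<ge> 1" and \<sigma>: "\<sigma> > 0" "\<sigma> \<le> T" and Ts: "1000 * \<sigma> \<le> T" and a: "0 \<le> a" "a \<le> T" "exp (- a\<^sup>2 / (2 * \<sigma>\<^sup>2)) \<le> 1 / T ^ 3"
  shows "(LINT t|lborel. weight (T - a) \<sigma> t * (cmod (zeta (Complex (1/2) t)))\<^sup>2) / 2
    \<le> integral {0..T} (\<lambda>t. (cmod (zeta (Complex (1/2) t)))\<^sup>2) + 1"
proof -
  define Z where "Z t = (cmod (zeta (Complex (1/2) t)))\<^sup>2" for t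
  define \<eta> where "\<eta> = exp (- a\<^sup>2 / (2 * \<sigma>\<^sup>2))"
  define c where "c = sqrt (2 * pi * \<sigma>\<^sup>2)"
  have Z0: "Z t \<ge> 0" and Z72: "Z t \<le> 72 * (1 + t\<^sup>2)" for t unfolding Z_def using zeta_square_le[of t] by auto
  have c0: "c > 0" using \<sigma> by (simp add: c_def)
  note S = symmetric_mean_square[of T, folded Z_def]
  have iw: "integrable lborel (\<lambda>t. weight (T - a) \<sigma> t * Z t)" unfolding Z_def by (rule weighted_zeta_square_integrable[OF \<sigma>(1)])
  \<comment> \<open>a majorant of the part of the weight outside [-T, T], times the bound for |\<zeta>|^2\<close>
  define tail where "tail t = 72 * \<eta> * c * (normal_density T \<sigma> t * (1 + t\<^sup>2) + normal_density (- T) \<sigma> t * (1 + t\<^sup>2))" for t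
  have "has_bochner_integral lborel tail (72 * \<eta> * c * ((1 + T\<^sup>2 + \<sigma>\<^sup>2) + (1 + (- T)\<^sup>2 + \<sigma>\<^sup>2)))"
    unfolding tail_def by (intro has_bochner_integral_mult_right has_bochner_integral_add normal_quadratic_moment \<sigma>)
  then have it: "integrable lborel tail" "(LINT t|lborel. tail t) = 144 * \<eta> * c * (1 + T\<^sup>2 + \<sigma>\<^sup>2)" by (simp_all add: has_bochner_integral_iff)
  have tail0: "tail t \<ge> 0" for t unfolding tail_def using c0 by (intro mult_nonneg_nonneg add_nonneg_nonneg) (auto simp: \<eta>_def)
  have "(LINT t|lborel. weight (T - a) \<sigma> t * Z t) \<le> (LINT t|lborel. indicator {-T..T} t * Z t + tail t)"
  proof (intro integral_mono iw Bochner_Integration.integrable_add S(2) it)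
    show "weight (T - a) \<sigma> t * Z t \<le> indicator {-T..T} t * Z t + tail t" for t
    proof (cases "t \<in> {-T..T}")
      case True
      have "weight (T - a) \<sigma> t * Z t \<le> 1 * Z t" using Z0 by (intro mult_right_mono weight_le_1 \<sigma>)
      then show ?thesis using True tail0[of t] by simp
    next
      case False
      then have t: "\<bar>t\<bar> > T" by auto
      define e where "e = exp (- (\<bar>t\<bar> - T)\<^sup>2 / (2 * \<sigma>\<^sup>2))"
      have "weight (T - a) \<sigma> t \<le> exp (- (\<bar>t\<bar> - (T - a))\<^sup>2 / (2 * \<sigma>\<^sup>2))" using t a by (intro weight_le_exp \<sigma>) auto
      also have "\<dots> \<le> exp (- a\<^sup>2 / (2 * \<sigma>\<^sup>2) + - (\<bar>t\<bar> - T)\<^sup>2 / (2 * \<sigma>\<^sup>2))"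
      proof -
        have "0 \<le> 2 * (\<bar>t\<bar> - T) * a" using t a by (intro mult_nonneg_nonneg) auto
        then have "- (\<bar>t\<bar> - (T - a))\<^sup>2 \<le> - a\<^sup>2 + - (\<bar>t\<bar> - T)\<^sup>2" by (simp add: power2_eq_square algebra_simps)
        then show ?thesis unfolding add_divide_distrib[symmetric] exp_le_cancel_iff by (intro divide_right_mono) auto
      qed
      also have "\<dots> = \<eta> * e" by (simp only: exp_add \<eta>_def e_def)
      finally have w: "weight (T - a) \<sigma> t \<le> \<eta> * e" .
      have "e \<le> c * (normal_density T \<sigma> t + normal_density (- T) \<sigma> t)"
      proof -
        define A B where "A = exp (- (t - T)\<^sup>2 / (2 * \<sigma>\<^sup>2))" and "B = exp (- (t - - T)\<^sup>2 / (2 * \<sigma>\<^sup>2))"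
        have "c * normal_density x \<sigma> t = exp (- (t - x)\<^sup>2 / (2 * \<sigma>\<^sup>2))" for x
          using c0 \<sigma> by (simp add: normal_density_def c_def)
        then have AB: "c * normal_density T \<sigma> t = A" "c * normal_density (- T) \<sigma> t = B" by (simp_all only: A_def B_def)
        have "e = A \<or> e = B"
        proof (cases "t \<ge> 0")
          case False
          then have "(\<bar>t\<bar> - T)\<^sup>2 = (t - - T)\<^sup>2" by (simp add: power2_eq_square algebra_simps)
          then show ?thesis unfolding e_def B_def by (intro disjI2) (simp only:)
        qed (simp add: e_def A_def)
        moreover have "A \<ge> 0" "B \<ge> 0" by (simp_all add: A_def B_def)
        ultimately show ?thesis unfolding distrib_left AB by auto
      qed
      then have "\<eta> * e \<le> \<eta> * (c * (normal_density T \<sigma> t + normal_density (- T) \<sigma> t))" by (intro mult_left_mono) (auto simp: \<eta>_def)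
      with w have "weight (T - a) \<sigma> t \<le> \<eta> * (c * (normal_density T \<sigma> t + normal_density (- T) \<sigma> t))" by linarith
      then have "weight (T - a) \<sigma> t * Z t \<le> \<eta> * (c * (normal_density T \<sigma> t + normal_density (- T) \<sigma> t)) * (72 * (1 + t\<^sup>2))"
        using Z0 Z72 c0 by (intro mult_mono) (auto simp: \<eta>_def weight_nonneg)
      also have "\<dots> = tail t" by (simp add: tail_def algebra_simps)
      finally show ?thesis using False by simp
    qed
  qed (use T in auto)
  also have "\<dots> = 2 * integral {0..T} Z + 144 * \<eta> * c * (1 + T\<^sup>2 + \<sigma>\<^sup>2)"
    using S T it by simp
  also have "144 * \<eta> * c * (1 + T\<^sup>2 + \<sigma>\<^sup>2) \<le> 2"
  proof -
    have "c \<le> 3 * \<sigma>"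
    proof (unfold c_def, rule real_le_lsqrt)
      have "(2 * pi) * \<sigma>\<^sup>2 \<le> 9 * \<sigma>\<^sup>2" using pi_approx by (intro mult_right_mono) auto
      then show "2 * pi * \<sigma>\<^sup>2 \<le> (3 * \<sigma>)\<^sup>2" by (simp add: power_mult_distrib)
    qed (use \<sigma> in auto)
    moreover have "\<sigma> * 1000 \<le> T" using Ts by simp
    ultimately have "c \<le> 3/1000 * T" by linarith
    moreover have "1 + T\<^sup>2 + \<sigma>\<^sup>2 \<le> 3 * T\<^sup>2"
    proof -
      have "\<sigma>\<^sup>2 \<le> T\<^sup>2" using \<sigma> by (intro power_mono) auto
      moreover have "1 \<le> T\<^sup>2" using T by simp
      ultimately show ?thesis by linarith
    qed
    ultimately have "144 * \<eta> * c * (1 + T\<^sup>2 + \<sigma>\<^sup>2) \<le> 144 * (1 / T ^ 3) * (3/1000 * T) * (3 * T\<^sup>2)"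
      using a T c0 by (intro mult_mono) (auto simp: \<eta>_def)
    also have "\<dots> \<le> 2" using T by (simp add: power2_eq_square power3_eq_cube)
    finally show ?thesis .
  qed
  finally show ?thesis unfolding Z_def[symmetric] by simp
qed

text \<open>
  The derivative of the main term is ln T + 2\<gamma> - ln 2\<pi>, and the constant 2\<gamma> - ln 2\<pi> is negative.
\<close>

lemma mean_square_main_increment:
  assumes "T > 0" "0 \<le> a" "a \<le> T / 1000"
  shows "mean_square_main (T + a) - mean_square_main T \<le> a * ln T"
proof -
  define c where "c = 2 * euler_mascheroni - 1 - ln (2 * pi)"
  define d where "d = ln (T + a) - ln T"
  have d: "d \<le> a / T" "d \<le> 1 / 1000"
  proof -
    have "d = ln ((T + a) / T)" unfolding d_def using assms by (subst ln_div) auto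
    also have "\<dots> = ln (1 + a / T)" using assms by (simp add: add_divide_distrib)
    also have "\<dots> \<le> a / T" using assms by (intro ln_add_one_self_le_self) auto
    finally show "d \<le> a / T" .
    also have "\<dots> \<le> 1 / 1000" using assms by (simp add: field_simps)
    finally show "d \<le> 1 / 1000" .
  qed
  have c: "c \<le> - 1.01"
  proof -
    have "ln 4 \<le> ln (2 * pi)" using pi_gt3 by (subst ln_le_cancel_iff) auto
    moreover have "ln (4 :: real) = 2 * ln 2" using ln_realpow[of 2 2] by simp
    ultimately show ?thesis using euler_mascheroni_less_13_over_22 ln2_ge_two_thirds unfolding c_def by simp
  qed
  have "T * d \<le> a" using mult_left_mono[OF d(1), of T] assms by simp
  moreover have "a * d \<le> a * (1 / 1000)" using d(2) assms by (intro mult_left_mono) auto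
  moreover have "a * c \<le> a * (- 1.01)" using c assms by (intro mult_left_mono) auto
  moreover have "mean_square_main (T + a) - mean_square_main T = T * d + a * d + a * ln T + a * c"
    unfolding mean_square_main_def c_def d_def by (simp add: algebra_simps)
  ultimately show ?thesis using assms by simp
qed

text \<open>
  The estimate \<open>smoothed_mean_square\<close> at a point T' near T, with \<sigma> and the bound taken at T. The
  changes of Q and u are at most 0.01 percent.
\<close>

lemma smoothed_mean_square_nearby:
  fixes T T' Q u :: real
  assumes Q: "Q \<ge> 1.01 * 10 ^ 10" and u: "u \<ge> 8.31" "ln Q = u\<^sup>2 / 3"
    and T: "T = Q ^ 3" "\<bar>T' - T\<bar> \<le> T / 10 ^ 6"
  shows "\<bar>(LINT t|lborel. weight T' (Q / 2) t * (cmod (zeta (Complex (1/2) t)))\<^sup>2) / 2 - mean_square_main T'\<bar> \<le> 4.6 * u ^ 3 * Q"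
proof -
  define Q' u' where "Q' = T' powr (1/3)" and "u' = sqrt (ln T')"
  have Q0: "Q > 0" using Q by simp
  have T0: "T > 1" unfolding T using Q by (intro one_less_power) auto
  have T': "0.99999 * T \<le> T'" "T' \<le> 1.00001 * T" "T' > 0" 
  proof -
    have "T' - T \<le> T / 10 ^ 6" "- (T' - T) \<le> T / 10 ^ 6" using T(2) by (simp_all only: abs_le_iff)
    then show "0.99999 * T \<le> T'" "T' \<le> 1.00001 * T" "T' > 0" using T0 by simp_all
  qed
  have Q'3: "Q' ^ 3 = T'" "Q' > 0" unfolding Q'_def using T' by (simp_all flip: powr_realpow add: powr_powr)
  have Q': "0.9999 * Q \<le> Q'" "Q' \<le> 1.0001 * Q"
  proof -
    have "(0.9999 * Q) ^ 3 = 0.9999 ^ 3 * T" unfolding T by (rule power_mult_distrib)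
    also have "\<dots> \<le> 0.99999 * T" using T0 by (intro mult_right_mono) (auto simp: eval_nat_numeral)
    also have "\<dots> \<le> Q' ^ 3" using T' Q'3 by simp
    finally show "0.9999 * Q \<le> Q'" by (rule power_le_imp_le_base[of _ 2, simplified]) (use Q'3 in auto)
    have "Q' ^ 3 \<le> 1.00001 * T" using T' Q'3 by simp
    also have "\<dots> \<le> 1.0001 ^ 3 * T" using T0 by (intro mult_right_mono) (auto simp: eval_nat_numeral)
    also have "\<dots> = (1.0001 * Q) ^ 3" unfolding T by (rule power_mult_distrib[symmetric])
    finally show "Q' \<le> 1.0001 * Q" by (rule power_le_imp_le_base[of _ 2, simplified]) (use Q0 in auto)
  qed
  have lnT: "ln T = u\<^sup>2" unfolding T using u Q0 by (simp add: ln_realpow)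
  have lnT': "u\<^sup>2 - 0.001 \<le> ln T'" "ln T' \<le> u\<^sup>2 + 0.001"
  proof -
    have "ln (T' / T) \<le> T' / T - 1" using T' T0 by (intro ln_le_minus_one) auto
    also have "\<dots> \<le> 0.001" using T' T0 by (simp add: field_simps)
    finally have 1: "ln (T' / T) \<le> 0.001" .
    have "ln (T / T') \<le> T / T' - 1" using T' T0 by (intro ln_le_minus_one) auto
    also have "\<dots> \<le> 0.001"
    proof -
      have "T \<le> 1.001 * T'" using T' by simp
      then show ?thesis using T' by (simp add: field_simps)
    qed
    finally have 2: "ln (T / T') \<le> 0.001" .
    have "ln (T' / T) = ln T' - u\<^sup>2" "ln (T / T') = u\<^sup>2 - ln T'" using T' T0 by (simp_all add: ln_div lnT)
    then show "u\<^sup>2 - 0.001 \<le> ln T'" "ln T' \<le> u\<^sup>2 + 0.001" using 1 2 by simp_all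
  qed
  have uu: "69.05 \<le> u\<^sup>2" using power_mono[OF u(1), of 2] by (simp add: power2_eq_square)
  have u'2: "u'\<^sup>2 = ln T'" unfolding u'_def using lnT' uu by simp
  have u'1: "8.3 \<le> u'" unfolding u'_def using lnT' uu by (intro real_le_rsqrt) (simp add: power2_eq_square)
  have u'2': "u' \<le> 1.0001 * u"
  proof (rule power2_le_imp_le)
    have "u'\<^sup>2 \<le> u\<^sup>2 + 0.001" using u'2 lnT' by simp
    also have "\<dots> \<le> 1.0001\<^sup>2 * u\<^sup>2" using uu by (simp add: power2_eq_square)
    finally show "u'\<^sup>2 \<le> (1.0001 * u)\<^sup>2" unfolding power_mult_distrib[of "1.0001" u] .
  qed (use u in simp)
  have "\<bar>(LINT t|lborel. weight (Q' ^ 3) (Q / 2) t * (cmod (zeta (Complex (1/2) t)))\<^sup>2) / 2 - mean_square_main (Q' ^ 3)\<bar> \<le> 4.57 * u' ^ 3 * Q'"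
  proof (rule smoothed_mean_square)
    show "ln Q' = u'\<^sup>2 / 3" unfolding u'2 Q'_def using T' by (simp add: ln_powr)
  qed (use Q Q' u'1 in auto)
  also have "4.57 * u' ^ 3 * Q' \<le> 4.57 * (1.0001 * u) ^ 3 * (1.0001 * Q)"
    using u'2' u'1 Q' Q'3 u by (intro mult_mono power_mono mult_left_mono mult_nonneg_nonneg zero_le_power) auto
  also have "\<dots> = (4.57 * 1.0001 ^ 4) * (u ^ 3 * Q)"
    unfolding power_mult_distrib[of "1.0001" u] by (simp add: eval_nat_numeral)
  also have "\<dots> \<le> 4.6 * (u ^ 3 * Q)" using u Q0 by (intro mult_right_mono) (auto simp: eval_nat_numeral)
  finally show ?thesis unfolding Q'3 by (simp add: mult.assoc)
qed

text \<open>
  The shift a = 1.225 u Q = 2.45 u \<sigma> is the least one, up to rounding, for which the Gaussian tail is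
  below T^(-3). The total is 4.6 + 1.225 in units of u^3 Q, plus a bounded amount.
\<close>

lemma abs_E_le:
  fixes T Q u :: real
  assumes Q: "Q \<ge> 1.01 * 10 ^ 10" and u: "u \<ge> 8.31" "ln Q = u\<^sup>2 / 3" and T: "T = Q ^ 3"
  shows "\<bar>E T\<bar> \<le> 5.9 * u ^ 3 * Q"
proof -
  define M where "M = integral {0..T} (\<lambda>t. (cmod (zeta (Complex (1/2) t)))\<^sup>2)"
  define S where "S T' = (LINT t|lborel. weight T' (Q / 2) t * (cmod (zeta (Complex (1/2) t)))\<^sup>2) / 2" for T'
  define \<sigma> a where "\<sigma> = Q / 2" and "a = 1.225 * u * Q"
  have Q0: "Q > 0" "Q \<ge> 1" "u > 0" using Q u by auto
  have uQ: "8000 * u \<le> Q" by (rule sqrt_log_le) (use Q u Q0 in auto)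
  have lnT: "ln T = u\<^sup>2" unfolding T using u Q0 by (simp add: ln_realpow)
  have T1: "T \<ge> 1" unfolding T using Q0 by simp
  have E: "E T = M - mean_square_main T"
    unfolding E_def M_def mean_square_main_def by (simp add: algebra_simps)
  have a0: "a \<ge> 0" using Q0 by (simp add: a_def)
  have aT: "a \<le> T / 10 ^ 7"
  proof -
    have "a \<le> (1.225 / 8000 * Q) * Q" unfolding a_def using uQ Q0 by (intro mult_right_mono) auto
    also have "\<dots> = 1.225 / 8000 * Q\<^sup>2" by (simp add: power2_eq_square)
    also have "\<dots> \<le> (Q / 10 ^ 7) * Q\<^sup>2" using Q by (intro mult_right_mono) auto
    also have "\<dots> = T / 10 ^ 7" by (simp add: T power2_eq_square power3_eq_cube)
    finally show ?thesis .
  qed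
  have \<sigma>: "\<sigma> > 0" "1000 * \<sigma> \<le> T"
  proof -
    show "\<sigma> > 0" using Q0 by (simp add: \<sigma>_def)
    have "500 * Q \<le> Q\<^sup>2 * Q" using power_mono[of 500 Q 2] Q by (intro mult_right_mono) auto
    then show "1000 * \<sigma> \<le> T" by (simp add: \<sigma>_def T power2_eq_square power3_eq_cube)
  qed
  have ex: "exp (- a\<^sup>2 / (2 * \<sigma>\<^sup>2)) \<le> 1 / T ^ 3"
  proof -
    have "a\<^sup>2 / (2 * \<sigma>\<^sup>2) = (2 * 1.225\<^sup>2) * u\<^sup>2" using Q0 by (simp add: a_def \<sigma>_def power2_eq_square)
    moreover have "3 * u\<^sup>2 \<le> (2 * 1.225\<^sup>2) * u\<^sup>2" by (intro mult_right_mono) (auto simp: power2_eq_square)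
    ultimately have "exp (- a\<^sup>2 / (2 * \<sigma>\<^sup>2)) \<le> exp (- (3 * ln T))" unfolding minus_divide_left[symmetric] lnT by simp
    also have "3 * ln T = ln (T ^ 3)" using T1 by (simp add: ln_realpow)
    also have "exp (- ln (T ^ 3)) = 1 / T ^ 3" using T1 by (simp add: exp_minus divide_inverse)
    finally show ?thesis .
  qed
  have aL: "a * ln T = 1.225 * (u ^ 3 * Q)" by (simp add: a_def lnT power2_eq_square power3_eq_cube)
  have near: "\<bar>S T' - mean_square_main T'\<bar> \<le> 4.6 * (u ^ 3 * Q)" if "\<bar>T' - T\<bar> \<le> T / 10 ^ 6" for T'
    using smoothed_mean_square_nearby[OF Q u T that] by (simp add: S_def mult.assoc)
  have up: "M \<le> mean_square_main T + a * ln T + 4.6 * (u ^ 3 * Q) + 288"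
  proof -
    have "M \<le> S (T + a) + 288" unfolding M_def S_def \<sigma>_def[symmetric] by (rule mean_square_le_smoothed[OF T1 \<sigma>(1) a0 ex])
    moreover have "S (T + a) - mean_square_main (T + a) \<le> 4.6 * (u ^ 3 * Q)"
      by (rule abs_le_D1[OF near]) (use a0 aT T1 in simp)
    moreover have "mean_square_main (T + a) - mean_square_main T \<le> a * ln T" using a0 aT T1 by (intro mean_square_main_increment) auto
    ultimately show ?thesis by linarith
  qed
  have low: "mean_square_main T - a * ln T - 4.6 * (u ^ 3 * Q) - 1 \<le> M"
  proof -
    have "S (T - a) \<le> M + 1" unfolding M_def S_def \<sigma>_def[symmetric]
      using \<sigma> a0 aT T1 ex by (intro smoothed_le_mean_square) auto
    moreover have "- (S (T - a) - mean_square_main (T - a)) \<le> 4.6 * (u ^ 3 * Q)"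
      by (rule abs_le_D2[OF near]) (use a0 aT T1 in simp)
    moreover have "mean_square_main ((T - a) + a) - mean_square_main (T - a) \<le> a * ln (T - a)"
      using a0 aT T1 by (intro mean_square_main_increment) auto
    moreover have "a * ln (T - a) \<le> a * ln T" using a0 aT T1 by (intro mult_left_mono) auto
    ultimately show ?thesis by simp
  qed
  have "288 \<le> 0.01 * (u ^ 3 * Q)"
  proof -
    have "1 * 10 ^ 10 \<le> u ^ 3 * Q" using u Q by (intro mult_mono one_le_power) auto
    then show ?thesis by simp
  qed
  moreover have "M - mean_square_main T \<le> 1.225 * (u ^ 3 * Q) + 4.6 * (u ^ 3 * Q) + 288"
    "- (M - mean_square_main T) \<le> 1.225 * (u ^ 3 * Q) + 4.6 * (u ^ 3 * Q) + 1"
    using up low unfolding aL by linarith+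
  moreover have "\<bar>m\<bar> \<le> 5.9 * x" if "288 \<le> 0.01 * x" "m \<le> 1.225 * x + 4.6 * x + 288" "- m \<le> 1.225 * x + 4.6 * x + 1" for m x :: real
    using that by (simp add: abs_le_iff)
  ultimately have "\<bar>M - mean_square_main T\<bar> \<le> 5.9 * (u ^ 3 * Q)" by blast
  then show ?thesis unfolding E by (simp add: mult.assoc)
qed

lemma ln_threshold: "69.1 \<le> ln (1.1 * 10 ^ 30 :: real)"
proof -
  have "exp (69.1 :: real) = exp 1 ^ 69 * exp (1 / 10)" by (simp flip: exp_of_nat_mult exp_add)
  also have "\<dots> \<le> (272 / 100) ^ 69 * 1.11"
  proof (intro mult_mono power_mono)
    show "exp (1 / 10) \<le> (1.11 :: real)" using exp_bound[of "1 / 10 :: real"] by (simp add: power2_eq_square)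
  qed (use e_less_272 in auto)
  also have "\<dots> \<le> 1.1 * 10 ^ 30" by (simp add: power_divide)
  finally show ?thesis by (subst ln_ge_iff) auto
qed

theorem corollary1:
  fixes T\<^sub>0 J T :: real
  assumes "(T\<^sub>0, J) \<in> {(10^30, 1.272 * 10^6), (10^40, 14.366), (10^50, 3.194), (10^60, 3.09),
                       (10^70, 3.011), (10^80, 2.95), (10^90, 2.9), (10^100, 2.856)}"
    and "T \<ge> 1.1 * T\<^sub>0"
  shows "\<bar>E T\<bar> \<le> J * T powr (1/3) * ln T powr (5/3)"
proof -
  have T30: "1.1 * 10 ^ 30 \<le> T" and J0: "J \<ge> 2.856" using assms by auto
  define L where "L = ln T"
  define Q u where "Q = T powr (1/3)" and "u = sqrt L"
  have T0: "T > 0" using T30 by simp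
  have L: "69.1 \<le> L"
  proof -
    have "ln (1.1 * 10 ^ 30) \<le> L" unfolding L_def using T30 T0 by (subst ln_le_cancel_iff) auto
    then show ?thesis using ln_threshold by linarith
  qed
  have Q3: "Q ^ 3 = T" "Q > 0" unfolding Q_def using T0 by (simp_all flip: powr_realpow add: powr_powr)
  have Q: "Q \<ge> 1.01 * 10 ^ 10"
  proof -
    have "(1.01 * 10 ^ 10) ^ 3 \<le> Q ^ 3" unfolding Q3 using T30 by (simp add: power_mult_distrib power_divide)
    then show ?thesis by (rule power_le_imp_le_base[of _ 2, simplified]) (use Q3 in auto)
  qed
  have uu: "u\<^sup>2 = L" "u \<ge> 0" using L by (auto simp: u_def)
  have u: "u \<ge> 8.31" unfolding u_def using L by (intro real_le_rsqrt) (simp add: power2_eq_square)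
  have lnQ: "ln Q = u\<^sup>2 / 3" unfolding uu Q_def L_def using T0 by (simp add: ln_powr)
  have E: "\<bar>E T\<bar> \<le> 5.9 * u ^ 3 * Q" by (rule abs_E_le[OF Q u lnQ Q3(1)[symmetric]])
  have u3: "u ^ 3 = L powr (3/2)"
  proof -
    have "u = L powr (1/2)" using L by (simp add: u_def powr_half_sqrt)
    then show ?thesis using L by (simp flip: powr_realpow add: powr_powr)
  qed
  have L53: "L powr (5/3) = L powr (3/2) * L powr (1/6)" by (simp flip: powr_add)
  have "5.9 \<le> J * L powr (1/6)"
  proof (cases "T\<^sub>0 \<in> {10^30, 10^40}")
    case True
    then have "J \<ge> 14" using assms(1) by auto
    moreover have "1 \<le> L powr (1/6)" using L by (intro ge_one_powr_ge_zero) auto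
    ultimately have "14 * 1 \<le> J * L powr (1/6)" by (intro mult_mono) auto
    then show ?thesis by simp
  next
    case False
    then have "10 ^ 50 \<le> T\<^sub>0" using assms(1) by auto
    then have T50: "10 ^ 50 \<le> T" using assms(2) by simp
    have "78 \<le> L" 
    proof -
      have "exp (78 :: real) = exp 1 ^ 78" by (simp flip: exp_of_nat_mult)
      also have "\<dots> \<le> 3 ^ 78" using exp_le by (intro power_mono) auto
      also have "\<dots> \<le> 10 ^ 50" by simp
      also note T50
      finally show ?thesis unfolding L_def using T0 by (subst ln_ge_iff) auto
    qed
    define y where "y = L powr (1/6)"
    have y: "y ^ 6 = L" "y \<ge> 0" unfolding y_def using L by (simp_all flip: powr_realpow add: powr_powr)
    have "2.066 ^ 6 \<le> y ^ 6" using y \<open>78 \<le> L\<close> by (simp add: power_divide)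
    then have "2.066 \<le> L powr (1/6)" unfolding y_def[symmetric] by (rule power_le_imp_le_base[of _ 5, simplified]) (use y in auto)
    then have "2.856 * 2.066 \<le> J * L powr (1/6)" using J0 by (intro mult_mono) auto
    then show ?thesis by simp
  qed
  then have "5.9 * (L powr (3/2) * Q) \<le> (J * L powr (1/6)) * (L powr (3/2) * Q)"
    using Q3 by (intro mult_right_mono) auto
  also have "\<dots> = J * Q * L powr (5/3)" unfolding L53 by simp
  finally show ?thesis using E unfolding u3 by (simp add: Q_def L_def mult.assoc)
qed

end
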